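(* For $i=1,2$, let $\Gamma_i$ be a finitely generated infinite virtually abelian group and $\Lambda_i$ a finite-index normal subgroup of $\Gamma_i$ identified with $\mathbb{Z}^{m_i}\subset\mathbb{R}^{m_i}$, $m_i\ge1$. Let $\nu$ be an aperiodic probability measure with finite second moment on $\Gamma_1\times\Gamma_2$ whose support generates $\Gamma_1\times\Gamma_2$ as a semigroup, with marginals $\mu^{(i)}$ on $\Gamma_i$. Then $\|\nu_n-\mathcal{N}_{n,\Sigma_\nu,\zeta_c}\|_{\mathrm{TV}}\to0$ as $n\to\infty$, where $\zeta_c\in\operatorname{im}(\underline\vartheta_1)\oplus\operatorname{im}(\underline\vartheta_2)\subset\mathbb{R}^{m_1}\times\mathbb{R}^{m_2}$, and the covariance matrix has, in a basis adapted to the decomposition $\mathbb{R}^{m_1}\times\mathbb{R}^{m_2}=\operatorname{im}(\underline\vartheta_1)\oplus\operatorname{im}(\underline\vartheta_1)^\perp\oplus\operatorname{im}(\underline\vartheta_2)\oplus\operatorname{im}(\underline\vartheta_2)^\perp$, the form $$\Sigma_\nu=\begin{pmatrix} \Sigma_{\mu^{(1)}} & A \\ A^{T} & \Sigma_{\mu^{(2)}} \end{pmatrix},\qquad A=\begin{pmatrix} * & 0 \\ 0 & 0 \end{pmatrix}.$$ That is: for all $v_1,w_1\in\mathbb{R}^{m_1}$ and $v_2,w_2\in\mathbb{R}^{m_2}$, $\langle(v_1,0),\Sigma_\nu(w_1,0)\rangle=\langle v_1,\Sigma_{\mu^{(1)}}w_1\rangle$, $\langle(0,v_2),\Sigma_\nu(0,w_2)\rangle=\langle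 v_2,\Sigma_{\mu^{(2)}}w_2\rangle$, and $\langle(v_1,0),\Sigma_\nu(0,v_2)\rangle=0$ whenever $v_1\in\operatorname{im}(\underline\vartheta_1)^\perp$ or $v_2\in\operatorname{im}(\underline\vartheta_2)^\perp$.
   Context: $\nu_n=\nu^{*n}$; $\nu$ is aperiodic if $\gcd\{n\ge1:\nu_n(\mathrm{id})>0\}=1$; finite second moment means $\sum_g|g|^2\nu(g)<\infty$ for a word metric. $\|\cdot\|_{\mathrm{TV}}$ is half the $\ell^1$-norm. Inner products on $\mathbb{R}^{m_i}$ and $\mathbb{R}^{m_1}\times\mathbb{R}^{m_2}$ are standard. General construction. Let $\Gamma$ be an infinite finitely generated group, $\Lambda$ a finite-index normal subgroup identified with $\mathbb{Z}^m$ (additive notation), $\Delta\ni\mathrm{id}$ a set of representatives, $\Gamma=\bigsqcup_{x\in\Delta}\Lambda x$, $F=\Lambda\backslash\Gamma$, and $\mu$ a probability measure on $\Gamma$ with finite second moment whose support $S$ generates $\Gamma$ as a semigroup. The weighted diagram $(G,c)$: $V(G)=\Lambda\backslash\Gamma$ with $[\gamma]=\Lambda\gamma$, $E(G)=\{([\gamma],s):s\in S\cup S^{-1}\}$, and $e=([\gamma],s)$ has $oe=[\gamma]$, $te=[\gamma s]$, $\bar e=([\gamma s],s^{-1})$; $\pi$ is uniform on $V(G)$ and $c(e)=\pi(oe)\mu(s)$. A $1$-form is $\omega:E(G)\to\mathbb{R}$ with $\omega(\bar e)=-\omega(e)$; $\ell_c^2(G,\mathbb{R})$ consists of those with $\sum_e\omega(e)^2c(e)<\infty$.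 $df(e)=f(te)-f(oe)$ for $f:V(G)\to\mathbb{R}$; $d^*\omega(x)=-\frac1{\pi(x)}\sum_{e:oe=x}c(e)\omega(e)$; $\chi_c(\omega)=\sum_e\omega(e)c(e)$; $\omega$ is harmonic if $d^*\omega+\chi_c(\omega)=0$. Each $\omega\in\ell^2_c(G,\mathbb{R})$ is $u+df$ for a unique harmonic $u$ (its harmonic part). $\Phi:\Gamma\to\mathbb{Z}^m$, $\Phi(vx)=v$ for $v\in\Lambda$, $x\in\Delta$; $\Phi_e=\Phi(\gamma s)-\Phi(\gamma)$ for $e=([\gamma],s)$; $\widehat v(e)=\langle v,\Phi_e\rangle$ for $v\in\mathbb{R}^m$; $\zeta_c=\sum_ec(e)\Phi_e$. The covariance matrix $\Sigma_\mu$ is defined by $\langle v_1,\Sigma_\mu v_2\rangle=\sum_eu_1(e)u_2(e)c(e)-\sum_eu_1(e)c(e)\sum_eu_2(e)c(e)$, $u_i$ the harmonic part of $\widehat v_i$ (it is positive definite). With $\xi_\Sigma(v)=(2\pi)^{-m/2}(\det\Sigma)^{-1/2}\exp(-\frac12\langle v,\Sigma^{-1}v\rangle)$, put $\mathcal{N}_{n,\Sigma,\zeta_c}(\gamma)=\pi([\gamma])\,\xi_{n\Sigma}(\Phi(\gamma)-n\zeta_c)/\sum_{w\in\mathbb{Z}^m}\xi_{n\Sigma}(w)$ for $\gamma\in\Gamma$. Transfer. For $x\in\Delta$, $\gamma\in\Gamma$ write $x\gamma=\alpha(x,\gamma)x^\gamma$ with $\alpha(x,\gamma)\in\Lambda$,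 $x^\gamma\in\Delta$. The transfer homomorphism is $\vartheta:\Gamma\to\Lambda$, $\vartheta(\gamma)=\sum_{x\in\Delta}\alpha(x,\gamma)$. $\underline\vartheta:\mathbb{R}^m\to\mathbb{R}^m$ is the linear map which coincides with $\vartheta/\#F$ on $\Lambda=\mathbb{Z}^m$. Application. $\Sigma_{\mu^{(i)}}$, $\vartheta_i$, $\underline\vartheta_i$ are those of $(\Gamma_i,\Lambda_i,\mu^{(i)})$ with representatives $\Delta_i\ni\mathrm{id}$; $\Sigma_\nu$, $\zeta_c$ and $\mathcal{N}_{n,\Sigma_\nu,\zeta_c}$ are those of $(\Gamma_1\times\Gamma_2,\Lambda_1\times\Lambda_2,\nu)$ with representatives $\Delta_1\times\Delta_2$, so that $m=m_1+m_2$ and $\Phi=\Phi_1\times\Phi_2$. *)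

theory Defs
  imports
    "HOL-Analysis.Analysis"
    "HOL-Probability.Probability"
    "HOL-Algebra.Coset"
    "HOL-Algebra.Generated_Groups"
begin

section \<open>Groups\<close>

definition finitely_generated :: "('a, 'x) monoid_scheme \<Rightarrow> bool" where
  "finitely_generated G \<longleftrightarrow>
     (\<exists>T. finite T \<and> T \<subseteq> carrier G \<and> generate G T = carrier G)"

definition virtually_abelian :: "('a, 'x) monoid_scheme \<Rightarrow> bool" where
  "virtually_abelian G \<longleftrightarrow>
     (\<exists>H. subgroup H G \<and> finite (rcosets\<^bsub>G\<^esub> H) \<and> comm_group (G\<lparr>carrier := H\<rparr>))"

inductive_set semigroup_generated :: "('a, 'x) monoid_scheme \<Rightarrow> 'a set \<Rightarrow> 'a set"
  for G :: "('a, 'x) monoid_scheme" and S :: "'a set" where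
  base: "s \<in> S \<Longrightarrow> s \<in> semigroup_generated G S"
| mult: "a \<in> semigroup_generated G S \<Longrightarrow> b \<in> semigroup_generated G S
           \<Longrightarrow> a \<otimes>\<^bsub>G\<^esub> b \<in> semigroup_generated G S"

definition word_length :: "('a, 'x) monoid_scheme \<Rightarrow> 'a set \<Rightarrow> 'a \<Rightarrow> nat" where
  "word_length G T g =
     (LEAST n. \<exists>xs. length xs = n \<and> set xs \<subseteq> T \<union> m_inv G ` T \<and> g = foldr (mult G) xs \<one>\<^bsub>G\<^esub>)"

definition int_lattice :: "(real ^ 'n) set" where
  "int_lattice = {v. \<forall>i. v $ i \<in> \<int>}"

definition int_lattice_group :: "(real ^ 'n) monoid" where
  "int_lattice_group = \<lparr>carrier = int_lattice, mult = (+), one = 0\<rparr>"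

definition representatives :: "('a, 'x) monoid_scheme \<Rightarrow> 'a set \<Rightarrow> 'a set \<Rightarrow> bool" where
  "representatives G \<Lambda> \<Delta> \<longleftrightarrow>
     \<Delta> \<subseteq> carrier G \<and> \<one>\<^bsub>G\<^esub> \<in> \<Delta> \<and>
     carrier G = (\<Union>x\<in>\<Delta>. \<Lambda> #>\<^bsub>G\<^esub> x) \<and> disjoint_family_on (\<lambda>x. \<Lambda> #>\<^bsub>G\<^esub> x) \<Delta>"


section \<open>Probability measures on discrete groups\<close>

primrec conv_power :: "('a, 'x) monoid_scheme \<Rightarrow> 'a pmf \<Rightarrow> nat \<Rightarrow> 'a pmf" where
  "conv_power G \<nu> 0 = return_pmf \<one>\<^bsub>G\<^esub>"
| "conv_power G \<nu> (Suc n) = map_pmf (\<lambda>(g, h). g \<otimes>\<^bsub>G\<^esub> h) (pair_pmf (conv_power G \<nu> n) \<nu>)"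

definition aperiodic :: "('a, 'x) monoid_scheme \<Rightarrow> 'a pmf \<Rightarrow> bool" where
  "aperiodic G \<nu> \<longleftrightarrow> Gcd {n :: nat. n \<ge> 1 \<and> pmf (conv_power G \<nu> n) \<one>\<^bsub>G\<^esub> > 0} = 1"

text \<open>Word metrics of a finitely generated group are pairwise bi-Lipschitz equivalent, so the
  choice of the finite generating set \<open>T\<close> is immaterial.\<close>

definition finite_second_moment :: "('a, 'x) monoid_scheme \<Rightarrow> 'a pmf \<Rightarrow> bool" where
  "finite_second_moment G \<nu> \<longleftrightarrow>
     (\<exists>T. finite T \<and> T \<subseteq> carrier G \<and> generate G T = carrier G \<and>
        (\<lambda>g. (real (word_length G T g))\<^sup>2 * pmf \<nu> g) summable_on carrier G)"

text \<open>Taken in \<^typ>\<open>ennreal\<close>, so that the norm of a function that is not summable is infinite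
  (a real-valued \<^const>\<open>infsum\<close> would be \<open>0\<close>).\<close>

definition tv_norm :: "('a, 'x) monoid_scheme \<Rightarrow> ('a \<Rightarrow> real) \<Rightarrow> ennreal" where
  "tv_norm G f = (\<Sum>\<^sub>\<infinity>\<gamma>\<in>carrier G. ennreal \<bar>f \<gamma>\<bar>) / 2"


section \<open>The weighted diagram\<close>

text \<open>Vertices are the right cosets of \<open>\<Lambda>\<close>. Below, \<open>X #> s\<close> is the coset \<open>[\<gamma>s]\<close> if
  \<open>X = [\<gamma>]\<close>.\<close>

definition edges :: "('a, 'x) monoid_scheme \<Rightarrow> 'a set \<Rightarrow> 'a pmf \<Rightarrow> ('a set \<times> 'a) set" where
  "edges G \<Lambda> \<mu> = (rcosets\<^bsub>G\<^esub> \<Lambda>) \<times> (set_pmf \<mu> \<union> m_inv G ` set_pmf \<mu>)"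

definition org :: "'a set \<times> 'a \<Rightarrow> 'a set" where
  "org e = fst e"

definition ter :: "('a, 'x) monoid_scheme \<Rightarrow> 'a set \<times> 'a \<Rightarrow> 'a set" where
  "ter G e = fst e #>\<^bsub>G\<^esub> snd e"

definition edge_rev :: "('a, 'x) monoid_scheme \<Rightarrow> 'a set \<times> 'a \<Rightarrow> 'a set \<times> 'a" where
  "edge_rev G e = (fst e #>\<^bsub>G\<^esub> snd e, inv\<^bsub>G\<^esub> (snd e))"

definition vertex_weight :: "('a, 'x) monoid_scheme \<Rightarrow> 'a set \<Rightarrow> 'a set \<Rightarrow> real" where
  "vertex_weight G \<Lambda> X = (if X \<in> rcosets\<^bsub>G\<^esub> \<Lambda> then 1 / real (card (rcosets\<^bsub>G\<^esub> \<Lambda>)) else 0)"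

definition edge_weight :: "('a, 'x) monoid_scheme \<Rightarrow> 'a set \<Rightarrow> 'a pmf \<Rightarrow> 'a set \<times> 'a \<Rightarrow> real" where
  "edge_weight G \<Lambda> \<mu> e = vertex_weight G \<Lambda> (org e) * pmf \<mu> (snd e)"

text \<open>Functions on the edge set are made extensional, so that equality of 1-forms is equality
  on edges.\<close>

definition one_forms :: "('a, 'x) monoid_scheme \<Rightarrow> 'a set \<Rightarrow> 'a pmf \<Rightarrow> ('a set \<times> 'a \<Rightarrow> real) set" where
  "one_forms G \<Lambda> \<mu> =
     {\<omega> \<in> extensional (edges G \<Lambda> \<mu>). \<forall>e\<in>edges G \<Lambda> \<mu>. \<omega> (edge_rev G e) = - \<omega> e}"

definition l2_forms :: "('a, 'x) monoid_scheme \<Rightarrow> 'a set \<Rightarrow> 'a pmf \<Rightarrow> ('a set \<times> 'a \<Rightarrow> real) set" where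
  "l2_forms G \<Lambda> \<mu> =
     {\<omega> \<in> one_forms G \<Lambda> \<mu>. (\<lambda>e. (\<omega> e)\<^sup>2 * edge_weight G \<Lambda> \<mu> e) summable_on edges G \<Lambda> \<mu>}"

definition differential :: "('a, 'x) monoid_scheme \<Rightarrow> ('a set \<Rightarrow> real) \<Rightarrow> 'a set \<times> 'a \<Rightarrow> real" where
  "differential G f e = f (ter G e) - f (org e)"

definition codifferential ::
  "('a, 'x) monoid_scheme \<Rightarrow> 'a set \<Rightarrow> 'a pmf \<Rightarrow> ('a set \<times> 'a \<Rightarrow> real) \<Rightarrow> 'a set \<Rightarrow> real" where
  "codifferential G \<Lambda> \<mu> \<omega> X =
     - (1 / vertex_weight G \<Lambda> X) *
       (\<Sum>\<^sub>\<infinity>e\<in>{e \<in> edges G \<Lambda> \<mu>. org e = X}. edge_weight G \<Lambda> \<mu> e * \<omega> e)"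

definition chi_form ::
  "('a, 'x) monoid_scheme \<Rightarrow> 'a set \<Rightarrow> 'a pmf \<Rightarrow> ('a set \<times> 'a \<Rightarrow> real) \<Rightarrow> real" where
  "chi_form G \<Lambda> \<mu> \<omega> = (\<Sum>\<^sub>\<infinity>e\<in>edges G \<Lambda> \<mu>. \<omega> e * edge_weight G \<Lambda> \<mu> e)"

definition harmonic_form ::
  "('a, 'x) monoid_scheme \<Rightarrow> 'a set \<Rightarrow> 'a pmf \<Rightarrow> ('a set \<times> 'a \<Rightarrow> real) \<Rightarrow> bool" where
  "harmonic_form G \<Lambda> \<mu> \<omega> \<longleftrightarrow>
     (\<forall>X\<in>rcosets\<^bsub>G\<^esub> \<Lambda>. codifferential G \<Lambda> \<mu> \<omega> X + chi_form G \<Lambda> \<mu> \<omega> = 0)"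

definition harmonic_part ::
  "('a, 'x) monoid_scheme \<Rightarrow> 'a set \<Rightarrow> 'a pmf \<Rightarrow> ('a set \<times> 'a \<Rightarrow> real) \<Rightarrow> 'a set \<times> 'a \<Rightarrow> real" where
  "harmonic_part G \<Lambda> \<mu> \<omega> =
     (THE u. u \<in> l2_forms G \<Lambda> \<mu> \<and> harmonic_form G \<Lambda> \<mu> u \<and>
        (\<exists>f. \<forall>e\<in>edges G \<Lambda> \<mu>. \<omega> e = u e + differential G f e))"


section \<open>Coordinates, covariance matrix, and Gaussian approximation\<close>

text \<open>The identification of \<open>\<Lambda>\<close> with \<open>\<int>\<^sup>m\<close> is an isomorphism
  \<open>\<iota>\<close> from \<open>\<Lambda>\<close> to \<^const>\<open>int_lattice_group\<close>.\<close>

definition lattice_part :: "('a, 'x) monoid_scheme \<Rightarrow> 'a set \<Rightarrow> 'a set \<Rightarrow> 'a \<Rightarrow> 'a" where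
  "lattice_part G \<Lambda> \<Delta> \<gamma> = (THE v. v \<in> \<Lambda> \<and> (\<exists>x\<in>\<Delta>. \<gamma> = v \<otimes>\<^bsub>G\<^esub> x))"

definition coord ::
  "('a, 'x) monoid_scheme \<Rightarrow> 'a set \<Rightarrow> 'a set \<Rightarrow> ('a \<Rightarrow> real ^ 'n) \<Rightarrow> 'a \<Rightarrow> real ^ 'n" where
  "coord G \<Lambda> \<Delta> \<iota> \<gamma> = \<iota> (lattice_part G \<Lambda> \<Delta> \<gamma>)"

text \<open>The value does not depend on the \<open>\<gamma>\<close> chosen in the coset, because \<open>coord\<close> is
  \<open>\<Lambda>\<close>-equivariant.\<close>

definition coord_edge ::
  "('a, 'x) monoid_scheme \<Rightarrow> 'a set \<Rightarrow> 'a set \<Rightarrow> ('a \<Rightarrow> real ^ 'n) \<Rightarrow> 'a set \<times> 'a \<Rightarrow> real ^ 'n" where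
  "coord_edge G \<Lambda> \<Delta> \<iota> e =
     (let \<gamma> = (SOME \<gamma>. \<gamma> \<in> org e)
      in coord G \<Lambda> \<Delta> \<iota> (\<gamma> \<otimes>\<^bsub>G\<^esub> snd e) - coord G \<Lambda> \<Delta> \<iota> \<gamma>)"

definition dual_form ::
  "('a, 'x) monoid_scheme \<Rightarrow> 'a set \<Rightarrow> 'a set \<Rightarrow> ('a \<Rightarrow> real ^ 'n) \<Rightarrow> 'a pmf \<Rightarrow> real ^ 'n
     \<Rightarrow> 'a set \<times> 'a \<Rightarrow> real" where
  "dual_form G \<Lambda> \<Delta> \<iota> \<mu> v =
     restrict (\<lambda>e. v \<bullet> coord_edge G \<Lambda> \<Delta> \<iota> e) (edges G \<Lambda> \<mu>)"

definition drift ::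
  "('a, 'x) monoid_scheme \<Rightarrow> 'a set \<Rightarrow> 'a set \<Rightarrow> ('a \<Rightarrow> real ^ 'n) \<Rightarrow> 'a pmf \<Rightarrow> real ^ 'n" where
  "drift G \<Lambda> \<Delta> \<iota> \<mu> =
     (\<Sum>\<^sub>\<infinity>e\<in>edges G \<Lambda> \<mu>. edge_weight G \<Lambda> \<mu> e *\<^sub>R coord_edge G \<Lambda> \<Delta> \<iota> e)"

definition covariance_form ::
  "('a, 'x) monoid_scheme \<Rightarrow> 'a set \<Rightarrow> 'a set \<Rightarrow> ('a \<Rightarrow> real ^ 'n) \<Rightarrow> 'a pmf
     \<Rightarrow> real ^ 'n \<Rightarrow> real ^ 'n \<Rightarrow> real" where
  "covariance_form G \<Lambda> \<Delta> \<iota> \<mu> v w =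
     (let u1 = harmonic_part G \<Lambda> \<mu> (dual_form G \<Lambda> \<Delta> \<iota> \<mu> v);
          u2 = harmonic_part G \<Lambda> \<mu> (dual_form G \<Lambda> \<Delta> \<iota> \<mu> w)
      in (\<Sum>\<^sub>\<infinity>e\<in>edges G \<Lambda> \<mu>. u1 e * u2 e * edge_weight G \<Lambda> \<mu> e)
         - (\<Sum>\<^sub>\<infinity>e\<in>edges G \<Lambda> \<mu>. u1 e * edge_weight G \<Lambda> \<mu> e)
           * (\<Sum>\<^sub>\<infinity>e\<in>edges G \<Lambda> \<mu>. u2 e * edge_weight G \<Lambda> \<mu> e))"

definition covariance_matrix ::
  "('a, 'x) monoid_scheme \<Rightarrow> 'a set \<Rightarrow> 'a set \<Rightarrow> ('a \<Rightarrow> real ^ 'n) \<Rightarrow> 'a pmf \<Rightarrow> real ^ 'n ^ 'n" where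
  "covariance_matrix G \<Lambda> \<Delta> \<iota> \<mu> =
     (THE \<Sigma>. \<forall>v w. v \<bullet> (\<Sigma> *v w) = covariance_form G \<Lambda> \<Delta> \<iota> \<mu> v w)"

definition gauss_density :: "real ^ 'n ^ 'n \<Rightarrow> real ^ 'n \<Rightarrow> real" where
  "gauss_density \<Sigma> v =
     (2 * pi) powr (- (real CARD('n) / 2)) * det \<Sigma> powr (- (1 / 2))
     * exp (- (1 / 2) * (v \<bullet> (matrix_inv \<Sigma> *v v)))"

definition gauss_approx ::
  "('a, 'x) monoid_scheme \<Rightarrow> 'a set \<Rightarrow> 'a set \<Rightarrow> ('a \<Rightarrow> real ^ 'n) \<Rightarrow> nat \<Rightarrow> real ^ 'n ^ 'n \<Rightarrow> real ^ 'n
     \<Rightarrow> 'a \<Rightarrow> real" where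
  "gauss_approx G \<Lambda> \<Delta> \<iota> n \<Sigma> \<zeta> \<gamma> =
     vertex_weight G \<Lambda> (\<Lambda> #>\<^bsub>G\<^esub> \<gamma>)
     * gauss_density (real n *\<^sub>R \<Sigma>) (coord G \<Lambda> \<Delta> \<iota> \<gamma> - real n *\<^sub>R \<zeta>)
     / (\<Sum>\<^sub>\<infinity>w\<in>int_lattice. gauss_density (real n *\<^sub>R \<Sigma>) w)"


section \<open>Transfer\<close>

text \<open>Here \<open>lattice_part (x \<otimes> \<gamma>)\<close> is \<open>\<alpha>(x, \<gamma>)\<close>; values are taken in \<open>\<int>\<^sup>m\<close> through \<open>\<iota>\<close>.\<close>

definition transfer_hom ::
  "('a, 'x) monoid_scheme \<Rightarrow> 'a set \<Rightarrow> 'a set \<Rightarrow> ('a \<Rightarrow> real ^ 'n) \<Rightarrow> 'a \<Rightarrow> real ^ 'n" where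
  "transfer_hom G \<Lambda> \<Delta> \<iota> \<gamma> = (\<Sum>x\<in>\<Delta>. \<iota> (lattice_part G \<Lambda> \<Delta> (x \<otimes>\<^bsub>G\<^esub> \<gamma>)))"

definition transfer_linear ::
  "('a, 'x) monoid_scheme \<Rightarrow> 'a set \<Rightarrow> 'a set \<Rightarrow> ('a \<Rightarrow> real ^ 'n) \<Rightarrow> real ^ 'n \<Rightarrow> real ^ 'n" where
  "transfer_linear G \<Lambda> \<Delta> \<iota> =
     (THE L. linear L \<and>
        (\<forall>g\<in>\<Lambda>. L (\<iota> g) = transfer_hom G \<Lambda> \<Delta> \<iota> g /\<^sub>R real (card (rcosets\<^bsub>G\<^esub> \<Lambda>))))"


section \<open>Products\<close>

text \<open>The product \<open>\<real>\<^sup>m \<times> \<real>\<^sup>n\<close> with its standard inner product is the space of vectors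
  indexed by the disjoint sum of the two index types, so that covariance matrices on it are
  library matrices.\<close>

definition vec_pair :: "real ^ 'm \<Rightarrow> real ^ 'n \<Rightarrow> real ^ ('m + 'n)" where
  "vec_pair v w = (\<chi> i. case i of Inl a \<Rightarrow> v $ a | Inr b \<Rightarrow> w $ b)"

definition prod_embedding ::
  "('a \<Rightarrow> real ^ 'm) \<Rightarrow> ('b \<Rightarrow> real ^ 'n) \<Rightarrow> 'a \<times> 'b \<Rightarrow> real ^ ('m + 'n)" where
  "prod_embedding \<iota>1 \<iota>2 g = vec_pair (\<iota>1 (fst g)) (\<iota>2 (snd g))"

end

theory Submission imports Defs "HOL-Real_Asymp.Real_Asymp" begin

text \<open>Functions on \<open>\<Gamma>\<close> that are invariant under \<open>\<Lambda>\<close> are functions on the finite quotient, on which a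
  power of the walk dominates a multiple of the uniform measure by aperiodicity. Hence the Poisson equation
  is solvable there, and \<open>\<Phi>\<close> can be corrected by a \<open>\<Lambda>\<close>-invariant function \<open>f\<close> such that the increments of
  \<open>\<Phi> - f\<close> have the same mean \<open>\<zeta>\<close> at every vertex; paired with \<open>v\<close>, these increments are the harmonic part of
  \<open>\<langle>v, \<Phi>\<^sub>e\<rangle>\<close>. A perturbation argument for the transition operator twisted by a character gives the central limit
  theorem, and a uniform bound on the twisted operators away from the trivial character turns it, by Fourier
  inversion, into a local limit theorem. Counting lattice points in balls and tightness upgrade this to total
  variation. In the product, correctors, drift and increments are taken componentwise. Averaged over the
  representatives, an increment along \<open>s\<close> is \<open>\<vartheta>(s)/#F\<close>, because \<open>f\<close> averages out; as
  \<open>\<vartheta>(s)\<close> is in the image of \<open>\<vartheta>\<close> extended linearly, this locates the drift and kills the mixed covariances.\<close>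

section \<open>Lebesgue measure and Fourier transforms\<close>

text \<open>The steps are identically distributed, but the coordinate increments depend on the coset
  reached, so neither the classical central limit theorem nor plain Fourier inversion applies to
  \<open>\<Phi>\<close>. Two devices restore them. Eigenvalue perturbation is replaced by an
  explicit approximate eigenfunction: it has to be correct only up to o(1/n) at finitely many
  vertices, and since twisted operators are contractions, the errors of n steps just add. Fourier
  inversion is done on one coset at a time, where \<open>\<Phi>\<close> is injective. The local
  limit controls each point up to o(n^(-m/2)), which sums to o(1) only over balls of radius of order
  sqrt n; the mass outside is bounded by the second moment of the martingale, which grows linearly.
  No overall normalising constant is computed: Jacobians and determinants enter as nonzero factors,
  and the total is fixed at the end because the law of the walk has mass one. The centre
  \<open>n zeta\<close> need not be a lattice point, whereas the normaliser of the Gaussian is an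
  unshifted sum; hence the two sums have to be compared.\<close>

lemma nn_integral_lborel_translate:
  fixes f :: "'a::euclidean_space \<Rightarrow> ennreal"
  assumes [measurable]: "f \<in> borel_measurable borel"
  shows "(\<integral>\<^sup>+x. f (t + x) \<partial>lborel) = (\<integral>\<^sup>+x. f x \<partial>lborel)"
proof -
  have "(\<integral>\<^sup>+x. f x \<partial>lborel) = (\<integral>\<^sup>+x. f x \<partial>density (distr lborel borel (\<lambda>x. t + 1 *\<^sub>R x)) (\<lambda>_. ennreal (\<bar>1\<bar>^DIM('a))))"
    by (subst lborel_affine[of 1 t]) auto
  also have "\<dots> = (\<integral>\<^sup>+x. f (t + x) \<partial>lborel)"
    by (simp add: nn_integral_density nn_integral_distr)
  finally show ?thesis by simp
qed

text \<open>Both sides are \<open>\<integral>\<integral> f (L x + y) g y\<close>, evaluated by translating in the one or the other variable;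
  this is the uniqueness proof for Haar measure.\<close>

lemma nn_integral_lborel_linear_swap:
  fixes L :: "'a::euclidean_space \<Rightarrow> 'a" and f g :: "'a \<Rightarrow> ennreal"
  assumes L: "linear L" and inj: "inj L"
    and [measurable]: "f \<in> borel_measurable borel" "g \<in> borel_measurable borel"
  shows "(\<integral>\<^sup>+x. f (L x) \<partial>lborel) * (\<integral>\<^sup>+y. g y \<partial>lborel)
       = (\<integral>\<^sup>+y. f y \<partial>lborel) * (\<integral>\<^sup>+x. g (- L x) \<partial>lborel)"
proof -
  obtain K where K: "linear K" "\<And>x. K (L x) = x" "\<And>x. L (K x) = x"
    using linear_injective_isomorphism[OF L inj] by auto
  have [measurable]: "L \<in> borel_measurable borel" "K \<in> borel_measurable borel"
    by (auto intro!: borel_measurable_continuous_onI linear_continuous_on simp: L K linear_conv_bounded_linear[symmetric])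
  have "(\<integral>\<^sup>+x. f (L x) \<partial>lborel) * (\<integral>\<^sup>+y. g y \<partial>lborel) = (\<integral>\<^sup>+y. g y * (\<integral>\<^sup>+x. f (L x) \<partial>lborel) \<partial>lborel)"
    by (simp add: nn_integral_multc mult.commute)
  also have "\<dots> = (\<integral>\<^sup>+y. g y * (\<integral>\<^sup>+x. f (L (K y + x)) \<partial>lborel) \<partial>lborel)"
    by (subst nn_integral_lborel_translate[of "\<lambda>x. f (L x)"]) auto
  also have "\<dots> = (\<integral>\<^sup>+y. \<integral>\<^sup>+x. g y * f (y + L x) \<partial>lborel \<partial>lborel)"
    by (simp add: nn_integral_cmult linear_add[OF L] K)
  also have "\<dots> = (\<integral>\<^sup>+x. \<integral>\<^sup>+y. g y * f (y + L x) \<partial>lborel \<partial>lborel)"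
    by (rule lborel_pair.Fubini') (simp add: split_beta')
  also have "\<dots> = (\<integral>\<^sup>+x. \<integral>\<^sup>+y. g (- L x + y) * f (- L x + y + L x) \<partial>lborel \<partial>lborel)"
    by (intro nn_integral_cong nn_integral_lborel_translate[symmetric]) measurable
  also have "\<dots> = (\<integral>\<^sup>+x. \<integral>\<^sup>+y. f y * g (y - L x) \<partial>lborel \<partial>lborel)"
    by (simp add: algebra_simps)
  also have "\<dots> = (\<integral>\<^sup>+y. \<integral>\<^sup>+x. f y * g (y - L x) \<partial>lborel \<partial>lborel)"
    by (rule lborel_pair.Fubini') (simp add: split_beta')
  also have "\<dots> = (\<integral>\<^sup>+y. f y * (\<integral>\<^sup>+x. g (y - L x) \<partial>lborel) \<partial>lborel)"
    by (simp add: nn_integral_cmult)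
  also have "\<dots> = (\<integral>\<^sup>+y. f y * (\<integral>\<^sup>+x. g (y - L (K y + x)) \<partial>lborel) \<partial>lborel)"
    by (intro nn_integral_cong arg_cong2[where f="(*)"] refl nn_integral_lborel_translate[symmetric]) measurable
  also have "\<dots> = (\<integral>\<^sup>+y. f y \<partial>lborel) * (\<integral>\<^sup>+x. g (- L x) \<partial>lborel)"
    by (simp add: linear_add[OF L] K nn_integral_multc)
  finally show ?thesis .
qed

text \<open>Putting the indicator of the unit ball for \<open>g\<close> into the swap identity makes
  the two measures proportional, with factor \<open>b / a\<close>. The work lies in
  \<open>0 < b < \<infinity>\<close>: the preimage of the ball contains a ball and lies in another
  one, because \<open>L\<close> and its inverse are bounded. The factor is the reciprocal of the
  absolute determinant of \<open>L\<close>, but is kept abstract.\<close>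

lemma lborel_distr_linear:
  fixes L :: "'a::euclidean_space \<Rightarrow> 'a"
  assumes L: "linear L" and inj: "inj L"
  obtains c :: real where "c > 0" "distr lborel borel L = density lborel (\<lambda>_. ennreal c)"
proof -
  have Lm [measurable]: "L \<in> borel_measurable borel"
    by (auto intro!: borel_measurable_continuous_onI linear_continuous_on simp: L linear_conv_bounded_linear[symmetric])
  define g :: "'a \<Rightarrow> ennreal" where "g = indicator (ball 0 1)"
  define a where "a = (\<integral>\<^sup>+y. g y \<partial>lborel)"
  define b where "b = (\<integral>\<^sup>+x. g (- L x) \<partial>lborel)"
  have [measurable]: "g \<in> borel_measurable borel" unfolding g_def by (rule borel_measurable_indicator) auto
  have "unit_ball_vol (real DIM('a)) \<noteq> 0"
    using unit_ball_vol_pos[of "real DIM('a)"] by linarith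
  with emeasure_lborel_ball_finite[of "0::'a" 1] have a: "a \<noteq> 0" "a \<noteq> \<infinity>"
    by (auto simp: a_def g_def emeasure_ball)
  obtain K where K: "linear K" "\<And>x. K (L x) = x" "\<And>x. L (K x) = x"
    using linear_injective_isomorphism[OF L inj] by auto
  \<comment> \<open>The ball is symmetric about 0, so the minus sign in \<open>b\<close> drops
    out.\<close>
  have b_eq: "b = emeasure lborel (L -` ball 0 1)"
    unfolding b_def g_def
    by (subst nn_integral_indicator[symmetric]) (auto intro!: nn_integral_cong measurable_sets_borel[OF Lm] simp: indicator_def)
  obtain M where M: "M > 0" "\<And>x. norm (L x) \<le> M * norm x"
    using linear_bounded_pos[OF L] by auto
  obtain M' where M': "M' > 0" "\<And>x. norm (K x) \<le> M' * norm x"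
    using linear_bounded_pos[OF K(1)] by auto
  have "ball 0 (1/M) \<subseteq> L -` ball 0 1"
    using M by (auto simp: field_simps) (meson le_less_trans)
  then have "emeasure lborel (ball (0::'a) (1/M)) \<le> b"
    unfolding b_eq by (rule emeasure_mono) (auto intro!: measurable_sets_borel[OF Lm])
  then have b0: "b \<noteq> 0" using M(1) by (auto simp: emeasure_ball \<open>unit_ball_vol (real DIM('a)) \<noteq> 0\<close>)
  have "L -` ball 0 1 \<subseteq> ball 0 M'"
  proof
    fix x assume "x \<in> L -` ball 0 1"
    then have "M' * norm (L x) < M' * 1" using M'(1) by (intro mult_strict_left_mono) auto
    then show "x \<in> ball 0 M'" using M'(2)[of "L x"] by (simp add: K)
  qed
  then have "b \<le> emeasure lborel (ball (0::'a) M')"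
    unfolding b_eq by (rule emeasure_mono) auto
  then have b1: "b \<noteq> \<infinity>"
    using emeasure_lborel_ball_finite[of "0::'a" M'] by (auto simp: top_unique)
  define c where "c = enn2real b / enn2real a"
  have c: "c > 0" using a b0 b1 by (simp add: c_def enn2real_positive_iff less_top zero_less_iff_neq_zero)
  have ab: "ennreal c * a = b"
    using a b1 enn2real_positive_iff[of a] unfolding c_def
    by (cases a; cases b) (auto simp: ennreal_mult[symmetric] less_top zero_less_iff_neq_zero)
  have "distr lborel borel L = density lborel (\<lambda>_. ennreal c)"
  proof (rule measure_eqI)
    fix A assume "A \<in> sets (distr lborel borel L)"
    then have A [measurable]: "A \<in> sets borel" by simp
    have "emeasure (distr lborel borel L) A = (\<integral>\<^sup>+x. indicator A x \<partial>distr lborel borel L)"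
      by simp
    also have "\<dots> = (\<integral>\<^sup>+x. indicator A (L x) \<partial>lborel)"
      by (rule nn_integral_distr) measurable
    finally have "emeasure (distr lborel borel L) A * a = (\<integral>\<^sup>+x. indicator A (L x) \<partial>lborel) * a"
      by simp
    also have "\<dots> = emeasure lborel A * b"
      unfolding a_def b_def by (subst nn_integral_lborel_linear_swap[OF L inj]) auto
    also have "\<dots> = ennreal c * emeasure lborel A * a"
      unfolding ab[symmetric] by (simp add: mult_ac)
    finally have "emeasure (distr lborel borel L) A = ennreal c * emeasure lborel A"
      using a by (auto simp: ennreal_mult_cancel_left mult.commute[of _ a])
    then show "emeasure (distr lborel borel L) A = emeasure (density lborel (\<lambda>_. ennreal c)) A"
      by (simp add: emeasure_density nn_integral_cmult)
  qed simp
  with c that show thesis by blast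
qed

lemma integral_lborel_linear:
  fixes L :: "'a::euclidean_space \<Rightarrow> 'a"
  assumes L: "linear L" and inj: "inj L"
  shows "\<exists>c>0. \<forall>f :: 'a \<Rightarrow> complex. f \<in> borel_measurable borel \<longrightarrow> (\<integral>x. f x \<partial>lborel) = c *\<^sub>R (\<integral>x. f (L x) \<partial>lborel)"
proof -
  obtain c where c: "c > 0" "distr lborel borel L = density lborel (\<lambda>_. ennreal c)"
    by (rule lborel_distr_linear[OF assms])
  have Lm [measurable]: "L \<in> borel_measurable borel"
    by (auto intro!: borel_measurable_continuous_onI linear_continuous_on simp: L linear_conv_bounded_linear[symmetric])
  show ?thesis
  proof (intro exI[of _ "1/c"] conjI allI impI)
    fix f :: "'a \<Rightarrow> complex" assume [measurable]: "f \<in> borel_measurable borel"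
    have "(\<integral>x. f (L x) \<partial>lborel) = (\<integral>x. f x \<partial>distr lborel borel L)"
      by (rule integral_distr[symmetric]) auto
    also have "\<dots> = c *\<^sub>R (\<integral>x. f x \<partial>lborel)"
      unfolding c using c(1) by (subst integral_density) auto
    finally show "(\<integral>x. f x \<partial>lborel) = (1/c) *\<^sub>R (\<integral>x. f (L x) \<partial>lborel)"
      using c(1) by simp
  qed (use c in auto)
qed

lemma
  fixes f :: "'a::euclidean_space \<Rightarrow> real \<Rightarrow> complex"
  assumes int: "\<And>b. b \<in> Basis \<Longrightarrow> integrable lborel (f b)"
  shows integrable_lborel_prod: "integrable lborel (\<lambda>x. \<Prod>b\<in>Basis. f b (x \<bullet> b))"
    and integral_lborel_prod: "(\<integral>x. (\<Prod>b\<in>Basis. f b (x \<bullet> b)) \<partial>lborel) = (\<Prod>b\<in>Basis. \<integral>x. f b x \<partial>lborel)"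
proof -
  interpret product_sigma_finite "\<lambda>b::'a. lborel :: real measure" by standard
  let ?s = "\<lambda>f::'a\<Rightarrow>real. \<Sum>b\<in>Basis. f b *\<^sub>R b"
  have [measurable]: "f b \<in> borel_measurable borel" if "b \<in> Basis" for b
    using int[OF that] by auto
  have m: "(\<lambda>x. \<Prod>b\<in>Basis. f b (x \<bullet> b)) \<in> borel_measurable borel" by measurable
  have s: "?s \<in> (\<Pi>\<^sub>M b\<in>Basis. lborel) \<rightarrow>\<^sub>M borel" by measurable
  have eq: "(\<Prod>b\<in>Basis. f b (?s x \<bullet> b)) = (\<Prod>b\<in>Basis. f b (x b))" for x
    by (intro prod.cong refl) simp
  show "integrable lborel (\<lambda>x. \<Prod>b\<in>Basis. f b (x \<bullet> b))"
    by (subst lborel_eq, subst integrable_distr_eq[OF s m]) (simp only: eq, rule product_integrable_prod, auto intro: int)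
  show "(\<integral>x. (\<Prod>b\<in>Basis. f b (x \<bullet> b)) \<partial>lborel) = (\<Prod>b\<in>Basis. \<integral>x. f b x \<partial>lborel)"
    by (subst lborel_eq, subst integral_distr[OF s m]) (simp only: eq, rule product_integral_prod, auto intro: int)
qed

section \<open>Orthogonality of lattice characters on the torus\<close>

abbreviation torus_box :: "'a::euclidean_space set" where
  "torus_box \<equiv> cbox ((- pi) *\<^sub>R One) (pi *\<^sub>R One)"

lemma mem_torus_box: "t \<in> torus_box \<longleftrightarrow> (\<forall>b\<in>Basis. \<bar>t \<bullet> b\<bar> \<le> pi)"
  by (auto simp: mem_box abs_le_iff)

lemma integral_iexp_period:
  assumes "k \<in> \<int>"
  shows "integrable lborel (\<lambda>x. indicator {-pi..pi} x * iexp (x * k))"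
    and "(\<integral>x. indicator {-pi..pi} x * iexp (x * k) \<partial>lborel) = (if k = 0 then 2 * pi else 0)"
proof -
  have *: "integrable lborel (\<lambda>x. indicator {-pi..pi} x *\<^sub>R iexp (x * k))"
    by (rule borel_integrable_compact) (auto intro!: continuous_intros)
  then show "integrable lborel (\<lambda>x. indicator {-pi..pi} x * iexp (x * k))"
    by (simp add: scaleR_conv_of_real of_real_indicator)
  have "(\<integral>x. indicator {-pi..pi} x *\<^sub>R iexp (x * k) \<partial>lborel) = (if k = 0 then 2 * pi else 0)"
  proof (cases "k = 0")
    case True
    then show ?thesis by (simp add: scaleR_conv_of_real)
  next
    case False
    define F where "F = (\<lambda>x. iexp (x * k) / (\<i> * k))"
    have "(F has_vector_derivative iexp (x * k)) (at x within {-pi..pi})" for x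
    proof -
      have "((\<lambda>x. exp (\<i> * (x * k)) / (\<i> * k)) has_field_derivative exp (\<i> * (x * k))) (at (of_real x))"
        using False by (auto intro!: derivative_eq_intros simp: field_simps)
      then have "((\<lambda>x. exp (\<i> * (complex_of_real x * k)) / (\<i> * k)) has_vector_derivative exp (\<i> * (x * k))) (at x within {-pi..pi})"
        by (rule has_vector_derivative_real_field)
      then show ?thesis by (simp add: F_def)
    qed
    then have "(\<integral>x. indicator {-pi..pi} x *\<^sub>R iexp (x * k) \<partial>lborel) = F pi - F (-pi)"
      by (intro integral_FTC_Icc) (auto intro!: continuous_intros)
    moreover obtain j where j: "k = of_int j" using assms by (auto elim: Ints_cases)
    have "iexp (pi * k) = iexp (- pi * k)"
    proof -
      have "sin (pi * k) = 0" by (subst sin_zero_iff_int2) (auto simp: j)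
      then show ?thesis by (simp add: exp_eq_polar complex_eq_iff Re_exp Im_exp)
    qed
    ultimately show ?thesis using False by (simp add: F_def)
  qed
  then show "(\<integral>x. indicator {-pi..pi} x * iexp (x * k) \<partial>lborel) = (if k = 0 then 2 * pi else 0)"
    by (simp add: scaleR_conv_of_real of_real_indicator)
qed

lemma iexp_inner:
  fixes t w :: "'a::euclidean_space"
  shows "iexp (t \<bullet> w) = (\<Prod>b\<in>Basis. iexp ((t \<bullet> b) * (w \<bullet> b)))"
  by (subst euclidean_inner) (simp add: exp_sum sum_distrib_left)

lemma indicator_torus_box:
  fixes t :: "'a::euclidean_space"
  shows "(indicator torus_box t :: complex) = (\<Prod>b\<in>Basis. indicator {-pi..pi} (t \<bullet> b))"
  by (auto simp: indicator_def mem_box prod_zero_iff)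

text \<open>The integral factors over the coordinates, and a single nonzero integer frequency
  already makes one factor vanish.\<close>

lemma integral_torus_character:
  fixes w :: "'a::euclidean_space"
  assumes w: "\<forall>b\<in>Basis. w \<bullet> b \<in> \<int>"
  shows "(\<integral>t. indicator torus_box t * iexp (t \<bullet> w) \<partial>lborel) = (if w = 0 then (2 * pi) ^ DIM('a) else 0)"
proof -
  have "(\<integral>t. indicator torus_box t * iexp (t \<bullet> w) \<partial>lborel)
      = (\<integral>t. (\<Prod>b\<in>Basis. indicator {-pi..pi} (t \<bullet> b) * iexp ((t \<bullet> b) * (w \<bullet> b))) \<partial>lborel)"
    by (simp only: iexp_inner indicator_torus_box prod.distrib)
  also have "\<dots> = (\<Prod>b\<in>Basis. \<integral>x. indicator {-pi..pi} x * iexp (x * (w \<bullet> b)) \<partial>lborel)"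
    by (rule integral_lborel_prod) (rule integral_iexp_period(1), use w in auto)
  also have "\<dots> = (\<Prod>b\<in>(Basis::'a set). if w \<bullet> b = 0 then of_real (2 * pi) else 0)"
    by (rule prod.cong[OF refl], subst integral_iexp_period(2)) (use w in auto)
  also have "\<dots> = (if w = 0 then (2 * pi) ^ DIM('a) else 0)"
    by (auto simp: euclidean_eq_iff[of w 0] prod_zero_iff)
  finally show ?thesis by simp
qed

section \<open>Fourier transforms of Gaussians\<close>

lemma std_gaussian_iexp:
  fixes y :: real
  shows "integrable lborel (\<lambda>x. of_real (exp (- x\<^sup>2 / 2)) * iexp (x * y))"
    and "(\<integral>x. of_real (exp (- x\<^sup>2 / 2)) * iexp (x * y) \<partial>lborel) = of_real (sqrt (2 * pi) * exp (- y\<^sup>2 / 2))"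
proof -
  have 1: "integrable lborel (\<lambda>x. std_normal_density x *\<^sub>R iexp (y * x))"
  proof (rule Bochner_Integration.integrable_bound)
    show "integrable lborel std_normal_density" by simp
  qed auto
  have 2: "(\<lambda>x. of_real (exp (- x\<^sup>2 / 2)) * iexp (x * y)) = (\<lambda>x. sqrt (2 * pi) * (std_normal_density x *\<^sub>R iexp (y * x)))"
    by (auto simp: std_normal_density_def scaleR_conv_of_real mult.commute field_simps simp flip: exp_of_real)
  show "integrable lborel (\<lambda>x. of_real (exp (- x\<^sup>2 / 2)) * iexp (x * y))"
    unfolding 2 using 1 by (rule integrable_mult_right)
  have "char std_normal_distribution y = of_real (exp (- (y\<^sup>2) / 2))"
    by (simp add: char_std_normal_distribution)
  also have "char std_normal_distribution y = (\<integral>x. std_normal_density x *\<^sub>R iexp (y * x) \<partial>lborel)"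
    unfolding char_def by (subst integral_density) auto
  finally show "(\<integral>x. of_real (exp (- x\<^sup>2 / 2)) * iexp (x * y) \<partial>lborel) = of_real (sqrt (2 * pi) * exp (- y\<^sup>2 / 2))"
    unfolding 2 by (subst integral_mult_right_zero) (simp add: mult.assoc)
qed

lemma std_gaussian_fourier:
  fixes y :: "'a::euclidean_space"
  shows "(\<integral>t. of_real (exp (- (t \<bullet> t) / 2)) * iexp (t \<bullet> y) \<partial>lborel) = of_real (sqrt (2 * pi) ^ DIM('a) * exp (- (y \<bullet> y) / 2))"
    and "integrable lborel (\<lambda>t. of_real (exp (- (t \<bullet> t) / 2)) * iexp (t \<bullet> y))"
proof -
  have e: "of_real (exp (- (t \<bullet> t) / 2)) * iexp (t \<bullet> y)
     = (\<Prod>b\<in>Basis. of_real (exp (- (t \<bullet> b)\<^sup>2 / 2)) * iexp ((t \<bullet> b) * (y \<bullet> b)))" for t :: 'a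
  proof -
    have "exp (- (t \<bullet> t) / 2) = (\<Prod>b\<in>Basis. exp (- (t \<bullet> b)\<^sup>2 / 2))"
      by (subst euclidean_inner, subst exp_sum[symmetric])
         (auto simp: sum_divide_distrib sum_negf power2_eq_square)
    then show ?thesis by (simp only: iexp_inner prod.distrib of_real_prod)
  qed
  show "integrable lborel (\<lambda>t. of_real (exp (- (t \<bullet> t) / 2)) * iexp (t \<bullet> y))"
    unfolding e by (rule integrable_lborel_prod) (rule std_gaussian_iexp(1))
  have "(\<integral>t. of_real (exp (- (t \<bullet> t) / 2)) * iexp (t \<bullet> y) \<partial>lborel)
      = (\<Prod>b\<in>Basis. of_real (sqrt (2 * pi) * exp (- (y \<bullet> b)\<^sup>2 / 2)))"
    unfolding e
    by (subst integral_lborel_prod, rule std_gaussian_iexp(1), rule prod.cong[OF refl], subst std_gaussian_iexp(2)) simp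
  also have "\<dots> = of_real (\<Prod>b\<in>(Basis::'a set). sqrt (2 * pi) * exp (- (y \<bullet> b)\<^sup>2 / 2))"
    by simp
  also have "(\<Prod>b\<in>(Basis::'a set). sqrt (2 * pi) * exp (- (y \<bullet> b)\<^sup>2 / 2)) = sqrt (2 * pi) ^ DIM('a) * exp (- (y \<bullet> y) / 2)"
    by (subst euclidean_inner[of y y])
       (auto simp: prod.distrib exp_sum[symmetric] sum_divide_distrib sum_negf power2_eq_square)
  finally show "(\<integral>t. of_real (exp (- (t \<bullet> t) / 2)) * iexp (t \<bullet> y) \<partial>lborel) = of_real (sqrt (2 * pi) ^ DIM('a) * exp (- (y \<bullet> y) / 2))" .
qed

text \<open>Gram-Schmidt for the scalar product \<open>x \<bullet> S y\<close>. The map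
  \<open>B\<close> sends the standard basis to an \<open>S\<close>-orthonormal one and thus plays
  the role of an inverse square root of \<open>S\<close>.\<close>

lemma positive_definite_orthonormalize:
  fixes S :: "'a::euclidean_space \<Rightarrow> 'a"
  assumes S: "linear S" and sym: "\<And>x y. x \<bullet> S y = S x \<bullet> y" and pos: "\<And>x. x \<noteq> 0 \<Longrightarrow> x \<bullet> S x > 0"
  shows "\<exists>B. linear B \<and> inj B \<and> (\<forall>s t. B s \<bullet> S (B t) = s \<bullet> (t::'a))"
proof -
  have "\<exists>f. \<forall>a\<in>A. \<forall>b\<in>A. f a \<bullet> S (f b) = (if a = b then 1 else 0)"
    if "finite A" "A \<subseteq> Basis" for A :: "'a set"
    using that
  proof (induction A)
    case empty then show ?case by simp
  next
    case (insert a A)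
    then obtain f where f: "f b \<bullet> S (f c) = (if b = c then 1 else 0)" if "b \<in> A" "c \<in> A" for b c by auto
    \<comment> \<open>Fewer than \<open>DIM('a)\<close> vectors do not span the space, so some
      \<open>x\<close> leaves a nonzero remainder \<open>y\<close> after its
      \<open>S\<close>-projection onto their span is removed.\<close>
    have "dim (f ` A) \<le> card (f ` A)" using insert by (intro dim_le_card') auto
    also have "\<dots> \<le> card A" using insert by (intro card_image_le)
    also have "\<dots> < card (insert a A)" using insert by simp
    also have "\<dots> \<le> DIM('a)" using insert by (intro card_mono) auto
    finally have "span (f ` A) \<noteq> UNIV" by (metis dim_span dim_UNIV less_irrefl)
    then obtain x where x: "x \<notin> span (f ` A)" by auto
    define y where "y = x - (\<Sum>b\<in>A. (x \<bullet> S (f b)) *\<^sub>R f b)"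
    have "(\<Sum>b\<in>A. (x \<bullet> S (f b)) *\<^sub>R f b) \<in> span (f ` A)"
      by (intro span_sum span_scale span_base) auto
    with x have "y \<noteq> 0" unfolding y_def by auto
    then have yy: "y \<bullet> S y > 0" by (rule pos)
    have yf: "y \<bullet> S (f b) = 0" if "b \<in> A" for b
      unfolding y_def using that insert.hyps
      by (simp add: inner_diff_left inner_sum_left f if_distrib[of "(*) _"] cong: if_cong)
    then have fy: "f b \<bullet> S y = 0" if "b \<in> A" for b using yf[OF that] sym[of "f b" y] by (metis inner_commute)
    define g where "g = f(a := (1 / sqrt (y \<bullet> S y)) *\<^sub>R y)"
    have "g b \<bullet> S (g c) = (if b = c then 1 else 0)" if "b \<in> insert a A" "c \<in> insert a A" for b c
    proof -
      have n: "(1 / sqrt (y \<bullet> S y)) * ((1 / sqrt (y \<bullet> S y)) * (y \<bullet> S y)) = 1"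
        using yy by (simp add: field_simps)
      show ?thesis
        using that insert.hyps n yf fy f by (auto simp: g_def linear_cmul[OF S])
    qed
    then show ?case by blast
  qed
  from this[OF finite_Basis order.refl] obtain f :: "'a \<Rightarrow> 'a" where
    f0: "\<forall>a\<in>Basis. \<forall>b\<in>Basis. f a \<bullet> S (f b) = (if a = b then 1 else 0)" by (elim exE)
  then have f: "f a \<bullet> S (f b) = (if a = b then 1 else 0)" if "a \<in> Basis" "b \<in> Basis" for a b
    using that by (elim ballE) auto
  define B where "B t = (\<Sum>b\<in>Basis. (t \<bullet> b) *\<^sub>R f b)" for t
  have B: "linear B" unfolding B_def
    by (intro linearI) (auto simp: inner_add_left scaleR_add_left sum.distrib scaleR_sum_right)
  have fB: "f b \<bullet> S (B t) = t \<bullet> b" if "b \<in> Basis" for b t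
  proof -
    have "f b \<bullet> S (B t) = (\<Sum>c\<in>Basis. (t \<bullet> c) * (f b \<bullet> S (f c)))"
      by (simp add: B_def linear_sum[OF S] linear_cmul[OF S] inner_sum_right)
    also have "\<dots> = (\<Sum>c\<in>Basis. if c = b then t \<bullet> c else 0)"
      using that by (intro sum.cong) (auto simp: f)
    finally show ?thesis using that by simp
  qed
  have BS: "B s \<bullet> S (B t) = s \<bullet> t" for s t
  proof -
    have "B s \<bullet> S (B t) = (\<Sum>b\<in>Basis. (s \<bullet> b) * (f b \<bullet> S (B t)))"
      by (simp add: B_def[of s] inner_sum_left)
    also have "\<dots> = (\<Sum>b\<in>Basis. (s \<bullet> b) * (t \<bullet> b))"
      by (intro sum.cong) (auto simp: fB)
    finally show ?thesis by (subst euclidean_inner[of s t])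
  qed
  have "inj B"
    unfolding linear_injective_0[OF B]
  proof (intro allI impI)
    fix t assume "B t = 0" then have "t \<bullet> t = 0" using BS[of t t] by simp then show "t = 0" by simp
  qed
  with B BS show ?thesis by (intro exI[of _ B] conjI allI)
qed

text \<open>Substituting \<open>B\<close> from \<open>positive_definite_orthonormalize\<close>
  reduces this to the standard Gaussian, with \<open>z = B u\<close>. Evaluating the transform at
  \<open>S z\<close> instead of at a free vector keeps the inverse of \<open>S\<close> out of the
  exponent; since \<open>S\<close> is bijective, every frequency is still reached.\<close>

lemma gaussian_fourier:
  fixes S :: "'a::euclidean_space \<Rightarrow> 'a"
  assumes S: "linear S" and sym: "\<And>x y. x \<bullet> S y = S x \<bullet> y" and pos: "\<And>x. x \<noteq> 0 \<Longrightarrow> x \<bullet> S x > 0"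
  shows "\<exists>C>0. \<forall>z. (\<integral>t. of_real (exp (- (t \<bullet> S t) / 2)) * iexp (t \<bullet> S z) \<partial>lborel) = of_real (C * exp (- (z \<bullet> S z) / 2))"
proof -
  have "\<exists>B. linear B \<and> inj B \<and> (\<forall>s t. B s \<bullet> S (B t) = s \<bullet> (t::'a))"
    by (rule positive_definite_orthonormalize[OF S sym]) (rule pos)
  then obtain B :: "'a \<Rightarrow> 'a" where B: "linear B" "inj B" and BS0: "\<forall>s t. B s \<bullet> S (B t) = s \<bullet> t"
    by (elim exE conjE)
  note BS = BS0[rule_format]
  obtain c where c: "c > 0"
    "\<forall>f :: 'a \<Rightarrow> complex. f \<in> borel_measurable borel \<longrightarrow> (\<integral>x. f x \<partial>lborel) = c *\<^sub>R (\<integral>x. f (B x) \<partial>lborel)"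
    using integral_lborel_linear[OF B] by (elim exE conjE)
  have [measurable]: "S \<in> borel_measurable borel"
    by (auto intro!: borel_measurable_continuous_onI linear_continuous_on simp: S linear_conv_bounded_linear[symmetric])
  show ?thesis
  proof (intro exI[of _ "c * sqrt (2 * pi) ^ DIM('a)"] conjI allI)
    show "c * sqrt (2 * pi) ^ DIM('a) > 0" using c(1) by simp
    fix z
    have "surj B" using B by (rule linear_inj_imp_surj)
    then obtain u where z: "z = B u" by auto
    have "(\<integral>t. of_real (exp (- (t \<bullet> S t) / 2)) * iexp (t \<bullet> S z) \<partial>lborel)
        = c *\<^sub>R (\<integral>t. of_real (exp (- (B t \<bullet> S (B t)) / 2)) * iexp (B t \<bullet> S z) \<partial>lborel)"
      by (rule c(2)[rule_format]) measurable
    then show "(\<integral>t. of_real (exp (- (t \<bullet> S t) / 2)) * iexp (t \<bullet> S z) \<partial>lborel)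
        = of_real (c * sqrt (2 * pi) ^ DIM('a) * exp (- (z \<bullet> S z) / 2))"
      unfolding z BS std_gaussian_fourier(1) by (simp add: scaleR_conv_of_real)
  qed
qed

section \<open>Expectations with respect to probability mass functions\<close>

lemma integrable_pmf_bounded:
  fixes F :: "'a \<Rightarrow> 'b::{banach,second_countable_topology}"
  assumes "\<And>x. x \<in> set_pmf p \<Longrightarrow> norm (F x) \<le> K"
  shows "integrable (measure_pmf p) F"
  by (rule measure_pmf.integrable_const_bound[where B=K]) (auto simp: AE_measure_pmf_iff assms)

lemma norm_expectation_le:
  fixes F :: "'a \<Rightarrow> 'b::{banach,second_countable_topology}"
  assumes "\<And>x. x \<in> set_pmf p \<Longrightarrow> norm (F x) \<le> K"
  shows "norm (measure_pmf.expectation p F) \<le> K"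
proof -
  have "norm (measure_pmf.expectation p F) \<le> measure_pmf.expectation p (\<lambda>x. norm (F x))"
    by (rule integral_norm_bound)
  also have "\<dots> \<le> measure_pmf.expectation p (\<lambda>x. K)"
    by (rule integral_mono_AE) (auto simp: AE_measure_pmf_iff assms intro!: integrable_pmf_bounded[where K=K])
  finally show ?thesis by simp
qed

lemma expectation_pair_pmf_real:
  fixes F :: "'a \<times> 'b \<Rightarrow> real"
  assumes "\<And>a b. a \<in> set_pmf p \<Longrightarrow> b \<in> set_pmf q \<Longrightarrow> \<bar>F (a, b)\<bar> \<le> K"
  shows "measure_pmf.expectation (pair_pmf p q) F = measure_pmf.expectation p (\<lambda>a. measure_pmf.expectation q (\<lambda>b. F (a, b)))"
proof -
  \<comment> \<open>\<open>F\<close> is bounded on the supports only, whereas integration along a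
    bind asks for a global bound. Cutting \<open>F\<close> off outside the supports changes no
    expectation.\<close>
  define F' where "F' z = (if z \<in> set_pmf p \<times> set_pmf q then F z else 0)" for z
  have b: "\<bar>F' z\<bar> \<le> max K 0" for z using assms by (cases z) (auto simp: F'_def max_def dest: assms)
  have bind: "measure_pmf.expectation (bind_pmf M N) f = measure_pmf.expectation M (\<lambda>a. measure_pmf.expectation (N a) f)"
    if "\<And>x. \<bar>f x\<bar> \<le> B" for M :: "'c pmf" and N :: "'c \<Rightarrow> 'd pmf" and f :: "'d \<Rightarrow> real" and B
    unfolding measure_pmf_bind
  proof (rule integral_bind[where K="count_space UNIV" and B=B and B'=1])
    show "(\<lambda>x. measure_pmf (N x)) \<in> measurable (measure_pmf M) (subprob_algebra (count_space UNIV))"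
      using measurable_measure_pmf[of N] by (simp cong: measurable_cong_sets)
    show "AE x in M. emeasure (N x) (space (N x)) \<le> ennreal 1"
      by (simp add: measure_pmf.emeasure_space_1[simplified])
  qed (use that in \<open>auto simp: measure_pmf.finite_measure_axioms\<close>)
  have "measure_pmf.expectation (pair_pmf p q) F = measure_pmf.expectation (pair_pmf p q) F'"
    by (intro integral_cong_AE) (auto simp: AE_measure_pmf_iff F'_def)
  also have "\<dots> = measure_pmf.expectation p (\<lambda>a. measure_pmf.expectation q (\<lambda>b. F' (a, b)))"
    unfolding pair_pmf_def by (subst bind[OF b], subst bind[OF b]) simp
  also have "\<dots> = measure_pmf.expectation p (\<lambda>a. measure_pmf.expectation q (\<lambda>b. F (a, b)))"
    by (intro integral_cong_AE) (auto simp: AE_measure_pmf_iff F'_def intro!: integral_cong_AE)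
  finally show ?thesis .
qed

text \<open>Reduced to the real case by testing both sides against the basis vectors; the bound on
  \<open>F\<close> supplies the integrability that moves the inner product through each
  integral.\<close>

lemma expectation_pair_pmf:
  fixes F :: "'a \<times> 'b \<Rightarrow> 'c::euclidean_space"
  assumes "\<And>a b. a \<in> set_pmf p \<Longrightarrow> b \<in> set_pmf q \<Longrightarrow> norm (F (a, b)) \<le> K"
  shows "measure_pmf.expectation (pair_pmf p q) F = measure_pmf.expectation p (\<lambda>a. measure_pmf.expectation q (\<lambda>b. F (a, b)))"
proof (rule euclidean_eqI)
  fix e :: 'c assume e: "e \<in> Basis"
  have i1: "integrable (pair_pmf p q) F"
    by (rule integrable_pmf_bounded[where K=K]) (use assms in auto)
  have i2: "integrable q (\<lambda>b. F (a, b))" if "a \<in> set_pmf p" for a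
    by (rule integrable_pmf_bounded[where K=K]) (use assms that in auto)
  have i3: "integrable p (\<lambda>a. measure_pmf.expectation q (\<lambda>b. F (a, b)))"
    by (rule integrable_pmf_bounded[where K=K]) (use assms in \<open>auto intro!: norm_expectation_le\<close>)
  have "measure_pmf.expectation (pair_pmf p q) F \<bullet> e = measure_pmf.expectation (pair_pmf p q) (\<lambda>z. F z \<bullet> e)"
    using i1 by (rule integral_inner_left[symmetric, rotated]) 
  also have "\<dots> = measure_pmf.expectation p (\<lambda>a. measure_pmf.expectation q (\<lambda>b. F (a, b) \<bullet> e))"
    by (rule expectation_pair_pmf_real[where K=K]) (use assms e Basis_le_norm in \<open>fastforce intro: order.trans\<close>)
  also have "\<dots> = measure_pmf.expectation p (\<lambda>a. measure_pmf.expectation q (\<lambda>b. F (a, b)) \<bullet> e)"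
    by (intro integral_cong_AE) (auto simp: AE_measure_pmf_iff intro!: integral_inner_left i2)
  also have "\<dots> = measure_pmf.expectation p (\<lambda>a. measure_pmf.expectation q (\<lambda>b. F (a, b))) \<bullet> e"
    using i3 by (rule integral_inner_left[rotated]) 
  finally show "measure_pmf.expectation (pair_pmf p q) F \<bullet> e
     = measure_pmf.expectation p (\<lambda>a. measure_pmf.expectation q (\<lambda>b. F (a, b))) \<bullet> e" .
qed

text \<open>Doeblin minorization: \<open>p\<close> contains \<open>d\<close> times counting measure
  on \<open>A\<close>, and what is left has mass \<open>1 - d * card A\<close>. It is applied twice:
  to mean-zero functions on the quotient, where the explicit sum vanishes, and to twisted functions,
  where the explicit sum has two terms that partly cancel.\<close>

lemma expectation_minorized:
  fixes h :: "'a \<Rightarrow> 'b::{banach,second_countable_topology}"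
  assumes A: "finite A" and d: "\<And>a. a \<in> A \<Longrightarrow> d \<le> pmf p a" and d0: "d \<ge> 0"
    and h: "\<And>x. x \<in> set_pmf p \<Longrightarrow> norm (h x) \<le> K"
  shows "norm (measure_pmf.expectation p h - d *\<^sub>R (\<Sum>a\<in>A. h a)) \<le> (1 - d * card A) * K"
proof -
  \<comment> \<open>\<open>u\<close> is the density relative to \<open>p\<close> of \<open>d\<close>
    times counting measure on \<open>A\<close>; it is at most 1 because \<open>d\<close> is a lower
    bound of \<open>pmf p\<close> on \<open>A\<close>.\<close>
  define u where "u x = (if x \<in> A then d / pmf p x else 0)" for x
  have u: "0 \<le> u x" "u x \<le> 1" for x
    using d[of x] d0 pmf_nonneg[of p x] by (auto simp: u_def divide_le_eq_1)
  have pu: "pmf p x * u x = d" if "x \<in> A" for x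
    using d[of x] d0 that by (auto simp: u_def)
  have iu: "integrable p (\<lambda>x. u x *\<^sub>R h x)"
    by (rule integrable_pmf_bounded[where K=K]) (use u h in \<open>auto intro: order.trans[OF mult_left_le_one_le]\<close>)
  have ih: "integrable p h" by (rule integrable_pmf_bounded[OF h])
  have iu': "integrable p u"
    by (rule integrable_pmf_bounded[where K=1]) (use u in auto)
  have "measure_pmf.expectation p (\<lambda>x. u x *\<^sub>R h x) = (\<Sum>a\<in>A. pmf p a *\<^sub>R (u a *\<^sub>R h a))"
    by (rule integral_measure_pmf[OF A]) (auto simp: u_def split: if_splits)
  also have "\<dots> = d *\<^sub>R (\<Sum>a\<in>A. h a)"
    by (simp add: pu scaleR_sum_right)
  finally have 1: "measure_pmf.expectation p h - d *\<^sub>R (\<Sum>a\<in>A. h a)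
     = measure_pmf.expectation p (\<lambda>x. (1 - u x) *\<^sub>R h x)"
    using iu ih by (simp add: algebra_simps)
  have "measure_pmf.expectation p u = (\<Sum>a\<in>A. pmf p a *\<^sub>R u a)"
    by (rule integral_measure_pmf[OF A]) (auto simp: u_def split: if_splits)
  then have 2: "measure_pmf.expectation p u = d * card A" by (simp add: pu)
  have i4: "integrable p (\<lambda>x. (1 - u x) *\<^sub>R h x)"
    using iu ih by (simp add: scaleR_left_diff_distrib)
  have i5: "integrable p (\<lambda>x. (1 - u x) * K)"
    using iu' by simp
  have "norm (measure_pmf.expectation p (\<lambda>x. (1 - u x) *\<^sub>R h x)) \<le> measure_pmf.expectation p (\<lambda>x. norm ((1 - u x) *\<^sub>R h x))"
    by (rule integral_norm_bound)
  also have "\<dots> \<le> measure_pmf.expectation p (\<lambda>x. (1 - u x) * K)"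
    by (rule integral_mono_AE[OF integrable_norm[OF i4] i5])
       (auto simp: AE_measure_pmf_iff u intro!: mult_left_mono h)
  also have "\<dots> = (1 - d * card A) * K"
    using iu' by (simp add: 2)
  finally show ?thesis unfolding 1 .
qed

text \<open>On an arbitrary type \<open>'g\<close>, measurability of every section
  \<open>\<lambda>t. F t s\<close> does not give joint measurability in the product. The support of
  \<open>p\<close> is countable, so the integral is moved to a law \<open>q\<close> on the natural
  numbers, where joint measurability is a countable gluing of sections.\<close>

lemma Fubini_pmf_lborel:
  fixes F :: "'a::euclidean_space \<Rightarrow> 'g \<Rightarrow> complex"
  assumes F [measurable]: "\<And>s. s \<in> set_pmf p \<Longrightarrow> (\<lambda>t. F t s) \<in> borel_measurable borel"
    and bound: "\<And>t s. s \<in> set_pmf p \<Longrightarrow> norm (F t s) \<le> g t"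
    and g: "integrable lborel g"
  shows "(\<integral>t. measure_pmf.expectation p (F t) \<partial>lborel) = measure_pmf.expectation p (\<lambda>s. \<integral>t. F t s \<partial>lborel)" (is ?A)
    and "(\<lambda>t. measure_pmf.expectation p (F t)) \<in> borel_measurable borel" (is ?B)
proof -
  define e where "e = from_nat_into (set_pmf p)"
  define q where "q = map_pmf (to_nat_on (set_pmf p)) p"
  have e: "e k \<in> set_pmf p" for k
    unfolding e_def by (rule from_nat_into) (rule set_pmf_not_empty)
  have "map_pmf e q = map_pmf id p"
    unfolding q_def map_pmf_comp by (rule map_pmf_cong) (auto simp: e_def countable_set_pmf)
  then have pq: "p = map_pmf e q" by simp
  have m [measurable]: "(\<lambda>(t, k). F t (e k)) \<in> borel_measurable (lborel \<Otimes>\<^sub>M measure_pmf q)"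
  proof -
    have "(\<lambda>z. (\<lambda>k z. F (fst z) (e k)) (snd z) z) \<in> borel_measurable (lborel \<Otimes>\<^sub>M measure_pmf q)"
      by (rule measurable_compose_countable[where g=snd]) (auto intro!: measurable_compose[OF measurable_fst] F e)
    then show ?thesis by (simp add: split_beta')
  qed
  interpret pair_sigma_finite "lborel :: 'a measure" "measure_pmf q"
    by (intro pair_sigma_finite.intro measure_pmf.sigma_finite_measure_axioms sigma_finite_lborel)
  have b: "norm (F t (e k)) \<le> g t" for t k using bound[OF e] .
  have int: "integrable (lborel \<Otimes>\<^sub>M measure_pmf q) (\<lambda>(t, k). F t (e k))"
  proof (rule Fubini_integrable)
    show "integrable lborel (\<lambda>t. measure_pmf.expectation q (\<lambda>k. norm ((\<lambda>(t, k). F t (e k)) (t, k))))"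
    proof (rule Bochner_Integration.integrable_bound[OF g])
      show "AE t in lborel. norm (measure_pmf.expectation q (\<lambda>k. norm ((\<lambda>(t, k). F t (e k)) (t, k)))) \<le> norm (g t)"
        using b by (auto intro!: AE_I2 norm_expectation_le[of q "\<lambda>k. cmod (F _ (e k))", simplified] order.trans[OF _ abs_ge_self])
    qed measurable
    show "AE t in lborel. integrable (measure_pmf q) (\<lambda>k. (\<lambda>(t, k). F t (e k)) (t, k))"
      using b by (auto intro!: AE_I2 integrable_pmf_bounded)
  qed (rule m)
  show ?A
    unfolding pq by (simp add: Fubini_integral[OF int, symmetric])
  show ?B
    unfolding pq by (simp, measurable)
qed

text \<open>In the application \<open>A\<close> is a coset of the lattice. On it the coordinate
  determines the group element, so the character integral keeps exactly the one \<open>s\<close>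
  with \<open>X s = w\<close>.\<close>

lemma fourier_inversion_pmf:
  fixes p :: "'g pmf" and X :: "'g \<Rightarrow> 'a::euclidean_space"
  assumes int: "\<And>s b. s \<in> set_pmf p \<Longrightarrow> s \<in> A \<Longrightarrow> b \<in> Basis \<Longrightarrow> (X s - w) \<bullet> b \<in> \<int>"
    and inj: "\<And>s. s \<in> set_pmf p \<Longrightarrow> s \<in> A \<Longrightarrow> X s = w \<longleftrightarrow> s = \<gamma>" and \<gamma>: "\<gamma> \<in> A"
  shows "(\<integral>t. indicator torus_box t * measure_pmf.expectation p (\<lambda>s. indicator A s * iexp (t \<bullet> (X s - w))) \<partial>lborel)
     = of_real ((2 * pi) ^ DIM('a) * pmf p \<gamma>)" (is "?L = _")
proof -
  define F where "F t s = indicator torus_box t * (indicator A s * iexp (t \<bullet> (X s - w)))" for t :: 'a and s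
  have "?L = (\<integral>t. measure_pmf.expectation p (F t) \<partial>lborel)"
    by (subst F_def[abs_def], subst integral_mult_right_zero) (rule refl)
  also have "\<dots> = measure_pmf.expectation p (\<lambda>s. \<integral>t. F t s \<partial>lborel)"
  proof (rule Fubini_pmf_lborel)
    show "(\<lambda>t. F t s) \<in> borel_measurable borel" for s unfolding F_def by measurable
    show "norm (F t s) \<le> indicator torus_box t" for t s by (auto simp: F_def norm_mult indicator_def)
    show "integrable lborel (indicator torus_box :: 'a \<Rightarrow> real)"
      by (simp add: integrable_indicator_iff emeasure_lborel_cbox_finite)
  qed
  also have "\<dots> = measure_pmf.expectation p (\<lambda>s. indicator {\<gamma>} s * of_real ((2 * pi) ^ DIM('a)))"
  proof (intro integral_cong_AE)
    show "AE s in p. (\<integral>t. F t s \<partial>lborel) = indicator {\<gamma>} s * complex_of_real ((2 * pi) ^ DIM('a))"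
      unfolding AE_measure_pmf_iff
    proof
      fix s assume s: "s \<in> set_pmf p"
      have "(\<integral>t. F t s \<partial>lborel) = indicator A s * (\<integral>t. indicator torus_box t * iexp (t \<bullet> (X s - w)) \<partial>lborel)"
        unfolding F_def by (subst integral_mult_right_zero[symmetric]) (simp add: mult_ac)
      also have "\<dots> = indicator {\<gamma>} s * complex_of_real ((2 * pi) ^ DIM('a))"
      proof (cases "s \<in> A")
        case True
        with int s have "(\<integral>t. indicator torus_box t * iexp (t \<bullet> (X s - w)) \<partial>lborel) = (if X s - w = 0 then (2 * pi) ^ DIM('a) else 0)"
          by (intro integral_torus_character) auto
        then show ?thesis using True inj[OF s] by (simp add: indicator_def)
      next
        case False then show ?thesis using \<gamma> by (auto simp: indicator_def)
      qed
      finally show "(\<integral>t. F t s \<partial>lborel) = indicator {\<gamma>} s * complex_of_real ((2 * pi) ^ DIM('a))" .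
    qed
  qed auto
  also have "\<dots> = of_real ((2 * pi) ^ DIM('a) * pmf p \<gamma>)"
    by (subst integral_measure_pmf[of "{\<gamma>}"]) (auto simp: indicator_def scaleR_conv_of_real)
  finally show ?thesis .
qed

section \<open>Groups with a normal lattice of finite index\<close>

lemma int_lattice_iff_Basis:
  fixes w :: "real ^ 'n"
  shows "w \<in> int_lattice \<longleftrightarrow> (\<forall>b\<in>Basis. w \<bullet> b \<in> \<int>)"
  by (auto simp: int_lattice_def Basis_vec_def inner_axis)

locale lattice_group = group G for G :: "('g, 'z) monoid_scheme" (structure) +
  fixes \<Lambda> \<Delta> :: "'g set" and \<iota> :: "'g \<Rightarrow> real ^ 'n"
  assumes normal: "\<Lambda> \<lhd> G" and finite_index: "finite (rcosets \<Lambda>)"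
    and iso: "\<iota> \<in> iso (G\<lparr>carrier := \<Lambda>\<rparr>) int_lattice_group"
    and reps: "representatives G \<Lambda> \<Delta>"
begin

abbreviation \<Phi> where "\<Phi> \<equiv> coord G \<Lambda> \<Delta> \<iota>"

lemma subgroup_L: "subgroup \<Lambda> G" using normal by (simp add: normal_def)

lemma L_carrier [simp, intro]: "v \<in> \<Lambda> \<Longrightarrow> v \<in> carrier G"
  using subgroup_L by (rule subgroup.mem_carrier)

lemma D_carrier [simp, intro]: "x \<in> \<Delta> \<Longrightarrow> x \<in> carrier G"
  using reps by (auto simp: representatives_def)

lemma one_L [simp]: "\<one> \<in> \<Lambda>" and one_D [simp]: "\<one> \<in> \<Delta>"
  and mult_L [simp]: "v \<in> \<Lambda> \<Longrightarrow> w \<in> \<Lambda> \<Longrightarrow> v \<otimes> w \<in> \<Lambda>"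
  and inv_L [simp]: "v \<in> \<Lambda> \<Longrightarrow> inv v \<in> \<Lambda>"
  using reps subgroup_L by (auto simp: representatives_def subgroup.one_closed subgroup.m_closed subgroup.m_inv_closed)

lemma conj_L: "v \<in> \<Lambda> \<Longrightarrow> \<gamma> \<in> carrier G \<Longrightarrow> \<gamma> \<otimes> v \<otimes> inv \<gamma> \<in> \<Lambda>"
  using normal by (auto simp: normal_inv_iff)

lemma conj_L': "v \<in> \<Lambda> \<Longrightarrow> \<gamma> \<in> carrier G \<Longrightarrow> inv \<gamma> \<otimes> v \<otimes> \<gamma> \<in> \<Lambda>"
  using conj_L[of v "inv \<gamma>"] by simp

lemma bij_iota: "bij_betw \<iota> \<Lambda> int_lattice"
  using iso by (auto simp: iso_def int_lattice_group_def)

lemma iota_mult: "v \<in> \<Lambda> \<Longrightarrow> w \<in> \<Lambda> \<Longrightarrow> \<iota> (v \<otimes> w) = \<iota> v + \<iota> w"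
  using iso by (auto simp: iso_def int_lattice_group_def hom_def)

lemma iota_one: "\<iota> \<one> = 0"
  using iota_mult[of \<one> \<one>] by simp

lemma iota_lattice: "v \<in> \<Lambda> \<Longrightarrow> \<iota> v \<in> int_lattice"
  using bij_iota by (auto simp: bij_betw_def)

lemma iota_inj: "v \<in> \<Lambda> \<Longrightarrow> w \<in> \<Lambda> \<Longrightarrow> \<iota> v = \<iota> w \<longleftrightarrow> v = w"
  using bij_iota by (auto simp: bij_betw_def inj_on_def)

lemma decomp:
  assumes "\<gamma> \<in> carrier G"
  obtains v x where "v \<in> \<Lambda>" "x \<in> \<Delta>" "\<gamma> = v \<otimes> x"
  using assms reps unfolding representatives_def r_coset_def by blast

lemma decomp_unique:
  assumes "v \<in> \<Lambda>" "x \<in> \<Delta>" "w \<in> \<Lambda>" "y \<in> \<Delta>" "v \<otimes> x = w \<otimes> y"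
  shows "v = w" "x = y"
proof -
  have "disjoint_family_on (\<lambda>x. \<Lambda> #> x) \<Delta>" using reps by (simp add: representatives_def)
  moreover have "v \<otimes> x \<in> \<Lambda> #> x" "w \<otimes> y \<in> \<Lambda> #> y"
    using assms(1,3) unfolding r_coset_def by auto
  ultimately show "x = y" using assms by (auto simp: disjoint_family_on_def)
  then show "v = w" using assms by (metis right_cancel L_carrier D_carrier)
qed

definition rep :: "'g \<Rightarrow> 'g" where
  "rep \<gamma> = (THE x. x \<in> \<Delta> \<and> (\<exists>v\<in>\<Lambda>. \<gamma> = v \<otimes> x))"

lemma rep_mult: "v \<in> \<Lambda> \<Longrightarrow> x \<in> \<Delta> \<Longrightarrow> rep (v \<otimes> x) = x"
  unfolding rep_def by (rule the_equality) (auto dest: decomp_unique)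

lemma lattice_part_mult: "v \<in> \<Lambda> \<Longrightarrow> x \<in> \<Delta> \<Longrightarrow> lattice_part G \<Lambda> \<Delta> (v \<otimes> x) = v"
  unfolding lattice_part_def by (rule the_equality) (auto dest: decomp_unique)

lemma rep_D: "\<gamma> \<in> carrier G \<Longrightarrow> rep \<gamma> \<in> \<Delta>"
  by (erule decomp) (simp add: rep_mult)

lemma lattice_part_L: "\<gamma> \<in> carrier G \<Longrightarrow> lattice_part G \<Lambda> \<Delta> \<gamma> \<in> \<Lambda>"
  by (erule decomp) (simp add: lattice_part_mult)

lemma decomp_rep: "\<gamma> \<in> carrier G \<Longrightarrow> \<gamma> = lattice_part G \<Lambda> \<Delta> \<gamma> \<otimes> rep \<gamma>"
  by (erule decomp) (simp add: lattice_part_mult rep_mult)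

lemma rep_idem: "x \<in> \<Delta> \<Longrightarrow> rep x = x"
  using rep_mult[of \<one> x] by simp

lemma coord_L_mult: "v \<in> \<Lambda> \<Longrightarrow> \<gamma> \<in> carrier G \<Longrightarrow> \<Phi> (v \<otimes> \<gamma>) = \<iota> v + \<Phi> \<gamma>"
  by (erule decomp) (simp add: coord_def lattice_part_mult iota_mult m_assoc[symmetric])

lemma coord_D: "x \<in> \<Delta> \<Longrightarrow> \<Phi> x = 0"
  using lattice_part_mult[of \<one> x] by (simp add: coord_def iota_one)

lemma coord_one [simp]: "\<Phi> \<one> = 0" by (simp add: coord_D)

lemma coord_lattice: "\<gamma> \<in> carrier G \<Longrightarrow> \<Phi> \<gamma> \<in> int_lattice"
  by (simp add: coord_def iota_lattice lattice_part_L)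

lemma rep_L_mult: "v \<in> \<Lambda> \<Longrightarrow> \<gamma> \<in> carrier G \<Longrightarrow> rep (v \<otimes> \<gamma>) = rep \<gamma>"
  by (erule decomp) (simp add: rep_mult m_assoc[symmetric])

lemma coord_rep_inj:
  assumes "\<gamma> \<in> carrier G" "\<gamma>' \<in> carrier G" "\<Phi> \<gamma> = \<Phi> \<gamma>'" "rep \<gamma> = rep \<gamma>'"
  shows "\<gamma> = \<gamma>'"
  using assms decomp_rep[of \<gamma>] decomp_rep[of \<gamma>']
  by (metis coord_def iota_inj lattice_part_L)

lemma coset_rep: "\<gamma> \<in> carrier G \<Longrightarrow> \<Lambda> #> \<gamma> = \<Lambda> #> rep \<gamma>"
proof -
  assume g: "\<gamma> \<in> carrier G"
  then have "\<gamma> \<in> \<Lambda> #> rep \<gamma>" using decomp_rep[OF g] lattice_part_L[OF g] unfolding r_coset_def by auto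
  then show ?thesis using g repr_independence[OF _ _ subgroup_L] rep_D by blast
qed

lemma mem_coset_iff: "\<gamma> \<in> carrier G \<Longrightarrow> \<gamma>' \<in> carrier G \<Longrightarrow> \<gamma> \<in> \<Lambda> #> \<gamma>' \<longleftrightarrow> rep \<gamma> = rep \<gamma>'"
proof
  assume "\<gamma>' \<in> carrier G" "\<gamma> \<in> \<Lambda> #> \<gamma>'" then show "rep \<gamma> = rep \<gamma>'"
    by (auto simp: r_coset_def rep_L_mult)
next
  assume "\<gamma> \<in> carrier G" "\<gamma>' \<in> carrier G" "rep \<gamma> = rep \<gamma>'"
  then show "\<gamma> \<in> \<Lambda> #> \<gamma>'" using coset_rep rcos_self[OF _ subgroup_L] by metis
qed

lemma bij_cosets: "bij_betw (\<lambda>x. \<Lambda> #> x) \<Delta> (rcosets \<Lambda>)"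
proof (rule bij_betwI')
  fix x y assume "x \<in> \<Delta>" "y \<in> \<Delta>"
  then show "(\<Lambda> #> x = \<Lambda> #> y) = (x = y)"
    using mem_coset_iff[of x y] rcos_self[OF _ subgroup_L, of x] by (auto simp: rep_idem)
next
  fix x assume "x \<in> \<Delta>" then show "\<Lambda> #> x \<in> rcosets \<Lambda>" by (auto simp: RCOSETS_def)
next
  fix X assume "X \<in> rcosets \<Lambda>"
  then obtain \<gamma> where "\<gamma> \<in> carrier G" "X = \<Lambda> #> \<gamma>" by (auto simp: RCOSETS_def)
  then show "\<exists>x\<in>\<Delta>. X = \<Lambda> #> x" using coset_rep rep_D by blast
qed

lemma finite_D: "finite \<Delta>" and card_D: "card (rcosets \<Lambda>) = card \<Delta>" and D_nonempty: "card \<Delta> > 0"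
proof -
  show f: "finite \<Delta>" using bij_betw_finite[OF bij_cosets] finite_index by simp
  show "card (rcosets \<Lambda>) = card \<Delta>" using bij_betw_same_card[OF bij_cosets] by simp
  show "card \<Delta> > 0" using f one_D by (metis card_gt_0_iff empty_iff)
qed

section \<open>Lattice-invariant functions, that is, functions on the quotient\<close>

definition Linv :: "('g \<Rightarrow> 'b) \<Rightarrow> bool" where
  "Linv g \<longleftrightarrow> (\<forall>v\<in>\<Lambda>. \<forall>\<gamma>\<in>carrier G. g (v \<otimes> \<gamma>) = g \<gamma>)"

lemma Linv_rep: "Linv g \<Longrightarrow> \<gamma> \<in> carrier G \<Longrightarrow> g (rep \<gamma>) = g \<gamma>"
  using decomp_rep[of \<gamma>] lattice_part_L[of \<gamma>] rep_D[of \<gamma>] by (metis Linv_def D_carrier)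

lemma Linv_right: "Linv g \<Longrightarrow> s \<in> carrier G \<Longrightarrow> Linv (\<lambda>\<gamma>. g (\<gamma> \<otimes> s))"
  by (auto simp: Linv_def m_assoc)

lemma Linv_coord_diff: "s \<in> carrier G \<Longrightarrow> Linv (\<lambda>\<gamma>. \<Phi> (\<gamma> \<otimes> s) - \<Phi> \<gamma>)"
  by (auto simp: Linv_def m_assoc coord_L_mult)

lemma Linv_bounded:
  fixes g :: "'g \<Rightarrow> 'b::real_normed_vector"
  assumes "Linv g" shows "\<exists>K>0. \<forall>\<gamma>\<in>carrier G. norm (g \<gamma>) \<le> K"
proof -
  have "norm (g \<gamma>) \<le> (\<Sum>x\<in>\<Delta>. norm (g x)) + 1" if "\<gamma> \<in> carrier G" for \<gamma>
    using member_le_sum[OF rep_D[OF that], of "\<lambda>x. norm (g x)"] Linv_rep[OF assms that] finite_D by simp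
  moreover have "(\<Sum>x\<in>\<Delta>. norm (g x)) + 1 > 0" by (simp add: add_nonneg_pos sum_nonneg)
  ultimately show ?thesis by blast
qed

lemma bij_rep_right: "s \<in> carrier G \<Longrightarrow> bij_betw (\<lambda>x. rep (x \<otimes> s)) \<Delta> \<Delta>"
proof -
  assume s: "s \<in> carrier G"
  have inj: "inj_on (\<lambda>x. rep (x \<otimes> s)) \<Delta>"
  proof (rule inj_onI)
    fix x y assume xy: "x \<in> \<Delta>" "y \<in> \<Delta>" "rep (x \<otimes> s) = rep (y \<otimes> s)"
    then have "x \<otimes> s \<in> \<Lambda> #> (y \<otimes> s)" using s by (subst mem_coset_iff) auto
    then obtain v where v: "v \<in> \<Lambda>" "x \<otimes> s = v \<otimes> (y \<otimes> s)" by (auto simp: r_coset_def)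
    then have "x = v \<otimes> y" using s xy by (metis m_assoc right_cancel m_closed L_carrier D_carrier)
    then show "x = y" using xy v rep_idem rep_mult by metis
  qed
  moreover have "(\<lambda>x. rep (x \<otimes> s)) ` \<Delta> \<subseteq> \<Delta>" using s by (auto intro!: rep_D)
  ultimately show ?thesis using finite_D by (metis bij_betw_def endo_inj_surj)
qed

text \<open>Left multiplication acts on right cosets because \<Lambda> is normal: a lattice factor
  crosses \<open>\<gamma>\<close> by conjugation. Hence \<open>\<gamma>\<close> times the
  representatives is again a full set of representatives, and a minorization at the identity serves
  every starting vertex.\<close>

lemma bij_rep_left: "\<gamma> \<in> carrier G \<Longrightarrow> bij_betw (\<lambda>x. rep (\<gamma> \<otimes> x)) \<Delta> \<Delta>"
proof -
  assume s: "\<gamma> \<in> carrier G"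
  have inj: "inj_on (\<lambda>x. rep (\<gamma> \<otimes> x)) \<Delta>"
  proof (rule inj_onI)
    fix x y assume xy: "x \<in> \<Delta>" "y \<in> \<Delta>" "rep (\<gamma> \<otimes> x) = rep (\<gamma> \<otimes> y)"
    then have "\<gamma> \<otimes> x \<in> \<Lambda> #> (\<gamma> \<otimes> y)" using s by (subst mem_coset_iff) auto
    then obtain v where v: "v \<in> \<Lambda>" "\<gamma> \<otimes> x = v \<otimes> (\<gamma> \<otimes> y)" by (auto simp: r_coset_def)
    have "x = inv \<gamma> \<otimes> (\<gamma> \<otimes> x)" using s xy by (simp add: m_assoc[symmetric])
    also have "\<dots> = (inv \<gamma> \<otimes> v \<otimes> \<gamma>) \<otimes> y" unfolding v using s xy v by (simp add: m_assoc)
    finally show "x = y" using xy conj_L'[OF v(1) s] rep_idem rep_mult by metis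
  qed
  moreover have "(\<lambda>x. rep (\<gamma> \<otimes> x)) ` \<Delta> \<subseteq> \<Delta>" using s by (auto intro!: rep_D)
  ultimately show ?thesis using finite_D by (metis bij_betw_def endo_inj_surj)
qed

lemma sum_Linv_right:
  assumes "Linv g" "s \<in> carrier G" shows "(\<Sum>x\<in>\<Delta>. g (x \<otimes> s)) = (\<Sum>x\<in>\<Delta>. g x)"
proof -
  have "(\<Sum>x\<in>\<Delta>. g (x \<otimes> s)) = (\<Sum>x\<in>\<Delta>. g (rep (x \<otimes> s)))"
    using assms by (intro sum.cong) (auto simp: Linv_rep)
  also have "\<dots> = (\<Sum>x\<in>\<Delta>. g x)" by (rule sum.reindex_bij_betw[OF bij_rep_right[OF assms(2)]])
  finally show ?thesis .
qed

lemma sum_Linv_left: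
  assumes "Linv g" "\<gamma> \<in> carrier G" shows "(\<Sum>x\<in>\<Delta>. g (\<gamma> \<otimes> x)) = (\<Sum>x\<in>\<Delta>. g x)"
proof -
  have "(\<Sum>x\<in>\<Delta>. g (\<gamma> \<otimes> x)) = (\<Sum>x\<in>\<Delta>. g (rep (\<gamma> \<otimes> x)))"
    using assms by (intro sum.cong) (auto simp: Linv_rep)
  also have "\<dots> = (\<Sum>x\<in>\<Delta>. g x)" by (rule sum.reindex_bij_betw[OF bij_rep_left[OF assms(2)]])
  finally show ?thesis .
qed

definition mean :: "('g \<Rightarrow> 'b::real_vector) \<Rightarrow> 'b" where
  "mean g = (1 / real (card \<Delta>)) *\<^sub>R (\<Sum>x\<in>\<Delta>. g x)"

end

section \<open>Random walks and the Poisson equation\<close>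

text \<open>The least positive difference \<open>d\<close> of two elements of \<open>E\<close>
  divides every element of \<open>D\<close>, hence equals 1. So \<open>b\<close> and
  \<open>b + 1\<close> both lie in \<open>E\<close>, and two consecutive numbers generate everything
  beyond \<open>b * b\<close>. Zero is added to \<open>D\<close> so that \<open>E\<close> is closed
  under all multiples.\<close>

lemma additive_gcd_one_cofinite:
  fixes D :: "nat set"
  assumes add: "\<And>a b. a \<in> D \<Longrightarrow> b \<in> D \<Longrightarrow> a + b \<in> D" and gcd: "Gcd D = 1"
  obtains n0 where "\<And>n. n \<ge> n0 \<Longrightarrow> n \<in> D"
proof -
  define E where "E = insert 0 D"
  have addE: "a + b \<in> E" if "a \<in> E" "b \<in> E" for a b using that add by (auto simp: E_def)
  have multE: "k * a \<in> E" if "a \<in> E" for k a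
    by (induction k) (use that addE in \<open>auto simp: E_def\<close>)
  define P where "P d \<longleftrightarrow> d > 0 \<and> (\<exists>b\<in>E. b + d \<in> E)" for d
  have "\<exists>a\<in>D. a > 0"
  proof (rule ccontr)
    assume "\<not> ?thesis"
    then have "D \<subseteq> {0}" by auto
    then have "Gcd D = 0" by (simp add: Gcd_0_iff)
    with gcd show False by simp
  qed
  then obtain a0 where "a0 \<in> D" "a0 > 0" by auto
  then have "P a0" unfolding P_def E_def by auto
  define d where "d = (LEAST d. P d)"
  have "P d" unfolding d_def by (rule LeastI) fact
  then obtain b where b: "d > 0" "b \<in> E" "b + d \<in> E" unfolding P_def by auto
  have "d dvd a" if a: "a \<in> D" for a
  proof (rule ccontr)
    assume "\<not> d dvd a"
    then have r: "a mod d > 0" by (auto simp: dvd_eq_mod_eq_0)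
    \<comment> \<open>Division with remainder exhibits \<open>a mod d\<close> as a difference of two
      elements of \<open>E\<close>, smaller than the least one.\<close>
    have e: "(a div d) * b + a = (a div d) * (b + d) + a mod d"
      by (simp add: algebra_simps)
    have "(a div d) * b + a \<in> E" "(a div d) * (b + d) \<in> E"
      using addE[OF multE[OF b(2)], of a] multE[OF b(3)] a by (auto simp: E_def)
    with r e have "P (a mod d)" unfolding P_def by metis
    then have "d \<le> a mod d" unfolding d_def by (rule Least_le)
    with b(1) show False by (metis mod_less_divisor not_le)
  qed
  then have "d dvd Gcd D" by (rule Gcd_greatest)
  then have b1: "b + 1 \<in> E" using b gcd by simp
  \<comment> \<open>The summand 1 makes \<open>n\<close> positive, so that membership in
    \<open>E\<close> means membership in \<open>D\<close>.\<close>
  have "n \<in> D" if n: "n \<ge> b * b + 1" for n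
  proof -
    have "n \<in> E"
    proof (cases "b = 0")
      case True
      then show ?thesis using multE[OF b1, of n] by simp
    next
      case False
      have "b * b \<le> n" using n by simp
      then have "b \<le> n div b" using False by (simp add: less_eq_div_iff_mult_less_eq)
      then have le: "n mod b \<le> n div b" using False by (meson le_trans less_imp_le mod_less_divisor neq0_conv)
      \<comment> \<open>With quotient q and remainder r one has \<open>r < b \<le> q\<close>, so r
        of the q copies of \<open>b\<close> can be exchanged for \<open>b + 1\<close>.\<close>
      have "n = (n div b - n mod b) * b + n mod b * (b + 1)"
      proof -
        have "(n div b - n mod b) * b + n mod b * (b + 1) = (n div b - n mod b + n mod b) * b + n mod b"
          by (simp only: algebra_simps)
        also have "\<dots> = n" using le by simp
        finally show ?thesis by simp
      qed
      then show ?thesis using addE[OF multE[OF b(2)] multE[OF b1]] by metis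
    qed
    then show ?thesis using n by (auto simp: E_def)
  qed
  then show thesis by (rule that)
qed

text \<open>The moment hypothesis is put on the coordinates, one representative at a time, because
  in this form it passes to the factors of a product by comparing norms.
  \<open>second_moment_coord\<close> derives it from the hypothesis on a word metric.\<close>

locale lattice_walk = lattice_group G \<Lambda> \<Delta> \<iota> for G :: "('g, 'z) monoid_scheme" (structure) and \<Lambda> \<Delta> and \<iota> :: "'g \<Rightarrow> real ^ 'n" +
  fixes \<nu> :: "'g pmf"
  assumes supp: "set_pmf \<nu> \<subseteq> carrier G"
    and gen: "semigroup_generated G (set_pmf \<nu>) = carrier G"
    and aper: "aperiodic G \<nu>"
    and moment: "\<And>x. x \<in> \<Delta> \<Longrightarrow> integrable (measure_pmf \<nu>) (\<lambda>s. (norm (\<Phi> (x \<otimes> s)))\<^sup>2)"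
begin

abbreviation conv :: "nat \<Rightarrow> 'g pmf" where "conv n \<equiv> conv_power G \<nu> n"

lemma set_conv_carrier: "s \<in> set_pmf (conv n) \<Longrightarrow> s \<in> carrier G"
  using supp by (induction n arbitrary: s) auto

lemma supp' [simp]: "s \<in> set_pmf \<nu> \<Longrightarrow> s \<in> carrier G" using supp by auto

lemma set_conv_1: "set_pmf (conv 1) = set_pmf \<nu>"
  using supp by (force simp: image_iff)

lemma set_conv_add: "a \<in> set_pmf (conv n) \<Longrightarrow> b \<in> set_pmf (conv m) \<Longrightarrow> a \<otimes> b \<in> set_pmf (conv (n + m))"
proof (induction m arbitrary: b)
  case 0 then show ?case by (auto simp: set_conv_carrier)
next
  case (Suc m)
  then obtain c d where "c \<in> set_pmf (conv m)" "d \<in> set_pmf \<nu>" "b = c \<otimes> d" by auto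
  with Suc.IH[of c] Suc.prems show ?case
    by (force simp: m_assoc[symmetric] set_conv_carrier intro!: image_eqI[of _ _ "(a \<otimes> c, d)"])
qed

lemma ex_conv:
  assumes "g \<in> carrier G" shows "\<exists>k\<ge>1. g \<in> set_pmf (conv k)"
proof -
  have "g \<in> semigroup_generated G (set_pmf \<nu>)" using assms gen by simp
  then show ?thesis
  proof induction
    case (base s) then show ?case using set_conv_1 by (intro exI[of _ 1]) auto
  next
    case (mult a b)
    then obtain k l where "k \<ge> 1" "a \<in> set_pmf (conv k)" "l \<ge> 1" "b \<in> set_pmf (conv l)" by auto
    then show ?case using set_conv_add by (intro exI[of _ "k + l"]) auto
  qed
qed

lemma eventually_conv_one: "\<exists>n0. \<forall>n\<ge>n0. \<one> \<in> set_pmf (conv n)"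
proof -
  let ?D = "{n. n \<ge> 1 \<and> pmf (conv n) \<one> > 0}"
  have D: "n \<in> ?D \<longleftrightarrow> n \<ge> 1 \<and> \<one> \<in> set_pmf (conv n)" for n
    by (simp add: pmf_positive_iff)
  have "\<exists>n0. \<forall>n\<ge>n0. n \<in> ?D"
  proof (rule additive_gcd_one_cofinite[of ?D])
    show "a + b \<in> ?D" if "a \<in> ?D" "b \<in> ?D" for a b
      using that set_conv_add[of \<one> a \<one> b] unfolding D by auto
    show "Gcd ?D = 1" using aper by (simp add: aperiodic_def)
  qed blast
  then show ?thesis unfolding D by blast
qed

text \<open>The walk can be back at the identity at every late time, and from there a path of fixed
  length \<open>k\<close> leads to \<open>a\<close>. So finitely many targets are charged at one
  common time, and at all later ones.\<close>

lemma eventually_conv_pos: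
  assumes "finite A" "A \<subseteq> carrier G"
  shows "\<exists>n0. \<forall>n\<ge>n0. A \<subseteq> set_pmf (conv n)"
  using assms
proof (induction A)
  case empty then show ?case by simp
next
  case (insert a A)
  then obtain n1 where n1: "\<forall>n\<ge>n1. A \<subseteq> set_pmf (conv n)" by auto
  obtain n0 where n0: "\<forall>n\<ge>n0. \<one> \<in> set_pmf (conv n)" using eventually_conv_one by auto
  obtain k where k: "a \<in> set_pmf (conv k)" using ex_conv insert by blast
  have "a \<in> set_pmf (conv n)" if "n \<ge> n0 + k" for n
  proof -
    have "\<one> \<otimes> a \<in> set_pmf (conv ((n - k) + k))"
      using n0 that k by (intro set_conv_add) auto
    then show ?thesis using that insert.prems by simp
  qed
  with n1 show ?case by (intro exI[of _ "max n1 (n0 + k)"]) auto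
qed

lemma conv_minorized:
  assumes "finite A" "A \<subseteq> carrier G"
  obtains N d where "N \<ge> 1" "d > 0" "\<And>a. a \<in> A \<Longrightarrow> d \<le> pmf (conv N) a"
proof -
  obtain n0 where n0: "\<forall>n\<ge>n0. A \<subseteq> set_pmf (conv n)" using eventually_conv_pos[OF assms] by auto
  define N where "N = max n0 1"
  define d where "d = Min (insert 1 (pmf (conv N) ` A))"
  have "A \<subseteq> set_pmf (conv N)" using n0 by (simp add: N_def)
  then have "d > 0" unfolding d_def using assms(1) by (subst Min_gr_iff) (auto simp: pmf_positive)
  moreover have "d \<le> pmf (conv N) a" if "a \<in> A" for a unfolding d_def using assms(1) that by (intro Min_le) auto
  ultimately show thesis using that[of N d] by (simp add: N_def)
qed

lemma expectation_conv_add: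
  fixes F :: "'g \<Rightarrow> 'c::euclidean_space"
  assumes "\<And>s. s \<in> carrier G \<Longrightarrow> norm (F s) \<le> K"
  shows "measure_pmf.expectation (conv (n + m)) F
     = measure_pmf.expectation (conv n) (\<lambda>a. measure_pmf.expectation (conv m) (\<lambda>b. F (a \<otimes> b)))"
  using assms
proof (induction m arbitrary: F)
  case 0
  then show ?case by (auto intro!: integral_cong_AE simp: AE_measure_pmf_iff set_conv_carrier)
next
  case (Suc m)
  have step: "measure_pmf.expectation (conv (Suc k)) H = measure_pmf.expectation (conv k) (\<lambda>a. measure_pmf.expectation \<nu> (\<lambda>b. H (a \<otimes> b)))"
    if "\<And>s. s \<in> carrier G \<Longrightarrow> norm (H s) \<le> K" for H :: "'g \<Rightarrow> 'c" and k
    using that by (simp add: split_beta') (subst expectation_pair_pmf[where K=K], auto simp: set_conv_carrier)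
  have "measure_pmf.expectation (conv (n + Suc m)) F
      = measure_pmf.expectation (conv (n + m)) (\<lambda>a. measure_pmf.expectation \<nu> (\<lambda>b. F (a \<otimes> b)))"
    using step[of F "n + m"] Suc.prems by simp
  also have "\<dots> = measure_pmf.expectation (conv n) (\<lambda>a. measure_pmf.expectation (conv m) (\<lambda>b. measure_pmf.expectation \<nu> (\<lambda>c. F ((a \<otimes> b) \<otimes> c))))"
    by (rule Suc.IH) (auto intro!: norm_expectation_le Suc.prems)
  also have "\<dots> = measure_pmf.expectation (conv n) (\<lambda>a. measure_pmf.expectation (conv (Suc m)) (\<lambda>b. F (a \<otimes> b)))"
  proof (intro integral_cong_AE, simp_all only: AE_measure_pmf_iff, safe)
    fix a assume a: "a \<in> set_pmf (conv n)"
    have "measure_pmf.expectation (conv (Suc m)) (\<lambda>b. F (a \<otimes> b))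
        = measure_pmf.expectation (conv m) (\<lambda>b. measure_pmf.expectation \<nu> (\<lambda>c. F (a \<otimes> (b \<otimes> c))))"
      by (rule step) (use a in \<open>auto intro!: Suc.prems simp: set_conv_carrier\<close>)
    also have "\<dots> = measure_pmf.expectation (conv m) (\<lambda>b. measure_pmf.expectation \<nu> (\<lambda>c. F ((a \<otimes> b) \<otimes> c)))"
      using a by (auto intro!: integral_cong_AE simp: AE_measure_pmf_iff set_conv_carrier m_assoc)
    finally show "measure_pmf.expectation (conv m) (\<lambda>b. measure_pmf.expectation \<nu> (\<lambda>c. F ((a \<otimes> b) \<otimes> c)))
      = measure_pmf.expectation (conv (Suc m)) (\<lambda>b. F (a \<otimes> b))" by simp
  qed auto
  finally show ?case .
qed

section \<open>Mixing of the walk on the quotient\<close>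

definition transition :: "nat \<Rightarrow> ('g \<Rightarrow> 'c::euclidean_space) \<Rightarrow> 'g \<Rightarrow> 'c" where
  "transition n g \<gamma> = measure_pmf.expectation (conv n) (\<lambda>s. g (\<gamma> \<otimes> s))"

lemma conv_1_expectation:
  "measure_pmf.expectation (conv 1) F = measure_pmf.expectation \<nu> (F :: _ \<Rightarrow> 'c::euclidean_space)"
proof -
  have "conv 1 = map_pmf (\<lambda>s. \<one> \<otimes> s) \<nu>"
    by (simp add: pair_return_pmf1 map_pmf_comp)
  also have "\<dots> = map_pmf (\<lambda>s. s) \<nu>" by (rule map_pmf_cong) auto
  finally show ?thesis by simp
qed

lemma transition_Linv: "Linv g \<Longrightarrow> Linv (transition n g)"
  unfolding Linv_def transition_def
  by (auto intro!: integral_cong_AE simp: AE_measure_pmf_iff set_conv_carrier m_assoc)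

lemma transition_norm_le:
  "\<lbrakk>\<And>\<gamma>. \<gamma> \<in> carrier G \<Longrightarrow> norm (g \<gamma>) \<le> K; \<gamma> \<in> carrier G\<rbrakk> \<Longrightarrow> norm (transition n g \<gamma>) \<le> K"
  unfolding transition_def by (rule norm_expectation_le) (auto simp: set_conv_carrier)

lemma transition_integrable: "Linv g \<Longrightarrow> \<gamma> \<in> carrier G \<Longrightarrow> integrable (conv n) (\<lambda>s. g (\<gamma> \<otimes> s :: 'g) :: 'c::euclidean_space)"
  by (drule Linv_bounded, elim exE conjE, rule integrable_pmf_bounded) (auto simp: set_conv_carrier)

lemma transition_add: "Linv g \<Longrightarrow> \<gamma> \<in> carrier G \<Longrightarrow> transition (n + m) g \<gamma> = transition n (transition m g) \<gamma>"
  unfolding transition_def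
  by (drule Linv_bounded, elim exE conjE, subst expectation_conv_add)
     (auto intro!: integral_cong_AE simp: AE_measure_pmf_iff set_conv_carrier m_assoc)

text \<open>Right multiplication by each step permutes the cosets, so the uniform measure on the
  quotient is stationary.\<close>

lemma mean_transition: "Linv g \<Longrightarrow> mean (transition n g) = mean (g :: 'g \<Rightarrow> 'c::euclidean_space)"
proof -
  assume g: "Linv g"
  have "(\<Sum>x\<in>\<Delta>. transition n g x) = measure_pmf.expectation (conv n) (\<lambda>s. \<Sum>x\<in>\<Delta>. g (x \<otimes> s))"
    unfolding transition_def by (rule Bochner_Integration.integral_sum[symmetric]) (use g transition_integrable in auto)
  also have "\<dots> = measure_pmf.expectation (conv n) (\<lambda>s. \<Sum>x\<in>\<Delta>. g x)"
    by (intro integral_cong_AE) (auto simp: AE_measure_pmf_iff set_conv_carrier intro!: sum_Linv_right g)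
  finally show ?thesis by (simp add: mean_def)
qed

text \<open>At a suitable time \<open>N\<close> the walk charges every representative with mass at
  least \<open>d\<close>. For a function of mean zero this part contributes nothing, since
  \<open>\<gamma> \<Delta>\<close> meets every coset once; only the factor
  \<open>1 - d * card \<Delta>\<close> remains. Other times are reached by iterating and taking an
  \<open>N\<close>-th root.\<close>

lemma transition_contraction:
  shows "\<exists>C r. 0 < C \<and> 0 < r \<and> r < 1 \<and> (\<forall>(g :: 'g \<Rightarrow> 'c::euclidean_space) K n. Linv g \<longrightarrow> mean g = 0 \<longrightarrow>
     (\<forall>\<gamma>\<in>carrier G. norm (g \<gamma>) \<le> K) \<longrightarrow> (\<forall>\<gamma>\<in>carrier G. norm (transition n g \<gamma>) \<le> C * r ^ n * K))"
proof -
  obtain N d where N: "N \<ge> 1" "d > 0" "\<And>a. a \<in> \<Delta> \<Longrightarrow> d \<le> pmf (conv N) a"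
    using conv_minorized[OF finite_D] by auto
  \<comment> \<open>The minorized part may exhaust the whole mass; the maximum with 1/2 keeps
    \<open>q\<close> positive, so that \<open>root N q\<close> and \<open>1 / q\<close> make
    sense.\<close>
  define q where "q = max (1 - d * card \<Delta>) (1/2)"
  have q: "0 < q" "q < 1" using N(2) D_nonempty by (auto simp: q_def)
  have one: "norm (transition N g \<gamma>) \<le> q * K"
    if g: "Linv g" "mean g = 0" "\<And>\<gamma>. \<gamma> \<in> carrier G \<Longrightarrow> norm (g \<gamma>) \<le> K" "\<gamma> \<in> carrier G" for g :: "'g \<Rightarrow> 'c" and K \<gamma>
  proof -
    have "(\<Sum>a\<in>\<Delta>. g (\<gamma> \<otimes> a)) = 0"
      using g sum_Linv_left[of g \<gamma>] D_nonempty by (simp add: mean_def)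
    then have "norm (transition N g \<gamma>) = norm (measure_pmf.expectation (conv N) (\<lambda>s. g (\<gamma> \<otimes> s)) - d *\<^sub>R (\<Sum>a\<in>\<Delta>. g (\<gamma> \<otimes> a)))"
      by (simp add: transition_def)
    also have "\<dots> \<le> (1 - d * card \<Delta>) * K"
      by (rule expectation_minorized) (use finite_D N g in \<open>auto simp: set_conv_carrier\<close>)
    also have "\<dots> \<le> q * K"
      using order.trans[OF norm_ge_zero g(3)[OF g(4)]] by (intro mult_right_mono) (auto simp: q_def)
    finally show ?thesis .
  qed
  have iter: "norm (transition (N * k) g \<gamma>) \<le> q ^ k * K"
    if g: "Linv g" "mean g = 0" "\<And>\<gamma>. \<gamma> \<in> carrier G \<Longrightarrow> norm (g \<gamma>) \<le> K" "\<gamma> \<in> carrier G" for g :: "'g \<Rightarrow> 'c" and K \<gamma> k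
    using g(4)
  proof (induction k arbitrary: \<gamma>)
    case 0 then show ?case using g(3) by (simp add: transition_def)
  next
    case (Suc k)
    have "norm (transition N (transition (N * k) g) \<gamma>) \<le> q * (q ^ k * K)"
      by (rule one) (use g Suc in \<open>auto simp: transition_Linv mean_transition\<close>)
    then show ?case using transition_add[OF g(1) Suc.prems, of N "N * k"] by (simp add: mult.assoc)
  qed
  define r where "r = root N q"
  have r: "0 < r" "r < 1" "r ^ N = q" using q N(1) by (auto simp: r_def real_root_pow_pos2)
  have "norm (transition n g \<gamma>) \<le> (1 / q) * r ^ n * K"
    if g: "Linv g" "mean g = 0" "\<forall>\<gamma>\<in>carrier G. norm (g \<gamma>) \<le> K" "\<gamma> \<in> carrier G" for g :: "'g \<Rightarrow> 'c" and K \<gamma> n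
  proof -
    have K: "0 \<le> K" using g(3,4) norm_ge_zero order.trans by blast
    have "norm (transition (N * (n div N) + n mod N) g \<gamma>) \<le> q ^ (n div N) * K"
      unfolding transition_add[OF g(1) g(4)]
      by (rule iter) (use g in \<open>auto intro!: transition_norm_le simp: transition_Linv mean_transition\<close>)
    \<comment> \<open>The steps left over when \<open>N\<close> does not divide \<open>n\<close>
      cost at most the factor \<open>1 / q\<close>, because \<open>r ^ N = q\<close>.\<close>
    also have "q ^ (n div N) \<le> (1 / q) * r ^ n"
    proof -
      have "r ^ N \<le> r ^ (n mod N)" using r N(1) by (intro power_decreasing) (auto simp: less_imp_le)
      then have "q * q ^ (n div N) \<le> r ^ (n mod N) * q ^ (n div N)" using q r by (intro mult_right_mono) auto
      also have "\<dots> = r ^ (n mod N + N * (n div N))" by (simp only: power_add power_mult r)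
      also have "\<dots> = r ^ n" by simp
      finally show ?thesis using q by (simp add: field_simps)
    qed
    finally show ?thesis using K by (simp add: mult_right_mono)
  qed
  then show ?thesis using q r by (intro exI[of _ "1/q"] exI[of _ r]) auto
qed

lemma transition_diff_mean: "Linv g \<Longrightarrow> Linv (\<lambda>\<gamma>. g \<gamma> - mean g) \<and> mean (\<lambda>\<gamma>. g \<gamma> - mean g) = (0 :: 'c::euclidean_space)"
  using D_nonempty by (auto simp: Linv_def mean_def sum_subtractf scaleR_diff_right sum_constant_scaleR)

lemma transition_tendsto_mean:
  fixes g :: "'g \<Rightarrow> 'c::euclidean_space"
  assumes g: "Linv g" and e: "e > 0"
  obtains k where "\<And>\<gamma>. \<gamma> \<in> carrier G \<Longrightarrow> norm (transition k g \<gamma> - mean g) \<le> e"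
proof -
  obtain C r where Cr: "0 < C" "0 < r" "r < 1" and c: "\<And>(g :: 'g \<Rightarrow> 'c) K n \<gamma>. Linv g \<Longrightarrow> mean g = 0 \<Longrightarrow>
     (\<forall>\<gamma>\<in>carrier G. norm (g \<gamma>) \<le> K) \<Longrightarrow> \<gamma>\<in>carrier G \<Longrightarrow> norm (transition n g \<gamma>) \<le> C * r ^ n * K"
    using transition_contraction[where 'c='c] by blast
  let ?g = "\<lambda>\<gamma>. g \<gamma> - mean g"
  have g': "Linv ?g" "mean ?g = 0" using transition_diff_mean[OF g] by auto
  obtain K where K: "K > 0" "\<And>\<gamma>. \<gamma> \<in> carrier G \<Longrightarrow> norm (?g \<gamma>) \<le> K" using Linv_bounded[OF g'(1)] by blast
  have "(\<lambda>n. C * r ^ n * K) \<longlonglongrightarrow> C * 0 * K" using Cr by (intro tendsto_intros LIMSEQ_realpow_zero) auto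
  then have "eventually (\<lambda>n. C * r ^ n * K < e) sequentially" using e by (intro order_tendstoD(2)[of _ "C * 0 * K"]) auto
  then obtain k where k: "C * r ^ k * K < e" by (auto simp: eventually_sequentially)
  have "norm (transition k g \<gamma> - mean g) \<le> e" if "\<gamma> \<in> carrier G" for \<gamma>
  proof -
    have "transition k g \<gamma> - mean g = transition k ?g \<gamma>"
      unfolding transition_def using transition_integrable[OF g that] by simp
    then show ?thesis using c[OF g', of K \<gamma> k] K that k by auto
  qed
  then show thesis by (rule that)
qed

text \<open>A harmonic function is fixed by every \<open>transition n\<close>, and these converge to
  the mean. This is what makes the harmonic part of a form unique.\<close>

lemma harmonic_const:
  fixes g :: "'g \<Rightarrow> 'c::euclidean_space"
  assumes g: "Linv g" and h: "\<And>\<gamma>. \<gamma> \<in> carrier G \<Longrightarrow> measure_pmf.expectation \<nu> (\<lambda>s. g (\<gamma> \<otimes> s)) = g \<gamma>" and \<gamma>: "\<gamma> \<in> carrier G"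
  shows "g \<gamma> = mean g"
proof -
  have P: "transition n g \<gamma> = g \<gamma>" if "\<gamma> \<in> carrier G" for n \<gamma>
    using that
  proof (induction n arbitrary: \<gamma>)
    case 0 then show ?case by (simp add: transition_def)
  next
    case (Suc n)
    have "transition (Suc n) g \<gamma> = transition 1 (transition n g) \<gamma>" using transition_add[OF g Suc.prems, of 1 n] by simp
    also have "\<dots> = measure_pmf.expectation \<nu> (\<lambda>s. transition n g (\<gamma> \<otimes> s))" by (simp only: transition_def[of 1] conv_1_expectation)
    also have "\<dots> = measure_pmf.expectation \<nu> (\<lambda>s. g (\<gamma> \<otimes> s))"
      using Suc by (intro integral_cong_AE) (auto simp: AE_measure_pmf_iff)
    finally show ?case using h Suc by simp
  qed
  have "norm (g \<gamma> - mean g) \<le> e" if "e > 0" for e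
    by (rule transition_tendsto_mean[OF g that]) (use P[OF \<gamma>] \<gamma> in metis)
  then have "norm (g \<gamma> - mean g) \<le> 0" by (rule field_le_epsilon[of _ 0, simplified]) 
  then show ?thesis by simp
qed

text \<open>The Neumann series \<open>\<Sum>k. transition k g\<close> converges by the contraction.\<close>

lemma poisson_equation:
  fixes g :: "'g \<Rightarrow> 'c::euclidean_space"
  assumes g: "Linv g" "mean g = 0"
  shows "\<exists>r. Linv r \<and> (\<forall>\<gamma>\<in>carrier G. r \<gamma> - measure_pmf.expectation \<nu> (\<lambda>s. r (\<gamma> \<otimes> s)) = g \<gamma>)"
proof -
  obtain C q where Cq: "0 < C" "0 < q" "q < 1" and c: "\<And>(g :: 'g \<Rightarrow> 'c) K n \<gamma>. Linv g \<Longrightarrow> mean g = 0 \<Longrightarrow>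
     (\<forall>\<gamma>\<in>carrier G. norm (g \<gamma>) \<le> K) \<Longrightarrow> \<gamma>\<in>carrier G \<Longrightarrow> norm (transition n g \<gamma>) \<le> C * q ^ n * K"
    using transition_contraction[where 'c='c] by blast
  obtain K where K: "K > 0" "\<And>\<gamma>. \<gamma> \<in> carrier G \<Longrightarrow> norm (g \<gamma>) \<le> K" using Linv_bounded[OF g(1)] by blast
  define r where "r \<gamma> = (\<Sum>n. transition n g \<gamma>)" for \<gamma>
  have b: "norm (transition n g \<gamma>) \<le> C * q ^ n * K" if "\<gamma> \<in> carrier G" for n \<gamma>
    using c[OF g] K that by blast
  have gs: "summable (\<lambda>n. C * q ^ n * K)"
    using Cq by (intro summable_mult summable_mult2 summable_geometric) auto
  have sn: "summable (\<lambda>n. norm (transition n g \<gamma>))" if "\<gamma> \<in> carrier G" for \<gamma>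
    using b[OF that] by (intro summable_comparison_test[OF _ gs]) auto
  have sm: "summable (\<lambda>n. transition n g \<gamma>)" if "\<gamma> \<in> carrier G" for \<gamma>
    by (rule summable_norm_cancel[OF sn[OF that]])
  have r: "Linv r"
    using transition_Linv[OF g(1)] by (auto simp: Linv_def r_def)
  have "r \<gamma> - measure_pmf.expectation \<nu> (\<lambda>s. r (\<gamma> \<otimes> s)) = g \<gamma>" if \<gamma>: "\<gamma> \<in> carrier G" for \<gamma>
  proof -
    have "(\<lambda>n. measure_pmf.expectation \<nu> (\<lambda>s. \<Sum>k<n. transition k g (\<gamma> \<otimes> s))) \<longlonglongrightarrow> measure_pmf.expectation \<nu> (\<lambda>s. r (\<gamma> \<otimes> s))"
    proof (rule integral_dominated_convergence[where w="\<lambda>_. \<Sum>n. C * q ^ n * K"])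
      show "AE s in \<nu>. (\<lambda>n. \<Sum>k<n. transition k g (\<gamma> \<otimes> s)) \<longlonglongrightarrow> r (\<gamma> \<otimes> s)"
        using sm \<gamma> by (auto simp: AE_measure_pmf_iff r_def intro!: summable_LIMSEQ)
      show "AE s in \<nu>. norm (\<Sum>k<n. transition k g (\<gamma> \<otimes> s)) \<le> (\<Sum>n. C * q ^ n * K)" for n
        unfolding AE_measure_pmf_iff
      proof
        fix s assume s: "s \<in> set_pmf \<nu>"
        have "norm (\<Sum>k<n. transition k g (\<gamma> \<otimes> s)) \<le> (\<Sum>k<n. C * q ^ k * K)"
          by (rule sum_norm_le) (use b s \<gamma> in auto)
        also have "\<dots> \<le> (\<Sum>n. C * q ^ n * K)"
          using Cq K by (intro sum_le_suminf gs) auto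
        finally show "norm (\<Sum>k<n. transition k g (\<gamma> \<otimes> s)) \<le> (\<Sum>n. C * q ^ n * K)" .
      qed
    qed auto
    \<comment> \<open>One step of the walk shifts the index of the Neumann series by one, so
      \<open>r\<close> and its expectation differ by the zeroth term, which is
      \<open>g\<close>.\<close>
    moreover have "measure_pmf.expectation \<nu> (\<lambda>s. \<Sum>k<n. transition k g (\<gamma> \<otimes> s)) = (\<Sum>k<n. transition (Suc k) g \<gamma>)" for n
    proof -
      have "measure_pmf.expectation \<nu> (\<lambda>s. \<Sum>k<n. transition k g (\<gamma> \<otimes> s)) = (\<Sum>k<n. measure_pmf.expectation \<nu> (\<lambda>s. transition k g (\<gamma> \<otimes> s)))"
        by (rule Bochner_Integration.integral_sum)
           (rule integrable_pmf_bounded, rule b, use \<gamma> in auto)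
      also have "\<dots> = (\<Sum>k<n. transition (Suc k) g \<gamma>)"
        by (intro sum.cong refl) (use transition_add[OF g(1) \<gamma>, of 1] in \<open>simp only: transition_def[of 1] conv_1_expectation plus_1_eq_Suc\<close>)
      finally show ?thesis .
    qed
    ultimately have l1: "(\<lambda>n. \<Sum>k<n. transition (Suc k) g \<gamma>) \<longlonglongrightarrow> measure_pmf.expectation \<nu> (\<lambda>s. r (\<gamma> \<otimes> s))" by simp
    have "(\<lambda>n. \<Sum>k<Suc n. transition k g \<gamma>) \<longlonglongrightarrow> r \<gamma>"
      unfolding r_def using summable_LIMSEQ[OF sm[OF \<gamma>]] by (rule LIMSEQ_Suc)
    then have "(\<lambda>n. transition 0 g \<gamma> + (\<Sum>k<n. transition (Suc k) g \<gamma>)) \<longlonglongrightarrow> r \<gamma>"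
      unfolding sum.lessThan_Suc_shift .
    moreover have "(\<lambda>n. transition 0 g \<gamma> + (\<Sum>k<n. transition (Suc k) g \<gamma>)) \<longlonglongrightarrow> transition 0 g \<gamma> + measure_pmf.expectation \<nu> (\<lambda>s. r (\<gamma> \<otimes> s))"
      by (intro tendsto_intros l1)
    ultimately have "r \<gamma> = transition 0 g \<gamma> + measure_pmf.expectation \<nu> (\<lambda>s. r (\<gamma> \<otimes> s))"
      by (rule LIMSEQ_unique)
    then show ?thesis using \<gamma> by (simp add: transition_def)
  qed
  with r show ?thesis by blast
qed

section \<open>Increments, correctors and the covariance\<close>

definition incr :: "'g \<Rightarrow> 'g \<Rightarrow> real ^ 'n" where
  "incr \<gamma> s = \<Phi> (\<gamma> \<otimes> s) - \<Phi> \<gamma>"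

lemma Linv_incr: "s \<in> carrier G \<Longrightarrow> Linv (\<lambda>\<gamma>. incr \<gamma> s)"
  unfolding incr_def by (rule Linv_coord_diff)

lemma incr_rep: "\<gamma> \<in> carrier G \<Longrightarrow> s \<in> carrier G \<Longrightarrow> incr \<gamma> s = \<Phi> (rep \<gamma> \<otimes> s)"
  using Linv_rep[OF Linv_incr, of s \<gamma>] rep_D[of \<gamma>] by (simp add: incr_def coord_D)

lemma incr_square_integrable: "\<gamma> \<in> carrier G \<Longrightarrow> integrable \<nu> (\<lambda>s. (norm (incr \<gamma> s))\<^sup>2)"
  by (rule integrable_cong_AE_imp[OF moment[OF rep_D]]) (auto simp: AE_measure_pmf_iff incr_rep)

definition mean_incr :: "'g \<Rightarrow> real ^ 'n" where
  "mean_incr \<gamma> = measure_pmf.expectation \<nu> (incr \<gamma>)"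

definition zeta :: "real ^ 'n" where "zeta = mean mean_incr"

lemma Linv_mean_incr: "Linv mean_incr"
  using Linv_incr unfolding Linv_def mean_incr_def
  by (auto intro!: integral_cong_AE simp: AE_measure_pmf_iff)

lemma square_integrable_imp_integrable:
  fixes F :: "'g \<Rightarrow> 'c::{banach,second_countable_topology}"
  assumes "integrable (measure_pmf p) (\<lambda>s. (norm (F s))\<^sup>2)"
  shows "integrable (measure_pmf p) F"
proof (rule Bochner_Integration.integrable_bound)
  show "integrable (measure_pmf p) (\<lambda>s. 1 + (norm (F s))\<^sup>2)" using assms by simp
  have "norm (F s) \<le> 1 + (norm (F s))\<^sup>2" for s
    using sum_squares_bound[of 1 "norm (F s)"] norm_ge_zero[of "F s"] by (simp only: power_one mult_1_right)
  then show "AE s in p. norm (F s) \<le> norm (1 + (norm (F s))\<^sup>2)"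
    by (auto intro!: AE_I2)
qed auto

lemma incr_integrable: "\<gamma> \<in> carrier G \<Longrightarrow> integrable \<nu> (incr \<gamma>)"
  by (rule square_integrable_imp_integrable) (rule incr_square_integrable)

definition cincr :: "('g \<Rightarrow> real ^ 'n) \<Rightarrow> 'g \<Rightarrow> 'g \<Rightarrow> real ^ 'n" where
  "cincr f \<gamma> s = incr \<gamma> s - (f (\<gamma> \<otimes> s) - f \<gamma>)"

text \<open>The increments of \<open>\<Phi> - f\<close> all have the mean \<^term>\<open>zeta\<close>, so that \<open>\<Phi> - f - n zeta\<close> is a martingale.\<close>

definition corrector :: "('g \<Rightarrow> real ^ 'n) \<Rightarrow> bool" where
  "corrector f \<longleftrightarrow> Linv f \<and> (\<forall>\<gamma>\<in>carrier G. measure_pmf.expectation \<nu> (cincr f \<gamma>) = zeta)"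

lemma integrable_shift_nu: "Linv f \<Longrightarrow> \<gamma> \<in> carrier G \<Longrightarrow> integrable \<nu> (\<lambda>s. f (\<gamma> \<otimes> s) :: 'c::euclidean_space)"
  by (drule Linv_bounded, elim exE conjE, rule integrable_pmf_bounded) auto

lemma ex_corrector: "\<exists>f. corrector f"
proof -
  let ?g = "\<lambda>\<gamma>. mean_incr \<gamma> - zeta"
  have "Linv ?g \<and> mean ?g = 0" unfolding zeta_def by (rule transition_diff_mean[OF Linv_mean_incr])
  then have "\<exists>r. Linv r \<and> (\<forall>\<gamma>\<in>carrier G. r \<gamma> - measure_pmf.expectation \<nu> (\<lambda>s. r (\<gamma> \<otimes> s)) = ?g \<gamma>)"
    by (intro poisson_equation) auto
  then obtain r where r: "Linv r" "\<And>\<gamma>. \<gamma> \<in> carrier G \<Longrightarrow> r \<gamma> - measure_pmf.expectation \<nu> (\<lambda>s. r (\<gamma> \<otimes> s)) = ?g \<gamma>"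
    by blast
  \<comment> \<open>\<open>cincr\<close> subtracts the coboundary of the corrector, hence the
    sign.\<close>
  have "corrector (\<lambda>\<gamma>. - r \<gamma>)"
    unfolding corrector_def
  proof (intro conjI ballI)
    show "Linv (\<lambda>\<gamma>. - r \<gamma>)" using r(1) by (auto simp: Linv_def)
    fix \<gamma> assume \<gamma>: "\<gamma> \<in> carrier G"
    have "measure_pmf.expectation \<nu> (cincr (\<lambda>\<gamma>. - r \<gamma>) \<gamma>)
        = measure_pmf.expectation \<nu> (\<lambda>s. incr \<gamma> s + (r (\<gamma> \<otimes> s) - r \<gamma>))"
      by (simp add: cincr_def[abs_def] algebra_simps)
    also have "\<dots> = mean_incr \<gamma> + (measure_pmf.expectation \<nu> (\<lambda>s. r (\<gamma> \<otimes> s)) - r \<gamma>)"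
      using incr_integrable[OF \<gamma>] integrable_shift_nu[OF r(1) \<gamma>] by (simp add: mean_incr_def)
    also have "\<dots> = zeta" using r(2)[OF \<gamma>] by (simp add: algebra_simps)
    finally show "measure_pmf.expectation \<nu> (cincr (\<lambda>\<gamma>. - r \<gamma>) \<gamma>) = zeta" .
  qed
  then show ?thesis by blast
qed

lemma Linv_cincr: "Linv f \<Longrightarrow> s \<in> carrier G \<Longrightarrow> Linv (\<lambda>\<gamma>. cincr f \<gamma> s)"
  using Linv_incr[of s] Linv_right[of f s] by (auto simp: Linv_def cincr_def)

lemma cincr_square_integrable:
  assumes f: "Linv f" and \<gamma>: "\<gamma> \<in> carrier G"
  shows "integrable \<nu> (\<lambda>s. (norm (cincr f \<gamma> s - z))\<^sup>2)"
proof -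
  obtain K where K: "K > 0" "\<forall>\<gamma>\<in>carrier G. norm (f \<gamma>) \<le> K" using Linv_bounded[OF f] by blast
  define M where "M = 2 * K + norm z"
  show ?thesis
  proof (rule Bochner_Integration.integrable_bound)
    show "integrable \<nu> (\<lambda>s. 2 * (norm (incr \<gamma> s))\<^sup>2 + 2 * M\<^sup>2)"
      using incr_square_integrable[OF \<gamma>] by simp
    show "AE s in \<nu>. norm ((norm (cincr f \<gamma> s - z))\<^sup>2) \<le> norm (2 * (norm (incr \<gamma> s))\<^sup>2 + 2 * M\<^sup>2)"
      unfolding AE_measure_pmf_iff
    proof
      fix s assume s: "s \<in> set_pmf \<nu>"
      have "norm (cincr f \<gamma> s - z) \<le> norm (incr \<gamma> s) + norm (f (\<gamma> \<otimes> s) - f \<gamma> + z)"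
        using norm_triangle_ineq4[of "incr \<gamma> s" "f (\<gamma> \<otimes> s) - f \<gamma> + z"] by (simp add: cincr_def diff_diff_eq)
      also have "norm (f (\<gamma> \<otimes> s) - f \<gamma> + z) \<le> norm (f (\<gamma> \<otimes> s)) + norm (f \<gamma>) + norm z"
        using norm_triangle_ineq[of "f (\<gamma> \<otimes> s) - f \<gamma>" z] norm_triangle_ineq4[of "f (\<gamma> \<otimes> s)" "f \<gamma>"] by linarith
      also have "norm (f (\<gamma> \<otimes> s)) \<le> K" using K s \<gamma> by auto
      also have "norm (f \<gamma>) \<le> K" using K \<gamma> by auto
      finally have "norm (cincr f \<gamma> s - z) \<le> norm (incr \<gamma> s) + M" by (simp add: M_def)
      then have "(norm (cincr f \<gamma> s - z))\<^sup>2 \<le> (norm (incr \<gamma> s) + M)\<^sup>2" by (rule power_mono) simp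
      also have "\<dots> \<le> 2 * (norm (incr \<gamma> s))\<^sup>2 + 2 * M\<^sup>2"
        using sum_squares_bound[of "norm (incr \<gamma> s)" M] by (simp add: power2_sum)
      finally show "norm ((norm (cincr f \<gamma> s - z))\<^sup>2) \<le> norm (2 * (norm (incr \<gamma> s))\<^sup>2 + 2 * M\<^sup>2)" by simp
    qed
  qed auto
qed

lemma cincr_integrable: "Linv f \<Longrightarrow> \<gamma> \<in> carrier G \<Longrightarrow> integrable \<nu> (cincr f \<gamma>)"
  using cincr_square_integrable[of f \<gamma> 0] by (simp add: square_integrable_imp_integrable)

lemma inner_cincr_integrable:
  assumes "Linv f" "\<gamma> \<in> carrier G"
  shows "integrable \<nu> (\<lambda>s. (v \<bullet> (cincr f \<gamma> s - z)) * (w \<bullet> (cincr f \<gamma> s - z)))"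
proof (rule Bochner_Integration.integrable_bound)
  show "integrable \<nu> (\<lambda>s. norm v * norm w * (norm (cincr f \<gamma> s - z))\<^sup>2)"
    using cincr_square_integrable[OF assms] by simp
  have "\<bar>v \<bullet> y\<bar> * \<bar>w \<bullet> y\<bar> \<le> norm v * norm w * (norm y)\<^sup>2" for y :: "real ^ 'n"
  proof -
    have "\<bar>v \<bullet> y\<bar> * \<bar>w \<bullet> y\<bar> \<le> (norm v * norm y) * (norm w * norm y)"
      by (intro mult_mono Cauchy_Schwarz_ineq2) auto
    also have "\<dots> = norm v * norm w * (norm y)\<^sup>2" by (simp add: power2_eq_square)
    finally show ?thesis .
  qed
  then show "AE s in \<nu>. norm ((v \<bullet> (cincr f \<gamma> s - z)) * (w \<bullet> (cincr f \<gamma> s - z)))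
     \<le> norm (norm v * norm w * (norm (cincr f \<gamma> s - z))\<^sup>2)"
    by (intro AE_I2) (simp add: abs_mult)
qed auto

text \<open>Stationary covariance of one step of the martingale. By
  \<open>covariance_form_eq\<close> it equals \<open>covariance_form\<close>, so it does not depend
  on the corrector \<open>f\<close>.\<close>

definition cov :: "('g \<Rightarrow> real ^ 'n) \<Rightarrow> real ^ 'n \<Rightarrow> real ^ 'n \<Rightarrow> real" where
  "cov f v w = mean (\<lambda>\<gamma>. measure_pmf.expectation \<nu> (\<lambda>s. (v \<bullet> (cincr f \<gamma> s - zeta)) * (w \<bullet> (cincr f \<gamma> s - zeta))))"

text \<open>For \<open>\<phi>\<close> with \<open>\<Lambda>\<close>-invariant increments this is the \<open>n\<close>-th power of an operator on functions on the
  quotient, which makes characteristic functions of the walk accessible to operator bounds.\<close>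

definition twisted :: "('g \<Rightarrow> real) \<Rightarrow> nat \<Rightarrow> ('g \<Rightarrow> complex) \<Rightarrow> 'g \<Rightarrow> complex" where
  "twisted \<phi> n g \<gamma> = measure_pmf.expectation (conv n) (\<lambda>s. iexp (\<phi> (\<gamma> \<otimes> s) - \<phi> \<gamma>) * g (\<gamma> \<otimes> s))"

lemma twisted_norm_le:
  "\<lbrakk>\<And>\<gamma>. \<gamma> \<in> carrier G \<Longrightarrow> norm (g \<gamma>) \<le> K; \<gamma> \<in> carrier G\<rbrakk> \<Longrightarrow> norm (twisted \<phi> n g \<gamma>) \<le> K"
  unfolding twisted_def by (rule norm_expectation_le) (auto simp: set_conv_carrier norm_mult)

lemma twisted_integrable:
  "\<lbrakk>\<And>\<gamma>. \<gamma> \<in> carrier G \<Longrightarrow> norm (g \<gamma>) \<le> K; \<gamma> \<in> carrier G\<rbrakk> \<Longrightarrow>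
    integrable (conv n) (\<lambda>s. iexp (\<phi> (\<gamma> \<otimes> s) - \<phi> \<gamma>) * g (\<gamma> \<otimes> s))"
  by (rule integrable_pmf_bounded[where K=K]) (auto simp: set_conv_carrier norm_mult)

lemma twisted_add:
  assumes g: "\<And>\<gamma>. \<gamma> \<in> carrier G \<Longrightarrow> norm (g \<gamma>) \<le> K" and \<gamma>: "\<gamma> \<in> carrier G"
  shows "twisted \<phi> (n + m) g \<gamma> = twisted \<phi> n (twisted \<phi> m g) \<gamma>"
proof -
  have "twisted \<phi> (n + m) g \<gamma> = measure_pmf.expectation (conv n) (\<lambda>a. measure_pmf.expectation (conv m)
      (\<lambda>b. iexp (\<phi> (\<gamma> \<otimes> (a \<otimes> b)) - \<phi> \<gamma>) * g (\<gamma> \<otimes> (a \<otimes> b))))"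
    unfolding twisted_def by (rule expectation_conv_add[where K=K]) (use g \<gamma> in \<open>auto simp: norm_mult\<close>)
  also have "\<dots> = measure_pmf.expectation (conv n) (\<lambda>a. measure_pmf.expectation (conv m)
      (\<lambda>b. iexp (\<phi> (\<gamma> \<otimes> a) - \<phi> \<gamma>) * (iexp (\<phi> ((\<gamma> \<otimes> a) \<otimes> b) - \<phi> (\<gamma> \<otimes> a)) * g ((\<gamma> \<otimes> a) \<otimes> b))))"
  proof (rule integral_cong_AE)
    have "iexp (\<phi> (\<gamma> \<otimes> (a \<otimes> b)) - \<phi> \<gamma>) * g (\<gamma> \<otimes> (a \<otimes> b))
        = iexp (\<phi> (\<gamma> \<otimes> a) - \<phi> \<gamma>) * (iexp (\<phi> ((\<gamma> \<otimes> a) \<otimes> b) - \<phi> (\<gamma> \<otimes> a)) * g ((\<gamma> \<otimes> a) \<otimes> b))"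
      if "a \<in> set_pmf (conv n)" "b \<in> set_pmf (conv m)" for a b
    proof -
      have e: "\<gamma> \<otimes> (a \<otimes> b) = (\<gamma> \<otimes> a) \<otimes> b" using that \<gamma> by (simp add: m_assoc set_conv_carrier)
      have "iexp (\<phi> (\<gamma> \<otimes> (a \<otimes> b)) - \<phi> \<gamma>)
          = iexp (\<phi> (\<gamma> \<otimes> a) - \<phi> \<gamma>) * iexp (\<phi> ((\<gamma> \<otimes> a) \<otimes> b) - \<phi> (\<gamma> \<otimes> a))"
        unfolding e exp_add[symmetric] by (simp add: algebra_simps)
      then show ?thesis unfolding e by (simp only: mult.assoc)
    qed
    then show "AE a in conv n. measure_pmf.expectation (conv m) (\<lambda>b. iexp (\<phi> (\<gamma> \<otimes> (a \<otimes> b)) - \<phi> \<gamma>) * g (\<gamma> \<otimes> (a \<otimes> b)))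
      = measure_pmf.expectation (conv m) (\<lambda>b. iexp (\<phi> (\<gamma> \<otimes> a) - \<phi> \<gamma>) * (iexp (\<phi> ((\<gamma> \<otimes> a) \<otimes> b) - \<phi> (\<gamma> \<otimes> a)) * g ((\<gamma> \<otimes> a) \<otimes> b)))"
      unfolding AE_measure_pmf_iff
      by (intro ballI integral_cong_AE) (auto simp: AE_measure_pmf_iff simp del: of_real_diff)
  qed auto
  also have "\<dots> = twisted \<phi> n (twisted \<phi> m g) \<gamma>"
    unfolding twisted_def by (simp only: integral_mult_right_zero)
  finally show ?thesis .
qed

lemma twisted_diff:
  assumes "\<And>\<gamma>. \<gamma> \<in> carrier G \<Longrightarrow> norm (g \<gamma>) \<le> K" "\<And>\<gamma>. \<gamma> \<in> carrier G \<Longrightarrow> norm (h \<gamma>) \<le> K'" "\<gamma> \<in> carrier G"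
  shows "twisted \<phi> n (\<lambda>\<gamma>. g \<gamma> - c * h \<gamma>) \<gamma> = twisted \<phi> n g \<gamma> - c * twisted \<phi> n h \<gamma>"
proof -
  have i1: "integrable (conv n) (\<lambda>s. iexp (\<phi> (\<gamma> \<otimes> s) - \<phi> \<gamma>) * g (\<gamma> \<otimes> s))"
    by (rule twisted_integrable[OF assms(1,3)])
  have i2: "integrable (conv n) (\<lambda>s. c * (iexp (\<phi> (\<gamma> \<otimes> s) - \<phi> \<gamma>) * h (\<gamma> \<otimes> s)))"
    by (rule integrable_mult_right, rule twisted_integrable[OF assms(2,3)])
  show ?thesis
    unfolding twisted_def integral_mult_right_zero[symmetric] Bochner_Integration.integral_diff[OF i1 i2, symmetric]
    by (rule Bochner_Integration.integral_cong) (simp_all add: right_diff_distrib mult.left_commute)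
qed

lemma twisted_Linv:
  assumes "Linv g" "\<And>s. s \<in> carrier G \<Longrightarrow> Linv (\<lambda>\<gamma>. \<phi> (\<gamma> \<otimes> s) - \<phi> \<gamma>)"
  shows "Linv (twisted \<phi> n g)"
  unfolding Linv_def twisted_def
proof (intro ballI)
  fix v \<gamma> assume a: "v \<in> \<Lambda>" "\<gamma> \<in> carrier G"
  have "iexp (\<phi> (v \<otimes> \<gamma> \<otimes> s) - \<phi> (v \<otimes> \<gamma>)) * g (v \<otimes> \<gamma> \<otimes> s) = iexp (\<phi> (\<gamma> \<otimes> s) - \<phi> \<gamma>) * g (\<gamma> \<otimes> s)"
    if "s \<in> set_pmf (conv n)" for s
  proof -
    have s: "s \<in> carrier G" using that by (rule set_conv_carrier)
    have "g (v \<otimes> \<gamma> \<otimes> s) = g (\<gamma> \<otimes> s)" using a s Linv_right[OF assms(1) s] by (auto simp: Linv_def)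
    moreover have "\<phi> (v \<otimes> \<gamma> \<otimes> s) - \<phi> (v \<otimes> \<gamma>) = \<phi> (\<gamma> \<otimes> s) - \<phi> \<gamma>"
      using a assms(2)[OF s] by (simp add: Linv_def)
    ultimately show ?thesis by (simp only:)
  qed
  then show "measure_pmf.expectation (conv n) (\<lambda>s. iexp (\<phi> (v \<otimes> \<gamma> \<otimes> s) - \<phi> (v \<otimes> \<gamma>)) * g (v \<otimes> \<gamma> \<otimes> s))
    = measure_pmf.expectation (conv n) (\<lambda>s. iexp (\<phi> (\<gamma> \<otimes> s) - \<phi> \<gamma>) * g (\<gamma> \<otimes> s))"
    by (intro integral_cong_AE) (auto simp: AE_measure_pmf_iff simp del: of_real_diff)
qed

end

section \<open>Central limit theorem\<close>

text \<open>Both bounds are wanted: the cubic one makes the remainder, multiplied by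
  \<open>n\<close>, vanish pointwise at scale \<open>1 / sqrt n\<close>, while the quadratic one
  dominates it with second moments only.\<close>

lemma iexp_second_order:
  "cmod (iexp x - 1 - \<i> * x + x\<^sup>2 / 2) \<le> min (x\<^sup>2) (\<bar>x\<bar> ^ 3 / 6)"
proof -
  have e: "(\<Sum>k\<le>2. (\<i> * x) ^ k / fact k) = 1 + \<i> * x - x\<^sup>2 / 2"
  proof -
    have s3: "(\<Sum>k\<le>2. F k) = F 0 + F 1 + F 2" for F :: "nat \<Rightarrow> complex"
      by (simp add: numeral_2_eq_2)
    show ?thesis unfolding s3 by (simp add: power_mult_distrib)
  qed
  have "cmod (iexp x - (\<Sum>k\<le>2. (\<i> * x) ^ k / fact k)) \<le> x\<^sup>2"
    using iexp_approx2[of x 2] by simp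
  moreover have "cmod (iexp x - (\<Sum>k\<le>2. (\<i> * x) ^ k / fact k)) \<le> \<bar>x\<bar> ^ 3 / 6"
    using iexp_approx1[of x 2] by (simp add: numeral_3_eq_3 fact_numeral)
  ultimately show ?thesis unfolding e by (simp add: algebra_simps)
qed

lemma iexp_sqrt_second_order_lim:
  "(\<lambda>n. of_nat n * (iexp (x / sqrt n) - 1 - \<i> * (x / sqrt n) + (x\<^sup>2 / n) / 2)) \<longlonglongrightarrow> (0::complex)"
proof (rule Lim_null_comparison)
  show "eventually (\<lambda>n. cmod (of_nat n * (iexp (x / sqrt n) - 1 - \<i> * (x / sqrt n) + (x\<^sup>2 / n) / 2)) \<le> \<bar>x\<bar> ^ 3 / 6 * (1 / sqrt n)) sequentially"
  proof (rule eventually_sequentiallyI[of 1])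
    fix n :: nat assume n: "1 \<le> n"
    have "cmod (iexp (x / sqrt n) - 1 - \<i> * (x / sqrt n) + (x / sqrt n)\<^sup>2 / 2) \<le> \<bar>x / sqrt n\<bar> ^ 3 / 6"
      using iexp_second_order[of "x / sqrt n"] by simp
    then have "n * cmod (iexp (x / sqrt n) - 1 - \<i> * (x / sqrt n) + (x / sqrt n)\<^sup>2 / 2) \<le> n * (\<bar>x / sqrt n\<bar> ^ 3 / 6)"
      by (rule mult_left_mono) simp
    also have "n * (\<bar>x / sqrt n\<bar> ^ 3 / 6) = \<bar>x\<bar> ^ 3 / 6 * (1 / sqrt n)"
      using n by (simp add: power_divide power3_eq_cube field_simps)
    finally show "cmod (of_nat n * (iexp (x / sqrt n) - 1 - \<i> * (x / sqrt n) + (x\<^sup>2 / n) / 2)) \<le> \<bar>x\<bar> ^ 3 / 6 * (1 / sqrt n)"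
      by (simp add: norm_mult power_divide)
  qed
  have "(\<lambda>n. \<bar>x\<bar> ^ 3 / 6 * (1 / sqrt (real n))) \<longlonglongrightarrow> \<bar>x\<bar> ^ 3 / 6 * 0"
    by (intro tendsto_intros) real_asymp
  then show "(\<lambda>n. \<bar>x\<bar> ^ 3 / 6 * (1 / sqrt (real n))) \<longlonglongrightarrow> 0" by simp
qed

lemma iexp_sqrt_second_order_le:
  "n \<ge> 1 \<Longrightarrow> cmod (of_nat n * (iexp (x / sqrt n) - 1 - \<i> * (x / sqrt n) + (x\<^sup>2 / n) / 2)) \<le> x\<^sup>2"
proof -
  assume n: "n \<ge> 1"
  have "cmod (iexp (x / sqrt n) - 1 - \<i> * (x / sqrt n) + (x / sqrt n)\<^sup>2 / 2) \<le> (x / sqrt n)\<^sup>2"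
    using iexp_second_order[of "x / sqrt n"] by simp
  then have "n * cmod (iexp (x / sqrt n) - 1 - \<i> * (x / sqrt n) + (x / sqrt n)\<^sup>2 / 2) \<le> n * (x / sqrt n)\<^sup>2"
    by (rule mult_left_mono) simp
  then show ?thesis using n by (simp add: norm_mult power_divide)
qed

lemma iexp_sqrt_lim: "(\<lambda>n. iexp (x / sqrt (real n))) \<longlonglongrightarrow> 1"
proof -
  have "(\<lambda>n. x / sqrt (real n)) \<longlonglongrightarrow> 0" by real_asymp
  then have "(\<lambda>n. iexp (x / sqrt (real n))) \<longlonglongrightarrow> iexp 0"
    by (intro tendsto_intros)
  then show ?thesis by simp
qed

context lattice_walk
begin

text \<open>Telescoping: \<open>twisted\<close> does not increase the sup norm and \<open>l\<close>
  has modulus at most 1, so replacing one application at a time by multiplication with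
  \<open>l\<close> costs \<open>e\<close> each time.\<close>

lemma twisted_power_approx:
  assumes h: "\<And>\<gamma>. \<gamma> \<in> carrier G \<Longrightarrow> norm (h \<gamma>) \<le> K"
    and one: "\<And>\<gamma>. \<gamma> \<in> carrier G \<Longrightarrow> norm (twisted \<phi> 1 h \<gamma> - l * h \<gamma>) \<le> e" and l: "norm l \<le> 1" and \<gamma>: "\<gamma> \<in> carrier G"
  shows "norm (twisted \<phi> k h \<gamma> - l ^ k * h \<gamma>) \<le> k * e"
  using \<gamma>
proof (induction k arbitrary: \<gamma>)
  case 0 then show ?case by (simp add: twisted_def)
next
  case (Suc k)
  have b: "norm (twisted \<phi> k h \<gamma>) \<le> K" if "\<gamma> \<in> carrier G" for \<gamma> using twisted_norm_le[OF h that] .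
  have "twisted \<phi> (Suc k) h \<gamma> - l ^ k * twisted \<phi> 1 h \<gamma> = twisted \<phi> 1 (\<lambda>\<gamma>. twisted \<phi> k h \<gamma> - l ^ k * h \<gamma>) \<gamma>"
    using twisted_diff[where g="twisted \<phi> k h" and h=h and c="l ^ k" and \<phi>=\<phi> and n=1, OF b h Suc.prems]
      twisted_add[where \<phi>=\<phi> and n=1 and m=k, OF h Suc.prems] by simp
  also have "norm \<dots> \<le> k * e" by (rule twisted_norm_le[OF Suc.IH Suc.prems])
  finally have 1: "norm (twisted \<phi> (Suc k) h \<gamma> - l ^ k * twisted \<phi> 1 h \<gamma>) \<le> k * e" .
  have "norm (l ^ k * (twisted \<phi> 1 h \<gamma> - l * h \<gamma>)) \<le> 1 * e"
    unfolding norm_mult norm_power using one[OF Suc.prems] l by (intro mult_mono power_le_one) auto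
  then have 2: "norm (l ^ k * twisted \<phi> 1 h \<gamma> - l ^ Suc k * h \<gamma>) \<le> e"
    by (simp add: algebra_simps)
  show ?case using norm_triangle_le[OF add_mono[OF 1 2]] by (simp add: algebra_simps)
qed

text \<open>The corrector is built into the phase so that its increments are the corrected ones, all
  of mean \<open>zeta\<close>; being bounded, it does not matter at scale \<open>sqrt n\<close> and
  is removed again in \<open>clt_char\<close>.\<close>

abbreviation phase :: "('g \<Rightarrow> real ^ 'n) \<Rightarrow> real ^ 'n \<Rightarrow> nat \<Rightarrow> 'g \<Rightarrow> real" where
  "phase f v n \<gamma> \<equiv> (v \<bullet> (\<Phi> \<gamma> - f \<gamma>)) / sqrt n"

lemma phase_diff: "phase f v n (\<gamma> \<otimes> s) - phase f v n \<gamma> = (v \<bullet> cincr f \<gamma> s) / sqrt n"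
  by (simp add: cincr_def incr_def diff_divide_distrib[symmetric] inner_diff_right)

definition local_var :: "('g \<Rightarrow> real ^ 'n) \<Rightarrow> real ^ 'n \<Rightarrow> 'g \<Rightarrow> real" where
  "local_var f v \<gamma> = measure_pmf.expectation \<nu> (\<lambda>s. (v \<bullet> (cincr f \<gamma> s - zeta))\<^sup>2)"

lemma local_var_Linv: "Linv f \<Longrightarrow> Linv (local_var f v)"
  using Linv_cincr unfolding Linv_def local_var_def
  by (auto intro!: integral_cong_AE simp: AE_measure_pmf_iff)

lemma mean_local_var: "mean (local_var f v) = cov f v v"
  by (simp add: cov_def local_var_def[abs_def] power2_eq_square)

lemma cov_nonneg: "cov f v v \<ge> 0"
  unfolding mean_local_var[symmetric] mean_def local_var_def by (simp add: sum_nonneg)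

text \<open>The first order term \<open>r/(2n)\<close> makes \<open>1 + r/(2n)\<close> an approximate eigenfunction, with the averaged variance
  \<open>c\<close> in place of the variance at \<open>\<gamma>\<close>.\<close>

lemma twisted_one_step:
  assumes f: "corrector f" and \<gamma>: "\<gamma> \<in> carrier G"
    and r: "Linv r" "r \<gamma> - measure_pmf.expectation \<nu> (\<lambda>s. r (\<gamma> \<otimes> s)) = c - local_var f v \<gamma>"
  shows "(\<lambda>n. of_nat n * (iexp (- (v \<bullet> zeta) / sqrt n) * twisted (phase f v n) 1 (\<lambda>\<gamma>. 1 + r \<gamma> / (2 * n)) \<gamma>
      - (1 - c / (2 * n)) * (1 + r \<gamma> / (2 * n)))) \<longlonglongrightarrow> (0::complex)"
proof -
  have Lf: "Linv f" using f by (simp add: corrector_def)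
  define \<xi> where "\<xi> s = v \<bullet> (cincr f \<gamma> s - zeta)" for s
  have i\<xi>2: "integrable \<nu> (\<lambda>s. (\<xi> s)\<^sup>2)"
    using inner_cincr_integrable[OF Lf \<gamma>, of v zeta v] by (simp add: \<xi>_def power2_eq_square)
  have i\<xi>: "integrable \<nu> \<xi>"
    unfolding \<xi>_def using cincr_integrable[OF Lf \<gamma>] by simp
  have E\<xi>: "measure_pmf.expectation \<nu> \<xi> = 0"
  proof -
    have "measure_pmf.expectation \<nu> \<xi> = v \<bullet> measure_pmf.expectation \<nu> (\<lambda>s. cincr f \<gamma> s - zeta)"
      unfolding \<xi>_def using cincr_integrable[OF Lf \<gamma>] by (intro integral_inner_right) simp
    also have "measure_pmf.expectation \<nu> (\<lambda>s. cincr f \<gamma> s - zeta) = 0"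
      using cincr_integrable[OF Lf \<gamma>] f \<gamma> by (simp add: corrector_def)
    finally show ?thesis by simp
  qed
  have local_var: "measure_pmf.expectation \<nu> (\<lambda>s. (\<xi> s)\<^sup>2) = local_var f v \<gamma>" by (simp add: local_var_def \<xi>_def)
  obtain K where K: "K > 0" "\<forall>\<gamma>\<in>carrier G. norm (r \<gamma>) \<le> K" using Linv_bounded[OF r(1)] by blast
  \<comment> \<open>\<open>A\<close> is \<open>n\<close> times the second order Taylor remainder of
    the centred phase, and \<open>B\<close> is the interaction of the phase with the first order
    term \<open>r\<close>. Both have expectation tending to 0 by dominated convergence.\<close>
  define A where "A n s = of_nat n * (iexp (\<xi> s / sqrt n) - 1 - \<i> * (\<xi> s / sqrt n) + ((\<xi> s)\<^sup>2 / n) / 2)" for n :: nat and s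
  define B where "B n s = (iexp (\<xi> s / sqrt n) - 1) * of_real (r (\<gamma> \<otimes> s))" for n :: nat and s
  have limA: "(\<lambda>n. measure_pmf.expectation \<nu> (A n)) \<longlonglongrightarrow> measure_pmf.expectation \<nu> (\<lambda>s. 0)"
  proof (rule integral_dominated_convergence[where w="\<lambda>s. (\<xi> s)\<^sup>2"])
    show "AE s in \<nu>. (\<lambda>n. A n s) \<longlonglongrightarrow> 0" unfolding A_def by (intro AE_I2 iexp_sqrt_second_order_lim)
    show "AE s in \<nu>. norm (A n s) \<le> (\<xi> s)\<^sup>2" for n
      unfolding A_def using iexp_sqrt_second_order_le[of n] by (cases "n = 0") (auto intro!: AE_I2)
  qed (use i\<xi>2 in auto)
  have iA: "integrable \<nu> (A n)" for n
  proof (rule Bochner_Integration.integrable_bound[OF i\<xi>2])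
    show "AE s in \<nu>. norm (A n s) \<le> norm ((\<xi> s)\<^sup>2)"
      unfolding A_def using iexp_sqrt_second_order_le[of n] by (cases "n = 0") (auto intro!: AE_I2)
  qed auto
  have Bb: "norm (B n s) \<le> 2 * K" if "s \<in> set_pmf \<nu>" for n s
  proof -
    have "norm (iexp (\<xi> s / sqrt n) - 1) \<le> 2"
      using norm_triangle_ineq4[of "iexp (\<xi> s / sqrt n)" 1] by simp
    then show ?thesis unfolding B_def norm_mult using K \<gamma> that by (intro mult_mono) auto
  qed
  have limB: "(\<lambda>n. measure_pmf.expectation \<nu> (B n)) \<longlonglongrightarrow> measure_pmf.expectation \<nu> (\<lambda>s. 0)"
  proof (rule integral_dominated_convergence[where w="\<lambda>s. 2 * K"])
    show "AE s in \<nu>. (\<lambda>n. B n s) \<longlonglongrightarrow> 0"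
    proof (rule AE_I2)
      fix s
      have "(\<lambda>n. B n s) \<longlonglongrightarrow> (1 - 1) * of_real (r (\<gamma> \<otimes> s))"
        unfolding B_def by (intro tendsto_intros iexp_sqrt_lim)
      then show "(\<lambda>n. B n s) \<longlonglongrightarrow> 0" by simp
    qed
  qed (use Bb in \<open>auto simp: AE_measure_pmf_iff\<close>)
  have iB: "integrable \<nu> (B n)" for n by (rule integrable_pmf_bounded[OF Bb])
  have ir: "integrable \<nu> (\<lambda>s. r (\<gamma> \<otimes> s))" by (rule integrable_shift_nu[OF r(1) \<gamma>])
  define rm where "rm = measure_pmf.expectation \<nu> (\<lambda>s. r (\<gamma> \<otimes> s))"
  \<comment> \<open>The linear term has mean zero because \<open>f\<close> is a corrector, and the
    quadratic one yields half of \<open>local_var\<close>. By the Poisson equation for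
    \<open>r\<close> the terms of order 1 then match those of
    \<open>(1 - c / (2 * n)) * (1 + r \<gamma> / (2 * n))\<close> up to the cross term
    \<open>c * r \<gamma> / (4 * n)\<close>.\<close>
  have eq: "of_nat n * (iexp (- (v \<bullet> zeta) / sqrt n) * twisted (phase f v n) 1 (\<lambda>\<gamma>. 1 + r \<gamma> / (2 * n)) \<gamma>
      - (1 - c / (2 * n)) * (1 + r \<gamma> / (2 * n)))
    = measure_pmf.expectation \<nu> (A n) + measure_pmf.expectation \<nu> (B n) / 2 + of_real (c * r \<gamma> / (4 * real n))" if n: "n \<ge> 1" for n :: nat
  proof -
    have e: "iexp (- (v \<bullet> zeta) / sqrt n) * (iexp (phase f v n (\<gamma> \<otimes> s) - phase f v n \<gamma>) * complex_of_real (1 + r (\<gamma> \<otimes> s) / (2 * n)))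
      = (A n s + B n s / 2 + of_real (real n + r (\<gamma> \<otimes> s) / 2) + \<i> * of_real (sqrt n * \<xi> s) - of_real ((\<xi> s)\<^sup>2 / 2)) / of_nat n" for s
    proof -
      have "iexp (- (v \<bullet> zeta) / sqrt n) * iexp (phase f v n (\<gamma> \<otimes> s) - phase f v n \<gamma>) = iexp (\<xi> s / sqrt n)"
        unfolding exp_add[symmetric] phase_diff \<xi>_def by (simp add: inner_diff_right diff_divide_distrib algebra_simps)
      then have "iexp (- (v \<bullet> zeta) / sqrt n) * (iexp (phase f v n (\<gamma> \<otimes> s) - phase f v n \<gamma>) * complex_of_real (1 + r (\<gamma> \<otimes> s) / (2 * n)))
        = iexp (\<xi> s / sqrt n) * complex_of_real (1 + r (\<gamma> \<otimes> s) / (2 * n))"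
        by (simp only: mult.assoc[symmetric])
      also have "\<dots> = (A n s + B n s / 2 + of_real (real n + r (\<gamma> \<otimes> s) / 2) + \<i> * of_real (sqrt n * \<xi> s) - of_real ((\<xi> s)\<^sup>2 / 2)) / of_nat n"
      proof -
        have "of_nat n * (\<i> * (complex_of_real (\<xi> s) / complex_of_real (sqrt n))) = \<i> * of_real (sqrt n * \<xi> s)"
        proof -
          have "real n * (\<xi> s / sqrt n) = sqrt n * \<xi> s" using n by (simp add: field_simps)
          moreover have "of_nat n * (\<i> * (complex_of_real (\<xi> s) / complex_of_real (sqrt n))) = \<i> * complex_of_real (real n * (\<xi> s / sqrt n))"
            by simp
          ultimately show ?thesis by (simp only:)
        qed
        then show ?thesis using n unfolding A_def B_def by (simp add: field_simps)
      qed
      finally show ?thesis .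
    qed
    have "iexp (- (v \<bullet> zeta) / sqrt n) * twisted (phase f v n) 1 (\<lambda>\<gamma>. 1 + r \<gamma> / (2 * n)) \<gamma>
      = measure_pmf.expectation \<nu> (\<lambda>s. iexp (- (v \<bullet> zeta) / sqrt n) * (iexp (phase f v n (\<gamma> \<otimes> s) - phase f v n \<gamma>) * complex_of_real (1 + r (\<gamma> \<otimes> s) / (2 * n))))"
      unfolding twisted_def conv_1_expectation by (simp only: integral_mult_right_zero of_real_add of_real_1 of_real_divide of_real_mult of_real_numeral of_real_of_nat_eq)
    also have "\<dots> = measure_pmf.expectation \<nu> (\<lambda>s. (A n s + B n s / 2 + of_real (real n + r (\<gamma> \<otimes> s) / 2) + \<i> * of_real (sqrt n * \<xi> s) - of_real ((\<xi> s)\<^sup>2 / 2)) / of_nat n)"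
      unfolding e by (rule refl)
    also have "\<dots> = (measure_pmf.expectation \<nu> (A n) + measure_pmf.expectation \<nu> (B n) / 2 + of_real (real n + rm / 2) + \<i> * of_real (sqrt n * 0) - of_real (local_var f v \<gamma> / 2)) / of_nat n"
    proof -
      have i1: "integrable \<nu> (\<lambda>s. complex_of_real (real n + r (\<gamma> \<otimes> s) / 2))" using ir by (intro integrable_of_real) simp
      have i2: "integrable \<nu> (\<lambda>s. \<i> * complex_of_real (sqrt n * \<xi> s))" using i\<xi> by (intro integrable_mult_right integrable_of_real) simp
      have i3: "integrable \<nu> (\<lambda>s. complex_of_real ((\<xi> s)\<^sup>2 / 2))" using i\<xi>2 by (intro integrable_of_real) simp
      have e1: "measure_pmf.expectation \<nu> (\<lambda>s. complex_of_real (real n + r (\<gamma> \<otimes> s) / 2)) = of_real (real n + rm / 2)"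
      proof -
        have "measure_pmf.expectation \<nu> (\<lambda>s. real n + r (\<gamma> \<otimes> s) / 2) = measure_pmf.expectation \<nu> (\<lambda>s. real n) + measure_pmf.expectation \<nu> (\<lambda>s. r (\<gamma> \<otimes> s) / 2)"
          by (rule Bochner_Integration.integral_add) (use ir in auto)
        then show ?thesis unfolding rm_def integral_complex_of_real by simp
      qed
      have e2: "measure_pmf.expectation \<nu> (\<lambda>s. \<i> * complex_of_real (sqrt n * \<xi> s)) = \<i> * of_real (sqrt n * 0)"
        unfolding integral_mult_right_zero integral_complex_of_real by (simp add: E\<xi>)
      have e3: "measure_pmf.expectation \<nu> (\<lambda>s. complex_of_real ((\<xi> s)\<^sup>2 / 2)) = of_real (local_var f v \<gamma> / 2)"
        unfolding integral_complex_of_real by (simp add: local_var)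
      have i4: "integrable \<nu> (\<lambda>s. B n s / 2)" using iB by simp
      show ?thesis
        unfolding integral_divide_zero
        by (subst Bochner_Integration.integral_diff, (intro Bochner_Integration.integrable_add iA i4 i1 i2)[1], rule i3,
            subst Bochner_Integration.integral_add, (intro Bochner_Integration.integrable_add iA i4 i1)[1], rule i2,
            subst Bochner_Integration.integral_add, (intro Bochner_Integration.integrable_add iA i4)[1], rule i1,
            subst Bochner_Integration.integral_add, rule iA, rule i4) (simp only: e1 e2 e3 integral_divide_zero)
    qed
    finally have f1: "of_nat n * (iexp (- (v \<bullet> zeta) / sqrt n) * twisted (phase f v n) 1 (\<lambda>\<gamma>. 1 + r \<gamma> / (2 * n)) \<gamma>)
      = measure_pmf.expectation \<nu> (A n) + measure_pmf.expectation \<nu> (B n) / 2 + of_real (n + rm / 2 - local_var f v \<gamma> / 2)"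
      using n by (simp add: field_simps)
    have f2: "complex_of_real (n + rm / 2 - local_var f v \<gamma> / 2) - of_nat n * ((1 - c / (2 * n)) * (1 + r \<gamma> / (2 * n))) = of_real (c * r \<gamma> / (4 * real n))"
    proof -
      have "n + rm / 2 - local_var f v \<gamma> / 2 - n * ((1 - c / (2 * n)) * (1 + r \<gamma> / (2 * n))) = c * r \<gamma> / (4 * real n)"
      proof -
        have rm: "rm = r \<gamma> - c + local_var f v \<gamma>" using r(2) unfolding rm_def[symmetric] by simp
        show ?thesis unfolding rm using n by (simp add: field_simps)
      qed
      then have "complex_of_real (n + rm / 2 - local_var f v \<gamma> / 2 - n * ((1 - c / (2 * n)) * (1 + r \<gamma> / (2 * n)))) = of_real (c * r \<gamma> / (4 * real n))"
        by (simp only:)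
      then show ?thesis by simp
    qed
    show ?thesis unfolding right_diff_distrib f1 by (simp only: f2[symmetric] add_diff_eq of_real_mult of_real_of_nat_eq)
  qed
  have "(\<lambda>n. measure_pmf.expectation \<nu> (A n) + measure_pmf.expectation \<nu> (B n) / 2 + complex_of_real (c * r \<gamma> / (4 * real n))) \<longlonglongrightarrow> 0 + 0 / 2 + of_real 0"
  proof (intro tendsto_intros)
    show "(\<lambda>n. c * r \<gamma> / (4 * real n)) \<longlonglongrightarrow> 0" by real_asymp
  qed (use limA limB in auto)
  then have "(\<lambda>n. measure_pmf.expectation \<nu> (A n) + measure_pmf.expectation \<nu> (B n) / 2 + complex_of_real (c * r \<gamma> / (4 * real n))) \<longlonglongrightarrow> 0" by simp
  then show ?thesis
    by (rule Lim_transform_eventually) (rule eventually_sequentiallyI[of 1], rule eq[symmetric])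
qed

text \<open>Each of the \<open>n\<close> steps has an error \<open>e n / n\<close> with
  \<open>e n\<close> tending to 0, so \<open>n\<close> steps together cost \<open>e n\<close>, and
  the \<open>n\<close>-th power of \<open>1 - c / (2 * n)\<close> tends to
  \<open>exp (- c / 2)\<close>. The unimodular numbers \<open>a n\<close> carry the drift.\<close>

lemma twisted_limit:
  assumes f: "corrector f" and \<gamma>: "\<gamma> \<in> carrier G"
  shows "(\<lambda>n. iexp (- (sqrt n * (v \<bullet> zeta))) * twisted (phase f v n) n (\<lambda>_. 1) \<gamma>) \<longlonglongrightarrow> of_real (exp (- cov f v v / 2))"
proof -
  define c where "c = cov f v v"
  have Lf: "Linv f" using f by (simp add: corrector_def)
  have c0: "c \<ge> 0" by (simp add: c_def cov_nonneg)
  have "Linv (\<lambda>\<gamma>. c - local_var f v \<gamma>) \<and> mean (\<lambda>\<gamma>. c - local_var f v \<gamma>) = 0"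
  proof -
    have "Linv (\<lambda>\<gamma>. local_var f v \<gamma> - c) \<and> mean (\<lambda>\<gamma>. local_var f v \<gamma> - c) = 0"
      unfolding c_def mean_local_var[symmetric] by (rule transition_diff_mean[OF local_var_Linv[OF Lf]])
    then show ?thesis using D_nonempty by (auto simp: Linv_def mean_def sum_subtractf)
  qed
  then have "\<exists>r. Linv r \<and> (\<forall>\<gamma>\<in>carrier G. r \<gamma> - measure_pmf.expectation \<nu> (\<lambda>s. r (\<gamma> \<otimes> s)) = c - local_var f v \<gamma>)"
    by (intro poisson_equation) auto
  then obtain r where r: "Linv r" "\<And>\<gamma>. \<gamma> \<in> carrier G \<Longrightarrow> r \<gamma> - measure_pmf.expectation \<nu> (\<lambda>s. r (\<gamma> \<otimes> s)) = c - local_var f v \<gamma>"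
    by blast
  obtain K where K: "K > 0" "\<forall>\<gamma>\<in>carrier G. norm (r \<gamma>) \<le> K" using Linv_bounded[OF r(1)] by blast
  define h where "h n \<gamma> = complex_of_real (1 + r \<gamma> / (2 * real n))" for n :: nat and \<gamma>
  define a where "a n = iexp (- (v \<bullet> zeta) / sqrt n)" for n :: nat
  have a1: "norm (a n) = 1" for n by (simp add: a_def del: of_real_divide of_real_minus)
  have an0: "a n \<noteq> 0" for n using a1[of n] by auto
  define l where "l n = complex_of_real (1 - c / (2 * real n))" for n :: nat
  define D where "D n \<gamma> = norm (of_nat n * (a n * twisted (phase f v n) 1 (h n) \<gamma> - l n * h n \<gamma>))" for n \<gamma>
  have Lh: "Linv (h n)" for n using r(1) by (auto simp: Linv_def h_def)
  have LT: "Linv (twisted (phase f v n) k g)" if "Linv g" for n k g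
    by (rule twisted_Linv[OF that]) (use Linv_cincr[OF Lf] in \<open>simp add: phase_diff Linv_def\<close>)
  have LD: "Linv (D n)" for n
  proof -
    have "Linv (twisted (phase f v n) 1 (h n))" by (rule LT[OF Lh])
    with Lh[of n] show ?thesis unfolding Linv_def D_def by simp
  qed
  have D0: "(\<lambda>n. D n x) \<longlonglongrightarrow> 0" if "x \<in> carrier G" for x
    unfolding D_def a_def l_def h_def
    using tendsto_norm[OF twisted_one_step[OF f that r(1) r(2)[OF that]]] by simp
  \<comment> \<open>\<open>D n\<close> is invariant, so a sum over the finitely many representatives
    bounds it on the whole group, and pointwise limits are uniform.\<close>
  define e where "e n = (\<Sum>x\<in>\<Delta>. D n x)" for n
  have "(\<lambda>n. \<Sum>x\<in>\<Delta>. D n x) \<longlonglongrightarrow> (\<Sum>x\<in>\<Delta>. 0)" by (intro tendsto_sum D0) auto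
  then have e0: "e \<longlonglongrightarrow> 0" by (simp add: e_def[abs_def])
  have De: "D n x \<le> e n" if "x \<in> carrier G" for n x
  proof -
    have "D n (rep x) \<le> e n" unfolding e_def
      by (rule member_le_sum) (use rep_D[OF that] finite_D in \<open>auto simp: D_def\<close>)
    then show ?thesis using Linv_rep[OF LD that] by simp
  qed
  have hb: "norm (h n x) \<le> 1 + K" if "x \<in> carrier G" for n x
  proof -
    have "norm (h n x) \<le> 1 + norm (r x / (2 * real n))"
      unfolding h_def norm_of_real using abs_triangle_ineq[of 1 "r x / (2 * real n)"] by simp
    also have "norm (r x / (2 * real n)) \<le> norm (r x)" by (cases n) (auto simp: field_simps)
    finally show ?thesis using bspec[OF K(2) that] by linarith
  qed
  have h1: "norm (h n x - 1) \<le> K / (2 * real n)" if "x \<in> carrier G" for n x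
    unfolding h_def using K that by (auto simp: norm_divide intro!: divide_right_mono)
  have main: "norm (a n ^ n * twisted (phase f v n) n (\<lambda>_. 1) \<gamma> - l n ^ n) \<le> e n + K / (2 * real n) + K / (2 * real n)"
    if n: "n \<ge> 1" "n \<ge> c" for n :: nat
  proof -
    \<comment> \<open>Since \<open>c\<close> is nonnegative and \<open>n \<ge> c\<close>, the number
      \<open>1 - c / (2 * n)\<close> lies between 1/2 and 1.\<close>
    have l1: "norm (l n) \<le> 1" unfolding l_def norm_of_real using n c0 by (auto simp: abs_le_iff field_simps)
    \<comment> \<open>Dividing by the unimodular \<open>a n\<close> turns the centred estimate into
      one for the uncentred operator, with approximate eigenvalue \<open>l n / a n\<close>.\<close>
    have one: "norm (twisted (phase f v n) 1 (h n) x - l n / a n * h n x) \<le> e n / n" if "x \<in> carrier G" for x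
    proof -
      have "a n * twisted (phase f v n) 1 (h n) x - l n * h n x = a n * (twisted (phase f v n) 1 (h n) x - l n / a n * h n x)"
        using an0[of n] by (simp add: right_diff_distrib)
      then have "D n x = n * norm (twisted (phase f v n) 1 (h n) x - l n / a n * h n x)"
        by (simp only: D_def norm_mult a1) simp
      then have "n * norm (twisted (phase f v n) 1 (h n) x - l n / a n * h n x) \<le> e n" using De[OF that, of n] by simp
      then show ?thesis using n by (simp add: pos_le_divide_eq mult.commute)
    qed
    have "norm (twisted (phase f v n) n (h n) \<gamma> - (l n / a n) ^ n * h n \<gamma>) \<le> n * (e n / n)"
      by (rule twisted_power_approx[OF hb one _ \<gamma>]) (use l1 a1 in \<open>auto simp: norm_divide\<close>)
    then have "norm (a n ^ n * (twisted (phase f v n) n (h n) \<gamma> - (l n / a n) ^ n * h n \<gamma>)) \<le> e n"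
      using n by (simp only: norm_mult norm_power a1) simp
    moreover have "a n ^ n * (twisted (phase f v n) n (h n) \<gamma> - (l n / a n) ^ n * h n \<gamma>) = a n ^ n * twisted (phase f v n) n (h n) \<gamma> - l n ^ n * h n \<gamma>"
      using an0[of n] by (simp add: right_diff_distrib power_divide)
    ultimately have 1: "norm (a n ^ n * twisted (phase f v n) n (h n) \<gamma> - l n ^ n * h n \<gamma>) \<le> e n" by simp
    have "twisted (phase f v n) n (\<lambda>x. h n x - 1 * 1) \<gamma> = twisted (phase f v n) n (h n) \<gamma> - 1 * twisted (phase f v n) n (\<lambda>_. 1) \<gamma>"
      by (rule twisted_diff[OF hb _ \<gamma>, where K'=1]) auto
    moreover have "norm (twisted (phase f v n) n (\<lambda>x. h n x - 1) \<gamma>) \<le> K / (2 * real n)"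
      by (rule twisted_norm_le[OF h1 \<gamma>])
    ultimately have "norm (twisted (phase f v n) n (h n) \<gamma> - twisted (phase f v n) n (\<lambda>_. 1) \<gamma>) \<le> K / (2 * real n)"
      by simp
    then have "norm (a n ^ n * (twisted (phase f v n) n (h n) \<gamma> - twisted (phase f v n) n (\<lambda>_. 1) \<gamma>)) \<le> K / (2 * real n)"
      by (simp only: norm_mult norm_power a1) simp
    then have 2: "norm (a n ^ n * twisted (phase f v n) n (h n) \<gamma> - a n ^ n * twisted (phase f v n) n (\<lambda>_. 1) \<gamma>) \<le> K / (2 * real n)"
      by (simp add: right_diff_distrib)
    have "norm (l n ^ n * (h n \<gamma> - 1)) \<le> 1 * (K / (2 * real n))"
      unfolding norm_mult norm_power using h1[OF \<gamma>, of n] l1 by (intro mult_mono power_le_one) auto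
    then have 3: "norm (l n ^ n * h n \<gamma> - l n ^ n) \<le> K / (2 * real n)" by (simp add: right_diff_distrib)
    let ?p = "a n ^ n * twisted (phase f v n) n (\<lambda>_. 1) \<gamma>" and ?q = "a n ^ n * twisted (phase f v n) n (h n) \<gamma>" and ?r = "l n ^ n * h n \<gamma>"
    have "norm (?p - l n ^ n) \<le> norm (?p - ?q) + norm (?q - ?r) + norm (?r - l n ^ n)"
      using norm_triangle_ineq[of "?p - ?q" "?q - l n ^ n"] norm_triangle_ineq[of "?q - ?r" "?r - l n ^ n"] by simp
    then show ?thesis using 1 2 3 by (simp add: norm_minus_commute)
  qed
  have l_lim: "(\<lambda>n. l n ^ n) \<longlonglongrightarrow> of_real (exp (- c / 2))"
  proof -
    have "(\<lambda>n. (1 + (- c / 2) / real n) ^ n) \<longlonglongrightarrow> exp (- c / 2)"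
      by (rule tendsto_exp_limit_sequentially)
    then have "(\<lambda>n. complex_of_real ((1 + (- c / 2) / real n) ^ n)) \<longlonglongrightarrow> of_real (exp (- c / 2))"
      by (rule tendsto_of_real)
    then show ?thesis by (simp add: l_def)
  qed
  have "(\<lambda>n. a n ^ n * twisted (phase f v n) n (\<lambda>_. 1) \<gamma> - l n ^ n) \<longlonglongrightarrow> 0"
  proof (rule Lim_null_comparison)
    show "eventually (\<lambda>n. norm (a n ^ n * twisted (phase f v n) n (\<lambda>_. 1) \<gamma> - l n ^ n) \<le> e n + K / (2 * real n) + K / (2 * real n)) sequentially"
      using main by (intro eventually_sequentiallyI[of "max 1 (nat \<lceil>c\<rceil>)"]) (auto simp: ceiling_le_iff nat_le_iff)
    have "(\<lambda>n. K / (2 * real n)) \<longlonglongrightarrow> 0" by real_asymp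
    from tendsto_add[OF tendsto_add[OF e0 this] this]
    show "(\<lambda>n. e n + K / (2 * real n) + K / (2 * real n)) \<longlonglongrightarrow> 0" by simp
  qed
  from tendsto_add[OF this l_lim]
  have "(\<lambda>n. a n ^ n * twisted (phase f v n) n (\<lambda>_. 1) \<gamma>) \<longlonglongrightarrow> of_real (exp (- c / 2))" by simp
  moreover have "a n ^ n = iexp (- (sqrt n * (v \<bullet> zeta)))" for n
  proof -
    have "a n ^ n = exp (of_nat n * (\<i> * complex_of_real (- (v \<bullet> zeta) / sqrt n)))"
      unfolding a_def by (rule exp_of_nat_mult[symmetric])
    also have "of_nat n * (\<i> * complex_of_real (- (v \<bullet> zeta) / sqrt n)) = \<i> * complex_of_real (real n * (- (v \<bullet> zeta) / sqrt n))"
      by simp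
    also have "real n * (- (v \<bullet> zeta) / sqrt n) = - (sqrt n * (v \<bullet> zeta))"
    proof (cases "n = 0")
      case False
      then have "real n / sqrt n = sqrt n" by (simp add: real_div_sqrt)
      then have "real n / sqrt n * (- (v \<bullet> zeta)) = sqrt n * (- (v \<bullet> zeta))" by (simp only:)
      then show ?thesis by simp
    qed simp
    finally show ?thesis .
  qed
  ultimately show ?thesis unfolding c_def by simp
qed

end

section \<open>Asymptotic independence of displacement and coset\<close>

context lattice_walk
begin

text \<open>For a fixed number \<open>k\<close> of steps the twist disappears as \<open>n\<close>
  grows, so \<open>k\<close> twisted steps bring \<open>g - mean g\<close> close to zero by mixing;
  the other \<open>n - k\<close> steps are a contraction and cannot undo this. Only the constant
  \<open>mean g\<close> survives, to which \<open>twisted_limit\<close> applies.\<close>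

lemma clt_Linv:
  assumes f: "corrector f" and g: "Linv g" and \<gamma>: "\<gamma> \<in> carrier G"
  shows "(\<lambda>n. iexp (- (sqrt n * (v \<bullet> zeta))) * twisted (phase f v n) n g \<gamma>) \<longlonglongrightarrow> mean g * of_real (exp (- cov f v v / 2))"
proof -
  have Lf: "Linv f" using f by (simp add: corrector_def)
  define g0 where "g0 \<gamma> = g \<gamma> - mean g * 1" for \<gamma>
  have Lg0: "Linv g0" using g by (auto simp: Linv_def g0_def)
  obtain K where K: "K > 0" "\<forall>\<gamma>\<in>carrier G. norm (g \<gamma>) \<le> K" using Linv_bounded[OF g] by blast
  obtain K0 where K0: "K0 > 0" "\<forall>\<gamma>\<in>carrier G. norm (g0 \<gamma>) \<le> K0" using Linv_bounded[OF Lg0] by blast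
  have LT: "Linv (twisted (phase f v n) k g0)" for n k
    by (rule twisted_Linv[OF Lg0]) (use Linv_cincr[OF Lf] in \<open>simp add: phase_diff Linv_def\<close>)
  have lim: "(\<lambda>n. twisted (phase f v n) k g0 x) \<longlonglongrightarrow> transition k g x - mean g" if x: "x \<in> carrier G" for k x
  proof -
    have "(\<lambda>n. twisted (phase f v n) k g0 x) \<longlonglongrightarrow> measure_pmf.expectation (conv k) (\<lambda>s. g0 (x \<otimes> s))"
      unfolding twisted_def
    proof (rule integral_dominated_convergence[where w="\<lambda>_. K0"])
      show "AE s in conv k. (\<lambda>n. iexp (phase f v n (x \<otimes> s) - phase f v n x) * g0 (x \<otimes> s)) \<longlonglongrightarrow> g0 (x \<otimes> s)"
      proof (rule AE_I2)
        fix s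
        have "(\<lambda>n. iexp ((v \<bullet> cincr f x s) / sqrt (real n)) * g0 (x \<otimes> s)) \<longlonglongrightarrow> 1 * g0 (x \<otimes> s)"
          by (intro tendsto_intros iexp_sqrt_lim)
        then show "(\<lambda>n. iexp (phase f v n (x \<otimes> s) - phase f v n x) * g0 (x \<otimes> s)) \<longlonglongrightarrow> g0 (x \<otimes> s)"
          unfolding phase_diff by simp
      qed
      show "AE s in conv k. norm (iexp (phase f v n (x \<otimes> s) - phase f v n x) * g0 (x \<otimes> s)) \<le> K0" for n
        using K0 x by (auto simp: AE_measure_pmf_iff norm_mult set_conv_carrier simp del: of_real_diff)
    qed auto
    also have "measure_pmf.expectation (conv k) (\<lambda>s. g0 (x \<otimes> s)) = transition k g x - mean g"
      unfolding transition_def g0_def using transition_integrable[OF g x] by simp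
    finally show ?thesis .
  qed
  have T0: "(\<lambda>n. twisted (phase f v n) n g0 \<gamma>) \<longlonglongrightarrow> 0"
    unfolding LIMSEQ_iff
  proof (intro allI impI)
    fix e :: real assume e: "e > 0"
    obtain k where k: "\<And>\<gamma>. \<gamma> \<in> carrier G \<Longrightarrow> norm (transition k g \<gamma> - mean g) \<le> e / 2"
      using transition_tendsto_mean[OF g, of "e/2"] e by auto
    have "eventually (\<lambda>n. \<forall>x\<in>\<Delta>. norm (twisted (phase f v n) k g0 x) < e) sequentially"
    proof (rule eventually_ball_finite[OF finite_D], rule ballI)
      fix x assume x: "x \<in> \<Delta>"
      have "norm (transition k g x - mean g) < e" using k[of x] x e by fastforce
      then show "eventually (\<lambda>n. norm (twisted (phase f v n) k g0 x) < e) sequentially"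
        using tendsto_norm[OF lim[of x k]] x by (intro order_tendstoD(2)) auto
    qed
    then obtain n0 where n0: "\<And>n x. n \<ge> n0 \<Longrightarrow> x \<in> \<Delta> \<Longrightarrow> norm (twisted (phase f v n) k g0 x) < e"
      by (auto simp: eventually_sequentially)
    have "norm (twisted (phase f v n) n g0 \<gamma>) < e" if n: "n \<ge> max n0 k" for n
    proof -
      define M where "M = Max ((\<lambda>x. norm (twisted (phase f v n) k g0 x)) ` \<Delta>)"
      have ne: "\<Delta> \<noteq> {}" using one_D by blast
      have M: "M < e" unfolding M_def using n0 n ne finite_D by (subst Max_less_iff) auto
      have b: "norm (twisted (phase f v n) k g0 x) \<le> M" if "x \<in> carrier G" for x
      proof -
        have "norm (twisted (phase f v n) k g0 (rep x)) \<le> M" unfolding M_def using rep_D[OF that] finite_D by (intro Max_ge) auto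
        then show ?thesis using Linv_rep[OF LT that] by simp
      qed
      have "twisted (phase f v n) n g0 \<gamma> = twisted (phase f v n) (n - k) (twisted (phase f v n) k g0) \<gamma>"
        using twisted_add[where n="n - k" and m=k and K=K0 and g=g0 and \<phi>="phase f v n", OF _ \<gamma>] K0 n by simp
      also have "norm \<dots> \<le> M" by (rule twisted_norm_le[OF b \<gamma>])
      finally show ?thesis using M by simp
    qed
    then show "\<exists>no. \<forall>n\<ge>no. norm (twisted (phase f v n) n g0 \<gamma> - 0) < e" by (intro exI[of _ "max n0 k"]) auto
  qed
  have eq: "twisted (phase f v n) n g \<gamma> = twisted (phase f v n) n g0 \<gamma> + mean g * twisted (phase f v n) n (\<lambda>_. 1) \<gamma>" for n
  proof -
    have "twisted (phase f v n) n (\<lambda>\<gamma>. g \<gamma> - mean g * 1) \<gamma> = twisted (phase f v n) n g \<gamma> - mean g * twisted (phase f v n) n (\<lambda>_. 1) \<gamma>"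
      by (rule twisted_diff[where K=K and K'=1, OF _ _ \<gamma>]) (use K in auto)
    then show ?thesis by (simp add: g0_def[abs_def])
  qed
  have "(\<lambda>n. iexp (- (sqrt n * (v \<bullet> zeta))) * twisted (phase f v n) n g0 \<gamma>) \<longlonglongrightarrow> 0"
    by (rule tendsto_norm_zero_cancel) (use tendsto_norm_zero[OF T0] in \<open>simp add: norm_mult\<close>)
  from tendsto_add[OF this tendsto_mult[OF tendsto_const[of "mean g"] twisted_limit[OF f \<gamma>, of v]]]
  show ?thesis unfolding eq by (simp add: algebra_simps)
qed

lemma norm_iexp_diff_le: "cmod (iexp x - iexp y) \<le> \<bar>x - y\<bar>"
proof -
  have "iexp x - iexp y = iexp y * (iexp (x - y) - 1)"
    by (simp add: right_diff_distrib flip: exp_add)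
  then have "cmod (iexp x - iexp y) = cmod (iexp (x - y) - 1)" by (simp add: norm_mult del: of_real_diff)
  then show ?thesis using iexp_approx1[of "x - y" 0] by simp
qed

text \<open>The walk starts at the identity, where \<open>\<Phi>\<close> vanishes, and dropping the
  bounded function \<open>f\<close> from the phase changes it by at most a multiple of
  \<open>1 / sqrt n\<close>.\<close>

lemma clt_char:
  assumes f: "corrector f" and g: "Linv g"
  shows "(\<lambda>n. measure_pmf.expectation (conv n) (\<lambda>s. iexp ((v \<bullet> (\<Phi> s - n *\<^sub>R zeta)) / sqrt n) * g s))
    \<longlonglongrightarrow> mean g * of_real (exp (- cov f v v / 2))"
proof -
  have Lf: "Linv f" using f by (simp add: corrector_def)
  obtain K where K: "K > 0" "\<forall>\<gamma>\<in>carrier G. norm (g \<gamma>) \<le> K" using Linv_bounded[OF g] by blast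
  obtain M where M: "M > 0" "\<forall>\<gamma>\<in>carrier G. norm (f \<gamma>) \<le> M" using Linv_bounded[OF Lf] by blast
  let ?E = "\<lambda>n. measure_pmf.expectation (conv n) (\<lambda>s. iexp ((v \<bullet> (\<Phi> s - n *\<^sub>R zeta)) / sqrt n) * g s)"
  let ?T = "\<lambda>n. iexp (- (sqrt n * (v \<bullet> zeta))) * twisted (phase f v n) n g \<one>"
  have T: "?T n = measure_pmf.expectation (conv n) (\<lambda>s. iexp ((v \<bullet> (\<Phi> s - n *\<^sub>R zeta - (f s - f \<one>))) / sqrt n) * g s)" for n
  proof -
    have e: "iexp (- (sqrt n * (v \<bullet> zeta))) * (iexp (phase f v n (\<one> \<otimes> s) - phase f v n \<one>) * g (\<one> \<otimes> s))
       = iexp ((v \<bullet> (\<Phi> s - n *\<^sub>R zeta - (f s - f \<one>))) / sqrt n) * g s" if "s \<in> set_pmf (conv n)" for s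
    proof -
      have s: "s \<in> carrier G" using that by (rule set_conv_carrier)
      have "real n / sqrt n = sqrt n" by (simp add: real_div_sqrt)
      then have r: "- (sqrt n * (v \<bullet> zeta)) + (phase f v n s - phase f v n \<one>) = (v \<bullet> (\<Phi> s - n *\<^sub>R zeta - (f s - f \<one>))) / sqrt n"
      proof -
        have "real n / sqrt n * (v \<bullet> zeta) = sqrt n * (v \<bullet> zeta)" by (simp only: \<open>real n / sqrt n = sqrt n\<close>)
        then have nz: "real n * (v \<bullet> zeta) / sqrt n = sqrt n * (v \<bullet> zeta)" by (simp only: times_divide_eq_left)
        show ?thesis unfolding inner_diff_right inner_scaleR_right diff_divide_distrib nz coord_one inner_zero_right by simp
      qed
      have "iexp (- (sqrt n * (v \<bullet> zeta))) * iexp (phase f v n s - phase f v n \<one>) = iexp (- (sqrt n * (v \<bullet> zeta)) + (phase f v n s - phase f v n \<one>))"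
        unfolding exp_add[symmetric] by (simp add: algebra_simps)
      then show ?thesis using s unfolding r mult.assoc[symmetric] by simp
    qed
    show ?thesis unfolding twisted_def integral_mult_right_zero[symmetric]
    proof (rule integral_cong_AE)
      show "AE s in conv n. iexp (- (sqrt n * (v \<bullet> zeta))) * (iexp (phase f v n (\<one> \<otimes> s) - phase f v n \<one>) * g (\<one> \<otimes> s))
         = iexp ((v \<bullet> (\<Phi> s - n *\<^sub>R zeta - (f s - f \<one>))) / sqrt n) * g s"
        unfolding AE_measure_pmf_iff using e by (rule ballI)
    qed simp_all
  qed
  have "norm (?E n - ?T n) \<le> (norm v * (2 * M)) / sqrt n * K" for n
  proof -
    have i: "integrable (conv n) (\<lambda>s. iexp (h s) * g s)" for h
      by (rule integrable_pmf_bounded[where K=K]) (use K in \<open>auto simp: norm_mult set_conv_carrier\<close>)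
    have "?E n - ?T n = measure_pmf.expectation (conv n) (\<lambda>s. iexp ((v \<bullet> (\<Phi> s - n *\<^sub>R zeta)) / sqrt n) * g s
       - iexp ((v \<bullet> (\<Phi> s - n *\<^sub>R zeta - (f s - f \<one>))) / sqrt n) * g s)"
      unfolding T by (rule Bochner_Integration.integral_diff[symmetric]) (rule i)+
    also have "norm \<dots> \<le> (norm v * (2 * M)) / sqrt n * K"
    proof (rule norm_expectation_le)
      fix s assume "s \<in> set_pmf (conv n)"
      then have s: "s \<in> carrier G" by (rule set_conv_carrier)
      have "norm (f s - f \<one>) \<le> 2 * M" using bspec[OF M(2) s] bspec[OF M(2) one_closed] norm_triangle_ineq4[of "f s" "f \<one>"] by linarith
      then have b: "\<bar>v \<bullet> (f s - f \<one>)\<bar> \<le> norm v * (2 * M)"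
        by (intro order.trans[OF Cauchy_Schwarz_ineq2] mult_left_mono) auto
      have "norm (iexp ((v \<bullet> (\<Phi> s - n *\<^sub>R zeta)) / sqrt n) - iexp ((v \<bullet> (\<Phi> s - n *\<^sub>R zeta - (f s - f \<one>))) / sqrt n))
         \<le> \<bar>(v \<bullet> (\<Phi> s - n *\<^sub>R zeta)) / sqrt n - (v \<bullet> (\<Phi> s - n *\<^sub>R zeta - (f s - f \<one>))) / sqrt n\<bar>"
        by (rule norm_iexp_diff_le)
      also have "\<dots> = \<bar>v \<bullet> (f s - f \<one>)\<bar> / sqrt n"
        unfolding diff_divide_distrib[symmetric] inner_diff_right[symmetric] by simp
      also have "\<dots> \<le> norm v * (2 * M) / sqrt n" using b by (simp add: divide_right_mono)
      finally have c: "norm (iexp ((v \<bullet> (\<Phi> s - n *\<^sub>R zeta)) / sqrt n) - iexp ((v \<bullet> (\<Phi> s - n *\<^sub>R zeta - (f s - f \<one>))) / sqrt n))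
         \<le> norm v * (2 * M) / sqrt n" .
      show "norm (iexp ((v \<bullet> (\<Phi> s - n *\<^sub>R zeta)) / sqrt n) * g s
       - iexp ((v \<bullet> (\<Phi> s - n *\<^sub>R zeta - (f s - f \<one>))) / sqrt n) * g s) \<le> (norm v * (2 * M)) / sqrt n * K"
        unfolding left_diff_distrib[symmetric] norm_mult
        using K s M by (intro mult_mono c) auto
    qed
    finally show ?thesis .
  qed
  then have "eventually (\<lambda>n. norm (?E n - ?T n) \<le> (norm v * (2 * M)) / sqrt n * K) sequentially" by (rule always_eventually[rule_format])
  moreover have "(\<lambda>n. (norm v * (2 * M)) / sqrt (real n) * K) \<longlonglongrightarrow> 0"
  proof -
    have "(\<lambda>n. 1 / sqrt (real n)) \<longlonglongrightarrow> 0" by real_asymp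
    from tendsto_mult_right[OF this, of "norm v * (2 * M) * K"] show ?thesis by (simp add: mult_ac)
  qed
  ultimately have "(\<lambda>n. ?E n - ?T n) \<longlonglongrightarrow> 0"
    by (rule Lim_null_comparison)
  from tendsto_add[OF this clt_Linv[OF f g one_closed, of v]]
  show ?thesis by (simp only: diff_add_cancel add_0)
qed

end

section \<open>Bounds for the characteristic function\<close>

text \<open>The Taylor bound \<open>1 - u^2 / 2 + u^4 / 24\<close> is combined with
  \<open>u^2 \<le> pi^2 \<le> 10\<close>; then \<open>1/2 - 10/24 = 1/12\<close>.\<close>

lemma cos_upper_bound: "\<bar>u\<bar> \<le> pi \<Longrightarrow> cos u \<le> 1 - u\<^sup>2 / 12"
proof -
  assume u: "\<bar>u\<bar> \<le> pi"
  obtain t where t: "cos u = (\<Sum>m<4. cos_coeff m * u ^ m) + (cos (t + 1/2 * real 4 * pi) / fact 4) * u ^ 4"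
    using Maclaurin_cos_expansion[of u 4] by blast
  have "(\<Sum>m<4. cos_coeff m * u ^ m) = 1 - u\<^sup>2 / 2"
    by (simp add: numeral_eq_Suc cos_coeff_def) presburger
  moreover have "(cos (t + 1/2 * real 4 * pi) / fact 4) * u ^ 4 \<le> (1 / 24) * u ^ 4"
    by (intro mult_right_mono) (auto simp: fact_numeral)
  moreover have "u ^ 4 \<le> 10 * u\<^sup>2"
  proof -
    have "pi\<^sup>2 < 3.15\<^sup>2" using pi_less_4 pi_gt_zero pi_approx by (intro power_strict_mono) auto
    have "u\<^sup>2 \<le> pi\<^sup>2" using power_mono[OF u, of 2] by simp
    also have "\<dots> \<le> 10" using \<open>pi\<^sup>2 < 3.15\<^sup>2\<close> by (simp add: power2_eq_square)
    finally have "u\<^sup>2 * u\<^sup>2 \<le> 10 * u\<^sup>2" by (intro mult_right_mono) auto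
    then show ?thesis by (simp add: power2_eq_square power4_eq_xxxx)
  qed
  ultimately show ?thesis using t by linarith
qed

text \<open>With \<open>y\<close> for the left side, \<open>4 * (2 - y) \<ge> (2 + y) * (2 - y) = 4
  - y^2 = 2 - 2 * cos u \<ge> u^2 / 6\<close>, which explains the 24.\<close>

lemma norm_one_plus_iexp:
  assumes "\<bar>u\<bar> \<le> pi" shows "cmod (1 + iexp u) \<le> 2 - u\<^sup>2 / 24"
proof -
  have sq: "(cmod (1 + iexp u))\<^sup>2 = 2 + 2 * cos u"
    by (simp add: cmod_power2 Re_exp Im_exp power2_sum algebra_simps)
  define y where "y = cmod (1 + iexp u)"
  have y: "0 \<le> y" "y \<le> 2" unfolding y_def using norm_triangle_ineq[of 1 "iexp u"] by auto
  have "4 * (2 - y) \<ge> (2 + y) * (2 - y)" using y by (intro mult_right_mono) auto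
  also have "(2 + y) * (2 - y) = 4 - y\<^sup>2" by (simp add: power2_eq_square algebra_simps)
  also have "\<dots> = 2 - 2 * cos u" using sq by (simp add: y_def)
  also have "\<dots> \<ge> u\<^sup>2 / 6" using cos_upper_bound[OF assms] by simp
  finally show ?thesis unfolding y_def[symmetric] by simp
qed

lemma exists_large_component:
  fixes t :: "real ^ 'n"
  shows "\<exists>i. (t $ i)\<^sup>2 \<ge> (norm t)\<^sup>2 / CARD('n)"
proof (rule ccontr)
  assume "\<not> ?thesis"
  then have "(\<Sum>i\<in>UNIV. (t $ i)\<^sup>2) < (\<Sum>i\<in>(UNIV::'n set). (norm t)\<^sup>2 / CARD('n))"
    by (intro sum_strict_mono) (auto simp: not_le)
  also have "\<dots> = (norm t)\<^sup>2" by simp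
  also have "\<dots> = (\<Sum>i\<in>UNIV. (t $ i)\<^sup>2)"
    by (simp add: norm_vec_def L2_set_def sum_nonneg)
  finally show False by simp
qed

context lattice_walk
begin

lemma iota_surj: "w \<in> int_lattice \<Longrightarrow> \<exists>v\<in>\<Lambda>. \<iota> v = w"
  using bij_iota by (force simp: bij_betw_def)

lemma Linv_inner_coord: "s \<in> carrier G \<Longrightarrow> Linv (\<lambda>\<gamma>. t \<bullet> \<Phi> (\<gamma> \<otimes> s) - t \<bullet> \<Phi> \<gamma>)"
  using Linv_coord_diff[of s] by (auto simp: Linv_def inner_diff_right[symmetric])

text \<open>Right multiplication by a conjugate of \<open>a\<close> that depends on the vertex only translates the coordinate
  by \<open>\<iota> a\<close>, and there are only finitely many such conjugates.\<close>

lemma lattice_translate: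
  assumes \<gamma>: "\<gamma> \<in> carrier G" and a: "a \<in> \<Lambda>"
  shows "\<Phi> (\<gamma> \<otimes> (inv (rep \<gamma>) \<otimes> a \<otimes> rep \<gamma>)) = \<Phi> \<gamma> + \<iota> a"
    "Linv g \<Longrightarrow> g (\<gamma> \<otimes> (inv (rep \<gamma>) \<otimes> a \<otimes> rep \<gamma>)) = g \<gamma>"
proof -
  define x v where "x = rep \<gamma>" and "v = lattice_part G \<Lambda> \<Delta> \<gamma>"
  have vx: "\<gamma> = v \<otimes> x" "v \<in> \<Lambda>" "x \<in> \<Delta>"
    unfolding x_def v_def using \<gamma> by (auto simp: decomp_rep[symmetric] lattice_part_L rep_D)
  have "x \<otimes> (inv x \<otimes> (a \<otimes> x)) = (x \<otimes> inv x) \<otimes> (a \<otimes> x)"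
    by (rule m_assoc[symmetric]) (use vx a in auto)
  also have "\<dots> = a \<otimes> x" using vx a by simp
  finally have "x \<otimes> (inv x \<otimes> (a \<otimes> x)) = a \<otimes> x" .
  then have e: "\<gamma> \<otimes> (inv x \<otimes> a \<otimes> x) = v \<otimes> (a \<otimes> x)"
    unfolding vx(1) using vx a by (simp add: m_assoc)
  have "\<Phi> (v \<otimes> (a \<otimes> x)) = \<Phi> \<gamma> + \<iota> a"
    unfolding vx(1) using vx a by (simp add: coord_L_mult coord_D)
  then show "\<Phi> (\<gamma> \<otimes> (inv (rep \<gamma>) \<otimes> a \<otimes> rep \<gamma>)) = \<Phi> \<gamma> + \<iota> a"
    using e unfolding x_def by simp
  assume g: "Linv g"
  have "g (v \<otimes> (a \<otimes> x)) = g x" "g \<gamma> = g x"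
    unfolding vx(1) using g vx a by (auto simp: Linv_def)
  then show "g (\<gamma> \<otimes> (inv (rep \<gamma>) \<otimes> a \<otimes> rep \<gamma>)) = g \<gamma>"
    using e unfolding x_def by simp
qed

text \<open>For large \<open>N\<close> the law of the \<open>N\<close>-th step charges both \<open>\<one>\<close> and the conjugates of the standard basis of the lattice;
  the corresponding terms \<open>1 + e\<^sup>i\<^sup>t\<close> interfere, and a coordinate of \<open>t\<close> of size at least a multiple of \<open>norm t\<close> gives
  the quadratic gain.\<close>

lemma twisted_dominated:
  "\<exists>c>0::real. \<exists>N\<ge>1::nat. \<forall>t\<in>torus_box. \<forall>n g K. Linv g \<longrightarrow> (\<forall>\<gamma>\<in>carrier G. norm (g \<gamma>) \<le> K) \<longrightarrow>
     (\<forall>\<gamma>\<in>carrier G. norm (twisted (\<lambda>\<gamma>. t \<bullet> \<Phi> \<gamma>) n g \<gamma>) \<le> exp (- (c * real (n div N) * (norm t)\<^sup>2)) * K)"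
proof -
  have "\<exists>a\<in>\<Lambda>. \<iota> a = axis i 1" for i
    by (rule iota_surj) (auto simp: int_lattice_def axis_def)
  then obtain a where a: "\<And>i. a i \<in> \<Lambda>" "\<And>i. \<iota> (a i) = axis i 1" by metis
  \<comment> \<open>One finite set for all vertices, so that \<open>N\<close> and \<open>d\<close>
    depend neither on the vertex nor on \<open>t\<close>.\<close>
  define W where "W = insert \<one> ((\<lambda>(x, i). inv x \<otimes> a i \<otimes> x) ` (\<Delta> \<times> UNIV))"
  have "finite W" "W \<subseteq> carrier G" unfolding W_def using finite_D a by auto
  then obtain N d where N: "N \<ge> 1" "d > 0" "\<And>w. w \<in> W \<Longrightarrow> d \<le> pmf (conv N) w"
    using conv_minorized[of W] by auto
  \<comment> \<open>The 24 comes from \<open>norm_one_plus_iexp\<close> and \<open>CARD('n)\<close>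
    from \<open>exists_large_component\<close>.\<close>
  define c where "c = d / (24 * CARD('n))"
  have c: "c > 0" using N by (simp add: c_def)
  have LT: "Linv (twisted (\<lambda>\<gamma>. t \<bullet> \<Phi> \<gamma>) n g)" if "Linv g" for t n g
    by (rule twisted_Linv[OF that]) (rule Linv_inner_coord)
  have one: "norm (twisted (\<lambda>\<gamma>. t \<bullet> \<Phi> \<gamma>) N g \<gamma>) \<le> exp (- (c * (norm t)\<^sup>2)) * K"
    if t: "t \<in> torus_box" and g: "Linv g" "\<And>\<gamma>. \<gamma> \<in> carrier G \<Longrightarrow> norm (g \<gamma>) \<le> K" and \<gamma>: "\<gamma> \<in> carrier G" for t g K \<gamma>
  proof -
    have K: "K \<ge> 0" using g(2)[OF \<gamma>] norm_ge_zero order.trans by blast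
    obtain i where i: "(t $ i)\<^sup>2 \<ge> (norm t)\<^sup>2 / CARD('n)" using exists_large_component[of t] by blast
    have "\<bar>t \<bullet> axis i 1\<bar> \<le> pi" using t unfolding mem_torus_box by (auto simp: Basis_vec_def)
    then have ti: "\<bar>t $ i\<bar> \<le> pi" by (simp add: inner_axis)
    define w where "w = inv (rep \<gamma>) \<otimes> a i \<otimes> rep \<gamma>"
    have wW: "w \<in> W" "\<one> \<in> W" unfolding W_def w_def using rep_D[OF \<gamma>] by force+
    have pw: "\<Phi> (\<gamma> \<otimes> w) = \<Phi> \<gamma> + axis i 1" "g (\<gamma> \<otimes> w) = g \<gamma>"
      unfolding w_def using lattice_translate[OF \<gamma> a(1)] g(1) by (auto simp: a)
    \<comment> \<open>The two interfering points have to be distinct for the minorized part to have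
      mass \<open>2 * d\<close>.\<close>
    have w1: "w \<noteq> \<one>"
    proof
      assume "w = \<one>" then have "(axis i 1 :: real ^ 'n) = 0" using pw(1) \<gamma> by simp
      then show False by (simp add: axis_eq_0_iff)
    qed
    define h where "h s = iexp (t \<bullet> \<Phi> (\<gamma> \<otimes> s) - t \<bullet> \<Phi> \<gamma>) * g (\<gamma> \<otimes> s)" for s
    have hb: "norm (h s) \<le> K" if "s \<in> set_pmf (conv N)" for s
      unfolding h_def using g \<gamma> set_conv_carrier[OF that] by (simp add: norm_mult del: of_real_diff)
    have "norm (measure_pmf.expectation (conv N) h - d *\<^sub>R (\<Sum>s\<in>{\<one>, w}. h s)) \<le> (1 - d * card {\<one>, w}) * K"
      by (rule expectation_minorized) (use N wW hb in auto)
    moreover have "(\<Sum>s\<in>{\<one>, w}. h s) = (1 + iexp (t $ i)) * g \<gamma>"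
      using w1 \<gamma> pw by (simp add: h_def inner_add_right inner_axis distrib_right)
    moreover have "card {\<one>, w} = 2" using w1 by simp
    ultimately have 1: "norm (measure_pmf.expectation (conv N) h - d *\<^sub>R ((1 + iexp (t $ i)) * g \<gamma>)) \<le> (1 - d * 2) * K"
      by simp
    have 2: "norm (d *\<^sub>R ((1 + iexp (t $ i)) * g \<gamma>)) \<le> d * ((2 - (t $ i)\<^sup>2 / 24) * K)"
      unfolding norm_scaleR norm_mult using N(2) g(2)[OF \<gamma>] norm_one_plus_iexp[OF ti] order.trans[OF norm_ge_zero norm_one_plus_iexp[OF ti]]
      by (intro mult_mono) (auto intro: order.trans)
    have "norm (measure_pmf.expectation (conv N) h) \<le> (1 - d * 2) * K + d * ((2 - (t $ i)\<^sup>2 / 24) * K)"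
      using norm_triangle_ineq[of "measure_pmf.expectation (conv N) h - d *\<^sub>R ((1 + iexp (t $ i)) * g \<gamma>)" "d *\<^sub>R ((1 + iexp (t $ i)) * g \<gamma>)"] 1 2
      by simp
    also have "\<dots> = (1 - d / 24 * (t $ i)\<^sup>2) * K" by (simp add: algebra_simps)
    also have "\<dots> \<le> exp (- (c * (norm t)\<^sup>2)) * K"
    proof (rule mult_right_mono[OF _ K])
      have "c * (norm t)\<^sup>2 = d / 24 * ((norm t)\<^sup>2 / CARD('n))" by (simp add: c_def)
      also have "\<dots> \<le> d / 24 * (t $ i)\<^sup>2" using i N(2) by (intro mult_left_mono) auto
      finally have "1 - d / 24 * (t $ i)\<^sup>2 \<le> 1 + - (c * (norm t)\<^sup>2)" by simp
      also have "\<dots> \<le> exp (- (c * (norm t)\<^sup>2))" by (rule exp_ge_add_one_self)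
      finally show "1 - d / 24 * (t $ i)\<^sup>2 \<le> exp (- (c * (norm t)\<^sup>2))" .
    qed
    finally show ?thesis unfolding twisted_def h_def .
  qed
  \<comment> \<open>The remaining \<open>l\<close> steps come without gain, but the operator is a
    contraction, so they also cost nothing.\<close>
  have iter: "norm (twisted (\<lambda>\<gamma>. t \<bullet> \<Phi> \<gamma>) (N * k + l) g \<gamma>) \<le> exp (- (c * k * (norm t)\<^sup>2)) * K"
    if t: "t \<in> torus_box" and g: "Linv g" "\<And>\<gamma>. \<gamma> \<in> carrier G \<Longrightarrow> norm (g \<gamma>) \<le> K" and \<gamma>: "\<gamma> \<in> carrier G" for t g K \<gamma> k l
    using \<gamma>
  proof (induction k arbitrary: \<gamma>)
    case 0 then show ?case using twisted_norm_le[OF g(2)] by simp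
  next
    case (Suc k)
    have "twisted (\<lambda>\<gamma>. t \<bullet> \<Phi> \<gamma>) (N * Suc k + l) g \<gamma> = twisted (\<lambda>\<gamma>. t \<bullet> \<Phi> \<gamma>) N (twisted (\<lambda>\<gamma>. t \<bullet> \<Phi> \<gamma>) (N * k + l) g) \<gamma>"
      using twisted_add[where n=N and m="N * k + l" and \<phi>="\<lambda>\<gamma>. t \<bullet> \<Phi> \<gamma>", OF g(2) Suc.prems] by (simp add: add.assoc)
    also have "norm \<dots> \<le> exp (- (c * (norm t)\<^sup>2)) * (exp (- (c * k * (norm t)\<^sup>2)) * K)"
      by (rule one[OF t LT[OF g(1)] Suc.IH Suc.prems])
    also have "\<dots> = exp (- (c * Suc k * (norm t)\<^sup>2)) * K"
      unfolding mult.assoc[symmetric] exp_add[symmetric] by (simp add: algebra_simps)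
    finally show ?case .
  qed
  have "norm (twisted (\<lambda>\<gamma>. t \<bullet> \<Phi> \<gamma>) n g \<gamma>) \<le> exp (- (c * real (n div N) * (norm t)\<^sup>2)) * K"
    if t: "t \<in> torus_box" and g: "Linv g" "\<forall>\<gamma>\<in>carrier G. norm (g \<gamma>) \<le> K" and \<gamma>: "\<gamma> \<in> carrier G" for t g K \<gamma> n
    using iter[OF t g(1) _ \<gamma>, of K "n div N" "n mod N"] g(2) by simp
  then show ?thesis using c N(1)
    by (intro exI[of _ c] conjI exI[of _ N] ballI allI impI)
qed

text \<open>For \<open>n \<ge> N\<close> one has \<open>n div N \<ge> n / (2 * N)\<close>, so after
  rescaling by \<open>sqrt n\<close> the exponent no longer involves \<open>n\<close>. The resulting
  Gaussian bound is the integrable majorant for the local limit theorem.\<close>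

lemma char_dominated:
  "\<exists>c>0. \<exists>n0. \<forall>n\<ge>n0. \<forall>t. (1 / sqrt n) *\<^sub>R t \<in> torus_box \<longrightarrow> (\<forall>g. Linv g \<longrightarrow> (\<forall>\<gamma>\<in>carrier G. norm (g \<gamma>) \<le> 1) \<longrightarrow>
     norm (measure_pmf.expectation (conv n) (\<lambda>s. iexp ((t \<bullet> \<Phi> s) / sqrt n) * g s)) \<le> exp (- (c * (norm t)\<^sup>2)))"
proof -
  obtain c :: real and N :: nat where c: "c > 0" "N \<ge> 1" and dom: "\<forall>t\<in>torus_box. \<forall>n g K. Linv g \<longrightarrow> (\<forall>\<gamma>\<in>carrier G. norm (g \<gamma>) \<le> K) \<longrightarrow>
     (\<forall>\<gamma>\<in>carrier G. norm (twisted (\<lambda>\<gamma>. t \<bullet> \<Phi> \<gamma>) n g \<gamma>) \<le> exp (- (c * real (n div N) * (norm t)\<^sup>2)) * K)"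
    using twisted_dominated by (elim exE conjE)
  have "norm (measure_pmf.expectation (conv n) (\<lambda>s. iexp ((t \<bullet> \<Phi> s) / sqrt n) * g s)) \<le> exp (- (c / (2 * N) * (norm t)\<^sup>2))"
    if n: "n \<ge> N" and t: "(1 / sqrt n) *\<^sub>R t \<in> torus_box" and g: "Linv g" "\<forall>\<gamma>\<in>carrier G. norm (g \<gamma>) \<le> 1" for n t g
  proof -
    have n0: "n > 0" using n c by simp
    have "norm (twisted (\<lambda>\<gamma>. ((1 / sqrt n) *\<^sub>R t) \<bullet> \<Phi> \<gamma>) n g \<one>) \<le> exp (- (c * real (n div N) * (norm ((1 / sqrt n) *\<^sub>R t))\<^sup>2)) * 1"
      using dom[rule_format, OF t g(1), of 1 \<one> n] g(2) by simp
    moreover have "twisted (\<lambda>\<gamma>. ((1 / sqrt n) *\<^sub>R t) \<bullet> \<Phi> \<gamma>) n g \<one> = measure_pmf.expectation (conv n) (\<lambda>s. iexp ((t \<bullet> \<Phi> s) / sqrt n) * g s)"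
      unfolding twisted_def by (rule integral_cong_AE) (auto simp: AE_measure_pmf_iff set_conv_carrier)
    moreover have "exp (- (c * real (n div N) * (norm ((1 / sqrt n) *\<^sub>R t))\<^sup>2)) \<le> exp (- (c / (2 * N) * (norm t)\<^sup>2))"
    proof -
      have "n \<le> 2 * N * (n div N)"
      proof -
        have "n div N \<ge> 1" using n c(2) by (simp add: Suc_leI div_greater_zero_iff)
        then have "N \<le> N * (n div N)" by simp
        moreover have "n = N * (n div N) + n mod N" by simp
        moreover have "n mod N < N" using c(2) by simp
        ultimately show ?thesis by linarith
      qed
      then have "real n \<le> 2 * real N * real (n div N)" by (metis of_nat_le_iff of_nat_mult of_nat_numeral)
      then have "1 / (2 * N) \<le> real (n div N) / n" using n0 c(2) by (simp add: field_simps)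
      then have "c * (norm t)\<^sup>2 * (1 / (2 * N)) \<le> c * (norm t)\<^sup>2 * (real (n div N) / n)"
        using c by (intro mult_left_mono) auto
      then show ?thesis using n0 by (simp add: power_divide mult_ac)
    qed
    ultimately show ?thesis by (simp only: mult_1_right)
  qed
  moreover have "c / (2 * N) > 0" using c by simp
  ultimately show ?thesis
    by (intro exI[of _ "c / (2 * N)"] conjI exI[of _ N] allI impI)
qed

text \<open>Nondegeneracy is read off from the limit: for fixed \<open>t\<close> the Gaussian bound
  of \<open>char_dominated\<close> holds for all large \<open>n\<close> and passes to
  \<open>exp (- cov f t t / 2)\<close>.\<close>

lemma cov_pos_def:
  assumes f: "corrector f" shows "\<exists>c>0. \<forall>t. cov f t t \<ge> c * (norm t)\<^sup>2"
proof -
  obtain c n0 where c: "c > 0" and dom: "\<forall>n\<ge>n0. \<forall>t. (1 / sqrt n) *\<^sub>R t \<in> torus_box \<longrightarrow> (\<forall>g. Linv g \<longrightarrow> (\<forall>\<gamma>\<in>carrier G. norm (g \<gamma>) \<le> 1) \<longrightarrow>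
     norm (measure_pmf.expectation (conv n) (\<lambda>s. iexp ((t \<bullet> \<Phi> s) / sqrt n) * g s)) \<le> exp (- (c * (norm t)\<^sup>2)))"
    using char_dominated by (elim exE conjE)
  have "cov f t t \<ge> 2 * c * (norm t)\<^sup>2" for t
  proof -
    let ?E = "\<lambda>n. measure_pmf.expectation (conv n) (\<lambda>s. iexp ((t \<bullet> (\<Phi> s - n *\<^sub>R zeta)) / sqrt n) * 1)"
    have lim: "?E \<longlonglongrightarrow> mean (\<lambda>_. 1) * of_real (exp (- cov f t t / 2))"
      by (rule clt_char[OF f]) (auto simp: Linv_def)
    have m: "mean (\<lambda>_. 1 :: complex) = 1"
      using D_nonempty by (simp add: mean_def scaleR_conv_of_real)
    have "eventually (\<lambda>n. norm (?E n) \<le> exp (- (c * (norm t)\<^sup>2))) sequentially"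
    proof -
      have "(\<lambda>n. norm t / sqrt (real n)) \<longlonglongrightarrow> 0" by real_asymp
      then have "eventually (\<lambda>n. norm t / sqrt (real n) < pi) sequentially"
        by (rule order_tendstoD(2)) simp
      then show ?thesis using eventually_ge_at_top[of n0]
      proof eventually_elim
        case (elim n)
        have "(1 / sqrt n) *\<^sub>R t \<in> torus_box"
          unfolding mem_torus_box
        proof
          fix b :: "real ^ 'n" assume b: "b \<in> Basis"
          have "\<bar>((1 / sqrt n) *\<^sub>R t) \<bullet> b\<bar> = \<bar>t \<bullet> b\<bar> / sqrt n" by simp
          also have "\<dots> \<le> norm t / sqrt n" using Basis_le_norm[OF b, of t] by (simp add: divide_right_mono)
          finally show "\<bar>((1 / sqrt n) *\<^sub>R t) \<bullet> b\<bar> \<le> pi" using elim(1) by simp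
        qed
        from dom[rule_format, OF elim(2) this, of "\<lambda>_. 1"]
        have d: "norm (measure_pmf.expectation (conv n) (\<lambda>s. iexp ((t \<bullet> \<Phi> s) / sqrt n) * 1)) \<le> exp (- (c * (norm t)\<^sup>2))"
          by (simp add: Linv_def)
        have "?E n = measure_pmf.expectation (conv n) (\<lambda>s. iexp (- (t \<bullet> (n *\<^sub>R zeta)) / sqrt n) * (iexp ((t \<bullet> \<Phi> s) / sqrt n) * 1))"
          by (rule Bochner_Integration.integral_cong[OF refl]) (simp add: inner_diff_right diff_divide_distrib exp_diff exp_minus right_diff_distrib divide_inverse mult.commute)
        then have "norm (?E n) = norm (measure_pmf.expectation (conv n) (\<lambda>s. iexp ((t \<bullet> \<Phi> s) / sqrt n) * 1))"
          unfolding integral_mult_right_zero by (simp add: norm_mult del: of_real_divide of_real_minus)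
        then show ?case using d by simp
      qed
    qed
    then have "norm (mean (\<lambda>_. 1 :: complex) * of_real (exp (- cov f t t / 2))) \<le> exp (- (c * (norm t)\<^sup>2))"
      by (intro tendsto_upperbound[OF tendsto_norm[OF lim]]) auto
    then show ?thesis by (simp add: m)
  qed
  then show ?thesis using c by (intro exI[of _ "2 * c"]) auto
qed

end

section \<open>Local limit theorem\<close>

lemma integral_lborel_scale:
  fixes f :: "'a::euclidean_space \<Rightarrow> complex"
  assumes f [measurable]: "f \<in> borel_measurable borel" and c: "c > 0"
  shows "(\<integral>x. f (c *\<^sub>R x) \<partial>lborel) = (1 / c ^ DIM('a)) *\<^sub>R (\<integral>x. f x \<partial>lborel)"
proof -
  have "(\<integral>x. f x \<partial>lborel) = (\<integral>x. f x \<partial>density (distr lborel borel (\<lambda>x. 0 + c *\<^sub>R x)) (\<lambda>_. ennreal (\<bar>c\<bar> ^ DIM('a))))"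
    using c by (subst lborel_affine[of c 0]) auto
  also have "\<dots> = c ^ DIM('a) *\<^sub>R (\<integral>x. f (c *\<^sub>R x) \<partial>lborel)"
    using c by (subst integral_density) (auto simp: integral_distr)
  finally show ?thesis using c by simp
qed

lemma integrable_exp_neg_norm2:
  fixes c :: real assumes c: "c > 0"
  shows "integrable lborel (\<lambda>t::'a::euclidean_space. exp (- (c * (norm t)\<^sup>2)))"
proof -
  define s where "s = 1 / sqrt (2 * c)"
  have s: "s > 0" "s\<^sup>2 = 1 / (2 * c)" using c by (auto simp: s_def power_divide)
  have e: "exp (- (c * x\<^sup>2)) = sqrt (2 * pi * s\<^sup>2) * normal_density 0 s x" for x
    using s c by (simp add: normal_density_def)
  have "integrable lborel (\<lambda>x::real. exp (- (c * x\<^sup>2)))"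
    unfolding e by (intro integrable_mult_right integrable_normal_density s(1))
  then have i: "integrable lborel (\<lambda>x::real. complex_of_real (exp (- (c * x\<^sup>2))))" by (rule integrable_of_real)
  have "complex_of_real (exp (- (c * (norm t)\<^sup>2))) = (\<Prod>b\<in>Basis. complex_of_real (exp (- (c * (t \<bullet> b)\<^sup>2))))" for t :: 'a
  proof -
    have "(norm t)\<^sup>2 = (\<Sum>b\<in>Basis. (t \<bullet> b)\<^sup>2)"
      unfolding power2_norm_eq_inner by (subst euclidean_inner) (simp add: power2_eq_square)
    then have "exp (- (c * (norm t)\<^sup>2)) = (\<Prod>b\<in>Basis. exp (- (c * (t \<bullet> b)\<^sup>2)))"
      by (simp add: exp_sum[symmetric] sum_negf sum_distrib_left)
    then show ?thesis by simp
  qed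
  then have "integrable lborel (\<lambda>t::'a. complex_of_real (exp (- (c * (norm t)\<^sup>2))))"
    using integrable_lborel_prod[where f="\<lambda>_::'a. \<lambda>x. complex_of_real (exp (- (c * x\<^sup>2)))", OF i] by simp
  then show ?thesis by (simp only: complex_of_real_integrable_eq)
qed

section \<open>The covariance operator and Fourier inversion at scale sqrt n\<close>

context lattice_walk
begin

lemma cov_add_left: "Linv f \<Longrightarrow> cov f (u + v) w = cov f u w + cov f v w"
  unfolding cov_def mean_def
  by (simp add: inner_add_left distrib_right inner_cincr_integrable sum.distrib scaleR_add_right distrib_left)

lemma cov_scale_left: "cov f (a *\<^sub>R v) w = a * cov f v w"
  unfolding cov_def mean_def by (simp add: mult.assoc sum_distrib_left mult.left_commute)

lemma cov_commute: "cov f v w = cov f w v"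
  by (simp add: cov_def mult.commute)

lemma cov_linear_left: "Linv f \<Longrightarrow> linear (\<lambda>v. cov f v w)"
  by (intro linearI) (simp_all add: cov_add_left cov_scale_left)

definition cov_map :: "('g \<Rightarrow> real ^ 'n) \<Rightarrow> real ^ 'n \<Rightarrow> real ^ 'n" where
  "cov_map f w = (\<Sum>b\<in>Basis. cov f b w *\<^sub>R b)"

lemma inner_cov_map: assumes f: "Linv f" shows "v \<bullet> cov_map f w = cov f v w"
proof -
  have "cov f v w = cov f (\<Sum>b\<in>Basis. (v \<bullet> b) *\<^sub>R b) w" by (simp add: euclidean_representation)
  also have "\<dots> = (\<Sum>b\<in>Basis. (v \<bullet> b) * cov f b w)"
    by (simp add: linear_sum[OF cov_linear_left[OF f]] cov_scale_left)
  finally show ?thesis by (simp add: cov_map_def inner_sum_right mult.commute)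
qed

lemma linear_cov_map: assumes f: "Linv f" shows "linear (cov_map f)"
proof (rule linearI)
  show "cov_map f (x + y) = cov_map f x + cov_map f y" for x y
    unfolding cov_map_def by (simp add: cov_commute[of _ _ "x + y"] cov_add_left[OF f] cov_commute[of _ x] cov_commute[of _ y] scaleR_add_left sum.distrib cov_commute[of f x] cov_commute[of f y])
  show "cov_map f (c *\<^sub>R x) = c *\<^sub>R cov_map f x" for c x
    unfolding cov_map_def by (simp add: cov_commute[of _ _ "c *\<^sub>R x"] cov_scale_left scaleR_sum_right cov_commute[of f x])
qed

lemma mean_indicator_coset: "x \<in> \<Delta> \<Longrightarrow> mean (\<lambda>\<gamma>. indicator {\<gamma>. rep \<gamma> = x} \<gamma> :: complex) = of_real (1 / card \<Delta>)"
proof -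
  assume x: "x \<in> \<Delta>"
  have "(\<Sum>y\<in>\<Delta>. indicator {\<gamma>. rep \<gamma> = x} y :: complex) = (\<Sum>y\<in>\<Delta>. if y = x then 1 else 0)"
    by (rule sum.cong) (auto simp: rep_idem)
  then show ?thesis using x finite_D by (simp add: mean_def scaleR_conv_of_real)
qed

lemma Linv_indicator_coset: "Linv (\<lambda>\<gamma>. indicator {\<gamma>. rep \<gamma> = x} \<gamma> :: complex)"
  by (auto simp: Linv_def rep_L_mult indicator_def)

text \<open>Dominated convergence: \<open>clt_char\<close> gives the pointwise limit, while
  \<open>char_dominated\<close> and \<open>cov_pos_def\<close> give the majorant \<open>w\<close>.
  The coset indicator is carried along because inversion works coset by coset; in the limit it
  contributes its mean, \<open>1 / card \<Delta>\<close>.\<close>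

lemma char_coset_L1:
  assumes f: "corrector f" and x: "x \<in> \<Delta>"
  defines "cf n t \<equiv> measure_pmf.expectation (conv n) (\<lambda>s. iexp ((t \<bullet> (\<Phi> s - n *\<^sub>R zeta)) / sqrt n) * indicator {\<gamma>. rep \<gamma> = x} s)"
  defines "h n t \<equiv> indicator torus_box ((1 / sqrt (real n)) *\<^sub>R t) * cf n t - of_real (1 / card \<Delta> * exp (- (t \<bullet> cov_map f t) / 2))"
  shows "(\<lambda>n. \<integral>t. norm (h n t) \<partial>lborel) \<longlonglongrightarrow> 0" "\<exists>n0. \<forall>n\<ge>n0. integrable lborel (h n)"
    "\<And>n. cf n \<in> borel_measurable borel"
proof -
  have Lf: "Linv f" using f by (simp add: corrector_def)
  have Sm [measurable]: "cov_map f \<in> borel_measurable borel"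
    by (auto intro!: borel_measurable_continuous_onI linear_continuous_on simp: linear_cov_map[OF Lf] linear_conv_bounded_linear[symmetric])
  have bnd1: "norm (iexp y * indicator {\<gamma>. rep \<gamma> = x} s) \<le> 1" for y s by (simp add: norm_mult indicator_def)
  have cfm [measurable]: "cf n \<in> borel_measurable borel" for n
  proof -
    \<comment> \<open>The Fubini lemma wants a bound integrable in \<open>t\<close>, so
      \<open>cf n\<close> is restricted to balls and recovered as their limit.\<close>
    define g where "g k t = (if norm t \<le> real k then cf n t else 0)" for k :: nat and t
    have "g k \<in> borel_measurable borel" for k
    proof -
      let ?F = "\<lambda>t s. indicator (cball 0 (real k)) t * (iexp ((t \<bullet> (\<Phi> s - n *\<^sub>R zeta)) / sqrt n) * indicator {\<gamma>. rep \<gamma> = x} s)"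
      have "(\<lambda>t. measure_pmf.expectation (conv n) (?F t)) \<in> borel_measurable borel"
      proof (rule Fubini_pmf_lborel(2))
        have "(\<lambda>t. indicator (cball 0 (real k)) t * (iexp ((t \<bullet> a) / q) * z)) \<in> borel_measurable borel" for a :: "real ^ 'n" and q z
        proof (intro borel_measurable_times borel_measurable_indicator borel_measurable_const)
          show "(\<lambda>t. iexp ((t \<bullet> a) / q)) \<in> borel_measurable borel" by measurable
        qed auto
        then show "(\<lambda>t. ?F t s) \<in> borel_measurable borel" for s .
        show "norm (?F t s) \<le> indicator (cball 0 (real k)) t" for t s
          by (auto simp: norm_mult indicator_def)
        show "integrable lborel (indicator (cball (0 :: real ^ 'n) (real k)) :: _ \<Rightarrow> real)"
          by (simp add: integrable_indicator_iff emeasure_lborel_cball_finite[unfolded infinity_ennreal_def])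
      qed
      also have "(\<lambda>t. measure_pmf.expectation (conv n) (?F t)) = g k"
        by (rule ext) (simp add: g_def cf_def indicator_def)
      finally show ?thesis .
    qed
    moreover have "(\<lambda>k. g k t) \<longlonglongrightarrow> cf n t" for t
    proof (rule tendsto_eventually, rule eventually_sequentiallyI)
      fix k assume "nat \<lceil>norm t\<rceil> \<le> k" then show "g k t = cf n t" by (simp add: g_def nat_le_iff ceiling_le_iff)
    qed
    ultimately show ?thesis by (rule borel_measurable_LIMSEQ_metric) 
  qed
  then show "\<And>n. cf n \<in> borel_measurable borel" .
  have hm [measurable]: "h n \<in> borel_measurable borel" for n
    unfolding h_def[abs_def] by measurable
  obtain c n0 where c: "c > 0" and dom: "\<forall>n\<ge>n0. \<forall>t. (1 / sqrt n) *\<^sub>R t \<in> torus_box \<longrightarrow> (\<forall>g. Linv g \<longrightarrow> (\<forall>\<gamma>\<in>carrier G. norm (g \<gamma>) \<le> 1) \<longrightarrow>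
     norm (measure_pmf.expectation (conv n) (\<lambda>s. iexp ((t \<bullet> \<Phi> s) / sqrt n) * g s)) \<le> exp (- (c * (norm t)\<^sup>2)))"
    using char_dominated by (elim exE conjE)
  obtain c' where c': "c' > 0" "\<forall>t. cov f t t \<ge> c' * (norm t)\<^sup>2" using cov_pos_def[OF f] by (elim exE conjE)
  define w where "w t = exp (- (c * (norm t)\<^sup>2)) + exp (- (c' / 2 * (norm t)\<^sup>2))" for t :: "real ^ 'n"
  have wi: "integrable lborel w" unfolding w_def
    using c c' by (intro Bochner_Integration.integrable_add integrable_exp_neg_norm2) auto
  have cf_shift: "norm (cf n t) = norm (measure_pmf.expectation (conv n) (\<lambda>s. iexp ((t \<bullet> \<Phi> s) / sqrt n) * indicator {\<gamma>. rep \<gamma> = x} s))" for n t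
  proof -
    have "cf n t = measure_pmf.expectation (conv n) (\<lambda>s. iexp (- (t \<bullet> (n *\<^sub>R zeta)) / sqrt n) * (iexp ((t \<bullet> \<Phi> s) / sqrt n) * indicator {\<gamma>. rep \<gamma> = x} s))"
      unfolding cf_def
      by (rule Bochner_Integration.integral_cong[OF refl]) (simp add: inner_diff_right diff_divide_distrib exp_diff exp_minus right_diff_distrib divide_inverse mult.commute)
    then show ?thesis
      unfolding integral_mult_right_zero by (simp add: norm_mult del: of_real_divide of_real_minus)
  qed
  have bound: "norm (h n t) \<le> w t" if n: "n \<ge> n0" for n t
  proof -
    have "norm (indicator torus_box ((1 / sqrt (real n)) *\<^sub>R t) * cf n t) \<le> exp (- (c * (norm t)\<^sup>2))"
    proof (cases "(1 / sqrt (real n)) *\<^sub>R t \<in> torus_box")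
      case True
      have "norm (cf n t) \<le> exp (- (c * (norm t)\<^sup>2))"
        unfolding cf_shift using dom[rule_format, OF n True Linv_indicator_coset[of x]] by (simp add: indicator_def)
      then show ?thesis using True by simp
    qed simp
    moreover have "norm (complex_of_real (1 / card \<Delta> * exp (- (t \<bullet> cov_map f t) / 2))) \<le> exp (- (c' / 2 * (norm t)\<^sup>2))"
    proof -
      have "norm (complex_of_real (1 / card \<Delta> * exp (- (t \<bullet> cov_map f t) / 2))) = 1 / card \<Delta> * exp (- (t \<bullet> cov_map f t) / 2)"
        unfolding norm_of_real by simp
      also have "\<dots> \<le> 1 * exp (- (c' / 2 * (norm t)\<^sup>2))"
        using D_nonempty c'(2)[rule_format, of t] by (intro mult_mono) (auto simp: inner_cov_map[OF Lf])
      finally show ?thesis by simp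
    qed
    ultimately show ?thesis unfolding h_def w_def by (intro order.trans[OF norm_triangle_ineq4] add_mono)
  qed
  have hi: "integrable lborel (h n)" if "n \<ge> n0" for n
    by (rule Bochner_Integration.integrable_bound[OF wi]) (use bound[OF that] in \<open>auto intro!: AE_I2 order.trans[OF _ abs_ge_self]\<close>)
  then show "\<exists>n0. \<forall>n\<ge>n0. integrable lborel (h n)" by blast
  have ptw: "(\<lambda>n. h n t) \<longlonglongrightarrow> 0" for t
  proof -
    have "cf = (\<lambda>n t. measure_pmf.expectation (conv n) (\<lambda>s. iexp ((t \<bullet> (\<Phi> s - n *\<^sub>R zeta)) / sqrt n) * indicator {\<gamma>. rep \<gamma> = x} s))"
      by (intro ext) (simp add: cf_def)
    with clt_char[OF f Linv_indicator_coset[of x], of t]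
    have "(\<lambda>n. cf n t) \<longlonglongrightarrow> of_real (1 / card \<Delta>) * of_real (exp (- cov f t t / 2))"
      unfolding mean_indicator_coset[OF x] by simp
    then have 1: "(\<lambda>n. cf n t - of_real (1 / card \<Delta> * exp (- (t \<bullet> cov_map f t) / 2))) \<longlonglongrightarrow> 0"
      unfolding inner_cov_map[OF Lf] by (intro LIM_zero) simp
    \<comment> \<open>For fixed \<open>t\<close> the rescaled point eventually lies in the box, so
      the indicator in \<open>h\<close> is eventually 1.\<close>
    have "(\<lambda>n. norm t / sqrt (real n)) \<longlonglongrightarrow> 0" by real_asymp
    then have "eventually (\<lambda>n. norm t / sqrt (real n) < pi) sequentially"
      by (rule order_tendstoD(2)) simp
    then have "eventually (\<lambda>n. cf n t - of_real (1 / card \<Delta> * exp (- (t \<bullet> cov_map f t) / 2)) = h n t) sequentially"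
    proof eventually_elim
      case (elim n)
      have "(1 / sqrt n) *\<^sub>R t \<in> torus_box"
        unfolding mem_torus_box
      proof
        fix b :: "real ^ 'n" assume b: "b \<in> Basis"
        have "\<bar>((1 / sqrt n) *\<^sub>R t) \<bullet> b\<bar> = \<bar>t \<bullet> b\<bar> / sqrt n" by simp
        also have "\<dots> \<le> norm t / sqrt n" using Basis_le_norm[OF b, of t] by (simp add: divide_right_mono)
        finally show "\<bar>((1 / sqrt n) *\<^sub>R t) \<bullet> b\<bar> \<le> pi" using elim by simp
      qed
      then show ?case by (simp add: h_def)
    qed
    with 1 show ?thesis by (rule Lim_transform_eventually)
  qed
  \<comment> \<open>The majorant is valid from \<open>n0\<close> on; the sequence is shifted
    accordingly.\<close>
  have "(\<lambda>n. \<integral>t. norm (h (n + n0) t) \<partial>lborel) \<longlonglongrightarrow> (\<integral>t. norm (0::complex) \<partial>(lborel :: (real ^ 'n) measure))"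
  proof (rule integral_dominated_convergence[where w=w])
    show "AE t in lborel. (\<lambda>n. norm (h (n + n0) t)) \<longlonglongrightarrow> norm (0::complex)"
      by (intro AE_I2 tendsto_norm LIMSEQ_ignore_initial_segment ptw)
    show "AE t in lborel. norm (norm (h (n + n0) t)) \<le> w t" for n
      using bound[of "n + n0"] by (auto intro!: AE_I2)
  qed (use wi in auto)
  then have "(\<lambda>n. \<integral>t. norm (h (n + n0) t) \<partial>lborel) \<longlonglongrightarrow> 0" by simp
  then show "(\<lambda>n. \<integral>t. norm (h n t) \<partial>lborel) \<longlonglongrightarrow> 0" by (rule LIMSEQ_offset)
qed

text \<open>Substituting \<open>t / sqrt n\<close> in the torus integral produces the Jacobian
  \<open>sqrt n ^ CARD('n)\<close>. The centring is free: \<open>n zeta\<close> is subtracted from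
  both \<open>\<Phi> s\<close> and \<open>\<Phi> \<gamma>\<close>.\<close>

lemma scaled_fourier_inversion:
  assumes n: "n \<ge> 1" and \<gamma>: "\<gamma> \<in> carrier G"
  defines "cf t \<equiv> measure_pmf.expectation (conv n) (\<lambda>s. iexp ((t \<bullet> (\<Phi> s - n *\<^sub>R zeta)) / sqrt n) * indicator {s. rep s = rep \<gamma>} s)"
  assumes m: "cf \<in> borel_measurable borel"
  shows "of_real ((2 * pi) ^ CARD('n) * (sqrt n ^ CARD('n) * pmf (conv n) \<gamma>))
    = (\<integral>t. indicator torus_box ((1 / sqrt n) *\<^sub>R t) * cf t * iexp (t \<bullet> (- ((1 / sqrt n) *\<^sub>R (\<Phi> \<gamma> - n *\<^sub>R zeta)))) \<partial>lborel)"
proof -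
  define A where "A = {s. rep s = rep \<gamma>}"
  define H where "H t = indicator torus_box t * measure_pmf.expectation (conv n) (\<lambda>s. indicator A s * iexp (t \<bullet> (\<Phi> s - \<Phi> \<gamma>)))" for t :: "real ^ 'n"
  define c where "c = 1 / sqrt n"
  have c: "c > 0" using n by (simp add: c_def)
  have inv: "(\<integral>t. H t \<partial>lborel) = of_real ((2 * pi) ^ DIM(real ^ 'n) * pmf (conv n) \<gamma>)"
    unfolding H_def
  proof (rule fourier_inversion_pmf)
    fix s b assume s: "s \<in> set_pmf (conv n)" and b: "b \<in> (Basis :: (real ^ 'n) set)"
    have "\<Phi> s \<in> int_lattice" "\<Phi> \<gamma> \<in> int_lattice" using s \<gamma> by (auto intro: coord_lattice set_conv_carrier)
    then show "(\<Phi> s - \<Phi> \<gamma>) \<bullet> b \<in> \<int>" using b by (auto simp: int_lattice_iff_Basis inner_diff_left)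
  next
    fix s assume s: "s \<in> set_pmf (conv n)" "s \<in> A"
    then show "\<Phi> s = \<Phi> \<gamma> \<longleftrightarrow> s = \<gamma>"
      using coord_rep_inj[OF set_conv_carrier[OF s(1)] \<gamma>] by (auto simp: A_def)
  qed (simp add: A_def)
  have Hc: "H (c *\<^sub>R t) = indicator torus_box ((1 / sqrt n) *\<^sub>R t) * cf t * iexp (t \<bullet> (- ((1 / sqrt n) *\<^sub>R (\<Phi> \<gamma> - n *\<^sub>R zeta))))" for t
  proof -
    have "measure_pmf.expectation (conv n) (\<lambda>s. indicator A s * iexp ((c *\<^sub>R t) \<bullet> (\<Phi> s - \<Phi> \<gamma>)))
      = measure_pmf.expectation (conv n) (\<lambda>s. iexp ((t \<bullet> (\<Phi> s - n *\<^sub>R zeta)) / sqrt n) * indicator A s * iexp (t \<bullet> (- ((1 / sqrt n) *\<^sub>R (\<Phi> \<gamma> - n *\<^sub>R zeta)))))"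
    proof (rule Bochner_Integration.integral_cong[OF refl])
      fix s
      have e: "(c *\<^sub>R t) \<bullet> (\<Phi> s - \<Phi> \<gamma>) = (t \<bullet> (\<Phi> s - n *\<^sub>R zeta)) / sqrt n + t \<bullet> (- ((1 / sqrt n) *\<^sub>R (\<Phi> \<gamma> - n *\<^sub>R zeta)))"
        by (simp add: c_def inner_diff_right diff_divide_distrib)
      show "indicator A s * iexp ((c *\<^sub>R t) \<bullet> (\<Phi> s - \<Phi> \<gamma>)) = iexp ((t \<bullet> (\<Phi> s - n *\<^sub>R zeta)) / sqrt n) * indicator A s * iexp (t \<bullet> (- ((1 / sqrt n) *\<^sub>R (\<Phi> \<gamma> - n *\<^sub>R zeta))))"
        unfolding e of_real_add distrib_left exp_add by (simp only: mult_ac)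
    qed
    also have "\<dots> = cf t * iexp (t \<bullet> (- ((1 / sqrt n) *\<^sub>R (\<Phi> \<gamma> - n *\<^sub>R zeta))))"
      unfolding cf_def A_def by (rule integral_mult_left_zero)
    finally show ?thesis by (simp only: H_def c_def mult.assoc)
  qed
  have Hm: "H \<in> borel_measurable borel"
  proof -
    have "(\<lambda>t. indicator torus_box ((1 / sqrt n) *\<^sub>R t) * cf t * iexp (t \<bullet> (- ((1 / sqrt n) *\<^sub>R (\<Phi> \<gamma> - n *\<^sub>R zeta))))) \<in> borel_measurable borel"
      using m by measurable
    then have "(\<lambda>t. H (c *\<^sub>R t)) \<in> borel_measurable borel" unfolding Hc .
    from measurable_compose[OF _ this, of "\<lambda>t. (1 / c) *\<^sub>R t" borel] show ?thesis using c by simp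
  qed
  have "(\<integral>t. H (c *\<^sub>R t) \<partial>lborel) = (1 / c ^ DIM(real ^ 'n)) *\<^sub>R (\<integral>t. H t \<partial>lborel)"
    by (rule integral_lborel_scale[OF Hm c])
  also have "\<dots> = of_real ((2 * pi) ^ CARD('n) * (sqrt n ^ CARD('n) * pmf (conv n) \<gamma>))"
    unfolding inv using n by (simp add: c_def scaleR_conv_of_real power_divide)
  finally show ?thesis unfolding Hc by simp
qed

text \<open>The character in the inversion formula has modulus 1, so the error is at most the L1
  norm from \<open>char_coset_L1\<close>, uniformly in \<open>\<gamma>\<close>; summing these norms
  over the representatives covers all cosets. The point is parametrised by its preimage
  \<open>z\<close> under \<open>cov_map\<close>, as in \<open>gaussian_fourier\<close>.\<close>

lemma local_limit:
  assumes f: "corrector f"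
  shows "\<exists>C>0. \<exists>e. e \<longlonglongrightarrow> 0 \<and> (\<exists>n0. \<forall>n\<ge>n0. \<forall>\<gamma>\<in>carrier G. \<forall>z. cov_map f z = (1 / sqrt (real n)) *\<^sub>R (\<Phi> \<gamma> - n *\<^sub>R zeta) \<longrightarrow>
     \<bar>sqrt n ^ CARD('n) * pmf (conv n) \<gamma> - C * exp (- (z \<bullet> cov_map f z) / 2)\<bar> \<le> e n)"
proof -
  have Lf: "Linv f" using f by (simp add: corrector_def)
  obtain c' where c': "c' > 0" "\<forall>t. cov f t t \<ge> c' * (norm t)\<^sup>2" using cov_pos_def[OF f] by (elim exE conjE)
  have "\<exists>C>0. \<forall>z. (\<integral>t. of_real (exp (- (t \<bullet> cov_map f t) / 2)) * iexp (t \<bullet> cov_map f z) \<partial>lborel) = of_real (C * exp (- (z \<bullet> cov_map f z) / 2))"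
  proof (rule gaussian_fourier[OF linear_cov_map[OF Lf]])
    show "x \<bullet> cov_map f y = cov_map f x \<bullet> y" for x y
      using inner_cov_map[OF Lf, of x y] inner_cov_map[OF Lf, of y x] cov_commute[of f x y] by (simp add: inner_commute)
    show "x \<bullet> cov_map f x > 0" if "x \<noteq> 0" for x
    proof -
      have "0 < c' * (norm x)\<^sup>2" using that c'(1) by simp
      also have "\<dots> \<le> cov f x x" using c'(2) by blast
      finally show ?thesis by (simp add: inner_cov_map[OF Lf])
    qed
  qed
  then obtain C0 where C0: "C0 > 0" "\<forall>z. (\<integral>t. of_real (exp (- (t \<bullet> cov_map f t) / 2)) * iexp (t \<bullet> cov_map f z) \<partial>lborel) = of_real (C0 * exp (- (z \<bullet> cov_map f z) / 2))"
    by (elim exE conjE)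
  define cf where "cf x n t = measure_pmf.expectation (conv n) (\<lambda>s. iexp ((t \<bullet> (\<Phi> s - n *\<^sub>R zeta)) / sqrt n) * indicator {\<gamma>. rep \<gamma> = x} s)" for x n t
  define h where "h x n t = indicator torus_box ((1 / sqrt (real n)) *\<^sub>R t) * cf x n t - of_real (1 / card \<Delta> * exp (- (t \<bullet> cov_map f t) / 2))" for x n t
  have lim: "(\<lambda>n. \<integral>t. norm (h x n t) \<partial>lborel) \<longlonglongrightarrow> 0"
    and int: "\<exists>n0. \<forall>n\<ge>n0. integrable lborel (h x n)"
    and cfm: "cf x n \<in> borel_measurable borel" if x: "x \<in> \<Delta>" for x n
    using char_coset_L1[OF f x] unfolding h_def[abs_def] cf_def[abs_def] by auto
  define e where "e n = (\<Sum>x\<in>\<Delta>. \<integral>t. norm (h x n t) \<partial>lborel)" for n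
  have "e \<longlonglongrightarrow> (\<Sum>x\<in>\<Delta>. 0)" unfolding e_def by (intro tendsto_sum lim)
  then have e0: "e \<longlonglongrightarrow> 0" by simp
  from int have "\<exists>N. \<forall>x\<in>\<Delta>. \<forall>n\<ge>N x. integrable lborel (h x n)" by metis
  then obtain N where N: "\<forall>x\<in>\<Delta>. \<forall>n\<ge>N x. integrable lborel (h x n)" by blast
  define n0 where "n0 = Max (insert 1 (N ` \<Delta>))"
  have n0: "n0 \<ge> 1" "\<And>x. x \<in> \<Delta> \<Longrightarrow> n0 \<ge> N x" unfolding n0_def using finite_D by auto
  define P where "P = (2 * pi) ^ CARD('n)"
  have P: "P > 0" by (simp add: P_def)
  define C where "C = C0 / (P * card \<Delta>)"
  have Gi: "integrable lborel (\<lambda>t. of_real (exp (- (t \<bullet> cov_map f t) / 2)) * iexp (t \<bullet> u))" for u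
  proof (rule Bochner_Integration.integrable_bound)
    show "integrable lborel (\<lambda>t::real ^ 'n. exp (- (c' / 2 * (norm t)\<^sup>2)))" by (rule integrable_exp_neg_norm2) (use c' in simp)
    have Sm [measurable]: "cov_map f \<in> borel_measurable borel"
      by (auto intro!: borel_measurable_continuous_onI linear_continuous_on simp: linear_cov_map[OF Lf] linear_conv_bounded_linear[symmetric])
    show "(\<lambda>t. of_real (exp (- (t \<bullet> cov_map f t) / 2)) * iexp (t \<bullet> u)) \<in> borel_measurable lborel" by measurable
    show "AE t in lborel. norm (of_real (exp (- (t \<bullet> cov_map f t) / 2)) * iexp (t \<bullet> u)) \<le> norm (exp (- (c' / 2 * (norm t)\<^sup>2)))"
      using c'(2) by (intro AE_I2) (simp add: norm_mult inner_cov_map[OF Lf])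
  qed
  have "\<bar>sqrt n ^ CARD('n) * pmf (conv n) \<gamma> - C * exp (- (z \<bullet> cov_map f z) / 2)\<bar> \<le> e n / P"
    if n: "n \<ge> n0" and \<gamma>: "\<gamma> \<in> carrier G" and z: "cov_map f z = (1 / sqrt (real n)) *\<^sub>R (\<Phi> \<gamma> - n *\<^sub>R zeta)" for n \<gamma> z
  proof -
    define x where "x = rep \<gamma>"
    have x: "x \<in> \<Delta>" unfolding x_def by (rule rep_D[OF \<gamma>])
    define u where "u = - ((1 / sqrt n) *\<^sub>R (\<Phi> \<gamma> - n *\<^sub>R zeta))"
    \<comment> \<open>The sign of the inversion formula is absorbed into \<open>- z\<close>, at
      which the Gaussian has the same value.\<close>
    have uz: "u = cov_map f (- z)" using z linear_neg[OF linear_cov_map[OF Lf], of z] by (simp add: u_def)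
    have n1: "n \<ge> 1" using n n0 by simp
    have hi: "integrable lborel (h x n)" using N x n n0(2)[OF x] by (meson order.trans)
    have "of_real (P * (sqrt n ^ CARD('n) * pmf (conv n) \<gamma>))
      = (\<integral>t. indicator torus_box ((1 / sqrt n) *\<^sub>R t) * cf x n t * iexp (t \<bullet> u) \<partial>lborel)"
      unfolding P_def u_def x_def cf_def
      by (rule scaled_fourier_inversion[OF n1 \<gamma>]) (use cfm[OF x, of n] in \<open>simp add: cf_def[abs_def] x_def\<close>)
    also have "\<dots> = (\<integral>t. h x n t * iexp (t \<bullet> u) + of_real (1 / card \<Delta>) * (of_real (exp (- (t \<bullet> cov_map f t) / 2)) * iexp (t \<bullet> u)) \<partial>lborel)"
      by (rule Bochner_Integration.integral_cong[OF refl]) (simp add: h_def algebra_simps)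
    also have "\<dots> = (\<integral>t. h x n t * iexp (t \<bullet> u) \<partial>lborel) + of_real (1 / card \<Delta>) * (\<integral>t. of_real (exp (- (t \<bullet> cov_map f t) / 2)) * iexp (t \<bullet> u) \<partial>lborel)"
    proof (subst Bochner_Integration.integral_add)
      show "integrable lborel (\<lambda>t. h x n t * iexp (t \<bullet> u))"
        by (rule Bochner_Integration.integrable_bound[OF hi]) (use hi in \<open>auto simp: norm_mult\<close>)
      show "integrable lborel (\<lambda>t. complex_of_real (1 / card \<Delta>) * (of_real (exp (- (t \<bullet> cov_map f t) / 2)) * iexp (t \<bullet> u)))"
        by (intro integrable_mult_right Gi)
    qed (simp only: integral_mult_right_zero)
    also have "(\<integral>t. of_real (exp (- (t \<bullet> cov_map f t) / 2)) * iexp (t \<bullet> u) \<partial>lborel) = of_real (C0 * exp (- (z \<bullet> cov_map f z) / 2))"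
      unfolding uz using C0(2)[rule_format, of "- z"] linear_neg[OF linear_cov_map[OF Lf], of z] by simp
    finally have "of_real (P * (sqrt n ^ CARD('n) * pmf (conv n) \<gamma>)) - of_real (1 / card \<Delta>) * complex_of_real (C0 * exp (- (z \<bullet> cov_map f z) / 2))
      = (\<integral>t. h x n t * iexp (t \<bullet> u) \<partial>lborel)" by simp
    moreover have "norm (\<integral>t. h x n t * iexp (t \<bullet> u) \<partial>lborel) \<le> e n"
    proof -
      have "norm (\<integral>t. h x n t * iexp (t \<bullet> u) \<partial>lborel) \<le> (\<integral>t. norm (h x n t * iexp (t \<bullet> u)) \<partial>lborel)"
        by (rule integral_norm_bound)
      also have "\<dots> = (\<integral>t. norm (h x n t) \<partial>lborel)" by (simp add: norm_mult)
      also have "\<dots> \<le> e n" unfolding e_def by (rule member_le_sum) (use x finite_D in auto)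
      finally show ?thesis .
    qed
    moreover have "of_real (P * (sqrt n ^ CARD('n) * pmf (conv n) \<gamma>)) - of_real (1 / card \<Delta>) * complex_of_real (C0 * exp (- (z \<bullet> cov_map f z) / 2))
      = of_real (P * (sqrt n ^ CARD('n) * pmf (conv n) \<gamma> - C * exp (- (z \<bullet> cov_map f z) / 2)))"
      using P by (simp add: C_def right_diff_distrib)
    ultimately have "norm (complex_of_real (P * (sqrt n ^ CARD('n) * pmf (conv n) \<gamma> - C * exp (- (z \<bullet> cov_map f z) / 2)))) \<le> e n"
      by metis
    then have "P * \<bar>sqrt n ^ CARD('n) * pmf (conv n) \<gamma> - C * exp (- (z \<bullet> cov_map f z) / 2)\<bar> \<le> e n"
      unfolding norm_of_real abs_mult using P by simp
    then show ?thesis using P by (simp add: pos_le_divide_eq mult.commute)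
  qed
  moreover have "(\<lambda>n. e n / P) \<longlonglongrightarrow> 0" using tendsto_divide[OF e0 tendsto_const[of P]] P by simp
  moreover have "C > 0" using C0 P D_nonempty by (simp add: C_def)
  ultimately show ?thesis by (intro exI[of _ C] conjI exI[of _ "\<lambda>n. e n / P"] exI[of _ n0] allI ballI impI)
qed

end

section \<open>From local limits to total variation\<close>

text \<open>Bounds for the sums over finite sets stand for bounds of \<open>\<ell>\<^sup>1\<close>-norms, without summability side
  conditions.\<close>

definition vanishing :: "(nat \<Rightarrow> 'i \<Rightarrow> real) \<Rightarrow> 'i set \<Rightarrow> bool" where
  "vanishing f J \<longleftrightarrow> (\<forall>e>0. eventually (\<lambda>n. \<forall>F. finite F \<longrightarrow> F \<subseteq> J \<longrightarrow> (\<Sum>i\<in>F. \<bar>f n i\<bar>) \<le> e) sequentially)"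

text \<open>\<open>Y\<close> is the rescaled position: for every \<open>e\<close> one radius works
  for all large \<open>n\<close>, and points beyond it carry total mass at most
  \<open>e\<close>.\<close>

definition tight_at :: "(nat \<Rightarrow> 'i \<Rightarrow> real) \<Rightarrow> (nat \<Rightarrow> 'i \<Rightarrow> 'b::real_normed_vector) \<Rightarrow> 'i set \<Rightarrow> bool" where
  "tight_at f Y J \<longleftrightarrow> (\<forall>e>0. \<exists>R>0. eventually (\<lambda>n. \<forall>F. finite F \<longrightarrow> F \<subseteq> J \<longrightarrow> (\<forall>i\<in>F. norm (Y n i) > R) \<longrightarrow> (\<Sum>i\<in>F. \<bar>f n i\<bar>) \<le> e) sequentially)"

text \<open>The growth of the number of lattice points in a ball of radius
  \<open>R * sqrt n\<close>. It balances the factor \<open>sqrt n ^ m\<close> by which the local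
  limit theorem is scaled.\<close>

definition count_bounded :: "(nat \<Rightarrow> 'i \<Rightarrow> 'b::real_normed_vector) \<Rightarrow> 'i set \<Rightarrow> nat \<Rightarrow> bool" where
  "count_bounded Y J m \<longleftrightarrow> (\<exists>K>0. \<forall>n\<ge>1. \<forall>R\<ge>0. \<forall>F. finite F \<longrightarrow> F \<subseteq> J \<longrightarrow> (\<forall>i\<in>F. norm (Y n i) \<le> R) \<longrightarrow>
     real (card F) \<le> K * (2 * R + 1) ^ m * sqrt (real n) ^ m)"

text \<open>First a radius \<open>R\<close> is chosen outside which both tails are at most
  \<open>e / 3\<close>; then, inside it, the number of points times the pointwise error is at most
  \<open>e / 3\<close> for large \<open>n\<close>.\<close>

lemma vanishing_diff:
  assumes Y: "count_bounded Y J m" and f: "tight_at f Y J" and g: "tight_at g Y J"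
    and close: "\<And>R e. R > 0 \<Longrightarrow> e > 0 \<Longrightarrow> eventually (\<lambda>n. \<forall>i\<in>J. norm (Y n i) \<le> R \<longrightarrow> sqrt (real n) ^ m * \<bar>f n i - g n i\<bar> \<le> e) sequentially"
  shows "vanishing (\<lambda>n i. f n i - g n i) J"
  unfolding vanishing_def
proof (intro allI impI)
  fix e :: real assume e: "e > 0"
  then have e3: "e / 3 > 0" by simp
  obtain R1 where R1: "R1 > 0" "eventually (\<lambda>n. \<forall>F. finite F \<longrightarrow> F \<subseteq> J \<longrightarrow> (\<forall>i\<in>F. norm (Y n i) > R1) \<longrightarrow> (\<Sum>i\<in>F. \<bar>f n i\<bar>) \<le> e/3) sequentially"
    using f[unfolded tight_at_def, THEN spec, THEN mp, OF e3] by (elim exE conjE)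
  obtain R2 where R2: "R2 > 0" "eventually (\<lambda>n. \<forall>F. finite F \<longrightarrow> F \<subseteq> J \<longrightarrow> (\<forall>i\<in>F. norm (Y n i) > R2) \<longrightarrow> (\<Sum>i\<in>F. \<bar>g n i\<bar>) \<le> e/3) sequentially"
    using g[unfolded tight_at_def, THEN spec, THEN mp, OF e3] by (elim exE conjE)
  define R where "R = max R1 R2"
  have R: "R > 0" "R \<ge> R1" "R \<ge> R2" using R1(1) by (auto simp: R_def)
  obtain K where K: "K > 0" "\<forall>n\<ge>1. \<forall>R\<ge>0. \<forall>F. finite F \<longrightarrow> F \<subseteq> J \<longrightarrow> (\<forall>i\<in>F. norm (Y n i) \<le> R) \<longrightarrow>
     real (card F) \<le> K * (2 * R + 1) ^ m * sqrt (real n) ^ m"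
    using Y[unfolded count_bounded_def] by (elim exE conjE)
  define B where "B = K * (2 * R + 1) ^ m"
  have B: "B > 0" using K(1) R by (simp add: B_def)
  \<comment> \<open>At most \<open>B * sqrt n ^ m\<close> points lie in the ball, hence the
    tolerance \<open>e / 3 / B\<close> for each of them.\<close>
  have "eventually (\<lambda>n. \<forall>i\<in>J. norm (Y n i) \<le> R \<longrightarrow> sqrt (real n) ^ m * \<bar>f n i - g n i\<bar> \<le> e / 3 / B) sequentially"
    by (rule close[OF R(1)]) (use e B in simp)
  with R1(2) R2(2) eventually_ge_at_top[of 1]
  show "eventually (\<lambda>n. \<forall>F. finite F \<longrightarrow> F \<subseteq> J \<longrightarrow> (\<Sum>i\<in>F. \<bar>f n i - g n i\<bar>) \<le> e) sequentially"
  proof eventually_elim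
    case (elim n)
    show ?case
    proof (intro allI impI)
      fix F assume F: "finite F" "F \<subseteq> J"
      define A where "A = {i\<in>F. norm (Y n i) \<le> R}"
      define T where "T = {i\<in>F. norm (Y n i) > R}"
      have FA: "F = A \<union> T" "A \<inter> T = {}" "finite A" "finite T" "A \<subseteq> J" "T \<subseteq> J" using F by (auto simp: A_def T_def)
      have n1: "1 \<le> n" by fact
      then have "sqrt (real n) > 0" by simp
      then have n: "sqrt (real n) ^ m > 0" by (rule zero_less_power)
      have "(\<Sum>i\<in>A. \<bar>f n i - g n i\<bar>) \<le> (\<Sum>i\<in>A. e / 3 / B / sqrt (real n) ^ m)"
      proof (rule sum_mono)
        fix i assume i: "i \<in> A"
        then have "i \<in> J" "norm (Y n i) \<le> R" using FA(5) by (auto simp: A_def)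
        then have "sqrt (real n) ^ m * \<bar>f n i - g n i\<bar> \<le> e / 3 / B" using elim(4) by blast
        then show "\<bar>f n i - g n i\<bar> \<le> e / 3 / B / sqrt (real n) ^ m"
          unfolding pos_le_divide_eq[OF n] by (simp only: mult.commute)
      qed
      also have "\<dots> = real (card A) * (e / 3 / B / sqrt (real n) ^ m)" by simp
      also have "\<dots> \<le> (B * sqrt (real n) ^ m) * (e / 3 / B / sqrt (real n) ^ m)"
      proof (rule mult_right_mono)
        show "real (card A) \<le> B * sqrt (real n) ^ m"
          unfolding B_def
        proof (rule K(2)[rule_format, OF n1 less_imp_le[OF R(1)] FA(3,5)])
          show "norm (Y n i) \<le> R" if "i \<in> A" for i using that by (simp add: A_def)
        qed
      qed (use e B n in simp)
      also have "\<dots> = e / 3" using n1 B by simp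
      finally have 1: "(\<Sum>i\<in>A. \<bar>f n i - g n i\<bar>) \<le> e / 3" .
      have "(\<Sum>i\<in>T. \<bar>f n i - g n i\<bar>) \<le> (\<Sum>i\<in>T. \<bar>f n i\<bar> + \<bar>g n i\<bar>)"
        by (rule sum_mono) (rule abs_triangle_ineq4)
      also have "\<dots> = (\<Sum>i\<in>T. \<bar>f n i\<bar>) + (\<Sum>i\<in>T. \<bar>g n i\<bar>)" by (rule sum.distrib)
      also have "\<dots> \<le> e / 3 + e / 3"
      proof (rule add_mono)
        show "(\<Sum>i\<in>T. \<bar>f n i\<bar>) \<le> e / 3"
          by (rule elim(1)[rule_format, OF FA(4,6)]) (use R in \<open>simp add: T_def\<close>)
        show "(\<Sum>i\<in>T. \<bar>g n i\<bar>) \<le> e / 3"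
          by (rule elim(2)[rule_format, OF FA(4,6)]) (use R in \<open>simp add: T_def\<close>)
      qed
      finally have 2: "(\<Sum>i\<in>T. \<bar>f n i - g n i\<bar>) \<le> e / 3 + e / 3" .
      have "(\<Sum>i\<in>F. \<bar>f n i - g n i\<bar>) = (\<Sum>i\<in>A. \<bar>f n i - g n i\<bar>) + (\<Sum>i\<in>T. \<bar>f n i - g n i\<bar>)"
        unfolding FA(1) by (rule sum.union_disjoint) (use FA in auto)
      then show "(\<Sum>i\<in>F. \<bar>f n i - g n i\<bar>) \<le> e" using 1 2 by simp
    qed
  qed
qed

text \<open>A power is at most a constant times \<open>exp\<close>, here evaluated at
  \<open>2 * r + 3\<close>; as soon as \<open>r \<ge> 3 / k\<close> the Gaussian is below
  \<open>exp (- 3 * r)\<close>. The product is of order \<open>exp (- r)\<close>, a geometric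
  series.\<close>

lemma summable_poly_gauss:
  assumes "k > (0::real)" shows "summable (\<lambda>r::nat. (2 * (real r + 1) + 1) ^ m * exp (- (k * (real r)\<^sup>2)))"
proof (rule summable_comparison_test)
  have pow: "x ^ m \<le> (real m ^ m + 1) * exp x" if x: "x \<ge> 0" for x :: real
  proof (cases "m = 0")
    case False
    have "x ^ m = real m ^ m * (x / m) ^ m" using False by (simp add: power_divide)
    also have "\<dots> \<le> real m ^ m * (1 + x / m) ^ m" using x by (intro mult_left_mono power_mono) auto
    also have "\<dots> \<le> real m ^ m * exp x"
      using False x by (intro mult_left_mono exp_ge_one_plus_x_over_n_power_n) auto
    also have "\<dots> \<le> (real m ^ m + 1) * exp x" by (simp add: distrib_right)
    finally show ?thesis .
  next
    case True
    then show ?thesis using x one_le_exp_iff[of x] by (simp del: one_le_exp_iff)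
  qed
  show "summable (\<lambda>r. (real m ^ m + 1) * exp 3 * exp (-1) ^ r)"
    by (intro summable_mult summable_geometric) simp
  show "\<exists>N. \<forall>r\<ge>N. norm ((2 * (real r + 1) + 1) ^ m * exp (- (k * (real r)\<^sup>2))) \<le> (real m ^ m + 1) * exp 3 * exp (-1) ^ r"
  proof (intro exI[of _ "nat \<lceil>3 / k\<rceil>"] allI impI)
    fix r assume "nat \<lceil>3 / k\<rceil> \<le> r"
    then have "3 / k \<le> real r" by (simp add: nat_le_iff ceiling_le_iff)
    then have "3 \<le> k * real r" using assms by (simp add: field_simps)
    then have kr: "3 * real r \<le> k * (real r)\<^sup>2" unfolding power2_eq_square mult.assoc[symmetric] by (rule mult_right_mono) simp
    have "norm ((2 * (real r + 1) + 1) ^ m * exp (- (k * (real r)\<^sup>2))) = (2 * (real r + 1) + 1) ^ m * exp (- (k * (real r)\<^sup>2))" by simp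
    also have "\<dots> \<le> ((real m ^ m + 1) * exp (2 * (real r + 1) + 1)) * exp (- (3 * real r))"
      using kr by (intro mult_mono pow) auto
    also have "\<dots> = (real m ^ m + 1) * (exp (2 * (real r + 1) + 1) * exp (- (3 * real r)))" by simp
    also have "exp (2 * (real r + 1) + 1) * exp (- (3 * real r)) = exp (3 + real r * (-1))"
      unfolding exp_add[symmetric] by (simp add: algebra_simps)
    also have "\<dots> = exp 3 * exp (-1) ^ r" unfolding exp_add exp_of_nat_mult ..
    finally show "norm ((2 * (real r + 1) + 1) ^ m * exp (- (k * (real r)\<^sup>2))) \<le> (real m ^ m + 1) * exp 3 * exp (-1) ^ r"
      by simp
  qed
qed

text \<open>The points are sorted into shells by the integer part of their norm. The number of
  points in a shell grows like \<open>sqrt n ^ m\<close>, which cancels the denominator of the bound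
  on \<open>f\<close>; what remains is a convergent series \<open>a\<close> that does not involve
  \<open>n\<close>.\<close>

lemma gaussian_sums:
  assumes Y: "count_bounded Y J m" and k: "k > 0"
    and f: "\<And>n i. n \<ge> 1 \<Longrightarrow> i \<in> J \<Longrightarrow> \<bar>f n i\<bar> \<le> B * exp (- (k * (norm (Y n i))\<^sup>2)) / sqrt (real n) ^ m"
    and B: "B \<ge> 0"
  shows "tight_at f Y J" and "\<exists>M. \<forall>n\<ge>1. \<forall>F. finite F \<longrightarrow> F \<subseteq> J \<longrightarrow> (\<Sum>i\<in>F. \<bar>f n i\<bar>) \<le> M"
proof -
  obtain K where K: "K > 0" "\<forall>n\<ge>1. \<forall>R\<ge>0. \<forall>F. finite F \<longrightarrow> F \<subseteq> J \<longrightarrow> (\<forall>i\<in>F. norm (Y n i) \<le> R) \<longrightarrow>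
     real (card F) \<le> K * (2 * R + 1) ^ m * sqrt (real n) ^ m"
    using Y[unfolded count_bounded_def] by (elim exE conjE)
  define a where "a r = B * K * ((2 * (real r + 1) + 1) ^ m * exp (- (k * (real r)\<^sup>2)))" for r :: nat
  have sa: "summable a" unfolding a_def by (rule summable_mult[OF summable_poly_gauss[OF k]])
  have a0: "a r \<ge> 0" for r using B K(1) by (simp add: a_def)
  have main: "(\<Sum>i\<in>F. \<bar>f n i\<bar>) \<le> (\<Sum>r. a (r + r0))"
    if n: "n \<ge> 1" and F: "finite F" "F \<subseteq> J" "\<forall>i\<in>F. norm (Y n i) \<ge> real r0" for n F r0
  proof -
    \<comment> \<open>Shells are numbered from \<open>r0\<close> on, so that points of norm at least
      \<open>r0\<close> are bounded by the tail of \<open>a\<close> starting there.\<close>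
    define p where "p i = nat \<lfloor>norm (Y n i)\<rfloor> - r0" for i
    have pr: "real (p i + r0) \<le> norm (Y n i) \<and> norm (Y n i) \<le> real (p i + r0) + 1" if "i \<in> F" for i
    proof -
      have "int r0 \<le> \<lfloor>norm (Y n i)\<rfloor>" using F(3) that by (simp add: le_floor_iff)
      then have "int (p i + r0) = \<lfloor>norm (Y n i)\<rfloor>" by (simp add: p_def nat_diff_distrib)
      then have "real (p i + r0) = of_int \<lfloor>norm (Y n i)\<rfloor>" by (metis of_int_of_nat_eq)
      then show ?thesis by linarith
    qed
    have sn: "sqrt (real n) ^ m > 0" using n by simp
    have "(\<Sum>i\<in>F. \<bar>f n i\<bar>) = (\<Sum>r\<in>p ` F. \<Sum>i\<in>{i\<in>F. p i = r}. \<bar>f n i\<bar>)"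
      by (rule sum.image_gen[OF F(1)])
    also have "\<dots> \<le> (\<Sum>r\<in>p ` F. a (r + r0))"
    proof (rule sum_mono)
      fix r assume "r \<in> p ` F"
      let ?A = "{i\<in>F. p i = r}"
      have "(\<Sum>i\<in>?A. \<bar>f n i\<bar>) \<le> (\<Sum>i\<in>?A. B * exp (- (k * (real (r + r0))\<^sup>2)) / sqrt (real n) ^ m)"
      proof (rule sum_mono)
        fix i assume i: "i \<in> ?A"
        then have "(real (r + r0))\<^sup>2 \<le> (norm (Y n i))\<^sup>2" using pr[of i] by (intro power_mono) auto
        then have "B * exp (- (k * (norm (Y n i))\<^sup>2)) \<le> B * exp (- (k * (real (r + r0))\<^sup>2))"
          using k B by (intro mult_left_mono) auto
        then have "B * exp (- (k * (norm (Y n i))\<^sup>2)) / sqrt (real n) ^ m \<le> B * exp (- (k * (real (r + r0))\<^sup>2)) / sqrt (real n) ^ m"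
          using sn by (intro divide_right_mono) auto
        with f[OF n, of i] i F show "\<bar>f n i\<bar> \<le> B * exp (- (k * (real (r + r0))\<^sup>2)) / sqrt (real n) ^ m"
          by auto
      qed
      also have "\<dots> = real (card ?A) * (B * exp (- (k * (real (r + r0))\<^sup>2)) / sqrt (real n) ^ m)" by simp
      also have "\<dots> \<le> (K * (2 * (real (r + r0) + 1) + 1) ^ m * sqrt (real n) ^ m) * (B * exp (- (k * (real (r + r0))\<^sup>2)) / sqrt (real n) ^ m)"
      proof (rule mult_right_mono)
        show "real (card ?A) \<le> K * (2 * (real (r + r0) + 1) + 1) ^ m * sqrt (real n) ^ m"
          by (rule K(2)[rule_format]) (use n F pr in auto)
      qed (use B sn in simp)
      also have "\<dots> = a (r + r0)" using sn n by (simp add: a_def)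
      finally show "(\<Sum>i\<in>?A. \<bar>f n i\<bar>) \<le> a (r + r0)" .
    qed
    also have "\<dots> \<le> (\<Sum>r. a (r + r0))"
      using F(1) a0 sa by (intro sum_le_suminf summable_ignore_initial_segment) auto
    finally show ?thesis .
  qed
  show "\<exists>M. \<forall>n\<ge>1. \<forall>F. finite F \<longrightarrow> F \<subseteq> J \<longrightarrow> (\<Sum>i\<in>F. \<bar>f n i\<bar>) \<le> M"
    using main[of _ _ 0] by auto
  show "tight_at f Y J"
    unfolding tight_at_def
  proof (intro allI impI)
    fix e :: real assume e: "e > 0"
    obtain N where N: "\<And>n. n \<ge> N \<Longrightarrow> norm (\<Sum>r. a (r + n)) < e"
      using suminf_exist_split[OF e sa] by blast
    \<comment> \<open>The successor makes the radius positive, as \<open>tight_at\<close>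
      demands.\<close>
    have "(\<Sum>r. a (r + Suc N)) \<le> e" using N[of "Suc N"] by simp
    then have "\<forall>F. finite F \<longrightarrow> F \<subseteq> J \<longrightarrow> (\<forall>i\<in>F. norm (Y n i) > real (Suc N)) \<longrightarrow> (\<Sum>i\<in>F. \<bar>f n i\<bar>) \<le> e" if "n \<ge> 1" for n
    proof (intro allI impI)
      fix F assume F: "finite F" "F \<subseteq> J" "\<forall>i\<in>F. norm (Y n i) > real (Suc N)"
      have "(\<Sum>i\<in>F. \<bar>f n i\<bar>) \<le> (\<Sum>r. a (r + Suc N))"
        by (rule main[OF that F(1,2)]) (use F(3) in \<open>auto intro: less_imp_le\<close>)
      then show "(\<Sum>i\<in>F. \<bar>f n i\<bar>) \<le> e" using \<open>(\<Sum>r. a (r + Suc N)) \<le> e\<close> by linarith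
    qed
    then show "\<exists>R>0. eventually (\<lambda>n. \<forall>F. finite F \<longrightarrow> F \<subseteq> J \<longrightarrow> (\<forall>i\<in>F. norm (Y n i) > R) \<longrightarrow> (\<Sum>i\<in>F. \<bar>f n i\<bar>) \<le> e) sequentially"
      by (intro exI[of _ "real (Suc N)"] conjI eventually_sequentiallyI[of 1]) auto
  qed
qed

section \<open>Counting lattice points\<close>

lemma card_int_interval_le:
  assumes "r \<ge> 0" shows "real (card {\<lceil>a - r\<rceil>..\<lfloor>a + r\<rfloor>}) \<le> 2 * r + 1"
proof -
  have "real (card {\<lceil>a - r\<rceil>..\<lfloor>a + r\<rfloor>}) = real (nat (\<lfloor>a + r\<rfloor> - \<lceil>a - r\<rceil> + 1))" by simp
  also have "\<dots> \<le> 2 * r + 1"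
  proof (cases "\<lfloor>a + r\<rfloor> - \<lceil>a - r\<rceil> + 1 \<ge> 0")
    case True
    then have "real (nat (\<lfloor>a + r\<rfloor> - \<lceil>a - r\<rceil> + 1)) = of_int (\<lfloor>a + r\<rfloor> - \<lceil>a - r\<rceil> + 1)" by simp
    then show ?thesis by linarith
  qed (use assms in simp)
  finally show ?thesis .
qed

lemma card_lattice_ball:
  fixes a :: "real ^ 'n"
  assumes r: "r \<ge> 0" and F: "finite F" "F \<subseteq> int_lattice" "\<And>w. w \<in> F \<Longrightarrow> norm (w - a) \<le> r"
  shows "real (card F) \<le> (2 * r + 1) ^ CARD('n)"
proof -
  define I where "I i = {\<lceil>a $ i - r\<rceil>..\<lfloor>a $ i + r\<rfloor>}" for i
  define \<phi> where "\<phi> w = (\<lambda>i. \<lfloor>w $ i\<rfloor>)" for w :: "real ^ 'n"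
  have "inj_on \<phi> F"
  proof (rule inj_onI)
    fix v w assume vw: "v \<in> F" "w \<in> F" "\<phi> v = \<phi> w"
    show "v = w"
    proof (rule vec_eq_iff[THEN iffD2], rule allI)
      fix i
      have "v $ i \<in> \<int>" "w $ i \<in> \<int>" using vw F(2) by (auto simp: int_lattice_def)
      moreover have "\<lfloor>v $ i\<rfloor> = \<lfloor>w $ i\<rfloor>" using vw(3) by (simp add: \<phi>_def fun_eq_iff)
      ultimately show "v $ i = w $ i" by (metis floor_of_int Ints_cases)
    qed
  qed
  moreover have "\<phi> ` F \<subseteq> PiE UNIV I"
  proof (intro subsetI, elim imageE)
    fix g w assume w: "w \<in> F" and g: "g = \<phi> w"
    have "\<phi> w i \<in> I i" for i
    proof -
      have "w $ i \<in> \<int>" using w F(2) by (auto simp: int_lattice_def)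
      then obtain j where j: "w $ i = of_int j" by (rule Ints_cases)
      have "\<bar>(w - a) $ i\<bar> \<le> r" using component_le_norm_cart[of "w - a" i] F(3)[OF w] by linarith
      then show ?thesis unfolding I_def \<phi>_def j by (auto simp: ceiling_le_iff le_floor_iff j)
    qed
    then show "g \<in> PiE UNIV I" unfolding g by auto
  qed
  moreover have fI: "finite (PiE UNIV I)" by (rule finite_PiE) (auto simp: I_def)
  ultimately have "card F \<le> card (PiE UNIV I)" by (metis card_image card_mono)
  also have "card (PiE UNIV I) = (\<Prod>i\<in>UNIV. card (I i))" by (rule card_PiE) simp
  finally have "real (card F) \<le> (\<Prod>i\<in>UNIV. real (card (I i)))" by (metis of_nat_le_iff of_nat_prod)
  also have "\<dots> \<le> (\<Prod>i\<in>(UNIV::'n set). 2 * r + 1)"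
    unfolding I_def by (intro prod_mono conjI card_int_interval_le[OF r]) auto
  finally show ?thesis by simp
qed

text \<open>The count is uniform in the centre, so one constant serves arbitrary \<open>a n\<close>;
  this matters because \<open>n zeta\<close> moves with \<open>n\<close>. The inequality
  \<open>2 * R * sqrt n + 1 \<le> (2 * R + 1) * sqrt n\<close> uses
  \<open>n \<ge> 1\<close>.\<close>

lemma count_bounded_lattice:
  fixes a :: "nat \<Rightarrow> real ^ 'n"
  shows "count_bounded (\<lambda>n w. (1 / sqrt (real n)) *\<^sub>R (w - a n)) int_lattice CARD('n)"
  unfolding count_bounded_def
proof (intro exI[of _ 1] conjI allI impI)
  fix n :: nat and R :: real and F :: "(real ^ 'n) set"
  assume n: "1 \<le> n" and R: "0 \<le> R" and F: "finite F" "F \<subseteq> int_lattice"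
    and b: "\<forall>i\<in>F. norm ((1 / sqrt (real n)) *\<^sub>R (i - a n)) \<le> R"
  have sn: "sqrt (real n) \<ge> 1" using n by simp
  have "real (card F) \<le> (2 * (R * sqrt (real n)) + 1) ^ CARD('n)"
  proof (rule card_lattice_ball[OF _ F])
    show "norm (w - a n) \<le> R * sqrt (real n)" if "w \<in> F" for w
    proof -
      have "norm ((1 / sqrt (real n)) *\<^sub>R (w - a n)) \<le> R" using b that by blast
      then show ?thesis unfolding norm_scaleR using n by (simp add: pos_divide_le_eq)
    qed
  qed (use R(1) in simp)
  also have "\<dots> \<le> ((2 * R + 1) * sqrt (real n)) ^ CARD('n)"
    using sn R by (intro power_mono) (auto simp: algebra_simps)
  finally show "real (card F) \<le> 1 * (2 * R + 1) ^ CARD('n) * sqrt (real n) ^ CARD('n)"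
    by (simp add: power_mult_distrib)
qed simp

lemma tight_at_perturb:
  assumes t: "tight_at f Y J" and d: "\<And>n i. i \<in> J \<Longrightarrow> norm (Y n i) \<ge> norm (Y' n i) - D"
  shows "tight_at f Y' J"
  unfolding tight_at_def
proof (intro allI impI)
  fix e :: real assume e: "e > 0"
  obtain R where R: "R > 0" "eventually (\<lambda>n. \<forall>F. finite F \<longrightarrow> F \<subseteq> J \<longrightarrow> (\<forall>i\<in>F. norm (Y n i) > R) \<longrightarrow> (\<Sum>i\<in>F. \<bar>f n i\<bar>) \<le> e) sequentially"
    using t[unfolded tight_at_def, THEN spec, THEN mp, OF e] by (elim exE conjE)
  show "\<exists>R>0. eventually (\<lambda>n. \<forall>F. finite F \<longrightarrow> F \<subseteq> J \<longrightarrow> (\<forall>i\<in>F. norm (Y' n i) > R) \<longrightarrow> (\<Sum>i\<in>F. \<bar>f n i\<bar>) \<le> e) sequentially"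
  proof (intro exI[of _ "R + \<bar>D\<bar>"] conjI)
    show "eventually (\<lambda>n. \<forall>F. finite F \<longrightarrow> F \<subseteq> J \<longrightarrow> (\<forall>i\<in>F. norm (Y' n i) > R + \<bar>D\<bar>) \<longrightarrow> (\<Sum>i\<in>F. \<bar>f n i\<bar>) \<le> e) sequentially"
      using R(2)
    proof eventually_elim
      case (elim n)
      show ?case
      proof (intro allI impI)
        fix F assume F: "finite F" "F \<subseteq> J" "\<forall>i\<in>F. norm (Y' n i) > R + \<bar>D\<bar>"
        have "norm (Y n i) > R" if "i \<in> F" for i
        proof -
          have "norm (Y' n i) > R + \<bar>D\<bar>" "i \<in> J" using F that by auto
          with d[of i n] show ?thesis by linarith
        qed
        then show "(\<Sum>i\<in>F. \<bar>f n i\<bar>) \<le> e" by (intro elim[rule_format] F(1) F(2))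
      qed
    qed
  qed (use R(1) in simp)
qed

lemma vanishing_infsum:
  assumes v: "vanishing f J" and e: "e > 0"
  shows "eventually (\<lambda>n. (\<lambda>i. \<bar>f n i\<bar>) summable_on J \<and> (\<Sum>\<^sub>\<infinity>i\<in>J. \<bar>f n i\<bar>) \<le> e) sequentially"
proof -
  have "eventually (\<lambda>n. \<forall>F. finite F \<longrightarrow> F \<subseteq> J \<longrightarrow> (\<Sum>i\<in>F. \<bar>f n i\<bar>) \<le> e) sequentially"
    by (rule v[unfolded vanishing_def, THEN spec, THEN mp, OF e])
  then show ?thesis
  proof eventually_elim
    case (elim n)
    have s: "(\<lambda>i. \<bar>f n i\<bar>) summable_on J"
      by (rule nonneg_bdd_above_summable_on) (use elim in \<open>auto intro!: bdd_aboveI[of _ e]\<close>)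
    then show ?case using elim by (auto intro!: infsum_le_finite_sums)
  qed
qed

section \<open>Tightness of the walk and the Gaussian profile\<close>

context lattice_walk
begin

abbreviation rescaled :: "nat \<Rightarrow> 'g \<Rightarrow> real ^ 'n" where
  "rescaled n \<gamma> \<equiv> (1 / sqrt (real n)) *\<^sub>R (\<Phi> \<gamma> - real n *\<^sub>R zeta)"

lemma count_bounded_walk: "count_bounded rescaled (carrier G) CARD('n)"
proof -
  obtain K where K: "K > 0" "\<forall>n\<ge>1. \<forall>R\<ge>0. \<forall>F. finite F \<longrightarrow> F \<subseteq> int_lattice \<longrightarrow> (\<forall>w\<in>F. norm ((1 / sqrt (real n)) *\<^sub>R (w - real n *\<^sub>R zeta)) \<le> R) \<longrightarrow>
     real (card F) \<le> K * (2 * R + 1) ^ CARD('n) * sqrt (real n) ^ CARD('n)"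
    using count_bounded_lattice[of "\<lambda>n. real n *\<^sub>R zeta", unfolded count_bounded_def] by (elim exE conjE)
  have "real (card F) \<le> card \<Delta> * K * (2 * R + 1) ^ CARD('n) * sqrt (real n) ^ CARD('n)"
    if n: "n \<ge> 1" and R: "R \<ge> 0" and F: "finite F" "F \<subseteq> carrier G" "\<forall>\<gamma>\<in>F. norm (rescaled n \<gamma>) \<le> R" for n R F
  proof -
    have "F = (\<Union>x\<in>\<Delta>. {\<gamma>\<in>F. rep \<gamma> = x})" using F(2) rep_D by auto
    then have "card F = card (\<Union>x\<in>\<Delta>. {\<gamma>\<in>F. rep \<gamma> = x})" by (rule arg_cong)
    also have "\<dots> \<le> (\<Sum>x\<in>\<Delta>. card {\<gamma>\<in>F. rep \<gamma> = x})" by (rule card_UN_le[OF finite_D])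
    finally have "real (card F) \<le> (\<Sum>x\<in>\<Delta>. real (card {\<gamma>\<in>F. rep \<gamma> = x}))"
      by (simp only: of_nat_le_iff of_nat_sum[symmetric])
    also have "\<dots> \<le> (\<Sum>x\<in>\<Delta>. K * (2 * R + 1) ^ CARD('n) * sqrt (real n) ^ CARD('n))"
    proof (rule sum_mono)
      fix x
      let ?A = "{\<gamma>\<in>F. rep \<gamma> = x}"
      have inj: "inj_on \<Phi> ?A"
      proof (rule inj_onI)
        fix a b assume "a \<in> ?A" "b \<in> ?A" and eq: "\<Phi> a = \<Phi> b"
        then have ab: "a \<in> F" "b \<in> F" and rep: "rep a = rep b" by simp_all
        from ab F(2) have "a \<in> carrier G" "b \<in> carrier G" by blast+
        from coord_rep_inj[OF this eq rep] show "a = b" .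
      qed
      have "real (card (\<Phi> ` ?A)) \<le> K * (2 * R + 1) ^ CARD('n) * sqrt (real n) ^ CARD('n)"
      proof (rule K(2)[rule_format, OF n R])
        show "finite (\<Phi> ` ?A)" using F(1) by simp
        show "\<Phi> ` ?A \<subseteq> int_lattice" using F(2) coord_lattice by blast
        show "norm ((1 / sqrt (real n)) *\<^sub>R (w - real n *\<^sub>R zeta)) \<le> R" if "w \<in> \<Phi> ` ?A" for w using that F(3) by blast
      qed
      then show "real (card ?A) \<le> K * (2 * R + 1) ^ CARD('n) * sqrt (real n) ^ CARD('n)"
        by (simp only: card_image[OF inj])
    qed
    also have "\<dots> = card \<Delta> * K * (2 * R + 1) ^ CARD('n) * sqrt (real n) ^ CARD('n)" by simp
    finally show ?thesis .
  qed
  moreover have "real (card \<Delta>) * K > 0" using K(1) D_nonempty by simp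
  ultimately show ?thesis unfolding count_bounded_def
    by (intro exI[of _ "real (card \<Delta>) * K"] conjI allI impI)
qed

text \<open>The increments of \<open>Dv\<close> are centred given the past, so the mixed term
  vanishes and every step adds at most \<open>K\<close>, a bound for the conditional variances at
  the vertices. Adding \<open>f \<one>\<close> lets the martingale start at 0. Nonnegative integrals
  make the induction run without knowing integrability beforehand.\<close>

lemma second_moment_bound:
  assumes f: "corrector f"
  shows "\<exists>K>0. \<forall>n. (\<integral>\<^sup>+s. ennreal ((norm (\<Phi> s - f s + f \<one> - real n *\<^sub>R zeta))\<^sup>2) \<partial>conv n) \<le> ennreal (real n * K)"
proof -
  have Lf: "Linv f" using f by (simp add: corrector_def)
  define V where "V \<gamma> = measure_pmf.expectation \<nu> (\<lambda>b. (norm (cincr f \<gamma> b - zeta))\<^sup>2)" for \<gamma>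
  have "Linv V"
    using Linv_cincr[OF Lf] unfolding Linv_def V_def
    by (auto intro!: integral_cong_AE simp: AE_measure_pmf_iff)
  then obtain K where K: "K > 0" "\<forall>\<gamma>\<in>carrier G. norm (V \<gamma>) \<le> K" using Linv_bounded by blast
  define Dv where "Dv n s = \<Phi> s - f s + f \<one> - real n *\<^sub>R zeta" for n :: nat and s
  have step: "(\<integral>\<^sup>+b. ennreal ((norm (Dv (Suc n) (a \<otimes> b)))\<^sup>2) \<partial>\<nu>) \<le> ennreal ((norm (Dv n a))\<^sup>2) + ennreal K"
    if a: "a \<in> carrier G" for a n
  proof -
    define \<xi> where "\<xi> b = cincr f a b - zeta" for b
    have D: "Dv (Suc n) (a \<otimes> b) = Dv n a + \<xi> b" for b
      by (simp add: Dv_def \<xi>_def cincr_def incr_def algebra_simps)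
    have i1: "integrable \<nu> \<xi>" unfolding \<xi>_def using cincr_integrable[OF Lf a] by simp
    have i2: "integrable \<nu> (\<lambda>b. (norm (\<xi> b))\<^sup>2)" unfolding \<xi>_def by (rule cincr_square_integrable[OF Lf a])
    have E: "measure_pmf.expectation \<nu> \<xi> = 0"
      unfolding \<xi>_def using cincr_integrable[OF Lf a] f a by (simp add: corrector_def)
    have e: "(norm (Dv n a + \<xi> b))\<^sup>2 = (norm (Dv n a))\<^sup>2 + 2 * (Dv n a \<bullet> \<xi> b) + (norm (\<xi> b))\<^sup>2" for b
      unfolding power2_norm_eq_inner by (simp add: inner_add_left inner_add_right inner_commute)
    have i3: "integrable \<nu> (\<lambda>b. 2 * (Dv n a \<bullet> \<xi> b))" using i1 by simp
    have "(\<integral>\<^sup>+b. ennreal ((norm (Dv (Suc n) (a \<otimes> b)))\<^sup>2) \<partial>\<nu>) = ennreal (measure_pmf.expectation \<nu> (\<lambda>b. (norm (Dv n a + \<xi> b))\<^sup>2))"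
    proof -
      have "integrable \<nu> (\<lambda>b. (norm (Dv n a + \<xi> b))\<^sup>2)"
        unfolding e by (intro Bochner_Integration.integrable_add i2 i3) simp
      then show ?thesis unfolding D by (rule nn_integral_eq_integral) simp
    qed
    also have "measure_pmf.expectation \<nu> (\<lambda>b. (norm (Dv n a + \<xi> b))\<^sup>2) = (norm (Dv n a))\<^sup>2 + 2 * (Dv n a \<bullet> measure_pmf.expectation \<nu> \<xi>) + V a"
      unfolding e using i1 i2 i3 by (simp add: V_def \<xi>_def[symmetric] integral_inner_right)
    also have "\<dots> \<le> (norm (Dv n a))\<^sup>2 + K" using K(2) a E by auto
    finally show ?thesis using K(1) by (simp add: ennreal_plus[symmetric] ennreal_leI del: ennreal_plus)
  qed
  have "(\<integral>\<^sup>+s. ennreal ((norm (Dv n s))\<^sup>2) \<partial>conv n) \<le> ennreal (real n * K)" for n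
  proof (induction n)
    case 0 then show ?case by (simp add: Dv_def)
  next
    case (Suc n)
    have "(\<integral>\<^sup>+s. ennreal ((norm (Dv (Suc n) s))\<^sup>2) \<partial>conv (Suc n)) = (\<integral>\<^sup>+a. \<integral>\<^sup>+b. ennreal ((norm (Dv (Suc n) (a \<otimes> b)))\<^sup>2) \<partial>\<nu> \<partial>conv n)"
      by (simp add: nn_integral_pair_pmf')
    also have "\<dots> \<le> (\<integral>\<^sup>+a. ennreal ((norm (Dv n a))\<^sup>2) + ennreal K \<partial>conv n)"
      by (rule nn_integral_mono_AE) (auto simp: AE_measure_pmf_iff intro!: step set_conv_carrier)
    also have "\<dots> = (\<integral>\<^sup>+a. ennreal ((norm (Dv n a))\<^sup>2) \<partial>conv n) + ennreal K"
      by (subst nn_integral_add) auto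
    also have "\<dots> \<le> ennreal (real n * K) + ennreal K" using Suc.IH by (rule add_right_mono)
    also have "\<dots> = ennreal (real (Suc n) * K)" using K(1) by (simp add: ennreal_plus[symmetric] distrib_right add.commute del: ennreal_plus)
    finally show ?case .
  qed
  then show ?thesis using K(1) unfolding Dv_def by blast
qed

text \<open>Chebyshev's inequality for the martingale, with \<open>R^2 = K / e\<close>; the
  corrector is bounded, so passing from the martingale to the coordinate is a bounded
  perturbation.\<close>

lemma tight_walk: "tight_at (\<lambda>n. pmf (conv n)) rescaled (carrier G)"
proof -
  obtain f where f: "corrector f" using ex_corrector by blast
  have Lf: "Linv f" using f by (simp add: corrector_def)
  obtain M where M: "M > 0" "\<forall>\<gamma>\<in>carrier G. norm (f \<gamma>) \<le> M" using Linv_bounded[OF Lf] by blast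
  obtain K where K: "K > 0" "\<forall>n. (\<integral>\<^sup>+s. ennreal ((norm (\<Phi> s - f s + f \<one> - real n *\<^sub>R zeta))\<^sup>2) \<partial>conv n) \<le> ennreal (real n * K)"
    using second_moment_bound[OF f] by (elim exE conjE)
  define Y' where "Y' n s = (1 / sqrt (real n)) *\<^sub>R (\<Phi> s - f s + f \<one> - real n *\<^sub>R zeta)" for n :: nat and s
  have "tight_at (\<lambda>n. pmf (conv n)) Y' (carrier G)"
    unfolding tight_at_def
  proof (intro allI impI)
    fix e :: real assume e: "e > 0"
    define R where "R = sqrt (K / e)"
    have R: "R > 0" "R\<^sup>2 = K / e" using e K(1) by (auto simp: R_def)
    have "(\<Sum>i\<in>F. \<bar>pmf (conv n) i\<bar>) \<le> e"
      if n: "n \<ge> 1" and F: "finite F" "\<forall>i\<in>F. norm (Y' n i) > R" for n F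
    proof -
      have b: "real n * R\<^sup>2 \<le> (norm (\<Phi> s - f s + f \<one> - real n *\<^sub>R zeta))\<^sup>2" if "s \<in> F" for s
      proof -
        have "R \<le> norm (\<Phi> s - f s + f \<one> - real n *\<^sub>R zeta) / sqrt (real n)" using F(2) that by (auto simp: Y'_def intro: less_imp_le)
        then have "R * sqrt (real n) \<le> norm (\<Phi> s - f s + f \<one> - real n *\<^sub>R zeta)" using n by (simp add: pos_le_divide_eq)
        then have "(R * sqrt (real n))\<^sup>2 \<le> (norm (\<Phi> s - f s + f \<one> - real n *\<^sub>R zeta))\<^sup>2" using R by (intro power_mono) auto
        then show ?thesis by (simp add: power_mult_distrib mult.commute)
      qed
      have "ennreal (real n * R\<^sup>2) * emeasure (conv n) F = (\<integral>\<^sup>+s. ennreal (real n * R\<^sup>2) * indicator F s \<partial>conv n)"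
        by (rule nn_integral_cmult_indicator[symmetric]) simp
      also have "\<dots> \<le> (\<integral>\<^sup>+s. ennreal ((norm (\<Phi> s - f s + f \<one> - real n *\<^sub>R zeta))\<^sup>2) \<partial>conv n)"
        by (rule nn_integral_mono) (auto simp: indicator_def intro!: ennreal_leI b)
      also have "\<dots> \<le> ennreal (real n * K)" using K(2) by blast
      finally have h: "ennreal (real n * R\<^sup>2) * emeasure (conv n) F \<le> ennreal (real n * K)" .
      have "emeasure (conv n) F = ennreal (\<Sum>i\<in>F. pmf (conv n) i)"
        using F(1) by (simp add: measure_pmf.emeasure_eq_measure measure_measure_pmf_finite)
      moreover have "0 \<le> (\<Sum>i\<in>F. pmf (conv n) i)" by (simp add: sum_nonneg)
      ultimately have "ennreal (real n * R\<^sup>2 * (\<Sum>i\<in>F. pmf (conv n) i)) \<le> ennreal (real n * K)"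
        using h by (simp only: ennreal_mult'')
      then have "real n * R\<^sup>2 * (\<Sum>i\<in>F. pmf (conv n) i) \<le> real n * K" using K(1) by (simp add: ennreal_le_iff)
      then have "real n * K * (\<Sum>i\<in>F. pmf (conv n) i) \<le> real n * K * e" using e unfolding R(2) by (simp add: field_simps)
      then show ?thesis using n K(1) by simp
    qed
    then show "\<exists>R>0. eventually (\<lambda>n. \<forall>F. finite F \<longrightarrow> F \<subseteq> carrier G \<longrightarrow> (\<forall>i\<in>F. norm (Y' n i) > R) \<longrightarrow> (\<Sum>i\<in>F. \<bar>pmf (conv n) i\<bar>) \<le> e) sequentially"
      using R(1) by (intro exI[of _ R] conjI eventually_sequentiallyI[of 1]) auto
  qed
  then show ?thesis
  proof (rule tight_at_perturb)
    fix n i assume i: "i \<in> carrier G"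
    have "norm (f i - f \<one>) \<le> 2 * M" using bspec[OF M(2) i] bspec[OF M(2) one_closed] norm_triangle_ineq4[of "f i" "f \<one>"] by linarith
    moreover have "(1 / sqrt (real n)) \<le> 1" by (cases n) auto
    ultimately have "(1 / sqrt (real n)) * norm (f i - f \<one>) \<le> 1 * (2 * M)" by (intro mult_mono) auto
    then have "norm ((1 / sqrt (real n)) *\<^sub>R (f i - f \<one>)) \<le> 2 * M" by simp
    moreover have eq: "rescaled n i = Y' n i + (1 / sqrt (real n)) *\<^sub>R (f i - f \<one>)"
      unfolding Y'_def scaleR_add_right[symmetric] by (simp add: algebra_simps)
    moreover have "norm (rescaled n i) \<le> norm (Y' n i) + norm ((1 / sqrt (real n)) *\<^sub>R (f i - f \<one>))"
      unfolding eq by (rule norm_triangle_ineq)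
    ultimately show "norm (Y' n i) \<ge> norm (rescaled n i) - 2 * M" by linarith
  qed
qed

definition cov_inv :: "('g \<Rightarrow> real ^ 'n) \<Rightarrow> real ^ 'n \<Rightarrow> real ^ 'n" where
  "cov_inv f = inv_into UNIV (cov_map f)"

text \<open>The Gaussian with the inverse covariance in the exponent and value 1 at the origin; all
  prefactors are kept apart from it.\<close>

definition gauss_profile :: "('g \<Rightarrow> real ^ 'n) \<Rightarrow> real ^ 'n \<Rightarrow> real" where
  "gauss_profile f y = exp (- (cov_inv f y \<bullet> y) / 2)"

lemma cov_map_bij: assumes f: "corrector f"
  shows "linear (cov_inv f)" "cov_map f (cov_inv f y) = y" "cov_inv f (cov_map f z) = z"
proof -
  have Lf: "Linv f" using f by (simp add: corrector_def)
  obtain c where c: "c > 0" "\<forall>t. cov f t t \<ge> c * (norm t)\<^sup>2" using cov_pos_def[OF f] by (elim exE conjE)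
  note lin = linear_cov_map[OF Lf]
  have inj: "inj (cov_map f)"
    unfolding linear_injective_0[OF lin]
  proof (intro allI impI)
    fix x assume "cov_map f x = 0"
    then have "cov f x x = 0" using inner_cov_map[OF Lf, of x x] by simp
    then have "c * (norm x)\<^sup>2 \<le> 0" using c(2) by metis
    then show "x = 0" using c(1) by (simp add: mult_le_0_iff)
  qed
  have surj: "surj (cov_map f)" by (rule linear_inj_imp_surj[OF lin inj])
  show "cov_map f (cov_inv f y) = y" unfolding cov_inv_def by (rule surj_f_inv_f[OF surj])
  show "cov_inv f (cov_map f z) = z" unfolding cov_inv_def by (rule inv_f_f[OF inj])
  show "linear (cov_inv f)" unfolding cov_inv_def
    by (rule inj_linear_imp_inv_linear[OF lin inj])
qed

lemma gauss_profile_cov_map: assumes f: "corrector f" shows "gauss_profile f (cov_map f z) = exp (- (z \<bullet> cov_map f z) / 2)"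
  by (simp add: gauss_profile_def cov_map_bij[OF f])

lemma gauss_profile_continuous: assumes f: "corrector f" shows "continuous_on UNIV (gauss_profile f)"
proof -
  have "continuous_on UNIV (cov_inv f)"
    using cov_map_bij(1)[OF f] by (simp add: linear_continuous_on linear_conv_bounded_linear)
  then show ?thesis unfolding gauss_profile_def by (intro continuous_intros) auto
qed

text \<open>For \<open>y = cov_map f z\<close> the exponent is half of \<open>cov f z z\<close>,
  hence at least \<open>c / 2\<close> times the square of \<open>norm z\<close>, and
  \<open>norm z \<ge> norm y / B\<close>.\<close>

lemma gauss_profile_bound: assumes f: "corrector f"
  shows "\<exists>k>0. \<forall>y. gauss_profile f y \<le> exp (- (k * (norm y)\<^sup>2))"
proof -
  have Lf: "Linv f" using f by (simp add: corrector_def)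
  obtain c where c: "c > 0" "\<forall>t. cov f t t \<ge> c * (norm t)\<^sup>2" using cov_pos_def[OF f] by (elim exE conjE)
  obtain B where B: "B > 0" "\<And>x. norm (cov_map f x) \<le> B * norm x"
    using linear_bounded_pos[OF linear_cov_map[OF Lf]] by blast
  have "gauss_profile f y \<le> exp (- (c / (2 * B\<^sup>2) * (norm y)\<^sup>2))" for y
  proof -
    define z where "z = cov_inv f y"
    have y: "cov_map f z = y" by (simp add: z_def cov_map_bij[OF f])
    have "norm y \<le> B * norm z" using B(2)[of z] by (simp add: y)
    then have "(norm y)\<^sup>2 \<le> (B * norm z)\<^sup>2" by (rule power_mono) simp
    then have "(norm y)\<^sup>2 / B\<^sup>2 \<le> (norm z)\<^sup>2" using B(1) by (simp add: power_mult_distrib pos_divide_le_eq mult.commute)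
    then have "c * ((norm y)\<^sup>2 / B\<^sup>2) \<le> c * (norm z)\<^sup>2" using c(1) by (intro mult_left_mono) auto
    also have "\<dots> \<le> cov f z z" using c(2) by blast
    also have "\<dots> = z \<bullet> y" using inner_cov_map[OF Lf, of z z] by (simp add: y)
    finally show ?thesis unfolding gauss_profile_def z_def[symmetric] by simp
  qed
  moreover have "c / (2 * B\<^sup>2) > 0" using c(1) B(1) by simp
  ultimately show ?thesis by blast
qed

end

lemma infsum_vanishing_diff:
  fixes f g :: "nat \<Rightarrow> 'i \<Rightarrow> real"
  assumes v: "vanishing (\<lambda>n i. f n i - g n i) J" and f: "\<And>n. n \<ge> 1 \<Longrightarrow> f n summable_on J" and g: "\<And>n. n \<ge> 1 \<Longrightarrow> g n summable_on J"
  shows "(\<lambda>n. infsum (f n) J - infsum (g n) J) \<longlonglongrightarrow> 0"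
  unfolding LIMSEQ_iff
proof (intro allI impI)
  fix e :: real assume e: "e > 0"
  then have e2: "e / 2 > 0" by simp
  from vanishing_infsum[OF v e2] obtain n0 where
    n0: "\<And>n. n \<ge> n0 \<Longrightarrow> (\<lambda>i. \<bar>f n i - g n i\<bar>) summable_on J \<and> (\<Sum>\<^sub>\<infinity>i\<in>J. \<bar>f n i - g n i\<bar>) \<le> e / 2"
    by (auto simp: eventually_sequentially)
  have "norm (infsum (f n) J - infsum (g n) J - 0) < e" if n: "n \<ge> max 1 n0" for n
  proof -
    have "infsum (f n) J - infsum (g n) J = (\<Sum>\<^sub>\<infinity>i\<in>J. f n i - g n i)"
    proof -
      have "(\<Sum>\<^sub>\<infinity>i\<in>J. f n i + - g n i) = infsum (f n) J + (\<Sum>\<^sub>\<infinity>i\<in>J. - g n i)"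
        by (rule infsum_add) (use n f g in \<open>auto simp: summable_on_uminus\<close>)
      then show ?thesis by (simp add: infsum_uminus)
    qed
    also have "norm \<dots> \<le> (\<Sum>\<^sub>\<infinity>i\<in>J. norm (f n i - g n i))"
      by (rule norm_infsum_bound) (use n0[of n] n in auto)
    also have "\<dots> \<le> e / 2" using n0[of n] n by simp
    finally show ?thesis using e by simp
  qed
  then show "\<exists>no. \<forall>n\<ge>no. norm (infsum (f n) J - infsum (g n) J - 0) < e" by (intro exI[of _ "max 1 n0"]) auto
qed

lemma tv_norm_vanishing:
  assumes v: "vanishing f (carrier G)"
  shows "(\<lambda>n. tv_norm G (f n)) \<longlonglongrightarrow> 0"
proof (rule order_tendstoI)
  fix a :: ennreal assume "0 < a"
  then obtain b where b: "0 < b" "b < a" using dense by blast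
  obtain e where e: "b = ennreal e" "e > 0" using b by (cases b) (auto simp: top_unique)
  have "eventually (\<lambda>n. \<forall>F. finite F \<longrightarrow> F \<subseteq> carrier G \<longrightarrow> (\<Sum>i\<in>F. \<bar>f n i\<bar>) \<le> e) sequentially"
    by (rule v[unfolded vanishing_def, THEN spec, THEN mp, OF e(2)])
  then show "eventually (\<lambda>n. tv_norm G (f n) < a) sequentially"
  proof eventually_elim
    case (elim n)
    have "(\<Sum>\<^sub>\<infinity>\<gamma>\<in>carrier G. ennreal \<bar>f n \<gamma>\<bar>) \<le> ennreal e"
    proof (rule infsum_le_finite_sums)
      show "(\<lambda>\<gamma>. ennreal \<bar>f n \<gamma>\<bar>) summable_on carrier G" by (rule nonneg_summable_on_complete) simp
      show "sum (\<lambda>\<gamma>. ennreal \<bar>f n \<gamma>\<bar>) F \<le> ennreal e" if "finite F" "F \<subseteq> carrier G" for F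
        using elim that by (simp add: sum_ennreal ennreal_leI)
    qed
    then have "tv_norm G (f n) \<le> ennreal e / 2" unfolding tv_norm_def by (rule divide_right_mono_ennreal)
    also have "\<dots> \<le> ennreal e"
      using e(2) by (simp add: divide_ennreal[of e 2, simplified] ennreal_leI)
    also have "\<dots> < a" using b e by simp
    finally show ?case .
  qed
qed simp

section \<open>Gaussian sums over the lattice and over the group\<close>

context lattice_walk
begin

lemma gauss_profile_summable:
  assumes f: "corrector f" and Y: "count_bounded Y J CARD('n)"
  shows "\<And>n. n \<ge> 1 \<Longrightarrow> (\<lambda>i. gauss_profile f (Y n i)) summable_on J"
    and "C \<ge> 0 \<Longrightarrow> tight_at (\<lambda>n i. C / sqrt (real n) ^ CARD('n) * gauss_profile f (Y n i)) Y J"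
proof -
  obtain k where k: "k > 0" "\<forall>y. gauss_profile f y \<le> exp (- (k * (norm y)\<^sup>2))" using gauss_profile_bound[OF f] by (elim exE conjE)
  have gq0: "gauss_profile f y \<ge> 0" for y by (simp add: gauss_profile_def)
  have b: "\<bar>C / sqrt (real n) ^ CARD('n) * gauss_profile f (Y n i)\<bar> \<le> C * exp (- (k * (norm (Y n i))\<^sup>2)) / sqrt (real n) ^ CARD('n)"
    if "n \<ge> 1" "C \<ge> 0" for n i C
  proof -
    have "C * gauss_profile f (Y n i) \<le> C * exp (- (k * (norm (Y n i))\<^sup>2))" using k(2) that(2) by (intro mult_left_mono) auto
    then have "C * gauss_profile f (Y n i) / sqrt (real n) ^ CARD('n) \<le> C * exp (- (k * (norm (Y n i))\<^sup>2)) / sqrt (real n) ^ CARD('n)"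
      by (rule divide_right_mono) simp
    then show ?thesis using that gq0 by simp
  qed
  show "tight_at (\<lambda>n i. C / sqrt (real n) ^ CARD('n) * gauss_profile f (Y n i)) Y J" if "C \<ge> 0"
    by (rule gaussian_sums(1)[OF Y k(1)]) (use b that in auto)
  fix n :: nat assume n: "n \<ge> 1"
  obtain M where M: "\<forall>n\<ge>1. \<forall>F. finite F \<longrightarrow> F \<subseteq> J \<longrightarrow> (\<Sum>i\<in>F. \<bar>1 / sqrt (real n) ^ CARD('n) * gauss_profile f (Y n i)\<bar>) \<le> M"
    using gaussian_sums(2)[OF Y k(1), of "\<lambda>n i. 1 / sqrt (real n) ^ CARD('n) * gauss_profile f (Y n i)" 1] b[of _ 1] by auto
  have sn: "sqrt (real n) ^ CARD('n) > 0" using n by simp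
  have "(\<lambda>i. 1 / sqrt (real n) ^ CARD('n) * gauss_profile f (Y n i)) summable_on J"
  proof (rule nonneg_bdd_above_summable_on)
    show "bdd_above (sum (\<lambda>i. 1 / sqrt (real n) ^ CARD('n) * gauss_profile f (Y n i)) ` {F. F \<subseteq> J \<and> finite F})"
    proof (rule bdd_aboveI[of _ M])
      fix x assume "x \<in> sum (\<lambda>i. 1 / sqrt (real n) ^ CARD('n) * gauss_profile f (Y n i)) ` {F. F \<subseteq> J \<and> finite F}"
      then obtain F where F: "finite F" "F \<subseteq> J" "x = (\<Sum>i\<in>F. 1 / sqrt (real n) ^ CARD('n) * gauss_profile f (Y n i))" by auto
      have "x \<le> (\<Sum>i\<in>F. \<bar>1 / sqrt (real n) ^ CARD('n) * gauss_profile f (Y n i)\<bar>)" unfolding F(3) by (rule sum_mono) (rule abs_ge_self)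
      also have "\<dots> \<le> M" using M n F(1,2) by blast
      finally show "x \<le> M" .
    qed
  qed (use gq0 in simp)
  then have "(\<lambda>i. sqrt (real n) ^ CARD('n) * (1 / sqrt (real n) ^ CARD('n) * gauss_profile f (Y n i))) summable_on J"
    by (rule summable_on_cmult_right)
  then show "(\<lambda>i. gauss_profile f (Y n i)) summable_on J" using n by simp
qed

abbreviation gauss_sum :: "('g \<Rightarrow> real ^ 'n) \<Rightarrow> nat \<Rightarrow> real" where
  "gauss_sum f n \<equiv> (\<Sum>\<^sub>\<infinity>w\<in>int_lattice. gauss_profile f ((1 / sqrt (real n)) *\<^sub>R w))"

lemma bij_rep_coord: "bij_betw (\<lambda>\<gamma>. (rep \<gamma>, \<Phi> \<gamma>)) (carrier G) (\<Delta> \<times> int_lattice)"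
proof (rule bij_betwI')
  fix a b assume "a \<in> carrier G" "b \<in> carrier G"
  then show "((rep a, \<Phi> a) = (rep b, \<Phi> b)) = (a = b)" using coord_rep_inj[of a b] by auto
next
  fix a assume "a \<in> carrier G" then show "(rep a, \<Phi> a) \<in> \<Delta> \<times> int_lattice" by (simp add: rep_D coord_lattice)
next
  fix z assume "z \<in> \<Delta> \<times> (int_lattice :: (real ^ 'n) set)"
  then obtain x w where z: "z = (x, w)" "x \<in> \<Delta>" "w \<in> int_lattice" by auto
  obtain v where v: "v \<in> \<Lambda>" "\<iota> v = w" using iota_surj[OF z(3)] by blast
  show "\<exists>a\<in>carrier G. z = (rep a, \<Phi> a)"
    by (rule bexI[of _ "v \<otimes> x"]) (use v z in \<open>auto simp: rep_mult coord_L_mult coord_D\<close>)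
qed

text \<open>Every lattice point is the coordinate of exactly one element in each coset, hence the
  factor \<open>card \<Delta>\<close>.\<close>

lemma infsum_coord:
  fixes h :: "real ^ 'n \<Rightarrow> real"
  assumes h: "h summable_on int_lattice" and h0: "\<And>w. h w \<ge> 0"
  shows "(\<Sum>\<^sub>\<infinity>\<gamma>\<in>carrier G. h (\<Phi> \<gamma>)) = card \<Delta> * (\<Sum>\<^sub>\<infinity>w\<in>int_lattice. h w)"
proof -
  have "(\<Sum>\<^sub>\<infinity>\<gamma>\<in>carrier G. h (\<Phi> \<gamma>)) = (\<Sum>\<^sub>\<infinity>\<gamma>\<in>carrier G. (\<lambda>(x, w). h w) (rep \<gamma>, \<Phi> \<gamma>))" by simp
  also have "\<dots> = (\<Sum>\<^sub>\<infinity>(x, w)\<in>\<Delta> \<times> int_lattice. h w)"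
    by (rule infsum_reindex_bij_betw[OF bij_rep_coord])
  also have "\<dots> = (\<Sum>\<^sub>\<infinity>x\<in>\<Delta>. \<Sum>\<^sub>\<infinity>w\<in>int_lattice. h w)"
  proof (rule infsum_Sigma'_banach[symmetric])
    show "(\<lambda>(x, w). h w) summable_on \<Delta> \<times> int_lattice"
    proof (rule summable_on_SigmaI[where g="\<lambda>_. infsum h int_lattice"])
      show "((\<lambda>w. case (x, w) of (x, w) \<Rightarrow> h w) has_sum infsum h int_lattice) int_lattice" for x
        using has_sum_infsum[OF h] by simp
    qed (use finite_D h0 in auto)
  qed
  also have "\<dots> = card \<Delta> * (\<Sum>\<^sub>\<infinity>w\<in>int_lattice. h w)" using finite_D by simp
  finally show ?thesis .
qed

text \<open>The centre \<open>n zeta\<close> is not a lattice point in general; shifting by its integer part leaves a bounded shift.\<close>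

lemma shifted_gaussian_sum:
  assumes f: "corrector f"
  shows "(\<lambda>n. ((\<Sum>\<^sub>\<infinity>w\<in>int_lattice. gauss_profile f ((1 / sqrt (real n)) *\<^sub>R (w - real n *\<^sub>R zeta))) - gauss_sum f n) / sqrt (real n) ^ CARD('n)) \<longlonglongrightarrow> 0"
proof -
  define k where "k n = (\<chi> i. of_int \<lfloor>(real n *\<^sub>R zeta) $ i\<rfloor> :: real ^ 'n)" for n :: nat
  define r where "r n = real n *\<^sub>R zeta - k n" for n
  have kl: "k n \<in> int_lattice" for n by (simp add: k_def int_lattice_def)
  \<comment> \<open>Each coordinate of \<open>r n\<close> is a fractional part, so the l1 norm is at
    most the dimension.\<close>
  have r1: "norm (r n) \<le> real CARD('n)" for n
  proof -
    have "norm (r n) \<le> (\<Sum>i\<in>UNIV. \<bar>r n $ i\<bar>)" by (rule norm_le_l1_cart)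
    also have "\<dots> \<le> (\<Sum>i\<in>(UNIV::'n set). 1)"
      by (rule sum_mono) (simp add: r_def k_def, linarith)
    finally show ?thesis by simp
  qed
  have shift: "(\<Sum>\<^sub>\<infinity>w\<in>int_lattice. gauss_profile f ((1 / sqrt (real n)) *\<^sub>R (w - real n *\<^sub>R zeta))) = (\<Sum>\<^sub>\<infinity>w\<in>int_lattice. gauss_profile f ((1 / sqrt (real n)) *\<^sub>R (w - r n)))" for n
  proof -
    have "bij_betw (\<lambda>w. w + k n) int_lattice int_lattice"
      by (rule bij_betw_byWitness[where f'="\<lambda>w. w - k n"]) (use kl[of n] in \<open>auto simp: int_lattice_def\<close>)
    from infsum_reindex_bij_betw[OF this, of "\<lambda>w. gauss_profile f ((1 / sqrt (real n)) *\<^sub>R (w - real n *\<^sub>R zeta))"]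
    show ?thesis by (simp add: r_def algebra_simps)
  qed
  define Y where "Y n w = (1 / sqrt (real n)) *\<^sub>R (w - 0)" for n :: nat and w :: "real ^ 'n"
  define Z where "Z n w = (1 / sqrt (real n)) *\<^sub>R (w - r n)" for n :: nat and w :: "real ^ 'n"
  have cY: "count_bounded Y int_lattice CARD('n)" unfolding Y_def[abs_def] by (rule count_bounded_lattice)
  have cZ: "count_bounded Z int_lattice CARD('n)" unfolding Z_def[abs_def] by (rule count_bounded_lattice)
  have YZ: "norm (Y n w - Z n w) \<le> real CARD('n) * (1 / sqrt (real n))" for n w
  proof -
    have "Y n w - Z n w = (1 / sqrt (real n)) *\<^sub>R r n" by (simp add: Y_def Z_def scaleR_diff_right)
    then show ?thesis using r1[of n] by (simp add: divide_right_mono)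
  qed
  have inv1: "1 / sqrt (real n) \<le> 1" for n by (cases n) auto
  have v: "vanishing (\<lambda>n w. 1 / sqrt (real n) ^ CARD('n) * gauss_profile f (Z n w) - 1 / sqrt (real n) ^ CARD('n) * gauss_profile f (Y n w)) int_lattice"
  proof (rule vanishing_diff[OF cY])
    show "tight_at (\<lambda>n w. 1 / sqrt (real n) ^ CARD('n) * gauss_profile f (Y n w)) Y int_lattice"
      by (rule gauss_profile_summable(2)[OF f cY]) simp
    show "tight_at (\<lambda>n w. 1 / sqrt (real n) ^ CARD('n) * gauss_profile f (Z n w)) Y int_lattice"
    proof (rule tight_at_perturb)
      show "tight_at (\<lambda>n w. 1 / sqrt (real n) ^ CARD('n) * gauss_profile f (Z n w)) Z int_lattice"
        by (rule gauss_profile_summable(2)[OF f cZ]) simp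
      fix n w
      have "real CARD('n) * (1 / sqrt (real n)) \<le> real CARD('n) * 1" using inv1[of n] by (intro mult_left_mono) auto
      with YZ[of n w] norm_triangle_ineq2[of "Y n w" "Z n w"]
      show "norm (Z n w) \<ge> norm (Y n w) - real CARD('n)" by linarith
    qed
    fix R e :: real assume R: "R > 0" and e: "e > 0"
    \<comment> \<open>The ball is enlarged by the size of the shift so that it contains
      \<open>Z n w\<close> along with \<open>Y n w\<close>.\<close>
    have "uniformly_continuous_on (cball 0 (R + real CARD('n))) (gauss_profile f)"
      by (rule compact_uniformly_continuous) (auto intro: continuous_on_subset[OF gauss_profile_continuous[OF f]])
    then obtain d where d: "d > 0" "\<And>y z. y \<in> cball 0 (R + real CARD('n)) \<Longrightarrow> z \<in> cball 0 (R + real CARD('n)) \<Longrightarrow> dist z y < d \<Longrightarrow> dist (gauss_profile f z) (gauss_profile f y) < e"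
      unfolding uniformly_continuous_on_def using e by blast
    have "(\<lambda>n. real CARD('n) * (1 / sqrt (real n))) \<longlonglongrightarrow> 0" by real_asymp
    then have "eventually (\<lambda>n. real CARD('n) * (1 / sqrt (real n)) < d) sequentially" using d(1) by (rule order_tendstoD(2))
    with eventually_ge_at_top[of 1]
    show "eventually (\<lambda>n. \<forall>w\<in>int_lattice. norm (Y n w) \<le> R \<longrightarrow>
       sqrt (real n) ^ CARD('n) * \<bar>1 / sqrt (real n) ^ CARD('n) * gauss_profile f (Z n w) - 1 / sqrt (real n) ^ CARD('n) * gauss_profile f (Y n w)\<bar> \<le> e) sequentially"
    proof eventually_elim
      case (elim n)
      show ?case
      proof (intro ballI impI)
        fix w assume w: "norm (Y n w) \<le> R"
        have sn: "sqrt (real n) ^ CARD('n) > 0" using elim(1) by simp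
        have "real CARD('n) * (1 / sqrt (real n)) \<le> real CARD('n) * 1" using inv1[of n] by (intro mult_left_mono) auto
        with YZ[of n w] norm_triangle_ineq2[of "Z n w" "Y n w"] w
        have "norm (Z n w) \<le> R + real CARD('n)" by (simp add: norm_minus_commute)
        moreover have "dist (Z n w) (Y n w) < d" using YZ[of n w] elim(2) by (simp add: dist_norm norm_minus_commute)
        ultimately have "dist (gauss_profile f (Z n w)) (gauss_profile f (Y n w)) < e" using w by (intro d(2)) auto
        then have "\<bar>gauss_profile f (Z n w) - gauss_profile f (Y n w)\<bar> \<le> e" by (simp add: dist_real_def)
        moreover have "1 / sqrt (real n) ^ CARD('n) * gauss_profile f (Z n w) - 1 / sqrt (real n) ^ CARD('n) * gauss_profile f (Y n w) = 1 / sqrt (real n) ^ CARD('n) * (gauss_profile f (Z n w) - gauss_profile f (Y n w))"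
          by (simp add: right_diff_distrib)
        ultimately show "sqrt (real n) ^ CARD('n) * \<bar>1 / sqrt (real n) ^ CARD('n) * gauss_profile f (Z n w) - 1 / sqrt (real n) ^ CARD('n) * gauss_profile f (Y n w)\<bar> \<le> e"
          using sn elim(1) by (simp add: abs_mult)
      qed
    qed
  qed
  have "(\<lambda>n. infsum (\<lambda>w. 1 / sqrt (real n) ^ CARD('n) * gauss_profile f (Z n w)) int_lattice - infsum (\<lambda>w. 1 / sqrt (real n) ^ CARD('n) * gauss_profile f (Y n w)) int_lattice) \<longlonglongrightarrow> 0"
    by (rule infsum_vanishing_diff[OF v]) (intro summable_on_cmult_right gauss_profile_summable(1)[OF f] cY cZ; assumption)+
  then show ?thesis
    unfolding shift infsum_cmult_right' by (simp add: Y_def Z_def diff_divide_distrib)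
qed

end

lemma vanishing_add:
  assumes "vanishing f J" "vanishing g J"
  shows "vanishing (\<lambda>n i. f n i + g n i) J"
  unfolding vanishing_def
proof (intro allI impI)
  fix e :: real assume "e > 0"
  then have e2: "e / 2 > 0" by simp
  show "eventually (\<lambda>n. \<forall>F. finite F \<longrightarrow> F \<subseteq> J \<longrightarrow> (\<Sum>i\<in>F. \<bar>f n i + g n i\<bar>) \<le> e) sequentially"
    using assms(1)[unfolded vanishing_def, THEN spec, THEN mp, OF e2] assms(2)[unfolded vanishing_def, THEN spec, THEN mp, OF e2]
  proof eventually_elim
    case (elim n)
    show ?case
    proof (intro allI impI)
      fix F assume F: "finite F" "F \<subseteq> J"
      have "(\<Sum>i\<in>F. \<bar>f n i + g n i\<bar>) \<le> (\<Sum>i\<in>F. \<bar>f n i\<bar> + \<bar>g n i\<bar>)"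
        by (rule sum_mono) (rule abs_triangle_ineq)
      also have "\<dots> = (\<Sum>i\<in>F. \<bar>f n i\<bar>) + (\<Sum>i\<in>F. \<bar>g n i\<bar>)" by (rule sum.distrib)
      also have "\<dots> \<le> e / 2 + e / 2" by (rule add_mono[OF elim(1)[rule_format, OF F] elim(2)[rule_format, OF F]])
      finally show "(\<Sum>i\<in>F. \<bar>f n i + g n i\<bar>) \<le> e" by simp
    qed
  qed
qed

lemma vanishing_cong_eventually:
  assumes v: "vanishing f J" and e: "\<And>n i. n \<ge> 1 \<Longrightarrow> i \<in> J \<Longrightarrow> f n i = g n i"
  shows "vanishing g J"
  unfolding vanishing_def
proof (intro allI impI)
  fix e :: real assume e0: "e > 0"
  show "eventually (\<lambda>n. \<forall>F. finite F \<longrightarrow> F \<subseteq> J \<longrightarrow> (\<Sum>i\<in>F. \<bar>g n i\<bar>) \<le> e) sequentially"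
    using v[unfolded vanishing_def, THEN spec, THEN mp, OF e0] eventually_ge_at_top[of 1]
  proof eventually_elim
    case (elim n)
    show ?case
    proof (intro allI impI)
      fix F assume F: "finite F" "F \<subseteq> J"
      have "(\<Sum>i\<in>F. \<bar>g n i\<bar>) = (\<Sum>i\<in>F. \<bar>f n i\<bar>)"
        by (rule sum.cong[OF refl]) (use F(2) e[OF elim(2)] in auto)
      also have "\<dots> \<le> e" by (rule elim(1)[rule_format, OF F])
      finally show "(\<Sum>i\<in>F. \<bar>g n i\<bar>) \<le> e" .
    qed
  qed
qed

section \<open>Convergence in total variation\<close>

context lattice_walk
begin

lemma infsum_conv: "pmf (conv n) summable_on carrier G" "infsum (pmf (conv n)) (carrier G) = 1"
proof -
  have s: "Infinite_Set_Sum.abs_summable_on (pmf (conv n)) (carrier G)" by (rule pmf_abs_summable)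
  then have "(\<lambda>x. norm (pmf (conv n) x)) summable_on carrier G" by (simp only: abs_summable_equivalent)
  then show "pmf (conv n) summable_on carrier G" by simp
  have "infsum (pmf (conv n)) (carrier G) = infsetsum (pmf (conv n)) (carrier G)"
    by (rule infsetsum_infsum[OF s, symmetric])
  also have "\<dots> = 1" by (rule infsetsum_pmf_eq_1) (use set_conv_carrier in blast)
  finally show "infsum (pmf (conv n)) (carrier G) = 1" .
qed

text \<open>In \<open>gauss_approx\<close> the prefactor \<open>D\<close> occurs in the numerator
  and in the normalising sum, so it cancels as soon as it is nonzero.\<close>

lemma gauss_density_eq:
  assumes f: "corrector f" and S: "\<And>v w. v \<bullet> (\<Sigma> *v w) = cov f v w" and n: "n \<ge> 1"
  shows "\<exists>D. D \<noteq> 0 \<and> (\<forall>y. gauss_density (real n *\<^sub>R \<Sigma>) y = D * gauss_profile f ((1 / sqrt (real n)) *\<^sub>R y))"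
proof -
  have Lf: "Linv f" using f by (simp add: corrector_def)
  have S': "\<Sigma> *v w = cov_map f w" for w
    by (rule vector_eq_ldot[THEN iffD1]) (simp add: S inner_cov_map[OF Lf])
  let ?A = "real n *\<^sub>R \<Sigma>"
  have A: "?A *v x = real n *\<^sub>R (\<Sigma> *v x)" for x by (simp add: scaleR_matrix_vector_assoc)
  have "inj ((*v) ?A)"
  proof (rule injI)
    fix x y assume "?A *v x = ?A *v y"
    then have "cov_map f x = cov_map f y" using n by (simp add: A S')
    then show "x = y" by (metis cov_map_bij(3)[OF f])
  qed
  then have inv: "invertible ?A" using invertible_left_inverse matrix_left_invertible_injective by blast
  have minv: "?A ** matrix_inv ?A = mat 1"
    using someI_ex[OF inv[unfolded invertible_def]] unfolding matrix_inv_def by (rule conjunct1)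
  define D where "D = (2 * pi) powr (- (real CARD('n) / 2)) * det ?A powr (- (1 / 2))"
  have "det ?A \<noteq> 0" using inv invertible_det_nz by blast
  \<comment> \<open>\<open>powr\<close> has a nonzero value at every nonzero base, so invertibility
    of the matrix suffices.\<close>
  then have "D \<noteq> 0" by (simp add: D_def powr_def)
  moreover have "gauss_density ?A y = D * gauss_profile f ((1 / sqrt (real n)) *\<^sub>R y)" for y
  proof -
    define z where "z = matrix_inv ?A *v y"
    have "?A *v z = y" unfolding z_def matrix_vector_mul_assoc minv by simp
    then have y: "y = real n *\<^sub>R cov_map f z" by (simp add: A S')
    have "(1 / sqrt (real n)) *\<^sub>R y = sqrt (real n) *\<^sub>R cov_map f z"
      unfolding y using n by (simp add: real_div_sqrt)
    also have "\<dots> = cov_map f (sqrt (real n) *\<^sub>R z)" by (rule linear_cmul[OF linear_cov_map[OF Lf], symmetric])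
    finally have "gauss_profile f ((1 / sqrt (real n)) *\<^sub>R y) = exp (- ((sqrt (real n) *\<^sub>R z) \<bullet> cov_map f (sqrt (real n) *\<^sub>R z)) / 2)"
      by (simp only: gauss_profile_cov_map[OF f])
    also have "(sqrt (real n) *\<^sub>R z) \<bullet> cov_map f (sqrt (real n) *\<^sub>R z) = y \<bullet> z"
      unfolding y linear_cmul[OF linear_cov_map[OF Lf]] by (simp add: inner_commute)
    finally show ?thesis unfolding gauss_density_def D_def z_def by simp
  qed
  ultimately show ?thesis by blast
qed

lemma gauss_approx_eq:
  assumes f: "corrector f" and S: "\<And>v w. v \<bullet> (\<Sigma> *v w) = cov f v w" and n: "n \<ge> 1" and \<gamma>: "\<gamma> \<in> carrier G"
  shows "gauss_approx G \<Lambda> \<Delta> \<iota> n \<Sigma> zeta \<gamma> = gauss_profile f (rescaled n \<gamma>) / (card \<Delta> * gauss_sum f n)"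
proof -
  obtain D where D: "D \<noteq> 0" "\<forall>y. gauss_density (real n *\<^sub>R \<Sigma>) y = D * gauss_profile f ((1 / sqrt (real n)) *\<^sub>R y)"
    using gauss_density_eq[OF f S n] by (elim exE conjE)
  have "\<Lambda> #> \<gamma> \<in> rcosets \<Lambda>" using \<gamma> by (auto simp: RCOSETS_def)
  then have vw: "vertex_weight G \<Lambda> (\<Lambda> #> \<gamma>) = 1 / real (card \<Delta>)" by (simp add: vertex_weight_def card_D)
  show ?thesis
    unfolding gauss_approx_def vw D(2)[rule_format] infsum_cmult_right' using D(1) by simp
qed

text \<open>The walk is first replaced by \<open>q\<close>, which carries the constant
  \<open>C\<close> of the local limit, and then \<open>q\<close> by the normalised Gaussian
  \<open>N\<close>. For each \<open>n\<close> the latter two are proportional, so the second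
  replacement concerns only the ratio of two constants. That this ratio tends to 1 follows from
  total masses: the walk has mass one, and centring does not change the Gaussian sum to leading
  order.\<close>

theorem tv_local_limit:
  assumes f: "corrector f" and S: "\<And>v w. v \<bullet> (\<Sigma> *v w) = cov f v w"
  shows "(\<lambda>n. tv_norm G (\<lambda>\<gamma>. pmf (conv n) \<gamma> - gauss_approx G \<Lambda> \<Delta> \<iota> n \<Sigma> zeta \<gamma>)) \<longlonglongrightarrow> 0"
proof -
  obtain C e n0 where C: "C > 0" and e: "e \<longlonglongrightarrow> 0" and ll: "\<forall>n\<ge>n0. \<forall>\<gamma>\<in>carrier G. \<forall>z. cov_map f z = (1 / sqrt (real n)) *\<^sub>R (\<Phi> \<gamma> - n *\<^sub>R zeta) \<longrightarrow>
     \<bar>sqrt n ^ CARD('n) * pmf (conv n) \<gamma> - C * exp (- (z \<bullet> cov_map f z) / 2)\<bar> \<le> e n"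
    using local_limit[OF f] by (elim exE conjE)
  define q where "q n \<gamma> = C / sqrt (real n) ^ CARD('n) * gauss_profile f (rescaled n \<gamma>)" for n \<gamma>
  define Z' where "Z' n = (\<Sum>\<^sub>\<infinity>w\<in>int_lattice. gauss_profile f ((1 / sqrt (real n)) *\<^sub>R (w - real n *\<^sub>R zeta)))" for n
  have gq0: "gauss_profile f y \<ge> 0" for y by (simp add: gauss_profile_def)
  have v1: "vanishing (\<lambda>n \<gamma>. pmf (conv n) \<gamma> - q n \<gamma>) (carrier G)"
  proof (rule vanishing_diff[OF count_bounded_walk tight_walk])
    show "tight_at q rescaled (carrier G)" unfolding q_def[abs_def]
      by (rule gauss_profile_summable(2)[OF f count_bounded_walk]) (use C in simp)
    fix R d :: real assume d: "d > 0"
    have "eventually (\<lambda>n. e n < d) sequentially" using e d by (rule order_tendstoD(2))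
    then show "eventually (\<lambda>n. \<forall>\<gamma>\<in>carrier G. norm (rescaled n \<gamma>) \<le> R \<longrightarrow> sqrt (real n) ^ CARD('n) * \<bar>pmf (conv n) \<gamma> - q n \<gamma>\<bar> \<le> d) sequentially"
      using eventually_ge_at_top[of n0] eventually_ge_at_top[of 1]
    proof eventually_elim
      case (elim n)
      have sn: "sqrt (real n) ^ CARD('n) > 0" using elim(3) by simp
      show ?case
      proof (intro ballI impI)
        fix \<gamma> assume \<gamma>: "\<gamma> \<in> carrier G"
        define z where "z = cov_inv f (rescaled n \<gamma>)"
        have z: "cov_map f z = rescaled n \<gamma>" by (simp only: z_def cov_map_bij[OF f])
        have "\<bar>sqrt (real n) ^ CARD('n) * pmf (conv n) \<gamma> - C * gauss_profile f (rescaled n \<gamma>)\<bar> \<le> e n"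
          using ll[rule_format, OF elim(2) \<gamma> z] gauss_profile_cov_map[OF f, of z] by (simp only: z)
        moreover have "sqrt (real n) ^ CARD('n) * pmf (conv n) \<gamma> - C * gauss_profile f (rescaled n \<gamma>) = sqrt (real n) ^ CARD('n) * (pmf (conv n) \<gamma> - q n \<gamma>)"
          using elim(3) by (simp add: q_def right_diff_distrib)
        ultimately show "sqrt (real n) ^ CARD('n) * \<bar>pmf (conv n) \<gamma> - q n \<gamma>\<bar> \<le> d"
          using sn elim(1) by (simp add: abs_mult)
      qed
    qed
  qed
  have sY: "(\<lambda>\<gamma>. gauss_profile f (rescaled n \<gamma>)) summable_on carrier G" if "n \<ge> 1" for n
    by (rule gauss_profile_summable(1)[OF f count_bounded_walk that])
  have sL: "(\<lambda>w. gauss_profile f ((1 / sqrt (real n)) *\<^sub>R (w - real n *\<^sub>R zeta))) summable_on int_lattice" if "n \<ge> 1" for n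
    by (rule gauss_profile_summable(1)[OF f count_bounded_lattice that])
  have tot: "(\<Sum>\<^sub>\<infinity>\<gamma>\<in>carrier G. gauss_profile f (rescaled n \<gamma>)) = card \<Delta> * Z' n" if "n \<ge> 1" for n
    unfolding Z'_def by (rule infsum_coord[OF sL[OF that]]) (rule gq0)
  \<comment> \<open>\<open>a n\<close> is the total mass of \<open>q n\<close>; \<open>b n\<close>
    is what it becomes when the centred Gaussian sum is replaced by the uncentred one in the
    normaliser.\<close>
  define a where "a n = C * card \<Delta> * Z' n / sqrt (real n) ^ CARD('n)" for n
  define b where "b n = C * card \<Delta> * gauss_sum f n / sqrt (real n) ^ CARD('n)" for n
  have a: "a \<longlonglongrightarrow> 1"
  proof -
    have "(\<lambda>n. infsum (pmf (conv n)) (carrier G) - infsum (q n) (carrier G)) \<longlonglongrightarrow> 0"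
      by (rule infsum_vanishing_diff[OF v1 infsum_conv(1)]) (unfold q_def, intro summable_on_cmult_right sY)
    then have "(\<lambda>n. 1 - infsum (q n) (carrier G)) \<longlonglongrightarrow> 0" unfolding infsum_conv(2) .
    from tendsto_diff[OF tendsto_const[of 1] this] have l: "(\<lambda>n. infsum (q n) (carrier G)) \<longlonglongrightarrow> 1" by simp
    have "eventually (\<lambda>n. infsum (q n) (carrier G) = a n) sequentially"
    proof (rule eventually_sequentiallyI[of 1])
      fix n :: nat assume n: "1 \<le> n"
      show "infsum (q n) (carrier G) = a n" unfolding q_def infsum_cmult_right' tot[OF n] a_def by simp
    qed
    with l show ?thesis by (rule Lim_transform_eventually)
  qed
  have b: "b \<longlonglongrightarrow> 1"
  proof -
    have "(\<lambda>n. C * card \<Delta> * ((Z' n - gauss_sum f n) / sqrt (real n) ^ CARD('n))) \<longlonglongrightarrow> C * card \<Delta> * 0"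
      unfolding Z'_def by (rule tendsto_mult_left[OF shifted_gaussian_sum[OF f]])
    from tendsto_diff[OF a this]
    have "(\<lambda>n. a n - C * card \<Delta> * ((Z' n - gauss_sum f n) / sqrt (real n) ^ CARD('n))) \<longlonglongrightarrow> 1" by simp
    moreover have "a n - C * card \<Delta> * ((Z' n - gauss_sum f n) / sqrt (real n) ^ CARD('n)) = b n" for n
      by (simp add: a_def b_def diff_divide_distrib right_diff_distrib)
    ultimately show ?thesis by (simp only:)
  qed
  define N where "N n \<gamma> = gauss_profile f (rescaled n \<gamma>) / (card \<Delta> * gauss_sum f n)" for n \<gamma>
  have ab: "(\<lambda>n. \<bar>a n - a n / b n\<bar>) \<longlonglongrightarrow> 0"
    using tendsto_rabs[OF tendsto_diff[OF a tendsto_divide[OF a b]]] by simp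
  have v2: "vanishing (\<lambda>n \<gamma>. q n \<gamma> - N n \<gamma>) (carrier G)"
    unfolding vanishing_def
  proof (intro allI impI)
    fix d :: real assume d: "d > 0"
    have "eventually (\<lambda>n. \<bar>a n - a n / b n\<bar> < d) sequentially" using ab d by (rule order_tendstoD(2))
    moreover have "eventually (\<lambda>n. 0 < b n) sequentially" using b by (rule order_tendstoD(1)) simp
    ultimately show "eventually (\<lambda>n. \<forall>F. finite F \<longrightarrow> F \<subseteq> carrier G \<longrightarrow> (\<Sum>\<gamma>\<in>F. \<bar>q n \<gamma> - N n \<gamma>\<bar>) \<le> d) sequentially"
      using eventually_ge_at_top[of 1]
    proof eventually_elim
      case (elim n)
      have n0: "n \<noteq> 0" using elim(3) by simp
      have g0: "gauss_sum f n \<noteq> 0" using elim(2) unfolding b_def by auto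
      \<comment> \<open>The factor of proportionality; multiplied by the total mass of the profile
        it becomes \<open>a n - a n / b n\<close>.\<close>
      define c where "c = C / sqrt (real n) ^ CARD('n) - 1 / (card \<Delta> * gauss_sum f n)"
      show ?case
      proof (intro allI impI)
        fix F assume F: "finite F" "F \<subseteq> carrier G"
        have qN: "q n \<gamma> - N n \<gamma> = c * gauss_profile f (rescaled n \<gamma>)" for \<gamma>
          by (simp add: q_def N_def c_def left_diff_distrib)
        have "(\<Sum>\<gamma>\<in>F. \<bar>q n \<gamma> - N n \<gamma>\<bar>) = \<bar>c\<bar> * (\<Sum>\<gamma>\<in>F. gauss_profile f (rescaled n \<gamma>))"
          unfolding qN abs_mult sum_distrib_left using gq0 by (intro sum.cong) auto
        also have "\<dots> \<le> \<bar>c\<bar> * (\<Sum>\<^sub>\<infinity>\<gamma>\<in>carrier G. gauss_profile f (rescaled n \<gamma>))"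
          by (rule mult_left_mono[OF finite_sum_le_infsum[OF sY[OF elim(3)] F]]) (use gq0 in auto)
        also have "\<dots> = \<bar>c\<bar> * (card \<Delta> * Z' n)" by (simp only: tot[OF elim(3)])
        also have "\<dots> = \<bar>c * (card \<Delta> * Z' n)\<bar>"
        proof -
          have "Z' n \<ge> 0" unfolding Z'_def by (rule infsum_nonneg) (rule gq0)
          then show ?thesis by (simp add: abs_mult)
        qed
        also have "c * (card \<Delta> * Z' n) = a n - a n / b n"
          using n0 g0 C D_nonempty by (simp add: c_def a_def b_def left_diff_distrib)
        finally show "(\<Sum>\<gamma>\<in>F. \<bar>q n \<gamma> - N n \<gamma>\<bar>) \<le> d" using elim(1) by simp
      qed
    qed
  qed
  have "vanishing (\<lambda>n \<gamma>. pmf (conv n) \<gamma> - gauss_approx G \<Lambda> \<Delta> \<iota> n \<Sigma> zeta \<gamma>) (carrier G)"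
    by (rule vanishing_cong_eventually[OF vanishing_add[OF v1 v2]]) (simp add: gauss_approx_eq[OF f S] N_def)
  then show ?thesis by (rule tv_norm_vanishing)
qed

end

section \<open>Harmonic parts and the covariance matrix\<close>

lemma has_sum_pmf:
  fixes k :: "'a \<Rightarrow> 'c::{banach,second_countable_topology}"
  assumes k: "integrable (measure_pmf p) k" and A: "set_pmf p \<subseteq> A"
  shows "((\<lambda>s. pmf p s *\<^sub>R k s) has_sum measure_pmf.expectation p k) A"
proof -
  have i: "integrable (count_space UNIV) (\<lambda>s. pmf p s *\<^sub>R k s)"
    using k unfolding measure_pmf_eq_density by (subst (asm) integrable_density) auto
  have E: "measure_pmf.expectation p k = infsetsum (\<lambda>s. pmf p s *\<^sub>R k s) UNIV"
    unfolding infsetsum_def measure_pmf_eq_density by (subst integral_density) auto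
  have s: "Infinite_Set_Sum.abs_summable_on (\<lambda>s. pmf p s *\<^sub>R k s) UNIV"
    using i by (simp add: abs_summable_on_def)
  then have "(\<lambda>s. pmf p s *\<^sub>R k s) summable_on UNIV"
    by (rule abs_summable_summable[OF abs_summable_equivalent[THEN iffD2]])
  then have "((\<lambda>s. pmf p s *\<^sub>R k s) has_sum measure_pmf.expectation p k) UNIV"
    unfolding E infsetsum_infsum[OF s] by (rule has_sum_infsum)
  then show ?thesis
    by (rule has_sum_cong_neutral[THEN iffD1, rotated -1]) (use A in \<open>auto simp: set_pmf_iff\<close>)
qed

lemma has_sum_finite_Times:
  fixes f :: "'a \<times> 'b \<Rightarrow> 'c::{topological_comm_monoid_add}"
  assumes R: "finite R" and f: "\<And>X. X \<in> R \<Longrightarrow> ((\<lambda>s. f (X, s)) has_sum g X) S"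
  shows "(f has_sum (\<Sum>X\<in>R. g X)) (R \<times> S)"
  using assms
proof (induction R)
  case empty then show ?case by simp
next
  case (insert X R)
  have "(f has_sum g X) ({X} \<times> S)"
  proof -
    have "bij_betw (\<lambda>s. (X, s)) S ({X} \<times> S)" by (auto simp: bij_betw_def inj_on_def)
    from has_sum_reindex_bij_betw[OF this, of f] insert.prems[of X] show ?thesis by simp
  qed
  moreover have "(f has_sum (\<Sum>X\<in>R. g X)) (R \<times> S)" by (rule insert.IH) (use insert.prems in auto)
  ultimately have "(f has_sum (g X + (\<Sum>X\<in>R. g X))) ({X} \<times> S \<union> R \<times> S)"
    by (rule has_sum_Un_disjoint) (use insert.hyps in auto)
  moreover have "{X} \<times> S \<union> R \<times> S = insert X R \<times> S" by auto
  ultimately show ?case using insert.hyps by simp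
qed

section \<open>Sums over edges as expectations\<close>

context lattice_walk
begin

abbreviation steps :: "'g set" where "steps \<equiv> set_pmf \<nu> \<union> m_inv G ` set_pmf \<nu>"

lemma edges_eq: "edges G \<Lambda> \<nu> = (rcosets \<Lambda>) \<times> steps"
  by (simp add: edges_def)

lemma steps_carrier: "s \<in> steps \<Longrightarrow> s \<in> carrier G" by auto

lemma steps_inv: "s \<in> steps \<Longrightarrow> inv s \<in> steps" by auto

lemma edge_weight_eq: "X \<in> rcosets \<Lambda> \<Longrightarrow> edge_weight G \<Lambda> \<nu> (X, s) = pmf \<nu> s / card \<Delta>"
  by (simp add: edge_weight_def vertex_weight_def org_def card_D)

text \<open>An inverse of a step that is not itself a step labels edges of weight zero, so the sum
  over all edges is the expectation over one step, averaged over the starting vertex.\<close>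

lemma edge_sum:
  fixes h :: "'g set \<times> 'g \<Rightarrow> 'c::{banach,second_countable_topology}"
  assumes h: "\<And>x. x \<in> \<Delta> \<Longrightarrow> integrable \<nu> (\<lambda>s. h (\<Lambda> #> x, s))"
  shows "((\<lambda>e. edge_weight G \<Lambda> \<nu> e *\<^sub>R h e) has_sum mean (\<lambda>x. measure_pmf.expectation \<nu> (\<lambda>s. h (\<Lambda> #> x, s)))) (edges G \<Lambda> \<nu>)"
proof -
  have "((\<lambda>e. edge_weight G \<Lambda> \<nu> e *\<^sub>R h e) has_sum (\<Sum>X\<in>rcosets \<Lambda>. (1 / card \<Delta>) *\<^sub>R measure_pmf.expectation \<nu> (\<lambda>s. h (X, s)))) (edges G \<Lambda> \<nu>)"
    unfolding edges_eq
  proof (rule has_sum_finite_Times[OF finite_index])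
    fix X assume X: "X \<in> rcosets \<Lambda>"
    then obtain x where x: "x \<in> \<Delta>" "X = \<Lambda> #> x" using bij_cosets by (auto simp: bij_betw_def)
    have "((\<lambda>s. pmf \<nu> s *\<^sub>R h (X, s)) has_sum measure_pmf.expectation \<nu> (\<lambda>s. h (X, s))) steps"
      by (rule has_sum_pmf) (use h[OF x(1)] x(2) in auto)
    from has_sum_bounded_linear[OF bounded_linear_scaleR_right this, of "1 / card \<Delta>"]
    show "((\<lambda>s. edge_weight G \<Lambda> \<nu> (X, s) *\<^sub>R h (X, s)) has_sum (1 / card \<Delta>) *\<^sub>R measure_pmf.expectation \<nu> (\<lambda>s. h (X, s))) steps"
      by (simp add: edge_weight_eq[OF X])
  qed
  also have "(\<Sum>X\<in>rcosets \<Lambda>. (1 / card \<Delta>) *\<^sub>R measure_pmf.expectation \<nu> (\<lambda>s. h (X, s)))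
      = (\<Sum>x\<in>\<Delta>. (1 / card \<Delta>) *\<^sub>R measure_pmf.expectation \<nu> (\<lambda>s. h (\<Lambda> #> x, s)))"
    by (rule sum.reindex_bij_betw[OF bij_cosets, symmetric])
  also have "\<dots> = mean (\<lambda>x. measure_pmf.expectation \<nu> (\<lambda>s. h (\<Lambda> #> x, s)))"
    by (simp add: mean_def scaleR_sum_right)
  finally show ?thesis .
qed

lemma some_coset:
  assumes g: "Linv g" and x: "x \<in> carrier G"
  shows "g (SOME \<gamma>. \<gamma> \<in> \<Lambda> #> x) = g x"
proof -
  have "(SOME \<gamma>. \<gamma> \<in> \<Lambda> #> x) \<in> \<Lambda> #> x" by (rule someI) (rule rcos_self[OF x subgroup_L])
  then show ?thesis using g x by (auto simp: r_coset_def Linv_def)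
qed

lemma Linv_coset: "Linv (\<lambda>\<gamma>. F (\<Lambda> #> \<gamma>))"
  by (simp add: Linv_def coset_rep[of "_ \<otimes> _"] rep_L_mult flip: coset_rep)

lemma coset_mult: "x \<in> carrier G \<Longrightarrow> s \<in> carrier G \<Longrightarrow> (\<Lambda> #> x) #> s = \<Lambda> #> (x \<otimes> s)"
  by (rule coset_mult_assoc) (auto simp: subset_iff)

lemma coord_edge_eq: "x \<in> carrier G \<Longrightarrow> s \<in> carrier G \<Longrightarrow> coord_edge G \<Lambda> \<Delta> \<iota> (\<Lambda> #> x, s) = incr x s"
  using some_coset[OF Linv_incr[of s], of x] by (simp add: coord_edge_def org_def incr_def Let_def)

lemma drift_eq: "drift G \<Lambda> \<Delta> \<iota> \<nu> = zeta"
proof -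
  have e: "measure_pmf.expectation \<nu> (\<lambda>s. coord_edge G \<Lambda> \<Delta> \<iota> (\<Lambda> #> x, s)) = mean_incr x" if "x \<in> carrier G" for x
    unfolding mean_incr_def by (intro integral_cong_AE) (auto simp: AE_measure_pmf_iff coord_edge_eq that)
  have "integrable \<nu> (\<lambda>s. coord_edge G \<Lambda> \<Delta> \<iota> (\<Lambda> #> x, s))" if "x \<in> \<Delta>" for x
    by (rule integrable_cong_AE_imp[OF incr_integrable[of x]]) (use that in \<open>auto simp: AE_measure_pmf_iff coord_edge_eq\<close>)
  from infsumI[OF edge_sum[OF this]]
  show ?thesis unfolding drift_def zeta_def by (simp add: mean_def e)
qed

text \<open>The choice of an element of the coset is harmless by \<open>Linv_cincr\<close>;
  restricting to the edges makes it extensional, as 1-forms are required to be.\<close>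

definition harmonic_repr :: "('g \<Rightarrow> real ^ 'n) \<Rightarrow> real ^ 'n \<Rightarrow> 'g set \<times> 'g \<Rightarrow> real" where
  "harmonic_repr f v = restrict (\<lambda>e. v \<bullet> cincr f (SOME \<gamma>. \<gamma> \<in> fst e) (snd e)) (edges G \<Lambda> \<nu>)"

lemma coset_in: "x \<in> carrier G \<Longrightarrow> \<Lambda> #> x \<in> rcosets \<Lambda>" by (auto simp: RCOSETS_def)

lemma harmonic_repr_eq: "Linv f \<Longrightarrow> x \<in> carrier G \<Longrightarrow> s \<in> steps \<Longrightarrow> harmonic_repr f v (\<Lambda> #> x, s) = v \<bullet> cincr f x s"
  using some_coset[OF Linv_cincr[OF _ steps_carrier], of f s x] by (simp add: harmonic_repr_def edges_eq coset_in)

lemma edge_cases: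
  assumes "e \<in> edges G \<Lambda> \<nu>"
  obtains x s where "x \<in> \<Delta>" "s \<in> steps" "e = (\<Lambda> #> x, s)"
  proof -
  obtain X s where X: "X \<in> (\<lambda>x. \<Lambda> #> x) ` \<Delta>" "s \<in> steps" "e = (X, s)"
    using assms unfolding edges_eq bij_betw_imp_surj_on[OF bij_cosets] by (elim SigmaE) simp
  then show thesis using that by blast
qed

lemma harmonic_repr_AE: "Linv f \<Longrightarrow> x \<in> carrier G \<Longrightarrow> AE s in \<nu>. harmonic_repr f v (\<Lambda> #> x, s) = v \<bullet> cincr f x s"
  unfolding AE_measure_pmf_iff by (intro ballI harmonic_repr_eq) auto

lemma harmonic_repr_integrable:
  assumes f: "Linv f" and x: "x \<in> carrier G"
  shows "integrable \<nu> (\<lambda>s. harmonic_repr f v (\<Lambda> #> x, s))"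
    "integrable \<nu> (\<lambda>s. harmonic_repr f v (\<Lambda> #> x, s) * harmonic_repr f w (\<Lambda> #> x, s))"
    "measure_pmf.expectation \<nu> (\<lambda>s. harmonic_repr f v (\<Lambda> #> x, s)) = v \<bullet> measure_pmf.expectation \<nu> (cincr f x)"
    "measure_pmf.expectation \<nu> (\<lambda>s. harmonic_repr f v (\<Lambda> #> x, s) * harmonic_repr f w (\<Lambda> #> x, s)) = measure_pmf.expectation \<nu> (\<lambda>s. (v \<bullet> cincr f x s) * (w \<bullet> cincr f x s))"
proof -
  note ae = harmonic_repr_AE[OF f x]
  show "integrable \<nu> (\<lambda>s. harmonic_repr f v (\<Lambda> #> x, s))"
  proof (rule integrable_cong_AE_imp)
    show "integrable \<nu> (\<lambda>s. v \<bullet> cincr f x s)" using cincr_integrable[OF f x] by simp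
    show "AE s in \<nu>. v \<bullet> cincr f x s = harmonic_repr f v (\<Lambda> #> x, s)" using ae[of v] by eventually_elim simp
  qed simp
  show "integrable \<nu> (\<lambda>s. harmonic_repr f v (\<Lambda> #> x, s) * harmonic_repr f w (\<Lambda> #> x, s))"
  proof (rule integrable_cong_AE_imp)
    show "integrable \<nu> (\<lambda>s. (v \<bullet> cincr f x s) * (w \<bullet> cincr f x s))" using inner_cincr_integrable[OF f x, of v 0 w] by simp
    show "AE s in \<nu>. (v \<bullet> cincr f x s) * (w \<bullet> cincr f x s) = harmonic_repr f v (\<Lambda> #> x, s) * harmonic_repr f w (\<Lambda> #> x, s)"
      using ae[of v] ae[of w] by eventually_elim simp
  qed simp
  have "measure_pmf.expectation \<nu> (\<lambda>s. harmonic_repr f v (\<Lambda> #> x, s)) = measure_pmf.expectation \<nu> (\<lambda>s. v \<bullet> cincr f x s)"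
    by (rule integral_cong_AE) (use ae[of v] in auto)
  also have "\<dots> = v \<bullet> measure_pmf.expectation \<nu> (cincr f x)"
    by (rule integral_inner_right) (rule cincr_integrable[OF f x])
  finally show "measure_pmf.expectation \<nu> (\<lambda>s. harmonic_repr f v (\<Lambda> #> x, s)) = v \<bullet> measure_pmf.expectation \<nu> (cincr f x)" .
  show "measure_pmf.expectation \<nu> (\<lambda>s. harmonic_repr f v (\<Lambda> #> x, s) * harmonic_repr f w (\<Lambda> #> x, s)) = measure_pmf.expectation \<nu> (\<lambda>s. (v \<bullet> cincr f x s) * (w \<bullet> cincr f x s))"
  proof (rule integral_cong_AE)
    show "AE s in \<nu>. harmonic_repr f v (\<Lambda> #> x, s) * harmonic_repr f w (\<Lambda> #> x, s) = (v \<bullet> cincr f x s) * (w \<bullet> cincr f x s)"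
      using ae[of v] ae[of w] by eventually_elim simp
  qed auto
qed

lemma mean_const: "mean (\<lambda>_. c) = (c :: 'c::real_vector)"
  using D_nonempty by (simp add: mean_def sum_constant_scaleR)

lemma mean_cong: "(\<And>x. x \<in> \<Delta> \<Longrightarrow> g x = h x) \<Longrightarrow> mean g = mean h"
  by (simp add: mean_def)

lemma chi_form_eq:
  assumes "\<And>x. x \<in> \<Delta> \<Longrightarrow> integrable \<nu> (\<lambda>s. \<omega> (\<Lambda> #> x, s))"
  shows "chi_form G \<Lambda> \<nu> \<omega> = mean (\<lambda>x. measure_pmf.expectation \<nu> (\<lambda>s. \<omega> (\<Lambda> #> x, s)))"
  unfolding chi_form_def using infsumI[OF edge_sum[of \<omega>, OF assms]] by (simp add: mult.commute)

lemma codifferential_eq: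
  assumes x: "x \<in> \<Delta>" and i: "integrable \<nu> (\<lambda>s. \<omega> (\<Lambda> #> x, s) :: real)"
  shows "codifferential G \<Lambda> \<nu> \<omega> (\<Lambda> #> x) = - measure_pmf.expectation \<nu> (\<lambda>s. \<omega> (\<Lambda> #> x, s))"
proof -
  let ?X = "\<Lambda> #> x"
  have X: "?X \<in> rcosets \<Lambda>" using x by (simp add: coset_in)
  have b: "bij_betw (\<lambda>s. (?X, s)) steps {e \<in> edges G \<Lambda> \<nu>. org e = ?X}"
    using X by (auto simp: bij_betw_def inj_on_def edges_eq org_def)
  have "(\<Sum>\<^sub>\<infinity>e\<in>{e \<in> edges G \<Lambda> \<nu>. org e = ?X}. edge_weight G \<Lambda> \<nu> e * \<omega> e) = (\<Sum>\<^sub>\<infinity>s\<in>steps. edge_weight G \<Lambda> \<nu> (?X, s) * \<omega> (?X, s))"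
    by (rule infsum_reindex_bij_betw[OF b, symmetric])
  also have "\<dots> = (\<Sum>\<^sub>\<infinity>s\<in>steps. (1 / card \<Delta>) * (pmf \<nu> s *\<^sub>R \<omega> (?X, s)))"
    by (simp add: edge_weight_eq[OF X])
  also have "\<dots> = (1 / card \<Delta>) * (\<Sum>\<^sub>\<infinity>s\<in>steps. pmf \<nu> s *\<^sub>R \<omega> (?X, s))"
    by (rule infsum_cmult_right')
  also have "(\<Sum>\<^sub>\<infinity>s\<in>steps. pmf \<nu> s *\<^sub>R \<omega> (?X, s)) = measure_pmf.expectation \<nu> (\<lambda>s. \<omega> (?X, s))"
    by (rule infsumI[OF has_sum_pmf[OF i]]) simp
  finally show ?thesis
    unfolding codifferential_def vertex_weight_def using X D_nonempty by (simp add: card_D)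
qed

lemma ball_cosets: "(\<forall>X\<in>rcosets \<Lambda>. P X) \<longleftrightarrow> (\<forall>x\<in>\<Delta>. P (\<Lambda> #> x))"
  unfolding bij_betw_imp_surj_on[OF bij_cosets, symmetric] by simp

text \<open>Existence: the corrected increments differ from the original ones by the differential of
  \<open>v \<bullet> f\<close>, and a form is harmonic exactly when its mean over the outgoing edges
  is the same at all vertices. Uniqueness: two candidates differ by the differential of some
  \<open>g\<close>, harmonicity of both makes \<open>g\<close> harmonic for the walk, and then
  \<open>g\<close> is constant.\<close>

lemma harmonic_part_dual_form:
  assumes f: "corrector f"
  shows "harmonic_part G \<Lambda> \<nu> (dual_form G \<Lambda> \<Delta> \<iota> \<nu> v) = harmonic_repr f v"
  unfolding harmonic_part_def
proof (rule the_equality)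
  have Lf: "Linv f" using f by (simp add: corrector_def)
  have Eu: "measure_pmf.expectation \<nu> (\<lambda>s. harmonic_repr f v (\<Lambda> #> x, s)) = v \<bullet> zeta" if "x \<in> carrier G" for x
    using f that by (simp add: harmonic_repr_integrable(3)[OF Lf that] corrector_def)
  define F where "F X = v \<bullet> f (SOME \<gamma>. \<gamma> \<in> X)" for X
  have F: "F (\<Lambda> #> x) = v \<bullet> f x" if "x \<in> carrier G" for x using some_coset[OF Lf that] by (simp add: F_def)
  have decomp: "dual_form G \<Lambda> \<Delta> \<iota> \<nu> v e = harmonic_repr f v e + differential G F e" if e: "e \<in> edges G \<Lambda> \<nu>" for e
  proof -
    obtain x s where xs: "x \<in> \<Delta>" "s \<in> steps" "e = (\<Lambda> #> x, s)" by (rule edge_cases[OF e])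
    have xs': "x \<in> carrier G" "s \<in> carrier G" using xs steps_carrier by auto
    show ?thesis using e unfolding dual_form_def xs(3)
      by (simp add: coord_edge_eq[OF xs'] harmonic_repr_eq[OF Lf xs'(1) xs(2)] differential_def ter_def org_def coset_mult[OF xs'] F[OF xs'(1)] F[of "x \<otimes> s"] xs' cincr_def inner_diff_right)
  qed
  show "harmonic_repr f v \<in> l2_forms G \<Lambda> \<nu> \<and> harmonic_form G \<Lambda> \<nu> (harmonic_repr f v) \<and>
    (\<exists>fa. \<forall>e\<in>edges G \<Lambda> \<nu>. dual_form G \<Lambda> \<Delta> \<iota> \<nu> v e = harmonic_repr f v e + differential G fa e)"
  proof (intro conjI)
    show "\<exists>fa. \<forall>e\<in>edges G \<Lambda> \<nu>. dual_form G \<Lambda> \<Delta> \<iota> \<nu> v e = harmonic_repr f v e + differential G fa e"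
      using decomp by blast
    show "harmonic_form G \<Lambda> \<nu> (harmonic_repr f v)"
      unfolding harmonic_form_def ball_cosets
    proof
      fix x assume x: "x \<in> \<Delta>"
      have "chi_form G \<Lambda> \<nu> (harmonic_repr f v) = mean (\<lambda>x. measure_pmf.expectation \<nu> (\<lambda>s. harmonic_repr f v (\<Lambda> #> x, s)))"
        by (rule chi_form_eq) (use harmonic_repr_integrable(1)[OF Lf] in auto)
      also have "\<dots> = mean (\<lambda>x. v \<bullet> zeta)" by (rule mean_cong) (simp add: Eu)
      finally have "chi_form G \<Lambda> \<nu> (harmonic_repr f v) = v \<bullet> zeta" by (simp add: mean_const)
      moreover have "codifferential G \<Lambda> \<nu> (harmonic_repr f v) (\<Lambda> #> x) = - (v \<bullet> zeta)"
        using codifferential_eq[OF x harmonic_repr_integrable(1)[OF Lf]] x by (simp add: Eu)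
      ultimately show "codifferential G \<Lambda> \<nu> (harmonic_repr f v) (\<Lambda> #> x) + chi_form G \<Lambda> \<nu> (harmonic_repr f v) = 0" by simp
    qed
    show "harmonic_repr f v \<in> l2_forms G \<Lambda> \<nu>"
      unfolding l2_forms_def one_forms_def mem_Collect_eq
    proof (intro conjI ballI)
      show "harmonic_repr f v \<in> extensional (edges G \<Lambda> \<nu>)" by (simp add: harmonic_repr_def)
      fix e assume e: "e \<in> edges G \<Lambda> \<nu>"
      obtain x s where xs: "x \<in> \<Delta>" "s \<in> steps" "e = (\<Lambda> #> x, s)" by (rule edge_cases[OF e])
      have xs': "x \<in> carrier G" "s \<in> carrier G" using xs steps_carrier by auto
      have r: "edge_rev G e = (\<Lambda> #> (x \<otimes> s), inv s)" by (simp add: edge_rev_def xs(3) coset_mult[OF xs'])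
      have "harmonic_repr f v (edge_rev G e) = v \<bullet> cincr f (x \<otimes> s) (inv s)"
        unfolding r by (rule harmonic_repr_eq[OF Lf]) (use xs' steps_inv[OF xs(2)] in auto)
      also have "cincr f (x \<otimes> s) (inv s) = - cincr f x s" using xs' by (simp add: cincr_def incr_def m_assoc)
      also have "v \<bullet> (- cincr f x s) = - harmonic_repr f v e" unfolding xs(3) harmonic_repr_eq[OF Lf xs'(1) xs(2)] by simp
      finally show "harmonic_repr f v (edge_rev G e) = - harmonic_repr f v e" .
    next
      have "((\<lambda>e. edge_weight G \<Lambda> \<nu> e *\<^sub>R (harmonic_repr f v e * harmonic_repr f v e)) has_sum
          mean (\<lambda>x. measure_pmf.expectation \<nu> (\<lambda>s. harmonic_repr f v (\<Lambda> #> x, s) * harmonic_repr f v (\<Lambda> #> x, s)))) (edges G \<Lambda> \<nu>)"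
        by (rule edge_sum[of "\<lambda>e. harmonic_repr f v e * harmonic_repr f v e"]) (use harmonic_repr_integrable(2)[OF Lf] in auto)
      then have "(\<lambda>e. edge_weight G \<Lambda> \<nu> e *\<^sub>R (harmonic_repr f v e * harmonic_repr f v e)) summable_on edges G \<Lambda> \<nu>"
        by (rule has_sum_imp_summable)
      then show "(\<lambda>e. (harmonic_repr f v e)\<^sup>2 * edge_weight G \<Lambda> \<nu> e) summable_on edges G \<Lambda> \<nu>"
        by (simp add: power2_eq_square mult.commute)
    qed
  qed
  fix u assume u: "u \<in> l2_forms G \<Lambda> \<nu> \<and> harmonic_form G \<Lambda> \<nu> u \<and>
    (\<exists>fa. \<forall>e\<in>edges G \<Lambda> \<nu>. dual_form G \<Lambda> \<Delta> \<iota> \<nu> v e = u e + differential G fa e)"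
  then obtain F' where F': "\<forall>e\<in>edges G \<Lambda> \<nu>. dual_form G \<Lambda> \<Delta> \<iota> \<nu> v e = u e + differential G F' e" by blast
  define g where "g \<gamma> = F (\<Lambda> #> \<gamma>) - F' (\<Lambda> #> \<gamma>)" for \<gamma>
  have Lg: "Linv g" unfolding g_def by (rule Linv_coset[of "\<lambda>X. F X - F' X"])
  have ug: "u (\<Lambda> #> x, s) = harmonic_repr f v (\<Lambda> #> x, s) + (g (x \<otimes> s) - g x)" if "x \<in> carrier G" "s \<in> steps" for x s
  proof -
    have e: "(\<Lambda> #> x, s) \<in> edges G \<Lambda> \<nu>" using that by (simp add: edges_eq coset_in)
    have s: "s \<in> carrier G" using that steps_carrier by auto
    from decomp[OF e] F'[rule_format, OF e] show ?thesis
      by (simp add: differential_def ter_def org_def coset_mult[OF that(1) s] g_def)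
  qed
  have aeu: "AE s in \<nu>. u (\<Lambda> #> x, s) = harmonic_repr f v (\<Lambda> #> x, s) + (g (x \<otimes> s) - g x)" if "x \<in> carrier G" for x
    unfolding AE_measure_pmf_iff by (intro ballI ug[OF that]) auto
  have igx: "integrable \<nu> (\<lambda>s. g (x \<otimes> s))" if "x \<in> carrier G" for x by (rule integrable_shift_nu[OF Lg that])
  have iu: "integrable \<nu> (\<lambda>s. u (\<Lambda> #> x, s))" if x: "x \<in> carrier G" for x
  proof (rule integrable_cong_AE_imp)
    show "integrable \<nu> (\<lambda>s. harmonic_repr f v (\<Lambda> #> x, s) + (g (x \<otimes> s) - g x))"
      using harmonic_repr_integrable(1)[OF Lf x] igx[OF x] by simp
    show "AE s in \<nu>. harmonic_repr f v (\<Lambda> #> x, s) + (g (x \<otimes> s) - g x) = u (\<Lambda> #> x, s)" using aeu[OF x] by eventually_elim simp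
  qed simp
  have Eu': "measure_pmf.expectation \<nu> (\<lambda>s. u (\<Lambda> #> x, s)) = v \<bullet> zeta + (measure_pmf.expectation \<nu> (\<lambda>s. g (x \<otimes> s)) - g x)" if x: "x \<in> carrier G" for x
  proof -
    have "measure_pmf.expectation \<nu> (\<lambda>s. u (\<Lambda> #> x, s)) = measure_pmf.expectation \<nu> (\<lambda>s. harmonic_repr f v (\<Lambda> #> x, s) + (g (x \<otimes> s) - g x))"
      by (rule integral_cong_AE) (use aeu[OF x] in auto)
    also have "\<dots> = measure_pmf.expectation \<nu> (\<lambda>s. harmonic_repr f v (\<Lambda> #> x, s)) + (measure_pmf.expectation \<nu> (\<lambda>s. g (x \<otimes> s)) - g x)"
      using harmonic_repr_integrable(1)[OF Lf x] igx[OF x] by simp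
    finally show ?thesis by (simp add: Eu[OF x])
  qed
  \<comment> \<open>Exact forms have total mean zero, because the uniform measure is
    stationary.\<close>
  have chi: "chi_form G \<Lambda> \<nu> u = v \<bullet> zeta"
  proof -
    have "chi_form G \<Lambda> \<nu> u = mean (\<lambda>x. measure_pmf.expectation \<nu> (\<lambda>s. u (\<Lambda> #> x, s)))"
      by (rule chi_form_eq) (use iu in auto)
    also have "\<dots> = mean (\<lambda>x. v \<bullet> zeta + (transition 1 g x - g x))"
      by (rule mean_cong) (simp only: Eu' D_carrier transition_def conv_1_expectation)
    also have "\<dots> = mean (\<lambda>_. v \<bullet> zeta) + (mean (transition 1 g) - mean g)"
      by (simp add: mean_def sum.distrib sum_subtractf scaleR_add_right right_diff_distrib distrib_left)
    also have "\<dots> = v \<bullet> zeta" unfolding mean_transition[OF Lg] mean_const by simp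
    finally show ?thesis .
  qed
  have harm: "measure_pmf.expectation \<nu> (\<lambda>s. g (x \<otimes> s)) = g x" if x: "x \<in> \<Delta>" for x
  proof -
    have "codifferential G \<Lambda> \<nu> u (\<Lambda> #> x) + chi_form G \<Lambda> \<nu> u = 0"
      using u x unfolding harmonic_form_def ball_cosets by blast
    moreover have "codifferential G \<Lambda> \<nu> u (\<Lambda> #> x) = - measure_pmf.expectation \<nu> (\<lambda>s. u (\<Lambda> #> x, s))"
      by (rule codifferential_eq[OF x iu]) (use x in auto)
    ultimately show ?thesis using x by (simp add: chi Eu')
  qed
  \<comment> \<open>\<open>harm\<close> speaks of representatives only; both sides being invariant,
    it extends to the whole group.\<close>
  have LP: "Linv (\<lambda>x. measure_pmf.expectation \<nu> (\<lambda>s. g (x \<otimes> s)))"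
    using transition_Linv[OF Lg, of 1] by (simp only: transition_def[abs_def] conv_1_expectation)
  have "measure_pmf.expectation \<nu> (\<lambda>s. g (x \<otimes> s)) = g x" if x: "x \<in> carrier G" for x
    using harm[OF rep_D[OF x]] Linv_rep[OF LP x] Linv_rep[OF Lg x] by simp
  then have gc: "g x = mean g" if "x \<in> carrier G" for x using harmonic_const[OF Lg _ that] by blast
  show "u = harmonic_repr f v"
  proof (rule extensionalityI)
    show "u \<in> extensional (edges G \<Lambda> \<nu>)" using u by (simp add: l2_forms_def one_forms_def)
    show "harmonic_repr f v \<in> extensional (edges G \<Lambda> \<nu>)" by (simp add: harmonic_repr_def)
    fix e assume e: "e \<in> edges G \<Lambda> \<nu>"
    obtain x s where xs: "x \<in> \<Delta>" "s \<in> steps" "e = (\<Lambda> #> x, s)" by (rule edge_cases[OF e])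
    have xs': "x \<in> carrier G" "s \<in> carrier G" using xs steps_carrier by auto
    show "u e = harmonic_repr f v e" unfolding xs(3) using ug[OF xs'(1) xs(2)] gc[of x] gc[of "x \<otimes> s"] xs' by simp
  qed
qed

text \<open>All vertices share the mean \<open>v \<bullet> zeta\<close>, so subtracting the product
  of the global means is the same as centring at each vertex. The second, uncentred formula is the
  one that is convenient for products.\<close>

lemma covariance_form_eq:
  assumes f: "corrector f"
  shows "covariance_form G \<Lambda> \<Delta> \<iota> \<nu> v w = cov f v w"
    "cov f v w = mean (\<lambda>x. measure_pmf.expectation \<nu> (\<lambda>s. (v \<bullet> cincr f x s) * (w \<bullet> cincr f x s))) - (v \<bullet> zeta) * (w \<bullet> zeta)"
proof -
  have Lf: "Linv f" using f by (simp add: corrector_def)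
  have E: "measure_pmf.expectation \<nu> (cincr f x) = zeta" if "x \<in> \<Delta>" for x using f that by (simp add: corrector_def)
  have 1: "(\<Sum>\<^sub>\<infinity>e\<in>edges G \<Lambda> \<nu>. harmonic_repr f v e * edge_weight G \<Lambda> \<nu> e) = v \<bullet> zeta" for v
  proof -
    have "chi_form G \<Lambda> \<nu> (harmonic_repr f v) = mean (\<lambda>x. measure_pmf.expectation \<nu> (\<lambda>s. harmonic_repr f v (\<Lambda> #> x, s)))"
      by (rule chi_form_eq) (use harmonic_repr_integrable(1)[OF Lf] in auto)
    also have "\<dots> = mean (\<lambda>x. v \<bullet> zeta)" by (rule mean_cong) (simp add: harmonic_repr_integrable(3)[OF Lf] E)
    finally show ?thesis by (simp add: mean_const chi_form_def)
  qed
  have "((\<lambda>e. edge_weight G \<Lambda> \<nu> e *\<^sub>R (harmonic_repr f v e * harmonic_repr f w e)) has_sum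
      mean (\<lambda>x. measure_pmf.expectation \<nu> (\<lambda>s. harmonic_repr f v (\<Lambda> #> x, s) * harmonic_repr f w (\<Lambda> #> x, s)))) (edges G \<Lambda> \<nu>)"
    by (rule edge_sum[of "\<lambda>e. harmonic_repr f v e * harmonic_repr f w e"]) (use harmonic_repr_integrable(2)[OF Lf] in auto)
  then have "((\<lambda>e. harmonic_repr f v e * harmonic_repr f w e * edge_weight G \<Lambda> \<nu> e) has_sum
      mean (\<lambda>x. measure_pmf.expectation \<nu> (\<lambda>s. harmonic_repr f v (\<Lambda> #> x, s) * harmonic_repr f w (\<Lambda> #> x, s)))) (edges G \<Lambda> \<nu>)"
    by (simp add: mult.commute)
  from infsumI[OF this] have 2: "(\<Sum>\<^sub>\<infinity>e\<in>edges G \<Lambda> \<nu>. harmonic_repr f v e * harmonic_repr f w e * edge_weight G \<Lambda> \<nu> e)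
     = mean (\<lambda>x. measure_pmf.expectation \<nu> (\<lambda>s. (v \<bullet> cincr f x s) * (w \<bullet> cincr f x s)))"
    by (simp add: mean_def harmonic_repr_integrable(4)[OF Lf])
  have "measure_pmf.expectation \<nu> (\<lambda>s. (v \<bullet> (cincr f x s - zeta)) * (w \<bullet> (cincr f x s - zeta)))
      = measure_pmf.expectation \<nu> (\<lambda>s. (v \<bullet> cincr f x s) * (w \<bullet> cincr f x s)) - (v \<bullet> zeta) * (w \<bullet> zeta)" if x: "x \<in> \<Delta>" for x
  proof -
    have x': "x \<in> carrier G" using x by simp
    have i1: "integrable \<nu> (\<lambda>s. (v \<bullet> cincr f x s) * (w \<bullet> cincr f x s))" using inner_cincr_integrable[OF Lf x', of v 0 w] by simp
    have i2: "integrable \<nu> (\<lambda>s. v \<bullet> cincr f x s)" for v using cincr_integrable[OF Lf x'] by simp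
    have e2: "measure_pmf.expectation \<nu> (\<lambda>s. v \<bullet> cincr f x s) = v \<bullet> zeta" for v
      using integral_inner_right[OF cincr_integrable[OF Lf x'], of v] by (simp add: E[OF x])
    have "measure_pmf.expectation \<nu> (\<lambda>s. (v \<bullet> (cincr f x s - zeta)) * (w \<bullet> (cincr f x s - zeta)))
      = measure_pmf.expectation \<nu> (\<lambda>s. (v \<bullet> cincr f x s) * (w \<bullet> cincr f x s) - (w \<bullet> zeta) * (v \<bullet> cincr f x s) - (v \<bullet> zeta) * (w \<bullet> cincr f x s) + (v \<bullet> zeta) * (w \<bullet> zeta))"
      by (rule Bochner_Integration.integral_cong[OF refl]) (simp add: inner_diff_right algebra_simps)
    also have "\<dots> = measure_pmf.expectation \<nu> (\<lambda>s. (v \<bullet> cincr f x s) * (w \<bullet> cincr f x s)) - (w \<bullet> zeta) * (v \<bullet> zeta) - (v \<bullet> zeta) * (w \<bullet> zeta) + (v \<bullet> zeta) * (w \<bullet> zeta)"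
      using i1 i2 by (simp add: e2)
    finally show ?thesis by simp
  qed
  then have "cov f v w = mean (\<lambda>x. measure_pmf.expectation \<nu> (\<lambda>s. (v \<bullet> cincr f x s) * (w \<bullet> cincr f x s)) - (v \<bullet> zeta) * (w \<bullet> zeta))"
    unfolding cov_def by (intro mean_cong)
  also have "\<dots> = mean (\<lambda>x. measure_pmf.expectation \<nu> (\<lambda>s. (v \<bullet> cincr f x s) * (w \<bullet> cincr f x s))) - mean (\<lambda>_. (v \<bullet> zeta) * (w \<bullet> zeta))"
    by (simp add: mean_def sum_subtractf right_diff_distrib)
  finally show 3: "cov f v w = mean (\<lambda>x. measure_pmf.expectation \<nu> (\<lambda>s. (v \<bullet> cincr f x s) * (w \<bullet> cincr f x s))) - (v \<bullet> zeta) * (w \<bullet> zeta)"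
    by (simp only: mean_const)
  show "covariance_form G \<Lambda> \<Delta> \<iota> \<nu> v w = cov f v w"
    unfolding covariance_form_def harmonic_part_dual_form[OF f] Let_def 1 2 3 ..
qed

lemma covariance_matrix_eq:
  assumes f: "corrector f"
  shows "v \<bullet> (covariance_matrix G \<Lambda> \<Delta> \<iota> \<nu> *v w) = cov f v w"
proof -
  have Lf: "Linv f" using f by (simp add: corrector_def)
  have ex: "\<forall>v w. v \<bullet> (matrix (cov_map f) *v w) = covariance_form G \<Lambda> \<Delta> \<iota> \<nu> v w"
    using linear_cov_map[OF Lf] by (simp add: matrix_works linear_matrix_vector_mul_eq[symmetric] inner_cov_map[OF Lf] covariance_form_eq(1)[OF f])
  have "covariance_matrix G \<Lambda> \<Delta> \<iota> \<nu> = matrix (cov_map f)"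
    unfolding covariance_matrix_def
  proof (rule the_equality, rule ex)
    fix M assume M: "\<forall>v w. v \<bullet> (M *v w) = covariance_form G \<Lambda> \<Delta> \<iota> \<nu> v w"
    have "M *v w = matrix (cov_map f) *v w" for w
      by (rule vector_eq_ldot[THEN iffD1]) (simp add: M ex)
    then show "M = matrix (cov_map f)" by (simp add: matrix_eq)
  qed
  then show ?thesis using ex by (simp add: covariance_form_eq(1)[OF f])
qed

end

section \<open>Transfer and word length\<close>

text \<open>Additivity is assumed on lattice points only, so the argument stays inside the lattice:
  natural multiples of a basis vector, then negative ones by adding their opposites, then finite
  sums.\<close>

lemma additive_int_lattice:
  fixes h :: "real ^ 'n \<Rightarrow> 'b::real_vector"
  assumes add: "\<And>a b. a \<in> int_lattice \<Longrightarrow> b \<in> int_lattice \<Longrightarrow> h (a + b) = h a + h b"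
    and w: "w \<in> int_lattice"
  shows "h w = (\<Sum>i\<in>UNIV. (w $ i) *\<^sub>R h (axis i 1))"
proof -
  have ax: "(of_int k *\<^sub>R axis i 1 :: real ^ 'n) \<in> int_lattice" for k i
    by (simp add: int_lattice_def axis_def)
  have zero: "(0 :: real ^ 'n) \<in> int_lattice" by (simp add: int_lattice_def)
  have h0: "h 0 = 0" using add[OF zero zero] by simp
  have nat: "h (of_int (int k) *\<^sub>R axis i 1) = of_int (int k) *\<^sub>R h (axis i 1)" for k i
  proof (induction k)
    case 0 then show ?case by (simp add: h0)
  next
    case (Suc k)
    have "h (of_int (int k) *\<^sub>R axis i 1 + of_int 1 *\<^sub>R axis i 1) = h (of_int (int k) *\<^sub>R axis i 1) + h (of_int 1 *\<^sub>R axis i 1)"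
      by (rule add[OF ax ax])
    with Suc show ?case by (simp add: scaleR_add_left add.commute)
  qed
  have int: "h (of_int k *\<^sub>R axis i 1) = of_int k *\<^sub>R h (axis i 1)" for k i
  proof (cases "k \<ge> 0")
    case True then show ?thesis using nat[of "nat k"] by simp
  next
    case False
    have "h (of_int k *\<^sub>R axis i 1 + of_int (int (nat (- k))) *\<^sub>R axis i 1)
        = h (of_int k *\<^sub>R axis i 1) + h (of_int (int (nat (- k))) *\<^sub>R axis i 1)" by (rule add[OF ax ax])
    moreover have "of_int k *\<^sub>R axis i 1 + of_int (int (nat (- k))) *\<^sub>R axis i 1 = (0 :: real ^ 'n)"
      using False by (simp add: scaleR_add_left[symmetric])
    ultimately have "h (of_int k *\<^sub>R axis i 1) + of_int (int (nat (- k))) *\<^sub>R h (axis i 1) = 0"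
      by (simp only: nat h0)
    then show ?thesis using False by (simp add: eq_neg_iff_add_eq_0[symmetric])
  qed
  have wi: "\<exists>k. w $ i = of_int k" for i using w by (auto simp: int_lattice_def elim: Ints_cases)
  have part: "(\<Sum>i\<in>I. (w $ i) *\<^sub>R axis i 1) \<in> int_lattice" for I :: "'n set"
    using w by (auto simp: int_lattice_def axis_def intro!: Ints_sum Ints_mult)
  have "h (\<Sum>i\<in>I. (w $ i) *\<^sub>R axis i 1) = (\<Sum>i\<in>I. (w $ i) *\<^sub>R h (axis i 1))" for I :: "'n set"
  proof (induction I rule: infinite_finite_induct)
    case (insert i I)
    obtain k where k: "w $ i = of_int k" using wi by blast
    have "h ((w $ i) *\<^sub>R axis i 1 + (\<Sum>i\<in>I. (w $ i) *\<^sub>R axis i 1)) = h ((w $ i) *\<^sub>R axis i 1) + h (\<Sum>i\<in>I. (w $ i) *\<^sub>R axis i 1)"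
      by (rule add[OF _ part]) (simp only: k ax)
    with insert show ?case by (simp add: k int)
  qed (simp_all add: h0)
  moreover have "(\<Sum>i\<in>UNIV. (w $ i) *\<^sub>R axis i 1) = w"
    using basis_expansion[of w] by (simp add: scalar_mult_eq_scaleR)
  ultimately show ?thesis by metis
qed

section \<open>The transfer homomorphism\<close>

context lattice_group
begin

abbreviation \<theta> where "\<theta> \<equiv> transfer_hom G \<Lambda> \<Delta> \<iota>"
abbreviation T where "T \<equiv> transfer_linear G \<Lambda> \<Delta> \<iota>"

lemma transfer_eq: "\<theta> \<gamma> = (\<Sum>x\<in>\<Delta>. \<Phi> (x \<otimes> \<gamma>))"
  by (simp add: transfer_hom_def coord_def)

text \<open>The coordinate increment along \<open>s\<close> is a function on the cosets, and right
  multiplication by \<open>\<gamma>\<close> permutes them.\<close>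

lemma transfer_mult:
  assumes "\<gamma> \<in> carrier G" "s \<in> carrier G" shows "\<theta> (\<gamma> \<otimes> s) = \<theta> \<gamma> + \<theta> s"
proof -
  have "\<theta> (\<gamma> \<otimes> s) = (\<Sum>x\<in>\<Delta>. \<Phi> (x \<otimes> \<gamma>) + (\<Phi> ((x \<otimes> \<gamma>) \<otimes> s) - \<Phi> (x \<otimes> \<gamma>)))"
    unfolding transfer_eq using assms by (intro sum.cong) (auto simp: m_assoc)
  also have "\<dots> = \<theta> \<gamma> + (\<Sum>x\<in>\<Delta>. \<Phi> (x \<otimes> s) - \<Phi> x)"
    unfolding sum.distrib sum_Linv_right[OF Linv_coord_diff[OF assms(2)] assms(1)] transfer_eq ..
  also have "(\<Sum>x\<in>\<Delta>. \<Phi> (x \<otimes> s) - \<Phi> x) = \<theta> s" unfolding transfer_eq by (intro sum.cong) (auto simp: coord_D)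
  finally show ?thesis .
qed

lemma transfer_one: "\<theta> \<one> = 0" using transfer_mult[of \<one> \<one>] by simp

lemma transfer_pow: "\<gamma> \<in> carrier G \<Longrightarrow> \<theta> (\<gamma> [^] n) = real n *\<^sub>R \<theta> \<gamma>"
  by (induction n) (simp_all add: transfer_one transfer_mult algebra_simps)

lemma ex_pow_in_L:
  assumes g: "\<gamma> \<in> carrier G" shows "\<exists>n::nat. n > 0 \<and> \<gamma> [^] n \<in> \<Lambda>"
proof -
  have "\<not> inj_on (\<lambda>n::nat. rep (\<gamma> [^] n)) UNIV"
  proof
    assume "inj_on (\<lambda>n::nat. rep (\<gamma> [^] n)) UNIV"
    moreover have "range (\<lambda>n::nat. rep (\<gamma> [^] n)) \<subseteq> \<Delta>" using g by (auto intro!: rep_D)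
    ultimately show False using finite_D by (meson finite_subset finite_imageD infinite_UNIV_nat)
  qed
  then obtain i j :: nat where "rep (\<gamma> [^] i) = rep (\<gamma> [^] j)" "i \<noteq> j" by (auto simp: inj_on_def)
  then obtain i j :: nat where r: "rep (\<gamma> [^] j) = rep (\<gamma> [^] i)" and ij: "i < j" by (metis linorder_neqE_nat)
  have "\<gamma> [^] j \<in> \<Lambda> #> (\<gamma> [^] i)" using r g by (subst mem_coset_iff) auto
  then obtain v where v: "v \<in> \<Lambda>" "\<gamma> [^] j = v \<otimes> \<gamma> [^] i" by (auto simp: r_coset_def)
  have "\<gamma> [^] (j - i) \<otimes> \<gamma> [^] i = \<gamma> [^] j" using g ij by (simp add: nat_pow_mult)
  with v have "\<gamma> [^] (j - i) = v" using g by (metis right_cancel nat_pow_closed L_carrier)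
  with v ij show ?thesis by (intro exI[of _ "j - i"]) auto
qed

text \<open>The standard basis consists of lattice points, so a linear map with the prescribed
  values is unique; additivity of \<open>\<theta>\<close> on the lattice makes the map defined
  through the basis have them.\<close>

lemma transfer_linear_works:
  "linear T" and transfer_linear_iota: "g \<in> \<Lambda> \<Longrightarrow> T (\<iota> g) = \<theta> g /\<^sub>R real (card \<Delta>)"
proof -
  define h where "h w = \<theta> (inv_into \<Lambda> \<iota> w) /\<^sub>R real (card \<Delta>)" for w
  have inv_iota: "inv_into \<Lambda> \<iota> (\<iota> g) = g" if "g \<in> \<Lambda>" for g
    by (rule inv_into_f_f[OF bij_betw_imp_inj_on[OF bij_iota] that])
  have lat: "\<exists>g\<in>\<Lambda>. \<iota> g = w" if "w \<in> int_lattice" for w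
    using that unfolding bij_betw_imp_surj_on[OF bij_iota, symmetric] by (elim imageE) blast
  have add: "h (a + b) = h a + h b" if ab: "a \<in> int_lattice" "b \<in> int_lattice" for a b
  proof -
    obtain g g' where "g \<in> \<Lambda>" "\<iota> g = a" "g' \<in> \<Lambda>" "\<iota> g' = b" using lat[OF ab(1)] lat[OF ab(2)] by blast
    then show ?thesis using inv_iota[of "g \<otimes> g'"] inv_iota[of g] inv_iota[of g']
      by (simp add: h_def iota_mult transfer_mult scaleR_add_right)
  qed
  define L where "L w = (\<Sum>i\<in>UNIV. (w $ i) *\<^sub>R h (axis i 1))" for w
  have L: "linear L" unfolding L_def
    by (intro linear_compose_sum ballI linearI) (simp_all add: scaleR_add_left)
  have LI: "L (\<iota> g) = \<theta> g /\<^sub>R real (card \<Delta>)" if "g \<in> \<Lambda>" for g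
    using additive_int_lattice[of h, OF add iota_lattice[OF that]] inv_iota[OF that] by (simp add: L_def h_def)
  have "T = L" unfolding transfer_linear_def
  proof (rule the_equality, intro conjI ballI)
    fix L' assume L': "linear L' \<and> (\<forall>g\<in>\<Lambda>. L' (\<iota> g) = \<theta> g /\<^sub>R real (card (rcosets \<Lambda>)))"
    show "L' = L"
    proof (rule linear_eq_stdbasis[OF conjunct1[OF L'] L])
      fix b :: "real ^ 'n" assume "b \<in> Basis"
      then have "b \<in> int_lattice" by (auto simp: Basis_vec_def int_lattice_def axis_def)
      then show "L' b = L b" using lat[of b] L' LI by (auto simp: card_D)
    qed
  qed (simp_all add: L LI card_D)
  then show "linear T" and "g \<in> \<Lambda> \<Longrightarrow> T (\<iota> g) = \<theta> g /\<^sub>R real (card \<Delta>)" by (simp_all add: L LI)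
qed

text \<open>Some power \<open>\<gamma> [^] n\<close> lies in the lattice, and
  \<open>\<theta> \<gamma>\<close> is its transfer divided by \<open>n\<close>. The range of
  \<open>T\<close> is a real subspace, so it contains the quotient although \<open>\<gamma>\<close>
  itself need not be in the lattice.\<close>

lemma transfer_in_range:
  assumes g: "\<gamma> \<in> carrier G" shows "\<theta> \<gamma> \<in> range T"
proof -
  obtain n :: nat where n: "n > 0" "\<gamma> [^] n \<in> \<Lambda>" using ex_pow_in_L[OF g] by blast
  have "T ((real (card \<Delta>) / real n) *\<^sub>R \<iota> (\<gamma> [^] n)) = (real (card \<Delta>) / real n) *\<^sub>R (real n *\<^sub>R \<theta> \<gamma> /\<^sub>R real (card \<Delta>))"
    unfolding linear_scale[OF transfer_linear_works] transfer_linear_iota[OF n(2)] transfer_pow[OF g] ..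
  also have "\<dots> = \<theta> \<gamma>" using n D_nonempty by simp
  finally show ?thesis by (metis rangeI)
qed

lemma ex_step_bound:
  assumes "finite B" "B \<subseteq> carrier G"
  shows "\<exists>K. K \<ge> 0 \<and> (\<forall>t\<in>B. \<forall>\<gamma>\<in>carrier G. norm (\<Phi> (\<gamma> \<otimes> t) - \<Phi> \<gamma>) \<le> K)"
  using assms
proof (induction B)
  case empty then show ?case by (intro exI[of _ 0]) simp
next
  case (insert t B)
  then obtain K where K: "K \<ge> 0" "\<forall>t\<in>B. \<forall>\<gamma>\<in>carrier G. norm (\<Phi> (\<gamma> \<otimes> t) - \<Phi> \<gamma>) \<le> K" by auto
  obtain K' where K': "K' > 0" "\<forall>\<gamma>\<in>carrier G. norm (\<Phi> (\<gamma> \<otimes> t) - \<Phi> \<gamma>) \<le> K'"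
    using Linv_bounded[OF Linv_coord_diff[of t]] insert.prems by auto
  show ?case by (rule exI[of _ "max K K'"]) (use K K' in \<open>auto simp: le_max_iff_disj\<close>)
qed

section \<open>Coordinates and word length\<close>

lemma foldr_mult_closed: "set xs \<subseteq> carrier G \<Longrightarrow> foldr (mult G) xs \<one> \<in> carrier G"
  by (induction xs) auto

lemma foldr_mult_append:
  "set xs \<subseteq> carrier G \<Longrightarrow> set ys \<subseteq> carrier G \<Longrightarrow>
    foldr (mult G) (xs @ ys) \<one> = foldr (mult G) xs \<one> \<otimes> foldr (mult G) ys \<one>"
  by (induction xs) (auto simp: foldr_mult_closed m_assoc)

lemma generate_word:
  assumes T: "B \<subseteq> carrier G" and g: "g \<in> generate G B"
  shows "\<exists>xs. set xs \<subseteq> B \<union> m_inv G ` B \<and> g = foldr (mult G) xs \<one>"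
  using g
proof induction
  case one show ?case by (intro exI[of _ "[]"]) simp
next
  case (incl h) then show ?case using T by (intro exI[of _ "[h]"]) auto
next
  case (inv h) then show ?case using T by (intro exI[of _ "[m_inv G h]"]) auto
next
  case (eng h1 h2)
  then obtain xs ys where x: "set xs \<subseteq> B \<union> m_inv G ` B" "h1 = foldr (mult G) xs \<one>"
    and y: "set ys \<subseteq> B \<union> m_inv G ` B" "h2 = foldr (mult G) ys \<one>" by blast
  have "B \<union> m_inv G ` B \<subseteq> carrier G" using T by auto
  then have "set xs \<subseteq> carrier G" "set ys \<subseteq> carrier G" using x y by blast+
  then show ?case using x y by (intro exI[of _ "xs @ ys"]) (simp add: foldr_mult_append del: foldr_append)
qed

text \<open>The coordinate is Lipschitz for the word metric: right multiplication by a generator or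
  its inverse moves it by an invariant, hence bounded, amount, and these bounds add up along a
  word.\<close>

lemma coord_word_length:
  assumes B: "finite B" "B \<subseteq> carrier G" "generate G B = carrier G"
  shows "\<exists>K. K \<ge> 0 \<and> (\<forall>\<gamma>\<in>carrier G. \<forall>g\<in>carrier G. norm (\<Phi> (\<gamma> \<otimes> g) - \<Phi> \<gamma>) \<le> K * real (word_length G B g))"
proof -
  let ?B = "B \<union> m_inv G ` B"
  have B': "?B \<subseteq> carrier G" "finite ?B" using B by auto
  obtain K where K: "K \<ge> 0" "\<forall>t\<in>?B. \<forall>\<gamma>\<in>carrier G. norm (\<Phi> (\<gamma> \<otimes> t) - \<Phi> \<gamma>) \<le> K"
    using ex_step_bound[OF B'(2,1)] by blast
  have word: "norm (\<Phi> (\<gamma> \<otimes> foldr (mult G) xs \<one>) - \<Phi> \<gamma>) \<le> K * real (length xs)"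
    if "set xs \<subseteq> ?B" "\<gamma> \<in> carrier G" for xs \<gamma>
    using that
  proof (induction xs arbitrary: \<gamma>)
    case (Cons t xs)
    have c: "t \<in> carrier G" "t \<in> ?B" "set xs \<subseteq> ?B" using Cons.prems B' by auto
    have d: "foldr (mult G) xs \<one> \<in> carrier G" using c B' by (intro foldr_mult_closed) blast
    have 1: "norm (\<Phi> ((\<gamma> \<otimes> t) \<otimes> foldr (mult G) xs \<one>) - \<Phi> (\<gamma> \<otimes> t)) \<le> K * real (length xs)"
      by (rule Cons.IH) (use c Cons.prems in auto)
    have 2: "norm (\<Phi> (\<gamma> \<otimes> t) - \<Phi> \<gamma>) \<le> K" using K(2) c Cons.prems by blast
    have "norm (\<Phi> (\<gamma> \<otimes> foldr (mult G) (t # xs) \<one>) - \<Phi> \<gamma>)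
      = norm ((\<Phi> ((\<gamma> \<otimes> t) \<otimes> foldr (mult G) xs \<one>) - \<Phi> (\<gamma> \<otimes> t)) + (\<Phi> (\<gamma> \<otimes> t) - \<Phi> \<gamma>))"
      using c d Cons.prems by (simp add: m_assoc)
    also have "\<dots> \<le> K * real (length xs) + K" using norm_triangle_ineq 1 2 by (meson add_mono order_trans)
    finally show ?case by (simp add: algebra_simps)
  qed simp
  have "\<exists>xs. length xs = word_length G B g \<and> set xs \<subseteq> ?B \<and> g = foldr (mult G) xs \<one>" if g: "g \<in> carrier G" for g
  proof -
    obtain xs where "set xs \<subseteq> ?B" "g = foldr (mult G) xs \<one>" using generate_word[OF B(2)] g B(3) by blast
    then have "\<exists>n xs. length xs = n \<and> set xs \<subseteq> ?B \<and> g = foldr (mult G) xs \<one>" by blast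
    then show ?thesis unfolding word_length_def by (rule LeastI_ex)
  qed
  with word K(1) show ?thesis by metis
qed

lemma second_moment_coord:
  assumes s: "set_pmf \<nu> \<subseteq> carrier G" and m: "finite_second_moment G \<nu>" and x: "x \<in> \<Delta>"
  shows "integrable (measure_pmf \<nu>) (\<lambda>s. (norm (\<Phi> (x \<otimes> s)))\<^sup>2)"
proof -
  obtain B where B: "finite B" "B \<subseteq> carrier G" "generate G B = carrier G"
    and su: "(\<lambda>g. (real (word_length G B g))\<^sup>2 * pmf \<nu> g) summable_on carrier G"
    using m unfolding finite_second_moment_def by blast
  obtain K where K: "K \<ge> 0" "\<forall>\<gamma>\<in>carrier G. \<forall>g\<in>carrier G. norm (\<Phi> (\<gamma> \<otimes> g) - \<Phi> \<gamma>) \<le> K * real (word_length G B g)"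
    using coord_word_length[OF B] by blast
  let ?F = "\<lambda>g. pmf \<nu> g * (norm (\<Phi> (x \<otimes> g)))\<^sup>2"
  have "?F summable_on carrier G"
  proof (rule summable_on_comparison_test)
    show "(\<lambda>g. K\<^sup>2 * ((real (word_length G B g))\<^sup>2 * pmf \<nu> g)) summable_on carrier G"
      by (rule summable_on_cmult_right[OF su])
    fix g assume g: "g \<in> carrier G"
    have "norm (\<Phi> (x \<otimes> g)) \<le> K * real (word_length G B g)" using K(2)[rule_format, OF D_carrier[OF x] g] by (simp add: coord_D[OF x])
    then have "(norm (\<Phi> (x \<otimes> g)))\<^sup>2 \<le> (K * real (word_length G B g))\<^sup>2" by (rule power_mono) simp
    from mult_left_mono[OF this pmf_nonneg[of \<nu> g]]
    show "?F g \<le> K\<^sup>2 * ((real (word_length G B g))\<^sup>2 * pmf \<nu> g)" by (simp add: power_mult_distrib mult_ac)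
  qed simp
  then have "?F summable_on UNIV"
    by (rule summable_on_cong_neutral[THEN iffD1, rotated -1]) (use s in \<open>auto simp: set_pmf_iff subset_iff\<close>)
  then have "(\<lambda>g. norm (?F g)) summable_on UNIV" by simp
  then have "Infinite_Set_Sum.abs_summable_on ?F UNIV" by (rule abs_summable_equivalent[THEN iffD1])
  then have "integrable (count_space UNIV) (\<lambda>g. pmf \<nu> g *\<^sub>R (norm (\<Phi> (x \<otimes> g)))\<^sup>2)" by (simp add: abs_summable_on_def)
  then show ?thesis unfolding measure_pmf_eq_density by (subst integrable_density) auto
qed

end

section \<open>Drift and transfer\<close>

context lattice_walk
begin

lemma mean_cincr:
  assumes f: "Linv f" and s: "s \<in> carrier G" shows "mean (\<lambda>x. cincr f x s) = \<theta> s /\<^sub>R real (card \<Delta>)"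
proof -
  have "(\<Sum>x\<in>\<Delta>. cincr f x s) = (\<Sum>x\<in>\<Delta>. \<Phi> (x \<otimes> s)) - ((\<Sum>x\<in>\<Delta>. f (x \<otimes> s)) - (\<Sum>x\<in>\<Delta>. f x))"
    by (simp add: cincr_def incr_def coord_D sum_subtractf)
  then show ?thesis unfolding mean_def sum_Linv_right[OF f s] transfer_eq by (simp add: divide_inverse)
qed

lemma orthogonal_transfer:
  assumes v: "v \<in> orthogonal_comp (range T)" and s: "s \<in> carrier G" shows "v \<bullet> \<theta> s = 0"
  using v transfer_in_range[OF s] unfolding orthogonal_comp_def by (auto simp: orthogonal_def inner_commute)

lemma expectation_mean:
  fixes k :: "'g \<Rightarrow> 'g \<Rightarrow> 'c::{banach,second_countable_topology}"
  assumes "\<And>x. x \<in> \<Delta> \<Longrightarrow> integrable \<nu> (k x)"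
  shows "measure_pmf.expectation \<nu> (\<lambda>s. mean (\<lambda>x. k x s)) = mean (\<lambda>x. measure_pmf.expectation \<nu> (k x))"
  unfolding mean_def using assms by simp

lemma transfer_integrable: "integrable \<nu> \<theta>"
proof -
  have "\<theta> = (\<lambda>s. \<Sum>x\<in>\<Delta>. incr x s)" by (simp add: fun_eq_iff transfer_eq incr_def coord_D)
  then show ?thesis using incr_integrable by simp
qed

lemma mean_expectation_cincr:
  assumes f: "Linv f"
  shows "mean (\<lambda>x. measure_pmf.expectation \<nu> (cincr f x)) = measure_pmf.expectation \<nu> \<theta> /\<^sub>R real (card \<Delta>)"
proof -
  have "mean (\<lambda>x. measure_pmf.expectation \<nu> (cincr f x)) = measure_pmf.expectation \<nu> (\<lambda>s. mean (\<lambda>x. cincr f x s))"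
    by (rule expectation_mean[symmetric]) (auto intro: cincr_integrable[OF f])
  also have "\<dots> = measure_pmf.expectation \<nu> (\<lambda>s. \<theta> s /\<^sub>R real (card \<Delta>))"
    by (rule integral_cong_AE) (auto simp: AE_measure_pmf_iff mean_cincr[OF f])
  finally show ?thesis using transfer_integrable by simp
qed

lemma zeta_eq: "zeta = measure_pmf.expectation \<nu> \<theta> /\<^sub>R real (card \<Delta>)"
proof -
  \<comment> \<open>With \<open>f = 0\<close> the corrected increments are the original
    ones.\<close>
  have "Linv (\<lambda>_. 0 :: real ^ 'n)" by (simp add: Linv_def)
  from mean_expectation_cincr[OF this] show ?thesis
    by (simp add: zeta_def mean_incr_def[abs_def] cincr_def[abs_def])
qed

text \<open>The average over the vertices of the corrected mean increments does not depend on
  \<open>f\<close>, so if they are all equal to some \<open>z\<close>, then \<open>z\<close> has to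
  be \<open>zeta\<close>. This identifies the drift of the product.\<close>

lemma correctorI:
  assumes f: "Linv f" and z: "\<And>\<gamma>. \<gamma> \<in> carrier G \<Longrightarrow> measure_pmf.expectation \<nu> (cincr f \<gamma>) = z"
  shows "corrector f" and "zeta = z"
proof -
  have "mean (\<lambda>x. measure_pmf.expectation \<nu> (cincr f x)) = mean (\<lambda>_. z)" by (rule mean_cong) (simp add: z)
  then show "zeta = z" unfolding mean_expectation_cincr[OF f] zeta_eq mean_const .
  with f z show "corrector f" by (simp add: corrector_def)
qed

text \<open>\<open>zeta\<close> is a multiple of the expectation of \<open>\<theta>\<close>, which
  takes values in the range of \<open>T\<close>. Testing against the orthogonal complement moves
  this through the integral, and a subspace is its own double complement.\<close>

lemma zeta_in_range: "zeta \<in> range T"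
proof -
  have "v \<bullet> zeta = 0" if v: "v \<in> orthogonal_comp (range T)" for v
  proof -
    have "v \<bullet> measure_pmf.expectation \<nu> \<theta> = measure_pmf.expectation \<nu> (\<lambda>s. v \<bullet> \<theta> s)"
      by (rule integral_inner_right[symmetric]) (rule transfer_integrable)
    also have "\<dots> = measure_pmf.expectation \<nu> (\<lambda>_. 0)"
      by (rule integral_cong_AE) (auto simp: AE_measure_pmf_iff orthogonal_transfer[OF v])
    finally show ?thesis by (simp add: zeta_eq)
  qed
  then have "zeta \<in> orthogonal_comp (orthogonal_comp (range T))"
    by (subst orthogonal_comp_def) (auto simp: orthogonal_def)
  also have "orthogonal_comp (orthogonal_comp (range T)) = range T"
    by (rule orthogonal_comp_self) (rule linear_subspace_image[OF transfer_linear_works subspace_UNIV])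
  finally show ?thesis .
qed

end

section \<open>Products\<close>

lemma vec_pair_nth [simp]: "vec_pair v w $ Inl i = v $ i" "vec_pair v w $ Inr j = w $ j"
  by (simp_all add: vec_pair_def)

lemma vec_pair_eq_iff: "vec_pair a b = vec_pair c d \<longleftrightarrow> a = c \<and> b = d"
  by (auto simp: vec_eq_iff vec_pair_def split: sum.splits) 

lemma ex_vec_pair: "\<exists>a b. w = vec_pair a b"
  by (rule exI[of _ "\<chi> i. w $ Inl i"], rule exI[of _ "\<chi> i. w $ Inr i"])
    (simp add: vec_eq_iff vec_pair_def split: sum.splits)

lemma vec_pair_add: "vec_pair a b + vec_pair c d = vec_pair (a + c) (b + d)"
  and vec_pair_diff: "vec_pair a b - vec_pair c d = vec_pair (a - c) (b - d)"
  and vec_pair_scaleR: "r *\<^sub>R vec_pair a b = vec_pair (r *\<^sub>R a) (r *\<^sub>R b)"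
  by (simp_all add: vec_eq_iff vec_pair_def split: sum.splits)

lemma inner_vec_pair: "vec_pair a b \<bullet> vec_pair c d = a \<bullet> c + b \<bullet> d"
proof -
  have "vec_pair a b \<bullet> vec_pair c d = (\<Sum>i\<in>UNIV <+> UNIV. vec_pair a b $ i \<bullet> vec_pair c d $ i)"
    by (simp add: inner_vec_def UNIV_Plus_UNIV)
  also have "\<dots> = a \<bullet> c + b \<bullet> d" by (simp add: sum.Plus inner_vec_def del: UNIV_Plus_UNIV)
  finally show ?thesis .
qed

lemma norm_vec_pair_ge: "norm a \<le> norm (vec_pair a b)" "norm b \<le> norm (vec_pair a b)"
  by (simp_all add: norm_eq_sqrt_inner inner_vec_pair)

lemma vec_pair_lattice: "vec_pair a b \<in> int_lattice \<longleftrightarrow> a \<in> int_lattice \<and> b \<in> int_lattice"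
proof -
  have "(\<forall>i. vec_pair a b $ i \<in> \<int>) \<longleftrightarrow> (\<forall>i. a $ i \<in> \<int>) \<and> (\<forall>i. b $ i \<in> \<int>)"
    by (metis vec_pair_nth sum.exhaust)
  then show ?thesis by (simp add: int_lattice_def)
qed

lemma expectation_vec_pair:
  fixes a :: "'s \<Rightarrow> real ^ 'm" and b :: "'s \<Rightarrow> real ^ 'k"
  assumes a: "integrable (measure_pmf p) a" and b: "integrable (measure_pmf p) b"
  shows "measure_pmf.expectation p (\<lambda>s. vec_pair (a s) (b s)) = vec_pair (measure_pmf.expectation p a) (measure_pmf.expectation p b)"
proof -
  have split: "vec_pair v w = vec_pair v 0 + vec_pair 0 w" for v :: "real ^ 'm" and w :: "real ^ 'k"
    by (simp add: vec_pair_add)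
  have L: "bounded_linear (\<lambda>v :: real ^ 'm. vec_pair v (0 :: real ^ 'k))" "bounded_linear (\<lambda>w :: real ^ 'k. vec_pair (0 :: real ^ 'm) w)"
    by (auto simp: linear_conv_bounded_linear[symmetric] vec_pair_add vec_pair_scaleR intro!: linearI)
  have "measure_pmf.expectation p (\<lambda>s. vec_pair (a s) (b s)) = measure_pmf.expectation p (\<lambda>s. vec_pair (a s) 0 + vec_pair 0 (b s))"
    by (simp add: vec_pair_add)
  also have "\<dots> = measure_pmf.expectation p (\<lambda>s. vec_pair (a s) 0) + measure_pmf.expectation p (\<lambda>s. vec_pair 0 (b s))"
    by (rule Bochner_Integration.integral_add) (rule integrable_bounded_linear[OF L(1) a], rule integrable_bounded_linear[OF L(2) b])
  also have "measure_pmf.expectation p (\<lambda>s. vec_pair (a s) 0) = vec_pair (measure_pmf.expectation p a) (0 :: real ^ 'k)"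
    by (rule integral_bounded_linear[OF L(1) a])
  also have "measure_pmf.expectation p (\<lambda>s. vec_pair 0 (b s)) = vec_pair (0 :: real ^ 'm) (measure_pmf.expectation p b)"
    by (rule integral_bounded_linear[OF L(2) b])
  finally show ?thesis by (simp add: vec_pair_add)
qed

text \<open>The bound on the coordinates transports the second moment.\<close>

lemma (in lattice_walk) lattice_walk_marginal:
  assumes H: "lattice_group H L D \<kappa>" and h: "\<pi> \<in> hom G H" and surj: "\<pi> ` carrier G = carrier H"
    and bound: "\<And>x. x \<in> D \<Longrightarrow> \<exists>y\<in>\<Delta>. \<forall>s\<in>carrier G. norm (coord H L D \<kappa> (x \<otimes>\<^bsub>H\<^esub> \<pi> s)) \<le> norm (\<Phi> (y \<otimes> s))"
  shows "lattice_walk H L D \<kappa> (map_pmf \<pi> \<nu>)"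
proof -
  interpret H: lattice_group H L D \<kappa> by (rule H)
  have hm: "\<pi> (a \<otimes> b) = \<pi> a \<otimes>\<^bsub>H\<^esub> \<pi> b" if "a \<in> carrier G" "b \<in> carrier G" for a b
    using h that by (simp add: hom_mult)
  have hc: "\<pi> a \<in> carrier H" if "a \<in> carrier G" for a using h that by (simp add: hom_in_carrier)
  have h1: "\<pi> \<one> = \<one>\<^bsub>H\<^esub>" using hom_one[OF h] by (simp add: H.is_group is_group)
  have conv_H: "conv_power H (map_pmf \<pi> \<nu>) n = map_pmf \<pi> (conv n)" for n
  proof (induction n)
    case 0 then show ?case by (simp add: h1)
  next
    case (Suc n)
    have "conv_power H (map_pmf \<pi> \<nu>) (Suc n) = map_pmf (\<lambda>(g, h). \<pi> g \<otimes>\<^bsub>H\<^esub> \<pi> h) (pair_pmf (conv n) \<nu>)"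
      by (simp add: Suc map_pair[symmetric] map_pmf_comp case_prod_unfold)
    also have "\<dots> = map_pmf (\<lambda>(g, h). \<pi> (g \<otimes> h)) (pair_pmf (conv n) \<nu>)"
      by (rule map_pmf_cong) (auto simp: hm set_conv_carrier)
    finally show ?case by (simp add: map_pmf_comp case_prod_unfold)
  qed
  show ?thesis
  proof
    show "set_pmf (map_pmf \<pi> \<nu>) \<subseteq> carrier H" using hc by auto
    show "semigroup_generated H (set_pmf (map_pmf \<pi> \<nu>)) = carrier H"
    proof (intro equalityI subsetI)
      fix x assume "x \<in> semigroup_generated H (set_pmf (map_pmf \<pi> \<nu>))"
      then show "x \<in> carrier H" by induction (use hc in auto)
    next
      have "\<pi> g \<in> semigroup_generated H (set_pmf (map_pmf \<pi> \<nu>))" if "g \<in> semigroup_generated G (set_pmf \<nu>)" for g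
        using that
      proof induction
        case (base s) then show ?case by (intro semigroup_generated.base) simp
      next
        case (mult a b)
        then have "a \<in> carrier G" "b \<in> carrier G" using gen by auto
        then show ?case using mult.IH by (simp add: hm semigroup_generated.mult)
      qed
      moreover fix x assume "x \<in> carrier H"
      ultimately show "x \<in> semigroup_generated H (set_pmf (map_pmf \<pi> \<nu>))"
        unfolding surj[symmetric] gen by auto
    qed
    show "aperiodic H (map_pmf \<pi> \<nu>)"
    proof -
      \<comment> \<open>Every return time of the walk on \<open>G\<close> is one of its image on
        \<open>H\<close>, so the gcd for \<open>H\<close> divides the gcd for
        \<open>G\<close>.\<close>
      let ?A = "{n. n \<ge> 1 \<and> pmf (conv n) \<one> > 0}" and ?B = "{n. n \<ge> 1 \<and> pmf (conv_power H (map_pmf \<pi> \<nu>) n) \<one>\<^bsub>H\<^esub> > 0}"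
      have "?A \<subseteq> ?B"
        unfolding conv_H by (auto simp: pmf_positive_iff h1[symmetric])
      then have "Gcd ?B dvd Gcd ?A" by (intro Gcd_greatest Gcd_dvd) auto
      then show ?thesis using aper by (simp add: aperiodic_def)
    qed
    fix x assume "x \<in> D"
    then obtain y where y: "y \<in> \<Delta>" "\<forall>s\<in>carrier G. norm (coord H L D \<kappa> (x \<otimes>\<^bsub>H\<^esub> \<pi> s)) \<le> norm (\<Phi> (y \<otimes> s))"
      using bound by blast
    have "integrable \<nu> (\<lambda>s. (norm (coord H L D \<kappa> (x \<otimes>\<^bsub>H\<^esub> \<pi> s)))\<^sup>2)"
      by (rule Bochner_Integration.integrable_bound[OF moment[OF y(1)]])
        (use y(2) in \<open>auto simp: AE_measure_pmf_iff intro!: power_mono\<close>)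
    then show "integrable (map_pmf \<pi> \<nu>) (\<lambda>s. (norm (coord H L D \<kappa> (x \<otimes>\<^bsub>H\<^esub> s)))\<^sup>2)"
      by (simp add: integrable_map_pmf_eq)
  qed
qed

section \<open>Products of lattice groups\<close>

locale lattice_group_pair = A: lattice_group G1 \<Lambda>1 \<Delta>1 \<iota>1 + B: lattice_group G2 \<Lambda>2 \<Delta>2 \<iota>2
  for G1 :: "('a, 'x) monoid_scheme" and \<Lambda>1 \<Delta>1 and \<iota>1 :: "'a \<Rightarrow> real ^ 'm1"
    and G2 :: "('b, 'y) monoid_scheme" and \<Lambda>2 \<Delta>2 and \<iota>2 :: "'b \<Rightarrow> real ^ 'm2"
begin

lemma r_coset_Times: "(\<Lambda>1 \<times> \<Lambda>2) #>\<^bsub>G1 \<times>\<times> G2\<^esub> g = (\<Lambda>1 #>\<^bsub>G1\<^esub> fst g) \<times> (\<Lambda>2 #>\<^bsub>G2\<^esub> snd g)"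
  by (cases g) (force simp: r_coset_def)

lemma lattice_group_prod:
  "lattice_group (G1 \<times>\<times> G2) (\<Lambda>1 \<times> \<Lambda>2) (\<Delta>1 \<times> \<Delta>2) (prod_embedding \<iota>1 \<iota>2)"
proof (intro lattice_group.intro lattice_group_axioms.intro)
  show "group (G1 \<times>\<times> G2)" by (rule DirProd_group[OF A.is_group B.is_group])
  show "\<Lambda>1 \<times> \<Lambda>2 \<lhd> G1 \<times>\<times> G2" by (rule A.DirProd_normal[OF B.is_group A.normal B.normal])
  have "rcosets\<^bsub>G1 \<times>\<times> G2\<^esub> (\<Lambda>1 \<times> \<Lambda>2) \<subseteq> (\<lambda>(X, Y). X \<times> Y) ` ((rcosets\<^bsub>G1\<^esub> \<Lambda>1) \<times> (rcosets\<^bsub>G2\<^esub> \<Lambda>2))"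
  proof
    fix Z assume "Z \<in> rcosets\<^bsub>G1 \<times>\<times> G2\<^esub> (\<Lambda>1 \<times> \<Lambda>2)"
    then obtain g h where "g \<in> carrier G1" "h \<in> carrier G2" "Z = (\<Lambda>1 #>\<^bsub>G1\<^esub> g) \<times> (\<Lambda>2 #>\<^bsub>G2\<^esub> h)"
      by (auto simp: RCOSETS_def r_coset_Times)
    then show "Z \<in> (\<lambda>(X, Y). X \<times> Y) ` ((rcosets\<^bsub>G1\<^esub> \<Lambda>1) \<times> (rcosets\<^bsub>G2\<^esub> \<Lambda>2))"
      by (intro image_eqI[of _ _ "(\<Lambda>1 #>\<^bsub>G1\<^esub> g, \<Lambda>2 #>\<^bsub>G2\<^esub> h)"]) (auto simp: RCOSETS_def)
  qed
  then show "finite (rcosets\<^bsub>G1 \<times>\<times> G2\<^esub> (\<Lambda>1 \<times> \<Lambda>2))"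
    by (rule finite_subset) (simp add: A.finite_index B.finite_index)
  show "prod_embedding \<iota>1 \<iota>2 \<in> iso ((G1 \<times>\<times> G2)\<lparr>carrier := \<Lambda>1 \<times> \<Lambda>2\<rparr>) int_lattice_group"
    unfolding iso_def
  proof (intro CollectI conjI)
    show "prod_embedding \<iota>1 \<iota>2 \<in> hom ((G1 \<times>\<times> G2)\<lparr>carrier := \<Lambda>1 \<times> \<Lambda>2\<rparr>) int_lattice_group"
      by (rule homI) (auto simp: int_lattice_group_def prod_embedding_def vec_pair_lattice A.iota_lattice B.iota_lattice
          A.iota_mult B.iota_mult vec_pair_add)
    show "bij_betw (prod_embedding \<iota>1 \<iota>2) (carrier ((G1 \<times>\<times> G2)\<lparr>carrier := \<Lambda>1 \<times> \<Lambda>2\<rparr>)) (carrier int_lattice_group)"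
    proof (rule bij_betwI')
      fix w :: "real ^ ('m1 + 'm2)" assume "w \<in> carrier int_lattice_group"
      then have w: "w \<in> int_lattice" by (simp add: int_lattice_group_def)
      obtain a b where ab: "w = vec_pair a b" using ex_vec_pair by blast
      then have "a \<in> int_lattice" "b \<in> int_lattice" using w by (simp_all add: vec_pair_lattice)
      then have "a \<in> \<iota>1 ` \<Lambda>1" "b \<in> \<iota>2 ` \<Lambda>2"
        using bij_betw_imp_surj_on[OF A.bij_iota] bij_betw_imp_surj_on[OF B.bij_iota] by simp_all
      then obtain g h where "g \<in> \<Lambda>1" "a = \<iota>1 g" "h \<in> \<Lambda>2" "b = \<iota>2 h" by (elim imageE) rule
      then show "\<exists>g\<in>carrier ((G1 \<times>\<times> G2)\<lparr>carrier := \<Lambda>1 \<times> \<Lambda>2\<rparr>). w = prod_embedding \<iota>1 \<iota>2 g"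
        by (intro bexI[of _ "(g, h)"]) (simp_all add: ab prod_embedding_def)
    qed (auto simp: prod_embedding_def vec_pair_eq_iff A.iota_inj B.iota_inj int_lattice_group_def vec_pair_lattice
        A.iota_lattice B.iota_lattice)
  qed
  note r1 = A.reps[unfolded representatives_def] and r2 = B.reps[unfolded representatives_def]
  note c = r1[THEN conjunct1] r1[THEN conjunct2, THEN conjunct1] r1[THEN conjunct2, THEN conjunct2, THEN conjunct1]
    r1[THEN conjunct2, THEN conjunct2, THEN conjunct2]
    r2[THEN conjunct1] r2[THEN conjunct2, THEN conjunct1] r2[THEN conjunct2, THEN conjunct2, THEN conjunct1]
    r2[THEN conjunct2, THEN conjunct2, THEN conjunct2]
  show "representatives (G1 \<times>\<times> G2) (\<Lambda>1 \<times> \<Lambda>2) (\<Delta>1 \<times> \<Delta>2)"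
    unfolding representatives_def r_coset_Times
  proof (intro conjI)
    show "carrier (G1 \<times>\<times> G2) = (\<Union>x\<in>\<Delta>1 \<times> \<Delta>2. (\<Lambda>1 #>\<^bsub>G1\<^esub> fst x) \<times> (\<Lambda>2 #>\<^bsub>G2\<^esub> snd x))"
      unfolding carrier_DirProd c(3,7) by force
    show "disjoint_family_on (\<lambda>x. (\<Lambda>1 #>\<^bsub>G1\<^esub> fst x) \<times> (\<Lambda>2 #>\<^bsub>G2\<^esub> snd x)) (\<Delta>1 \<times> \<Delta>2)"
      using c(4,8) unfolding disjoint_family_on_def by force
  qed (use c(1,2,5,6) in auto)
qed

end

locale lattice_walk_pair = lattice_group_pair +
  fixes \<nu>
  assumes walk: "lattice_walk (G1 \<times>\<times> G2) (\<Lambda>1 \<times> \<Lambda>2) (\<Delta>1 \<times> \<Delta>2) (prod_embedding \<iota>1 \<iota>2) \<nu>"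

sublocale lattice_walk_pair \<subseteq> P: lattice_walk "G1 \<times>\<times> G2" "\<Lambda>1 \<times> \<Lambda>2" "\<Delta>1 \<times> \<Delta>2" "prod_embedding \<iota>1 \<iota>2" \<nu>
  by (rule walk)

context lattice_walk_pair
begin

lemma coord_prod:
  assumes "g \<in> carrier G1" "h \<in> carrier G2"
  shows "P.\<Phi> (g, h) = vec_pair (A.\<Phi> g) (B.\<Phi> h)"
proof -
  obtain v x where v: "v \<in> \<Lambda>1" "x \<in> \<Delta>1" "g = v \<otimes>\<^bsub>G1\<^esub> x" by (rule A.decomp[OF assms(1)])
  obtain w y where w: "w \<in> \<Lambda>2" "y \<in> \<Delta>2" "h = w \<otimes>\<^bsub>G2\<^esub> y" by (rule B.decomp[OF assms(2)])
  have "lattice_part (G1 \<times>\<times> G2) (\<Lambda>1 \<times> \<Lambda>2) (\<Delta>1 \<times> \<Delta>2) ((v, w) \<otimes>\<^bsub>G1 \<times>\<times> G2\<^esub> (x, y)) = (v, w)"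
    by (rule P.lattice_part_mult) (use v w in auto)
  then show ?thesis using v w
    by (simp add: coord_def A.lattice_part_mult B.lattice_part_mult prod_embedding_def)
qed

end

sublocale lattice_walk_pair \<subseteq> A: lattice_walk G1 \<Lambda>1 \<Delta>1 \<iota>1 "map_pmf fst \<nu>"
proof (rule P.lattice_walk_marginal)
  show "lattice_group G1 \<Lambda>1 \<Delta>1 \<iota>1" by (rule A.lattice_group_axioms)
  show "fst \<in> hom (G1 \<times>\<times> G2) G1" by (rule homI) (auto simp: mult_DirProd')
  have "carrier G2 \<noteq> {}" using B.one_closed by blast
  then show "fst ` carrier (G1 \<times>\<times> G2) = carrier G1" by simp
  fix x assume "x \<in> \<Delta>1"
  then show "\<exists>y\<in>\<Delta>1 \<times> \<Delta>2. \<forall>s\<in>carrier (G1 \<times>\<times> G2). norm (A.\<Phi> (x \<otimes>\<^bsub>G1\<^esub> fst s)) \<le> norm (P.\<Phi> (y \<otimes>\<^bsub>G1 \<times>\<times> G2\<^esub> s))"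
    \<comment> \<open>Any representative in the second factor would do; a component of a pair is
      never longer than the pair.\<close>
    by (intro bexI[of _ "(x, \<one>\<^bsub>G2\<^esub>)"]) (auto simp: coord_prod norm_vec_pair_ge)
qed

sublocale lattice_walk_pair \<subseteq> B: lattice_walk G2 \<Lambda>2 \<Delta>2 \<iota>2 "map_pmf snd \<nu>"
proof (rule P.lattice_walk_marginal)
  show "lattice_group G2 \<Lambda>2 \<Delta>2 \<iota>2" by (rule B.lattice_group_axioms)
  show "snd \<in> hom (G1 \<times>\<times> G2) G2" by (rule homI) (auto simp: mult_DirProd')
  have "carrier G1 \<noteq> {}" using A.one_closed by blast
  then show "snd ` carrier (G1 \<times>\<times> G2) = carrier G2" by simp
  fix x assume "x \<in> \<Delta>2"
  then show "\<exists>y\<in>\<Delta>1 \<times> \<Delta>2. \<forall>s\<in>carrier (G1 \<times>\<times> G2). norm (B.\<Phi> (x \<otimes>\<^bsub>G2\<^esub> snd s)) \<le> norm (P.\<Phi> (y \<otimes>\<^bsub>G1 \<times>\<times> G2\<^esub> s))"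
    by (intro bexI[of _ "(\<one>\<^bsub>G1\<^esub>, x)"]) (auto simp: coord_prod norm_vec_pair_ge)
qed

section \<open>Correctors and covariances of the product\<close>

context lattice_walk_pair
begin

lemma Linv_prod_embedding: "A.Linv f \<Longrightarrow> B.Linv g \<Longrightarrow> P.Linv (prod_embedding f g)"
  by (auto simp: P.Linv_def A.Linv_def B.Linv_def prod_embedding_def)

lemma cincr_prod_embedding:
  assumes "x \<in> carrier (G1 \<times>\<times> G2)" "s \<in> carrier (G1 \<times>\<times> G2)"
  shows "P.cincr (prod_embedding f g) x s = vec_pair (A.cincr f (fst x) (fst s)) (B.cincr g (snd x) (snd s))"
  using assms by (cases x; cases s)
    (simp add: P.cincr_def P.incr_def A.cincr_def A.incr_def B.cincr_def B.incr_def coord_prod prod_embedding_def vec_pair_diff)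

lemma AE_cincr_prod_embedding:
  assumes x: "x \<in> carrier (G1 \<times>\<times> G2)"
  shows "AE s in \<nu>. P.cincr (prod_embedding f g) x s = vec_pair (A.cincr f (fst x) (fst s)) (B.cincr g (snd x) (snd s))"
  unfolding AE_measure_pmf_iff by (intro ballI cincr_prod_embedding[OF x] P.supp')

text \<open>The corrected increment of the product is the pair of those of the factors. The mean of
  each component sees only the corresponding marginal of \<open>\<nu>\<close>, however the two
  components are correlated.\<close>

lemma corrector_prod_embedding:
  assumes f: "A.corrector f" and g: "B.corrector g"
  shows "P.corrector (prod_embedding f g)" and "P.zeta = vec_pair A.zeta B.zeta"
proof -
  have Lf: "A.Linv f" and Lg: "B.Linv g" using f g by (simp_all add: A.corrector_def B.corrector_def)
  have L: "P.Linv (prod_embedding f g)" by (rule Linv_prod_embedding[OF Lf Lg])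
  have z: "measure_pmf.expectation \<nu> (P.cincr (prod_embedding f g) x) = vec_pair A.zeta B.zeta"
    if x: "x \<in> carrier (G1 \<times>\<times> G2)" for x
  proof -
    have x': "fst x \<in> carrier G1" "snd x \<in> carrier G2" using x by auto
    have i: "integrable \<nu> (\<lambda>s. A.cincr f (fst x) (fst s))" "integrable \<nu> (\<lambda>s. B.cincr g (snd x) (snd s))"
      using A.cincr_integrable[OF Lf x'(1)] B.cincr_integrable[OF Lg x'(2)] by (simp_all add: integrable_map_pmf_eq)
    have "measure_pmf.expectation \<nu> (P.cincr (prod_embedding f g) x)
      = measure_pmf.expectation \<nu> (\<lambda>s. vec_pair (A.cincr f (fst x) (fst s)) (B.cincr g (snd x) (snd s)))"
      by (rule integral_cong_AE) (use AE_cincr_prod_embedding[OF x] in simp_all)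
    also have "\<dots> = vec_pair (measure_pmf.expectation (map_pmf fst \<nu>) (A.cincr f (fst x))) (measure_pmf.expectation (map_pmf snd \<nu>) (B.cincr g (snd x)))"
      unfolding expectation_vec_pair[OF i] by simp
    finally show ?thesis using f g x' by (simp add: A.corrector_def B.corrector_def)
  qed
  show "P.corrector (prod_embedding f g)" "P.zeta = vec_pair A.zeta B.zeta"
    using P.correctorI[OF L z] by simp_all
qed

lemma mean_prod: "P.mean h = A.mean (\<lambda>x. B.mean (\<lambda>y. h (x, y)))"
  by (simp add: P.mean_def A.mean_def B.mean_def card_cartesian_product scaleR_sum_right sum.cartesian_product case_prod_unfold)

lemma cov_eq:
  assumes f: "A.corrector f" and g: "B.corrector g"
  shows "P.cov (prod_embedding f g) v w
    = A.mean (\<lambda>x. B.mean (\<lambda>y. measure_pmf.expectation \<nu> (\<lambda>s.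
        (v \<bullet> vec_pair (A.cincr f x (fst s)) (B.cincr g y (snd s))) * (w \<bullet> vec_pair (A.cincr f x (fst s)) (B.cincr g y (snd s))))))
      - (v \<bullet> vec_pair A.zeta B.zeta) * (w \<bullet> vec_pair A.zeta B.zeta)"
proof -
  have e: "measure_pmf.expectation \<nu> (\<lambda>s. (v \<bullet> P.cincr (prod_embedding f g) x s) * (w \<bullet> P.cincr (prod_embedding f g) x s))
      = measure_pmf.expectation \<nu> (\<lambda>s.
        (v \<bullet> vec_pair (A.cincr f (fst x) (fst s)) (B.cincr g (snd x) (snd s))) * (w \<bullet> vec_pair (A.cincr f (fst x) (fst s)) (B.cincr g (snd x) (snd s))))"
    if "x \<in> \<Delta>1 \<times> \<Delta>2" for x
  proof (rule integral_cong_AE)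
    have "x \<in> carrier (G1 \<times>\<times> G2)" using that by auto
    from AE_cincr_prod_embedding[OF this, of f g]
    show "AE s in \<nu>. (v \<bullet> P.cincr (prod_embedding f g) x s) * (w \<bullet> P.cincr (prod_embedding f g) x s)
      = (v \<bullet> vec_pair (A.cincr f (fst x) (fst s)) (B.cincr g (snd x) (snd s))) * (w \<bullet> vec_pair (A.cincr f (fst x) (fst s)) (B.cincr g (snd x) (snd s)))"
      by eventually_elim simp
  qed simp_all
  show ?thesis
    unfolding P.covariance_form_eq(2)[OF corrector_prod_embedding(1)[OF f g]] corrector_prod_embedding(2)[OF f g] mean_prod
    by (intro arg_cong2[where f = "(-)"] refl A.mean_cong B.mean_cong) (simp add: e)
qed

text \<open>With zero second components the integrand no longer involves the vertex of the second
  factor, so averaging over it does nothing, and the expectation is one over the marginal.\<close>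

lemma cov_fst:
  assumes f: "A.corrector f" and g: "B.corrector g"
  shows "P.cov (prod_embedding f g) (vec_pair v 0) (vec_pair w 0) = A.cov f v w"
  unfolding cov_eq[OF f g] A.covariance_form_eq(2)[OF f] by (simp add: inner_vec_pair B.mean_const)

lemma cov_snd:
  assumes f: "A.corrector f" and g: "B.corrector g"
  shows "P.cov (prod_embedding f g) (vec_pair 0 v) (vec_pair 0 w) = B.cov g v w"
  unfolding cov_eq[OF f g] B.covariance_form_eq(2)[OF g] by (simp add: inner_vec_pair A.mean_const)

text \<open>The two vertices range over \<Delta>1 and \<Delta>2 separately, so for a fixed step the
  double average of the product is the product of the two averages, each a multiple of the transfer
  by \<open>mean_cincr\<close>. Only the correlation between \<open>fst s\<close> and
  \<open>snd s\<close> stays inside the expectation.\<close>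

lemma cov_mixed:
  assumes f: "A.corrector f" and g: "B.corrector g"
  shows "P.cov (prod_embedding f g) (vec_pair v 0) (vec_pair 0 w)
    = measure_pmf.expectation \<nu> (\<lambda>s. (v \<bullet> A.\<theta> (fst s)) * (w \<bullet> B.\<theta> (snd s))) / (real (card \<Delta>1) * real (card \<Delta>2))
      - (v \<bullet> A.zeta) * (w \<bullet> B.zeta)"
proof -
  have Lf: "A.Linv f" and Lg: "B.Linv g" using f g by (simp_all add: A.corrector_def B.corrector_def)
  have i: "integrable \<nu> (\<lambda>s. (v \<bullet> A.cincr f x (fst s)) * (w \<bullet> B.cincr g y (snd s)))" if xy: "x \<in> \<Delta>1" "y \<in> \<Delta>2" for x y
  proof -
    have xy': "(x, y) \<in> carrier (G1 \<times>\<times> G2)" using xy by simp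
    have "integrable \<nu> (\<lambda>s. (vec_pair v 0 \<bullet> P.cincr (prod_embedding f g) (x, y) s) * (vec_pair 0 w \<bullet> P.cincr (prod_embedding f g) (x, y) s))"
      using P.inner_cincr_integrable[OF Linv_prod_embedding[OF Lf Lg] xy', of "vec_pair v 0" 0 "vec_pair 0 w"] by simp
    then show ?thesis
    proof (rule integrable_cong_AE_imp)
      show "AE s in \<nu>. (vec_pair v 0 \<bullet> P.cincr (prod_embedding f g) (x, y) s) * (vec_pair 0 w \<bullet> P.cincr (prod_embedding f g) (x, y) s)
        = (v \<bullet> A.cincr f x (fst s)) * (w \<bullet> B.cincr g y (snd s))"
        using AE_cincr_prod_embedding[OF xy', of f g] by eventually_elim (simp add: inner_vec_pair)
    qed simp
  qed
  have "P.cov (prod_embedding f g) (vec_pair v 0) (vec_pair 0 w) =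
      A.mean (\<lambda>x. B.mean (\<lambda>y. measure_pmf.expectation \<nu> (\<lambda>s. (v \<bullet> A.cincr f x (fst s)) * (w \<bullet> B.cincr g y (snd s)))))
      - (v \<bullet> A.zeta) * (w \<bullet> B.zeta)"
    unfolding cov_eq[OF f g] by (simp add: inner_vec_pair)
  also have "A.mean (\<lambda>x. B.mean (\<lambda>y. measure_pmf.expectation \<nu> (\<lambda>s. (v \<bullet> A.cincr f x (fst s)) * (w \<bullet> B.cincr g y (snd s)))))
      = measure_pmf.expectation \<nu> (\<lambda>s. A.mean (\<lambda>x. B.mean (\<lambda>y. (v \<bullet> A.cincr f x (fst s)) * (w \<bullet> B.cincr g y (snd s)))))"
    unfolding A.mean_def B.mean_def using i by simp
  also have "\<dots> = measure_pmf.expectation \<nu> (\<lambda>s. (v \<bullet> A.mean (\<lambda>x. A.cincr f x (fst s))) * (w \<bullet> B.mean (\<lambda>y. B.cincr g y (snd s))))"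
    unfolding A.mean_def B.mean_def
    by (rule Bochner_Integration.integral_cong[OF refl]) (simp add: inner_sum_right sum_distrib_left[symmetric] sum_distrib_right[symmetric] sum_divide_distrib[symmetric])
  also have "\<dots> = measure_pmf.expectation \<nu> (\<lambda>s. ((v \<bullet> A.\<theta> (fst s)) * (w \<bullet> B.\<theta> (snd s))) / (real (card \<Delta>1) * real (card \<Delta>2)))"
  proof (rule integral_cong_AE)
    have "(v \<bullet> A.mean (\<lambda>x. A.cincr f x (fst s))) * (w \<bullet> B.mean (\<lambda>y. B.cincr g y (snd s)))
      = ((v \<bullet> A.\<theta> (fst s)) * (w \<bullet> B.\<theta> (snd s))) / (real (card \<Delta>1) * real (card \<Delta>2))" if "s \<in> set_pmf \<nu>" for s
    proof -
      have "fst s \<in> carrier G1" "snd s \<in> carrier G2" using P.supp'[OF that] by auto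
      then show ?thesis by (simp add: A.mean_cincr[OF Lf] B.mean_cincr[OF Lg] divide_inverse)
    qed
    then show "AE s in \<nu>. (v \<bullet> A.mean (\<lambda>x. A.cincr f x (fst s))) * (w \<bullet> B.mean (\<lambda>y. B.cincr g y (snd s)))
      = ((v \<bullet> A.\<theta> (fst s)) * (w \<bullet> B.\<theta> (snd s))) / (real (card \<Delta>1) * real (card \<Delta>2))"
      unfolding AE_measure_pmf_iff by blast
  qed simp_all
  finally show ?thesis by simp
qed

text \<open>A vector orthogonal to the range of the transfer annihilates the transfer of every step
  as well as the drift, so both terms of \<open>cov_mixed\<close> vanish.\<close>

lemma cov_orthogonal:
  assumes f: "A.corrector f" and g: "B.corrector g"
    and o: "v \<in> orthogonal_comp (range A.T) \<or> w \<in> orthogonal_comp (range B.T)"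
  shows "P.cov (prod_embedding f g) (vec_pair v 0) (vec_pair 0 w) = 0"
proof -
  have "(v \<bullet> A.\<theta> (fst s)) * (w \<bullet> B.\<theta> (snd s)) = 0" if "s \<in> set_pmf \<nu>" for s
    using o A.orthogonal_transfer[of v "fst s"] B.orthogonal_transfer[of w "snd s"] P.supp'[OF that] by auto
  then have "measure_pmf.expectation \<nu> (\<lambda>s. (v \<bullet> A.\<theta> (fst s)) * (w \<bullet> B.\<theta> (snd s))) = measure_pmf.expectation \<nu> (\<lambda>_. 0)"
    by (intro integral_cong_AE) (simp_all only: AE_measure_pmf_iff borel_measurable_count_space, simp_all)
  moreover have "(v \<bullet> A.zeta) * (w \<bullet> B.zeta) = 0"
    using o A.zeta_in_range B.zeta_in_range unfolding orthogonal_comp_def orthogonal_def by (force simp: inner_commute)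
  ultimately show ?thesis unfolding cov_mixed[OF f g] by simp
qed

end

theorem theorem5p1:
  fixes G1 :: "('a, 'x) monoid_scheme" and G2 :: "('b, 'y) monoid_scheme"
    and \<Lambda>1 \<Delta>1 :: "'a set" and \<Lambda>2 \<Delta>2 :: "'b set"
    and \<iota>1 :: "'a \<Rightarrow> real ^ 'm1" and \<iota>2 :: "'b \<Rightarrow> real ^ 'm2"
    and \<nu> :: "('a \<times> 'b) pmf" and \<mu>1 :: "'a pmf" and \<mu>2 :: "'b pmf"
    and \<Sigma>1 :: "real ^ 'm1 ^ 'm1" and \<Sigma>2 :: "real ^ 'm2 ^ 'm2"
    and \<Sigma> :: "real ^ ('m1 + 'm2) ^ ('m1 + 'm2)" and \<zeta> :: "real ^ ('m1 + 'm2)"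
    and T1 :: "real ^ 'm1 \<Rightarrow> real ^ 'm1" and T2 :: "real ^ 'm2 \<Rightarrow> real ^ 'm2"
  assumes "group G1" and "finitely_generated G1" and "infinite (carrier G1)"
    and "virtually_abelian G1"
    and "\<Lambda>1 \<lhd> G1" and "finite (rcosets\<^bsub>G1\<^esub> \<Lambda>1)"
    and "\<iota>1 \<in> iso (G1\<lparr>carrier := \<Lambda>1\<rparr>) int_lattice_group"
    and "representatives G1 \<Lambda>1 \<Delta>1"
    and "group G2" and "finitely_generated G2" and "infinite (carrier G2)"
    and "virtually_abelian G2"
    and "\<Lambda>2 \<lhd> G2" and "finite (rcosets\<^bsub>G2\<^esub> \<Lambda>2)"
    and "\<iota>2 \<in> iso (G2\<lparr>carrier := \<Lambda>2\<rparr>) int_lattice_group"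
    and "representatives G2 \<Lambda>2 \<Delta>2"
    and "set_pmf \<nu> \<subseteq> carrier (G1 \<times>\<times> G2)"
    and "aperiodic (G1 \<times>\<times> G2) \<nu>"
    and "finite_second_moment (G1 \<times>\<times> G2) \<nu>"
    and "semigroup_generated (G1 \<times>\<times> G2) (set_pmf \<nu>) = carrier (G1 \<times>\<times> G2)"
    and "\<mu>1 = map_pmf fst \<nu>" and "\<mu>2 = map_pmf snd \<nu>"
    and "\<Sigma>1 = covariance_matrix G1 \<Lambda>1 \<Delta>1 \<iota>1 \<mu>1"
    and "\<Sigma>2 = covariance_matrix G2 \<Lambda>2 \<Delta>2 \<iota>2 \<mu>2"
    and "\<Sigma> = covariance_matrix (G1 \<times>\<times> G2) (\<Lambda>1 \<times> \<Lambda>2) (\<Delta>1 \<times> \<Delta>2) (prod_embedding \<iota>1 \<iota>2) \<nu>"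
    and "\<zeta> = drift (G1 \<times>\<times> G2) (\<Lambda>1 \<times> \<Lambda>2) (\<Delta>1 \<times> \<Delta>2) (prod_embedding \<iota>1 \<iota>2) \<nu>"
    and "T1 = transfer_linear G1 \<Lambda>1 \<Delta>1 \<iota>1" and "T2 = transfer_linear G2 \<Lambda>2 \<Delta>2 \<iota>2"
  shows "((\<lambda>n. tv_norm (G1 \<times>\<times> G2)
             (\<lambda>\<gamma>. pmf (conv_power (G1 \<times>\<times> G2) \<nu> n) \<gamma>
                   - gauss_approx (G1 \<times>\<times> G2) (\<Lambda>1 \<times> \<Lambda>2) (\<Delta>1 \<times> \<Delta>2) (prod_embedding \<iota>1 \<iota>2)
                       n \<Sigma> \<zeta> \<gamma>)) \<longlonglongrightarrow> 0) \<and>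
         (\<exists>z1\<in>range T1. \<exists>z2\<in>range T2. \<zeta> = vec_pair z1 z2) \<and>
         (\<forall>v1 w1. vec_pair v1 0 \<bullet> (\<Sigma> *v vec_pair w1 0) = v1 \<bullet> (\<Sigma>1 *v w1)) \<and>
         (\<forall>v2 w2. vec_pair 0 v2 \<bullet> (\<Sigma> *v vec_pair 0 w2) = v2 \<bullet> (\<Sigma>2 *v w2)) \<and>
         (\<forall>v1 v2. vec_pair 0 v2 \<bullet> (\<Sigma> *v vec_pair v1 0) = vec_pair v1 0 \<bullet> (\<Sigma> *v vec_pair 0 v2)) \<and>
         (\<forall>v1 v2. v1 \<in> orthogonal_comp (range T1) \<or> v2 \<in> orthogonal_comp (range T2) \<longrightarrow>
                   vec_pair v1 0 \<bullet> (\<Sigma> *v vec_pair 0 v2) = 0)"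
proof -
  interpret lattice_group_pair G1 \<Lambda>1 \<Delta>1 \<iota>1 G2 \<Lambda>2 \<Delta>2 \<iota>2
    using assms(1,5-9,13-16)
    by (simp add: lattice_group_pair_def lattice_group_def lattice_group_axioms_def)
  interpret P: lattice_group "G1 \<times>\<times> G2" "\<Lambda>1 \<times> \<Lambda>2" "\<Delta>1 \<times> \<Delta>2" "prod_embedding \<iota>1 \<iota>2"
    by (rule lattice_group_prod)
  have "lattice_walk (G1 \<times>\<times> G2) (\<Lambda>1 \<times> \<Lambda>2) (\<Delta>1 \<times> \<Delta>2) (prod_embedding \<iota>1 \<iota>2) \<nu>"
    by unfold_locales (fact assms(17) assms(20) assms(18) P.second_moment_coord[OF assms(17,19)])+
  then interpret lattice_walk_pair G1 \<Lambda>1 \<Delta>1 \<iota>1 G2 \<Lambda>2 \<Delta>2 \<iota>2 \<nu>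
    by (intro lattice_walk_pair.intro lattice_walk_pair_axioms.intro lattice_group_pair_axioms)
  obtain f g where f: "A.corrector f" and g: "B.corrector g" using A.ex_corrector B.ex_corrector by blast
  \<comment> \<open>The covariance matrix is the same for every corrector of the product, so the one
    assembled from the factors may be used to relate the blocks to the marginals.\<close>
  define F where "F = prod_embedding f g"
  have F: "P.corrector F" unfolding F_def by (rule corrector_prod_embedding(1)[OF f g])
  have zeta: "\<zeta> = P.zeta" unfolding assms(26) by (rule P.drift_eq)
  have \<Sigma>: "v \<bullet> (\<Sigma> *v w) = P.cov F v w" for v w unfolding assms(25) by (rule P.covariance_matrix_eq[OF F])
  have \<Sigma>1: "v \<bullet> (\<Sigma>1 *v w) = A.cov f v w" for v w unfolding assms(21,23) by (rule A.covariance_matrix_eq[OF f])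
  have \<Sigma>2: "v \<bullet> (\<Sigma>2 *v w) = B.cov g v w" for v w unfolding assms(22,24) by (rule B.covariance_matrix_eq[OF g])
  show ?thesis
  proof (intro conjI allI impI)
    show "(\<lambda>n. tv_norm (G1 \<times>\<times> G2) (\<lambda>\<gamma>. pmf (conv_power (G1 \<times>\<times> G2) \<nu> n) \<gamma>
        - gauss_approx (G1 \<times>\<times> G2) (\<Lambda>1 \<times> \<Lambda>2) (\<Delta>1 \<times> \<Delta>2) (prod_embedding \<iota>1 \<iota>2) n \<Sigma> \<zeta> \<gamma>)) \<longlonglongrightarrow> 0"
      unfolding zeta by (rule P.tv_local_limit[OF F \<Sigma>])
    show "\<exists>z1\<in>range T1. \<exists>z2\<in>range T2. \<zeta> = vec_pair z1 z2"
      unfolding zeta assms(27,28) corrector_prod_embedding(2)[OF f g] using A.zeta_in_range B.zeta_in_range by blast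
    show "vec_pair v1 0 \<bullet> (\<Sigma> *v vec_pair w1 0) = v1 \<bullet> (\<Sigma>1 *v w1)" for v1 w1
      unfolding \<Sigma> \<Sigma>1 F_def by (rule cov_fst[OF f g])
    show "vec_pair 0 v2 \<bullet> (\<Sigma> *v vec_pair 0 w2) = v2 \<bullet> (\<Sigma>2 *v w2)" for v2 w2
      unfolding \<Sigma> \<Sigma>2 F_def by (rule cov_snd[OF f g])
    show "vec_pair 0 v2 \<bullet> (\<Sigma> *v vec_pair v1 0) = vec_pair v1 0 \<bullet> (\<Sigma> *v vec_pair 0 v2)" for v1 v2
      unfolding \<Sigma> P.cov_def by (simp only: mult.commute)
    show "vec_pair v1 0 \<bullet> (\<Sigma> *v vec_pair 0 v2) = 0"
      if "v1 \<in> orthogonal_comp (range T1) \<or> v2 \<in> orthogonal_comp (range T2)" for v1 v2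
      unfolding \<Sigma> F_def using that unfolding assms(27,28) by (rule cov_orthogonal[OF f g])
  qed
qed

end
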